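(* Let $X\subset\mathbb{P}_n$ be a Gorenstein curve of degree $d$ with characteristic sequence $(m_i)_{0\le i\le d-1}$, and let $Y$ be a group of points on $X$, of degree $\alpha$, locally principal on $X$ (i.e. locally defined on $X$ by one equation). Then $$\dim|Y|=\alpha-\phi_Y(m_{d-1}-2).$$
   Context: $k$ is an algebraically closed field of characteristic $0$, $A_n=k[X_0,\dots,X_n]$. A projective subscheme $X\subset\mathbb{P}_n$ is given by its saturated homogeneous ideal $I_X$; $A_X=A_n/I_X$ and $\phi_X(l)=\dim_k A_X(l)$ is its Hilbert function ($0$ for $l<0$). A curve is a projective subscheme of pure dimension $1$; a group of points is one of pure dimension $0$. $X$ of dimension $m$ is arithmetically Cohen-Macaulay (ACM) if $A_X$ admits a regular sequence of $m+1$ homogeneous polynomials. $X$ is Gorenstein (in the arithmetic sense) if it is ACM and $\omega_{A_X}\simeq A_X[a]$ for some integer $a$, where $A_X[a](l)=A_X(a+l)$. Characteristic sequence of an ACM curve $X$ of degree $d$: let $Y_0,Y_1$ be linear forms with no common zero on $X$, $R_1=k[Y_0,Y_1]$; then $A_X\simeq\bigoplus_{i=0}^{d-1}R_1[-m_i]$ as graded $R_1$-modules with $0=m_0\le\dots\le m_{d-1}$; $(m_i)$ depends only on $\phi_X$. Linear systems: for $Y$ locally principal on $X$, $\mathcal{O}_X(Y)$ is the invertible sheaf associated with the effective Cartier divisor $Y$ (dual of the ideal sheaf of $Y$ in $X$); the complete linear system $|Y|$ is the set of groups of points on $X$ linearly equivalent to $Y$, and its dimension is $\dim|Y|:=h^0(\mathcal{O}_X(Y))-1$.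 *)

theory Defs
  imports
    "HOL-Library.Poly_Mapping"
    "HOL-Library.Function_Algebras"
    "HOL-Algebra.QuotRing"
    "HOL-Computational_Algebra.Polynomial"
    "Jordan_Normal_Form.VS_Connect"
begin

section \<open>Homogeneous ideals of the polynomial ring\<close>

text \<open>
  The type \<open>('n, 'k) mpoly\<close> is \<open>A\<^sub>n = k[X\<^sub>0, \<dots>, X\<^sub>n]\<close>, the variables being indexed by the
  elements of a finite type \<open>'n\<close> with \<open>n + 1\<close> elements. In the theorem \<open>'n\<close> is also linearly
  ordered, as the index set \<open>0 < \<dots> < n\<close> is; none of the definitions uses the order.
  Ideal-theoretic notions are those of \<open>HOL-Algebra\<close>, applied to the record \<open>class_ring\<close> of the
  ring operations of the type.
\<close>

type_synonym ('n, 'k) mpoly = "('n \<Rightarrow>\<^sub>0 nat) \<Rightarrow>\<^sub>0 'k"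

definition Const :: "'k::field \<Rightarrow> ('n::finite, 'k) mpoly" where
  "Const c = Poly_Mapping.single 0 c"

definition Var :: "'n::finite \<Rightarrow> ('n, 'k::field) mpoly" where
  "Var i = Poly_Mapping.single (Poly_Mapping.single i 1) 1"

text \<open>The graded pieces contain \<open>0\<close>, and they are \<open>{0}\<close> in negative degrees.\<close>

definition homog :: "int \<Rightarrow> ('n::finite, 'k::field) mpoly set" where
  "homog l = {p. \<forall>t \<in> Poly_Mapping.keys p. int (\<Sum>i\<in>UNIV. Poly_Mapping.lookup t i) = l}"

definition homogeneous_ideal :: "('n::finite, 'k::field) mpoly set \<Rightarrow> bool" where
  "homogeneous_ideal I \<longleftrightarrow>
     ideal I class_ring \<and> I = Idl\<^bsub>class_ring\<^esub> {p \<in> I. \<exists>l. p \<in> homog l}"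

text \<open>The condition \<open>(I : \<mm>) = I\<close> with \<open>\<mm> = (X\<^sub>0, \<dots>, X\<^sub>n)\<close>, equivalently \<open>(I : \<mm>\<^sup>N) = I\<close> for all \<open>N\<close>.\<close>

definition saturated :: "('n::finite, 'k::field) mpoly set \<Rightarrow> bool" where
  "saturated I \<longleftrightarrow> (\<forall>p. (\<forall>i. Var i * p \<in> I) \<longrightarrow> p \<in> I)"

definition projective_subscheme :: "('n::finite, 'k::field) mpoly set \<Rightarrow> bool" where
  "projective_subscheme I \<longleftrightarrow> homogeneous_ideal I \<and> saturated I"


section \<open>Quotients and graded modules\<close>

text \<open>The multiplication and the unit of a \<^typ>\<open>('r, 'a) module\<close> record play no role for modules.\<close>

definition quotient_module ::
    "('r \<Rightarrow> 'a \<Rightarrow> 'a::ab_group_add) \<Rightarrow> 'a set \<Rightarrow> 'a set \<Rightarrow> ('r, 'a set) module" where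
  "quotient_module scale V W =
     \<lparr>carrier = {{v + w | w. w \<in> W} | v. v \<in> V},
      mult = undefined, one = undefined,
      zero = W,
      add = (\<lambda>A B. {a + b | a b. a \<in> A \<and> b \<in> B}),
      smult = (\<lambda>r A. {scale r a + w | a w. a \<in> A \<and> w \<in> W})\<rparr>"

record ('r, 'a) graded_module = "('r, 'a) module" +
  gpart :: "int \<Rightarrow> 'a set"

definition graded_isomorphic ::
    "('r, 'x) ring_scheme \<Rightarrow> ('r, 'a, 'y) graded_module_scheme \<Rightarrow>
      ('r, 'b, 'z) graded_module_scheme \<Rightarrow> bool" where
  "graded_isomorphic R M N \<longleftrightarrow>
     (\<exists>f \<in> LinearCombinations.module_hom R M N.
        bij_betw f (carrier M) (carrier N) \<and> (\<forall>l. f ` gpart M l = gpart N l))"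

text \<open>\<open>M[a]\<close>, with \<open>M[a](l) = M(a + l)\<close>.\<close>

definition twist :: "int \<Rightarrow> ('r, 'a) graded_module \<Rightarrow> ('r, 'a) graded_module" where
  "twist a M = M\<lparr>gpart := (\<lambda>l. gpart M (a + l))\<rparr>"

definition graded_quotient ::
    "('r \<Rightarrow> 'a \<Rightarrow> 'a::ab_group_add) \<Rightarrow> 'a set \<Rightarrow> 'a set \<Rightarrow> (int \<Rightarrow> 'a set) \<Rightarrow>
      ('r, 'a set) graded_module" where
  "graded_quotient scale V W G =
     module.extend (quotient_module scale V W)
       \<lparr>gpart = (\<lambda>l. {{v + w | w. w \<in> W} | v. v \<in> V \<inter> G l})\<rparr>"

text \<open>The homogeneous coordinate ring \<open>A\<^sub>X\<close>, as a graded module over \<open>A\<^sub>n\<close>.\<close>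

definition coord_ring ::
    "('n::finite, 'k::field) mpoly set \<Rightarrow>
      (('n, 'k) mpoly, ('n, 'k) mpoly set) graded_module" where
  "coord_ring I = graded_quotient (*) UNIV I homog"

definition hilbert_fun :: "('n::finite, 'k::field) mpoly set \<Rightarrow> int \<Rightarrow> nat" where
  "hilbert_fun I l =
     vectorspace.dim (class_ring :: 'k ring)
       (quotient_module (\<lambda>c p. Const c * p) (homog l) (I \<inter> homog l))"

text \<open>
  \<open>d = m! \<cdot> (coefficient of l\<^sup>m in the Hilbert polynomial)\<close>, for a subscheme of dimension \<open>m\<close>;
  for \<open>m = 0\<close> this is the length.
\<close>

definition has_degree :: "('n::finite, 'k::field) mpoly set \<Rightarrow> nat \<Rightarrow> nat \<Rightarrow> bool" where
  "has_degree I m d \<longleftrightarrow>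
     (\<exists>q :: rat poly. Polynomial.degree q \<le> m \<and>
        (\<exists>l0. \<forall>l\<ge>l0. of_nat (hilbert_fun I (int l)) = poly q (of_nat l)) \<and>
        of_nat d = fact m * Polynomial.coeff q m)"


section \<open>The space Proj and dimension\<close>

text \<open>The points of the scheme \<open>X = Proj(A\<^sub>X)\<close>, as primes of \<open>A\<^sub>n\<close> containing \<open>I\<^sub>X\<close>.\<close>

definition Proj :: "('n::finite, 'k::field) mpoly set \<Rightarrow> ('n, 'k) mpoly set set" where
  "Proj I = {P. homogeneous_ideal P \<and> primeideal P class_ring \<and> I \<subseteq> P \<and> (\<exists>i. Var i \<notin> P)}"

definition zariski_opens ::
    "('n::finite, 'k::field) mpoly set \<Rightarrow> ('n, 'k) mpoly set set set" where
  "zariski_opens I = {{P \<in> Proj I. \<not> K \<subseteq> P} | K. homogeneous_ideal K}"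

definition chain_above ::
    "('n::finite, 'k::field) mpoly set \<Rightarrow> ('n, 'k) mpoly set \<Rightarrow> nat \<Rightarrow> bool" where
  "chain_above I P m \<longleftrightarrow>
     (\<exists>c. c 0 = P \<and> (\<forall>i\<le>m. c i \<in> Proj I) \<and> (\<forall>i<m. c i \<subset> c (Suc i)))"

definition has_dimension :: "('n::finite, 'k::field) mpoly set \<Rightarrow> nat \<Rightarrow> bool" where
  "has_dimension I m \<longleftrightarrow> (\<exists>P. chain_above I P m) \<and> \<not> (\<exists>P. chain_above I P (Suc m))"

text \<open>
  Every irreducible component, i.e. every closure of a minimal point, has dimension \<open>m\<close>.
  The empty subscheme satisfies this for every \<open>m\<close>; in particular it is a group of points.
\<close>

definition pure_dimension :: "('n::finite, 'k::field) mpoly set \<Rightarrow> nat \<Rightarrow> bool" where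
  "pure_dimension I m \<longleftrightarrow>
     (\<forall>P \<in> Proj I. (\<forall>Q \<in> Proj I. Q \<subseteq> P \<longrightarrow> Q = P) \<longrightarrow>
        chain_above I P m \<and> \<not> chain_above I P (Suc m))"

definition curve :: "('n::finite, 'k::field) mpoly set \<Rightarrow> bool" where
  "curve I \<longleftrightarrow> projective_subscheme I \<and> has_dimension I 1 \<and> pure_dimension I 1"

definition group_of_points :: "('n::finite, 'k::field) mpoly set \<Rightarrow> bool" where
  "group_of_points I \<longleftrightarrow> projective_subscheme I \<and> pure_dimension I 0"


section \<open>Arithmetically Cohen-Macaulay and Gorenstein subschemes\<close>

definition regular_sequence ::
    "('n::finite, 'k::field) mpoly set \<Rightarrow> ('n, 'k) mpoly list \<Rightarrow> bool" where
  "regular_sequence I fs \<longleftrightarrow>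
     (\<forall>i < length fs. \<forall>p. fs ! i * p \<in> Idl\<^bsub>class_ring\<^esub> (I \<union> set (take i fs)) \<longrightarrow>
        p \<in> Idl\<^bsub>class_ring\<^esub> (I \<union> set (take i fs))) \<and>
     Idl\<^bsub>class_ring\<^esub> (I \<union> set fs) \<noteq> UNIV"

definition acm :: "('n::finite, 'k::field) mpoly set \<Rightarrow> bool" where
  "acm I \<longleftrightarrow>
     (\<exists>m fs. has_dimension I m \<and> length fs = m + 1 \<and>
        (\<forall>f \<in> set fs. \<exists>l. f \<in> homog l) \<and> regular_sequence I fs)"

text \<open>
  The canonical module of a subscheme of dimension \<open>m\<close> is
  \<open>\<omega> = Ext\<^sup>n\<^sup>-\<^sup>m(A\<^sub>X, A\<^sub>n[-n-1])\<close>, the \<open>Ext\<close> being taken over \<open>A\<^sub>n\<close>. It is computed from a graded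
  free resolution \<open>\<cdots> \<rightarrow> F\<^sub>1 \<rightarrow> F\<^sub>0 = A\<^sub>n \<rightarrow> A\<^sub>X \<rightarrow> 0\<close>. Here \<open>F\<^sub>i\<close> is the sum over \<open>j < r i\<close> of the
  \<open>A\<^sub>n[- e i j]\<close>, its elements are the functions in \<open>free_vectors (r i)\<close>, and the differential
  \<open>F\<^sub>i\<^sub>+\<^sub>1 \<rightarrow> F\<^sub>i\<close> has the \<open>r i \<times> r (i + 1)\<close> matrix \<open>D i\<close>.
\<close>

definition free_vectors :: "nat \<Rightarrow> (nat \<Rightarrow> 'a::zero) set" where
  "free_vectors r = {v. \<forall>j\<ge>r. v j = 0}"

definition matrix_apply ::
    "nat \<Rightarrow> nat \<Rightarrow> (nat \<Rightarrow> nat \<Rightarrow> 'a::comm_ring_1) \<Rightarrow> (nat \<Rightarrow> 'a) \<Rightarrow> nat \<Rightarrow> 'a" where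
  "matrix_apply r s D v = (\<lambda>i. if i < r then \<Sum>j<s. D i j * v j else 0)"

definition graded_free_resolution ::
    "('n::finite, 'k::field) mpoly set \<Rightarrow> (nat \<Rightarrow> nat) \<Rightarrow> (nat \<Rightarrow> nat \<Rightarrow> int) \<Rightarrow>
      (nat \<Rightarrow> nat \<Rightarrow> nat \<Rightarrow> ('n, 'k) mpoly) \<Rightarrow> bool" where
  "graded_free_resolution I r e D \<longleftrightarrow>
     r 0 = 1 \<and> e 0 0 = 0 \<and>
     (\<forall>i. \<forall>j < r i. \<forall>j' < r (Suc i). D i j j' \<in> homog (e (Suc i) j' - e i j)) \<and>
     (\<lambda>v. matrix_apply (r 0) (r 1) (D 0) v 0) ` free_vectors (r 1) = I \<and>
     (\<forall>i. {v \<in> free_vectors (r (Suc i)). matrix_apply (r i) (r (Suc i)) (D i) v = 0} =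
        matrix_apply (r (Suc i)) (r (Suc (Suc i))) (D (Suc i)) ` free_vectors (r (Suc (Suc i))))"

text \<open>
  \<open>Ext\<^sup>c(A\<^sub>X, A\<^sub>n[a])\<close>: cohomology of the transposed complex. A cochain of degree \<open>l\<close> on \<open>F\<^sub>c\<close>
  sends the \<open>j\<close>-th generator, of degree \<open>e c j\<close>, to \<open>A\<^sub>n[a](l + e c j)\<close>.
\<close>

definition ext_module ::
    "(nat \<Rightarrow> nat) \<Rightarrow> (nat \<Rightarrow> nat \<Rightarrow> int) \<Rightarrow> (nat \<Rightarrow> nat \<Rightarrow> nat \<Rightarrow> ('n::finite, 'k::field) mpoly) \<Rightarrow>
      nat \<Rightarrow> int \<Rightarrow> (('n, 'k) mpoly, (nat \<Rightarrow> ('n, 'k) mpoly) set) graded_module" where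
  "ext_module r e D c a =
     graded_quotient (\<lambda>p v j. p * v j)
       {v \<in> free_vectors (r c). matrix_apply (r (Suc c)) (r c) (\<lambda>i j. D c j i) v = 0}
       (case c of 0 \<Rightarrow> {0}
        | Suc b \<Rightarrow> matrix_apply (r c) (r b) (\<lambda>i j. D b j i) ` free_vectors (r b))
       (\<lambda>l. {v. \<forall>j < r c. v j \<in> homog (a + (l + e c j))})"

definition canonical_module ::
    "('n::finite, 'k::field) mpoly set \<Rightarrow>
      (('n, 'k) mpoly, (nat \<Rightarrow> ('n, 'k) mpoly) set) graded_module \<Rightarrow> bool" where
  "canonical_module I W \<longleftrightarrow>
     (\<exists>m r e D. has_dimension I m \<and> graded_free_resolution I r e D \<and>
        W = ext_module r e D (card (UNIV :: 'n set) - 1 - m) (- int (card (UNIV :: 'n set))))"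

definition gorenstein :: "('n::finite, 'k::field) mpoly set \<Rightarrow> bool" where
  "gorenstein I \<longleftrightarrow>
     acm I \<and>
     (\<exists>W a. canonical_module I W \<and>
        graded_isomorphic class_ring W (twist a (coord_ring I)))"


section \<open>The characteristic sequence of an ACM curve\<close>

inductive_set subalgebra_gen ::
    "('n::finite, 'k::field) mpoly set \<Rightarrow> ('n, 'k) mpoly set" for S where
  "Const c \<in> subalgebra_gen S"
| "p \<in> S \<Longrightarrow> p \<in> subalgebra_gen S"
| "p \<in> subalgebra_gen S \<Longrightarrow> q \<in> subalgebra_gen S \<Longrightarrow> p + q \<in> subalgebra_gen S"
| "p \<in> subalgebra_gen S \<Longrightarrow> q \<in> subalgebra_gen S \<Longrightarrow> p * q \<in> subalgebra_gen S"

text \<open>The direct sum of the \<open>R[- m i]\<close>, \<open>i < d\<close>, for a graded subring \<open>R\<close> of \<open>A\<^sub>n\<close>.\<close>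

definition graded_free_module ::
    "('n::finite, 'k::field) mpoly set \<Rightarrow> nat \<Rightarrow> (nat \<Rightarrow> nat) \<Rightarrow>
      (('n, 'k) mpoly, nat \<Rightarrow> ('n, 'k) mpoly) graded_module" where
  "graded_free_module R d m =
     \<lparr>carrier = {v \<in> free_vectors d. \<forall>i<d. v i \<in> R},
      mult = undefined, one = undefined,
      zero = 0, add = (+), smult = (\<lambda>p v i. p * v i),
      gpart = (\<lambda>l. {v \<in> free_vectors d. \<forall>i<d. v i \<in> R \<inter> homog (l - int (m i))})\<rparr>"

text \<open>
  As \<open>Y0\<close> and \<open>Y1\<close> have no common zero on a curve, they are linearly independent, so that the
  polynomial ring \<open>k[Y0, Y1]\<close> is the subalgebra of \<open>A\<^sub>n\<close> generated by them.
\<close>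

definition characteristic_sequence ::
    "('n::finite, 'k::field) mpoly set \<Rightarrow> nat \<Rightarrow> (nat \<Rightarrow> nat) \<Rightarrow> bool" where
  "characteristic_sequence I d m \<longleftrightarrow>
     m 0 = 0 \<and> (\<forall>i j. i \<le> j \<longrightarrow> j < d \<longrightarrow> m i \<le> m j) \<and>
     (\<exists>Y0 \<in> homog 1. \<exists>Y1 \<in> homog 1.
        (\<forall>P \<in> Proj I. \<not> (Y0 \<in> P \<and> Y1 \<in> P)) \<and>
        graded_isomorphic (class_ring\<lparr>carrier := subalgebra_gen {Y0, Y1}\<rparr>)
          (graded_free_module (subalgebra_gen {Y0, Y1}) d m) (coord_ring I))"


section \<open>The structure sheaf and ideal sheaves\<close>

text \<open>
  The local ring of \<open>X\<close> at the point \<open>P\<close> is the degree \<open>0\<close> part of the localisation of \<open>A\<^sub>X\<close> at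
  the homogeneous elements outside \<open>P\<close>; \<open>fraction I P a f\<close> is the class of \<open>a/f\<close>.
\<close>

definition fraction ::
    "('n::finite, 'k::field) mpoly set \<Rightarrow> ('n, 'k) mpoly set \<Rightarrow> ('n, 'k) mpoly \<Rightarrow> ('n, 'k) mpoly \<Rightarrow>
      (('n, 'k) mpoly \<times> ('n, 'k) mpoly) set" where
  "fraction I P a f =
     {(b, g). (\<exists>l. b \<in> homog l \<and> g \<in> homog l) \<and> g \<notin> P \<and>
        (\<exists>l. \<exists>t \<in> homog l. t \<notin> P \<and> t * (a * g - b * f) \<in> I)}"

text \<open>For an ideal \<open>K\<close> containing \<open>I\<close>: the stalk at \<open>P\<close> of the ideal sheaf defined by \<open>K\<close>.\<close>

definition ideal_stalk ::
    "('n::finite, 'k::field) mpoly set \<Rightarrow> ('n, 'k) mpoly set \<Rightarrow> ('n, 'k) mpoly set \<Rightarrow>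
      (('n, 'k) mpoly \<times> ('n, 'k) mpoly) set set" where
  "ideal_stalk I K P =
     {fraction I P a f | a f. \<exists>l. a \<in> K \<inter> homog l \<and> f \<in> homog l \<and> f \<notin> P}"

definition local_ring ::
    "('n::finite, 'k::field) mpoly set \<Rightarrow> ('n, 'k) mpoly set \<Rightarrow>
      (('n, 'k) mpoly \<times> ('n, 'k) mpoly) set ring" where
  "local_ring I P =
     \<lparr>carrier = ideal_stalk I UNIV P,
      mult = (\<lambda>x y. \<Union>(a, f) \<in> x. \<Union>(b, g) \<in> y. fraction I P (a * b) (f * g)),
      one = fraction I P 1 1,
      zero = fraction I P 0 1,
      add = (\<lambda>x y. \<Union>(a, f) \<in> x. \<Union>(b, g) \<in> y. fraction I P (a * g + b * f) (f * g))\<rparr>"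

type_synonym ('n, 'k) sheaf_section =
  "('n, 'k) mpoly set \<Rightarrow> (('n, 'k) mpoly \<times> ('n, 'k) mpoly) set"

text \<open>
  Sections over the open set \<open>U\<close> of the ideal sheaf on \<open>X\<close> defined by an ideal \<open>K\<close> containing
  \<open>I\<^sub>X\<close>: families of elements of the local rings which are locally fractions \<open>a/f\<close> with \<open>a \<in> K\<close>.
  The structure sheaf is the case \<open>K = UNIV\<close>. The record is both a module over the sections of
  the structure sheaf (through \<open>smult\<close>) and, for \<open>K = UNIV\<close>, the ring of these.
\<close>

definition sections ::
    "('n::finite, 'k::field) mpoly set \<Rightarrow> ('n, 'k) mpoly set \<Rightarrow> ('n, 'k) mpoly set set \<Rightarrow>
      (('n, 'k) sheaf_section, ('n, 'k) sheaf_section) module" where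
  "sections I K U =
     \<lparr>carrier = {s \<in> (\<Pi>\<^sub>E P\<in>U. carrier (local_ring I P)).
        \<forall>P\<in>U. \<exists>V \<in> zariski_opens I. P \<in> V \<and> V \<subseteq> U \<and>
          (\<exists>l. \<exists>a \<in> K \<inter> homog l. \<exists>f \<in> homog l. \<forall>Q\<in>V. f \<notin> Q \<and> s Q = fraction I Q a f)},
      mult = (\<lambda>s t. \<lambda>P\<in>U. s P \<otimes>\<^bsub>local_ring I P\<^esub> t P),
      one = (\<lambda>P\<in>U. \<one>\<^bsub>local_ring I P\<^esub>),
      zero = (\<lambda>P\<in>U. \<zero>\<^bsub>local_ring I P\<^esub>),
      add = (\<lambda>s t. \<lambda>P\<in>U. s P \<oplus>\<^bsub>local_ring I P\<^esub> t P),
      smult = (\<lambda>r s. \<lambda>P\<in>U. r P \<otimes>\<^bsub>local_ring I P\<^esub> s P)\<rparr>"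

abbreviation structure_sheaf ::
    "('n::finite, 'k::field) mpoly set \<Rightarrow> ('n, 'k) mpoly set set \<Rightarrow>
      (('n, 'k) sheaf_section, ('n, 'k) sheaf_section) module" where
  "structure_sheaf I \<equiv> sections I UNIV"

text \<open>
  On a neighbourhood of each point of \<open>X\<close> the ideal sheaf of \<open>Y\<close> is generated by one section.
\<close>

definition locally_principal ::
    "('n::finite, 'k::field) mpoly set \<Rightarrow> ('n, 'k) mpoly set \<Rightarrow> bool" where
  "locally_principal IX IY \<longleftrightarrow>
     (\<forall>P \<in> Proj IX. \<exists>U \<in> zariski_opens IX. P \<in> U \<and>
        (\<exists>g \<in> carrier (structure_sheaf IX U). \<forall>Q\<in>U.
           ideal_stalk IX IY Q =
             {g Q \<otimes>\<^bsub>local_ring IX Q\<^esub> x | x. x \<in> carrier (local_ring IX Q)}))"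


section \<open>Linear systems\<close>

type_synonym ('n, 'k) sheaf_map =
  "('n, 'k) mpoly set set \<Rightarrow> ('n, 'k) sheaf_section \<Rightarrow> ('n, 'k) sheaf_section"

text \<open>
  The \<open>k\<close>-vector space of global sections of \<open>\<O>\<^sub>X(Y)\<close>, the dual of the ideal sheaf of \<open>Y\<close> in \<open>X\<close>;
  these are by definition the morphisms of sheaves of modules from the ideal sheaf of \<open>Y\<close> to the
  structure sheaf of \<open>X\<close>.
\<close>

definition divisor_sections ::
    "('n::finite, 'k::field) mpoly set \<Rightarrow> ('n, 'k) mpoly set \<Rightarrow>
      ('k, ('n, 'k) sheaf_map) module" where
  "divisor_sections IX IY =
     \<lparr>carrier = {\<phi> \<in> extensional (zariski_opens IX).
        (\<forall>U \<in> zariski_opens IX.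
           \<phi> U \<in> LinearCombinations.module_hom (structure_sheaf IX U)
                    (sections IX IY U) (structure_sheaf IX U) \<and>
           \<phi> U \<in> extensional (carrier (sections IX IY U))) \<and>
        (\<forall>U \<in> zariski_opens IX. \<forall>V \<in> zariski_opens IX. V \<subseteq> U \<longrightarrow>
           (\<forall>s \<in> carrier (sections IX IY U). \<phi> V (restrict s V) = restrict (\<phi> U s) V))},
      mult = undefined, one = undefined,
      zero = (\<lambda>U \<in> zariski_opens IX. \<lambda>s \<in> carrier (sections IX IY U).
        \<zero>\<^bsub>structure_sheaf IX U\<^esub>),
      add = (\<lambda>\<phi> \<psi>. \<lambda>U \<in> zariski_opens IX. \<lambda>s \<in> carrier (sections IX IY U).
        \<phi> U s \<oplus>\<^bsub>structure_sheaf IX U\<^esub> \<psi> U s),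
      smult = (\<lambda>c \<phi>. \<lambda>U \<in> zariski_opens IX. \<lambda>s \<in> carrier (sections IX IY U).
        (\<lambda>P\<in>U. fraction IX P (Const c) 1) \<odot>\<^bsub>structure_sheaf IX U\<^esub> \<phi> U s)\<rparr>"

definition linear_system_dim ::
    "('n::finite, 'k::field) mpoly set \<Rightarrow> ('n, 'k) mpoly set \<Rightarrow> int" where
  "linear_system_dim IX IY =
     int (vectorspace.dim (class_ring :: 'k ring) (divisor_sections IX IY)) - 1"

end

theory Submission
  imports Defs
begin

text \<open>
  The global sections of \<open>\<O>\<^sub>X(Y)\<close> are computed as fractions. Let \<open>A = A\<^sub>n/I\<^sub>X\<close>, let \<open>R = k[Y0, Y1]\<close> be the
  polynomial ring of the characteristic sequence, and let \<open>u \<in> R \<inter> I\<^sub>Y\<close> be nonzero of degree \<open>\<delta>\<close>; it is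
  regular on \<open>A\<close>. Since \<open>Y0, Y1\<close> is a regular sequence on \<open>A\<close> without common zero on \<open>X\<close>, a morphism
  from the ideal sheaf to the structure sheaf is multiplication by \<open>c/u\<close> for a form \<open>c\<close> of degree \<open>\<delta>\<close> with
  \<open>c I\<^sub>Y \<subseteq> u A\<close>, unique modulo \<open>I\<^sub>X\<close>; these \<open>c\<close> form \<open>Hom(I\<^sub>Y/I\<^sub>X, A)\<close> in degree \<open>0\<close>.

  To compute the dimension of the space of these \<open>c\<close>, choose a regular sequence \<open>\<theta>\<close> of \<open>n - 1\<close> forms in
  \<open>I\<^sub>X\<close> that remains regular together with \<open>Y0, Y1\<close>. As \<open>\<omega>\<^sub>A\<close> is cyclic with annihilator \<open>I\<^sub>X\<close>, linkage gives
  a form \<open>g\<close> with \<open>(\<theta>) : I\<^sub>X = (\<theta>, g)\<close> and \<open>(\<theta>) : g = I\<^sub>X\<close>. Modulo \<open>\<theta>, Y0\<^sup>N, Y1\<^sup>N\<close> the polynomial ring has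
  a one-dimensional socle and hence a perfect pairing \<open>\<sigma>\<close>. For large \<open>N\<close> the form \<open>(c, x) \<mapsto> \<sigma>(g b)\<close>, where
  \<open>c x = u b\<close>, is a perfect pairing of \<open>Hom(I\<^sub>Y/I\<^sub>X, A)\<close> in degree \<open>0\<close> with
  \<open>I\<^sub>Y/(I\<^sub>X + (Y0\<^sup>N, Y1\<^sup>N) I\<^sub>Y)\<close> in degree \<open>t = m\<^sub>d\<^sub>-\<^sub>1 + 2N - 2\<close>. The dimension of the latter is the second
  difference \<open>h(t) - 2 h(t - N) + h(t - 2N)\<close> of \<open>h = \<phi>\<^sub>X - \<phi>\<^sub>Y\<close>, which is \<open>1 + \<alpha> - \<phi>\<^sub>Y(m\<^sub>d\<^sub>-\<^sub>1 - 2)\<close>.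
\<close>

section \<open>Dimensions of quotients of subspaces\<close>

text \<open>Cohomology is traded for linear algebra in one Artinian complete intersection. The
  regular sequence inside the ideal is taken monic in the variables complementary to
  \<open>Y0\<close>, \<open>Y1\<close>, so that regularity, the socle and its degree are read off
  from an explicit monomial basis. The resolution behind the canonical module is arbitrary, possibly
  infinite; dividing by one element of the sequence at a time lowers the index of Ext by one, until
  it is a Hom whose generator is the form \<open>g\<close>. The exponent \<open>N\<close> is
  auxiliary: it makes the quotients finite-dimensional, and below degree \<open>N\<close> the powers
  of \<open>Y0\<close> and \<open>Y1\<close> are invisible, so that identities modulo them hold
  modulo the regular sequence alone. The degree of the pairing is not read off from the twists of a
  resolution. The same duality applied to the whole coordinate ring with \<open>u = 1\<close> shows
  it to be the top degree of that ring modulo the \<open>N\<close>-th powers, and freeness over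
  \<open>R\<close> gives this top degree in terms of the largest \<open>m i\<close>. In the second
  difference the curve contributes \<open>1\<close>, the values of the Hilbert function of the
  points at \<open>t\<close> and \<open>t - N\<close> are already the degree, and
  \<open>t - 2N\<close> is the argument in the theorem.\<close>

locale kspace = vector_space scale for scale :: "'a::field \<Rightarrow> 'b::ab_group_add \<Rightarrow> 'b" (infixr \<open>*s\<close> 75)
begin

text \<open>Quotients \<open>V/W\<close> are handled through indexed families of representatives in
  the ambient space, so that no quotient type is formed and \<open>W\<close> may vary. The dimension
  \<open>qdim\<close> is a relation because finiteness is part of what is proved.\<close>

definition indep_mod :: "'b set \<Rightarrow> 'i set \<Rightarrow> ('i \<Rightarrow> 'b) \<Rightarrow> bool" where
  "indep_mod W T b \<longleftrightarrow> finite T \<and> (\<forall>c. (\<Sum>i\<in>T. c i *s b i) \<in> W \<longrightarrow> (\<forall>i\<in>T. c i = 0))"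

definition spans_mod :: "'b set \<Rightarrow> 'b set \<Rightarrow> 'i set \<Rightarrow> ('i \<Rightarrow> 'b) \<Rightarrow> bool" where
  "spans_mod V W T b \<longleftrightarrow> finite T \<and> (\<forall>i\<in>T. b i \<in> V) \<and>
     (\<forall>v\<in>V. \<exists>c. v - (\<Sum>i\<in>T. c i *s b i) \<in> W)"

definition qbasis :: "'b set \<Rightarrow> 'b set \<Rightarrow> 'i set \<Rightarrow> ('i \<Rightarrow> 'b) \<Rightarrow> bool" where
  "qbasis V W T b \<longleftrightarrow> indep_mod W T b \<and> spans_mod V W T b"

definition qdim :: "'b set \<Rightarrow> 'b set \<Rightarrow> nat \<Rightarrow> bool" where
  "qdim V W n \<longleftrightarrow> (\<exists>b. qbasis V W {..<n} b)"

text \<open>The Steinitz bound modulo \<open>W\<close>: each \<open>b i\<close> is replaced by a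
  combination \<open>e i\<close> of the spanning family that is congruent to it. Independence modulo
  \<open>W\<close> turns into plain independence of the \<open>e i\<close>, which lie in the span of
  at most \<open>card T'\<close> vectors.\<close>

lemma indep_mod_card_le:
  assumes W: "subspace W" and i: "indep_mod W T b" and s: "spans_mod V W T' b'"
    and bV: "\<And>i. i \<in> T \<Longrightarrow> b i \<in> V"
  shows "card T \<le> card T'"
proof -
  have fT: "finite T" and fT': "finite T'" using i s by (auto simp: indep_mod_def spans_mod_def)
  have "\<forall>i\<in>T. \<exists>c. b i - (\<Sum>j\<in>T'. c j *s b' j) \<in> W" using s bV by (auto simp: spans_mod_def)
  then obtain C where C: "\<And>i. i \<in> T \<Longrightarrow> b i - (\<Sum>j\<in>T'. C i j *s b' j) \<in> W" by metis
  define e where "e i = (\<Sum>j\<in>T'. C i j *s b' j)" for i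
  have diff: "(\<Sum>i\<in>T. c i *s b i) - (\<Sum>i\<in>T. c i *s e i) \<in> W" for c
  proof -
    have "(\<Sum>i\<in>T. c i *s b i) - (\<Sum>i\<in>T. c i *s e i) = (\<Sum>i\<in>T. c i *s (b i - e i))"
      by (simp add: sum_subtractf scale_right_diff_distrib)
    also have "\<dots> \<in> W" using C by (intro subspace_sum[OF W] subspace_scale[OF W]) (auto simp: e_def)
    finally show ?thesis .
  qed
  have key: "c i = 0" if "(\<Sum>i\<in>T. c i *s e i) = 0" "i \<in> T" for c i
    using diff[of c] that i by (auto simp: indep_mod_def)
  have inj: "inj_on e T"
  proof (rule inj_onI, rule ccontr)
    fix x y assume xy: "x \<in> T" "y \<in> T" "e x = e y" "x \<noteq> y"
    have "(\<Sum>i\<in>T. (if i = x then 1 else if i = y then -1 else 0) *s e i)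
        = (\<Sum>i\<in>{x,y}. (if i = x then 1 else if i = y then -1 else 0) *s e i)"
      using xy fT by (intro sum.mono_neutral_right) auto
    also have "\<dots> = 0" using xy by simp
    finally have "(if x = x then 1 else if x = y then -1 else 0) = (0::'a)"
      using key[of "\<lambda>i. if i = x then 1 else if i = y then -1 else 0" x] xy by blast
    then show False by simp
  qed
  have ind: "independent (e ` T)"
  proof (rule independent_if_scalars_zero)
    show "finite (e ` T)" using fT by simp
    fix f x assume "(\<Sum>x\<in>e ` T. f x *s x) = 0" and x: "x \<in> e ` T"
    then have "(\<Sum>i\<in>T. f (e i) *s e i) = 0" by (simp add: sum.reindex[OF inj])
    then show "f x = 0" using key[of "\<lambda>i. f (e i)"] x by blast
  qed
  have "e ` T \<subseteq> span (b' ` T')"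
  proof
    fix x assume "x \<in> e ` T"
    then obtain i where "x = e i" by blast
    then show "x \<in> span (b' ` T')"
      unfolding e_def by (simp only:) (rule span_sum, rule span_scale, rule span_base, simp)
  qed
  from independent_span_bound[OF _ ind this] fT' have "card (e ` T) \<le> card (b' ` T')" by simp
  also have "card (e ` T) = card T" by (rule card_image[OF inj])
  also have "card (b' ` T') \<le> card T'" by (rule card_image_le[OF fT'])
  finally show ?thesis .
qed

lemma qbasis_reindex:
  fixes T :: "'i set" and T' :: "'j set"
  assumes "qbasis V W T b" and f: "bij_betw f T' T"
  shows "qbasis V W T' (b \<circ> f)"
proof -
  have inj: "inj_on f T'" and im: "f ` T' = T" using f by (auto simp: bij_betw_def)
  have fin: "finite T'" using assms bij_betw_finite by (auto simp: qbasis_def indep_mod_def)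
  have s: "(\<Sum>i\<in>T. c i *s b i) = (\<Sum>i\<in>T'. c (f i) *s b (f i))" for c :: "'i \<Rightarrow> 'a"
    unfolding im[symmetric] by (simp add: sum.reindex[OF inj])
  have s': "(\<Sum>i\<in>T'. c i *s b (f i)) = (\<Sum>i\<in>T. c (the_inv_into T' f i) *s b i)" for c :: "'j \<Rightarrow> 'a"
    unfolding s by (rule sum.cong) (simp_all add: the_inv_into_f_f[OF inj])
  have "indep_mod W T' (b \<circ> f)"
    unfolding indep_mod_def
  proof (intro conjI allI impI ballI fin)
    fix c i assume h: "(\<Sum>i\<in>T'. c i *s (b \<circ> f) i) \<in> W" and i: "i \<in> T'"
    then have "(\<Sum>i\<in>T. c (the_inv_into T' f i) *s b i) \<in> W" by (simp add: s')
    then have "\<forall>i\<in>T. c (the_inv_into T' f i) = 0"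
      using assms(1) spec[of _ "\<lambda>i. c (the_inv_into T' f i)"] unfolding qbasis_def indep_mod_def by blast
    then have "c (the_inv_into T' f (f i)) = 0" using i im by blast
    then show "c i = 0" using i by (simp add: the_inv_into_f_f[OF inj])
  qed
  moreover have "spans_mod V W T' (b \<circ> f)"
    unfolding spans_mod_def
  proof (intro conjI ballI fin)
    show "(b \<circ> f) i \<in> V" if "i \<in> T'" for i
      using that assms(1) im by (auto simp: qbasis_def spans_mod_def)
    fix v assume "v \<in> V"
    then obtain c where "v - (\<Sum>i\<in>T. c i *s b i) \<in> W"
      using assms(1) by (auto simp: qbasis_def spans_mod_def)
    then have "v - (\<Sum>i\<in>T'. c (f i) *s (b \<circ> f) i) \<in> W" by (simp add: s)
    then show "\<exists>c. v - (\<Sum>i\<in>T'. c i *s (b \<circ> f) i) \<in> W" by (rule exI[where x = "\<lambda>i. c (f i)"])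
  qed
  ultimately show ?thesis by (simp add: qbasis_def)
qed

lemma qdimI: "qbasis V W T b \<Longrightarrow> card T = n \<Longrightarrow> qdim V W n"
proof -
  assume q: "qbasis V W T b" and n: "card T = n"
  then have "finite T" by (simp add: qbasis_def indep_mod_def)
  then obtain f where "bij_betw f {..<n} T"
    using n ex_bij_betw_nat_finite[of T] by (auto simp: lessThan_atLeast0)
  from qbasis_reindex[OF q this] show ?thesis by (auto simp: qdim_def)
qed

lemma qdim_unique:
  assumes "subspace W" "qdim V W n" "qdim V W m" shows "n = m"
proof -
  have "n \<le> m" if "qdim V W n" "qdim V W m" for n m
    using that indep_mod_card_le[OF assms(1), where T = "{..<n}" and T' = "{..<m}"]
    unfolding qdim_def qbasis_def spans_mod_def by fastforce
  then show ?thesis using assms by (simp add: antisym)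
qed

text \<open>A longest family independent modulo \<open>W\<close> spans: a relation that appears on
  adjoining \<open>v\<close> must involve \<open>v\<close> and can be solved for it. The bound
  \<open>bd\<close> makes a longest family exist.\<close>

lemma qdim_exists:
  assumes V: "subspace V" and W: "subspace W"
    and bd: "\<And>k b. indep_mod W {..<k} b \<Longrightarrow> (\<And>i. i < k \<Longrightarrow> b i \<in> V) \<Longrightarrow> k \<le> (n::nat)"
  shows "\<exists>k\<le>n. qdim V W k"
proof -
  define P where "P k \<longleftrightarrow> (\<exists>b. indep_mod W {..<k} b \<and> (\<forall>i<k. b i \<in> V))" for k :: nat
  have P0: "P 0" by (auto simp: P_def indep_mod_def)
  have Pn: "P k \<Longrightarrow> k \<le> n" for k using bd by (auto simp: P_def)
  define k where "k = Greatest P"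
  have Pk: "P k" unfolding k_def by (rule GreatestI_nat[of P 0 n]) (use P0 Pn in auto)
  have nP: "\<not> P (Suc k)" using Greatest_le_nat[of P "Suc k" n] Pn unfolding k_def by force
  from Pk obtain b where b: "indep_mod W {..<k} b" "\<And>i. i < k \<Longrightarrow> b i \<in> V" by (auto simp: P_def)
  have "\<exists>c. v - (\<Sum>i<k. c i *s b i) \<in> W" if v: "v \<in> V" for v
  proof -
    have "\<not> indep_mod W {..<Suc k} (b(k := v))"
      using nP b v by (auto simp: P_def less_Suc_eq)
    then obtain c where c: "(\<Sum>i<Suc k. c i *s (b(k := v)) i) \<in> W" "\<exists>i<Suc k. c i \<noteq> 0"
      by (auto simp: indep_mod_def)
    have s: "(\<Sum>i<Suc k. c i *s (b(k := v)) i) = (\<Sum>i<k. c i *s b i) + c k *s v" by simp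
    have "c k \<noteq> 0"
    proof
      assume "c k = 0"
      then have "(\<Sum>i<k. c i *s b i) \<in> W" using c(1) s by simp
      then have "\<forall>i<k. c i = 0" using b(1) by (auto simp: indep_mod_def)
      then show False using c(2) \<open>c k = 0\<close> by (metis less_Suc_eq)
    qed
    have "inverse (c k) *s ((\<Sum>i<k. c i *s b i) + c k *s v) \<in> W"
      using c(1) s W by (simp only: subspace_scale)
    also have "inverse (c k) *s ((\<Sum>i<k. c i *s b i) + c k *s v)
       = v - (\<Sum>i<k. (- inverse (c k) * c i) *s b i)"
      using \<open>c k \<noteq> 0\<close> by (simp add: scale_right_distrib scale_sum_right sum_negf)
    finally show ?thesis by (rule exI[where x = "\<lambda>i. - inverse (c k) * c i"])
  qed
  then have "qbasis V W {..<k} b" using b by (auto simp: qbasis_def spans_mod_def)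
  then show ?thesis using Pn[OF Pk] by (auto simp: qdim_def)
qed

lemma qdim_sub:
  assumes "subspace V" "subspace W" "subspace W'" "W' \<subseteq> W" "V \<subseteq> U" "qdim U W' n"
  shows "\<exists>k\<le>n. qdim V W k"
proof (rule qdim_exists[OF assms(1,2)])
  fix k :: nat and b assume b: "indep_mod W {..<k} b" "\<And>i. i < k \<Longrightarrow> b i \<in> V"
  from assms(6) obtain b' where "spans_mod U W' {..<n} b'" by (auto simp: qdim_def qbasis_def)
  moreover have "indep_mod W' {..<k} b" using b(1) assms(4) by (auto simp: indep_mod_def)
  ultimately show "k \<le> n"
    using indep_mod_card_le[OF assms(3), of "{..<k}" b U "{..<n}" b'] b(2) assms(5) by auto
qed

lemma qdim_add:
  assumes U: "subspace U" and V: "subspace V" and W: "subspace W" and sub: "W \<subseteq> V" "V \<subseteq> U"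
    and a: "qdim V W n" and b: "qdim U V m"
  shows "qdim U W (n + m)"
proof -
  from a obtain x where x: "indep_mod W {..<n} x" "spans_mod V W {..<n} x" by (auto simp: qdim_def qbasis_def)
  from b obtain y where y: "indep_mod V {..<m} y" "spans_mod U V {..<m} y" by (auto simp: qdim_def qbasis_def)
  let ?T = "{..<n} <+> {..<m}" and ?z = "case_sum x y"
  have s: "(\<Sum>i\<in>?T. c i *s ?z i) = (\<Sum>i<n. c (Inl i) *s x i) + (\<Sum>i<m. c (Inr i) *s y i)" for c
    by (simp add: sum.Plus o_def)
  have xV: "(\<Sum>i<n. c i *s x i) \<in> V" for c
    using x(2) by (intro subspace_sum[OF V] subspace_scale[OF V]) (auto simp: spans_mod_def)
  have "indep_mod W ?T ?z"
    unfolding indep_mod_def s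
  proof (intro conjI allI impI ballI)
    fix c i assume h: "(\<Sum>i<n. c (Inl i) *s x i) + (\<Sum>i<m. c (Inr i) *s y i) \<in> W" and i: "i \<in> ?T"
    have "((\<Sum>i<n. c (Inl i) *s x i) + (\<Sum>i<m. c (Inr i) *s y i)) - (\<Sum>i<n. c (Inl i) *s x i) \<in> V"
      using h sub xV by (intro subspace_diff[OF V]) auto
    then have "(\<Sum>i<m. c (Inr i) *s y i) \<in> V" by simp
    then have z: "\<forall>i<m. c (Inr i) = 0" using y(1) by (auto simp: indep_mod_def)
    then have "(\<Sum>i<n. c (Inl i) *s x i) \<in> W" using h by simp
    then have "\<forall>i\<in>{..<n}. c (Inl i) = 0" using spec[OF conjunct2[OF x(1)[unfolded indep_mod_def]], of "\<lambda>i. c (Inl i)"] by blast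
    with z i show "c i = 0" by (cases i) auto
  qed simp
  moreover have "spans_mod U W ?T ?z"
    unfolding spans_mod_def
  proof (intro conjI ballI)
    show "finite ?T" by simp
    show "?z i \<in> U" if "i \<in> ?T" for i using that x(2) y(2) sub by (auto simp: spans_mod_def)
    fix v assume "v \<in> U"
    then obtain c where c: "v - (\<Sum>i<m. c i *s y i) \<in> V" using y(2) by (auto simp: spans_mod_def)
    then obtain d where d: "v - (\<Sum>i<m. c i *s y i) - (\<Sum>i<n. d i *s x i) \<in> W"
      using x(2) unfolding spans_mod_def by blast
    then have "v - (\<Sum>i\<in>?T. case_sum d c i *s ?z i) \<in> W"
      unfolding s by (simp add: algebra_simps)
    then show "\<exists>c. v - (\<Sum>i\<in>?T. c i *s ?z i) \<in> W" by (rule exI[where x = "case_sum d c"])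
  qed
  ultimately show ?thesis by (intro qdimI[of _ _ ?T ?z]) (auto simp: qbasis_def card_Plus)
qed

lemma qdim_diff:
  assumes U: "subspace U" and V: "subspace V" and W: "subspace W" and sub: "W \<subseteq> V" "V \<subseteq> U"
    and a: "qdim V W n" and b: "qdim U W m"
  shows "n \<le> m \<and> qdim U V (m - n)"
proof -
  obtain k where k: "qdim U V k" using qdim_sub[OF U V W sub(1) _ b] by auto
  from qdim_add[OF U V W sub a k] qdim_unique[OF W b] have "m = n + k" by auto
  with k show ?thesis by simp
qed

text \<open>The map \<open>f\<close> induces an isomorphism from \<open>V/W\<close> to
  \<open>V'/W'\<close>; linearity is asked only modulo \<open>W'\<close>. The uses are
  multiplications by \<open>Y0 ^ N\<close> and \<open>Y1 ^ N\<close>.\<close>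

lemma qdim_image:
  assumes q: "qdim V W n" and fV: "\<And>v. v \<in> V \<Longrightarrow> f v \<in> V'"
    and lin: "\<And>c b. (\<And>i. i < n \<Longrightarrow> b i \<in> V) \<Longrightarrow> f (\<Sum>i<n. c i *s b i) - (\<Sum>i<n. c i *s f (b i)) \<in> W'"
    and diff: "\<And>x y. x \<in> V \<Longrightarrow> y \<in> V \<Longrightarrow> f x - f y - f (x - y) \<in> W'"
    and V: "subspace V" and W': "subspace W'"
    and ker: "\<And>v. v \<in> V \<Longrightarrow> f v \<in> W' \<longleftrightarrow> v \<in> W"
    and sur: "\<And>v'. v' \<in> V' \<Longrightarrow> \<exists>v\<in>V. v' - f v \<in> W'"
  shows "qdim V' W' n"
proof -
  from q obtain b where b: "indep_mod W {..<n} b" "spans_mod V W {..<n} b" by (auto simp: qdim_def qbasis_def)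
  have bV: "\<And>i. i < n \<Longrightarrow> b i \<in> V" using b(2) by (auto simp: spans_mod_def)
  have sV: "(\<Sum>i<n. c i *s b i) \<in> V" for c
    using bV by (intro subspace_sum[OF V] subspace_scale[OF V]) auto
  have "indep_mod W' {..<n} (\<lambda>i. f (b i))"
    unfolding indep_mod_def
  proof (intro conjI allI impI ballI)
    fix c i assume h: "(\<Sum>i<n. c i *s f (b i)) \<in> W'" and i: "i \<in> {..<n}"
    have "f (\<Sum>i<n. c i *s b i) \<in> W'"
      using subspace_add[OF W' lin[of b c, OF bV] h] by simp
    then have "(\<Sum>i<n. c i *s b i) \<in> W" using ker[OF sV] by simp
    then show "c i = 0" using b(1) i by (auto simp: indep_mod_def)
  qed simp
  moreover have "spans_mod V' W' {..<n} (\<lambda>i. f (b i))"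
    unfolding spans_mod_def
  proof (intro conjI ballI)
    show "f (b i) \<in> V'" if "i \<in> {..<n}" for i using that bV fV by auto
    fix v' assume "v' \<in> V'"
    then obtain v where v: "v \<in> V" "v' - f v \<in> W'" using sur by blast
    then obtain c where c: "v - (\<Sum>i<n. c i *s b i) \<in> W" using b(2) by (auto simp: spans_mod_def)
    have "f (v - (\<Sum>i<n. c i *s b i)) \<in> W'" using c ker subspace_diff[OF V v(1) sV] by blast
    then have "f v - f (\<Sum>i<n. c i *s b i) \<in> W'"
      using subspace_add[OF W' diff[OF v(1) sV[of c]]] by fastforce
    from subspace_add[OF W' v(2) subspace_add[OF W' this lin[of b c, OF bV]]]
    have "v' - (\<Sum>i<n. c i *s f (b i)) \<in> W'" by simp
    then show "\<exists>c. v' - (\<Sum>i<n. c i *s f (b i)) \<in> W'" by blast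
  qed simp
  ultimately show ?thesis by (auto simp: qdim_def qbasis_def)
qed

lemma functional_in_span:
  assumes T: "finite T" and V: "subspace V"
    and lin: "\<And>i x y. i \<in> T \<Longrightarrow> x \<in> V \<Longrightarrow> y \<in> V \<Longrightarrow> l i (x + y) = (l i x + l i y :: 'a)"
             "\<And>i c x. i \<in> T \<Longrightarrow> x \<in> V \<Longrightarrow> l i (c *s x) = c * l i x"
    and mlin: "\<And>x y. x \<in> V \<Longrightarrow> y \<in> V \<Longrightarrow> m (x + y) = (m x + m y :: 'a)"
             "\<And>c x. x \<in> V \<Longrightarrow> m (c *s x) = c * m x"
    and ker: "\<And>x. x \<in> V \<Longrightarrow> (\<And>i. i \<in> T \<Longrightarrow> l i x = 0) \<Longrightarrow> m x = 0"
  shows "\<exists>c. \<forall>x\<in>V. m x = (\<Sum>i\<in>T. c i * l i x)"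
  using T lin mlin ker
proof (induction T arbitrary: m rule: finite_induct)
  case empty
  then show ?case by auto
next
  case (insert j T)
  have mdiff: "m (x - y) = m x - m y" if "x \<in> V" "y \<in> V" for x y
    using insert.prems(3)[of "x - y" y] that subspace_diff[OF V] by simp
  have ldiff: "l i (x - y) = l i x - l i y" if "i \<in> insert j T" "x \<in> V" "y \<in> V" for x y i
    using insert.prems(1)[of i "x - y" y] that subspace_diff[OF V] by simp
  show ?case
  proof (cases "\<exists>z\<in>V. (\<forall>i\<in>T. l i z = 0) \<and> l j z \<noteq> 0")
    case True
    then obtain z where z: "z \<in> V" "\<And>i. i \<in> T \<Longrightarrow> l i z = 0" "l j z \<noteq> 0" by blast
    define a where "a = m z / l j z"
    define m' where "m' x = m x - a * l j x" for x
    have "\<exists>c. \<forall>x\<in>V. m' x = (\<Sum>i\<in>T. c i * l i x)"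
    proof (rule insert.IH)
      fix x assume x: "x \<in> V" "\<And>i. i \<in> T \<Longrightarrow> l i x = 0"
      define w where "w = x - (l j x / l j z) *s z"
      have wV: "w \<in> V" using x z V by (simp add: w_def subspace_diff subspace_scale)
      have "l i w = 0" if "i \<in> insert j T" for i
        using that x z ldiff[OF that x(1) subspace_scale[OF V z(1), of "l j x / l j z"]]
          insert.prems(2)[OF that z(1)] by (auto simp: w_def)
      then have "m w = 0" using insert.prems(5)[OF wV] by blast
      then have "m x = (l j x / l j z) * m z"
        using mdiff[OF x(1) subspace_scale[OF V z(1), of "l j x / l j z"]] insert.prems(4)[OF z(1)]
        by (simp add: w_def)
      then show "m' x = 0" by (simp add: m'_def a_def)
    next
      show "m' (x + y) = m' x + m' y" if "x \<in> V" "y \<in> V" for x y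
        using that insert.prems by (simp add: m'_def algebra_simps)
      show "m' (c *s x) = c * m' x" if "x \<in> V" for x c
        using that insert.prems by (simp add: m'_def algebra_simps)
    qed (use insert.prems in auto)
    then obtain c where c: "\<forall>x\<in>V. m' x = (\<Sum>i\<in>T. c i * l i x)" by blast
    have "m x = (\<Sum>i\<in>insert j T. (c(j := a)) i * l i x)" if "x \<in> V" for x
    proof -
      have "(\<Sum>i\<in>T. (c(j := a)) i * l i x) = (\<Sum>i\<in>T. c i * l i x)"
        using insert.hyps by (intro sum.cong) auto
      then show ?thesis using c that insert.hyps by (simp add: m'_def algebra_simps)
    qed
    then show ?thesis by blast
  next
    case False
    have "\<exists>c. \<forall>x\<in>V. m x = (\<Sum>i\<in>T. c i * l i x)"
    proof (rule insert.IH)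
      fix x assume x: "x \<in> V" "\<And>i. i \<in> T \<Longrightarrow> l i x = 0"
      then have "l j x = 0" using False by blast
      then show "m x = 0" using insert.prems(5)[OF x(1)] x(2) by blast
    qed (use insert.prems in auto)
    then obtain c where c: "\<forall>x\<in>V. m x = (\<Sum>i\<in>T. c i * l i x)" by blast
    have "m x = (\<Sum>i\<in>insert j T. (c(j := 0)) i * l i x)" if "x \<in> V" for x
    proof -
      have "(\<Sum>i\<in>T. (c(j := 0)) i * l i x) = (\<Sum>i\<in>T. c i * l i x)"
        using insert.hyps by (intro sum.cong) auto
      then show ?thesis using c that insert.hyps by simp
    qed
    then show ?thesis by blast
  qed
qed

end

section \<open>Polynomials and homogeneous ideals\<close>

text \<open>The ring as a module over itself: ideals are the \<open>idl.subspace\<close> sets and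
  \<open>idl.span\<close> is the generated ideal. The interpretation \<open>kv\<close> below is the
  same ring as a vector space over the field.\<close>

interpretation idl: Modules.module "(*) :: 'a::comm_ring_1 \<Rightarrow> 'a \<Rightarrow> 'a"
  by unfold_locales (simp_all add: algebra_simps)

lemma lookup_Const_mult: "Poly_Mapping.lookup (Const c * p) t = c * Poly_Mapping.lookup p t"
proof -
  have "(c when 0 = l) * Sum_any (\<lambda>q. Poly_Mapping.lookup p q when t = l + q)
      = (c * Poly_Mapping.lookup p t when l = 0)" for l
    by (cases "l = 0") auto
  then show ?thesis
    by (simp add: Const_def lookup_mult Poly_Mapping.lookup_single)
qed

lemma Const_add: "Const (c + d) = Const c + Const d"
  by (simp add: Const_def single_add)

lemma Const_mult: "Const (c * d) = Const c * Const d"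
  by (simp add: Const_def mult_single)

lemma Const_0 [simp]: "Const 0 = 0"
  by (simp add: Const_def)

lemma Const_1 [simp]: "Const 1 = 1"
  by (simp add: Const_def)

lemma Const_uminus: "Const (- c) = - Const c"
  by (simp add: Const_def single_uminus)

interpretation kv: kspace "\<lambda>c (p :: ('n::finite, 'k::field) mpoly). Const c * p"
  by unfold_locales (simp_all only: distrib_left distrib_right Const_add Const_mult Const_1 mult.assoc mult_1_left)

declare idl.scale_scale [simp del] kv.scale_scale [simp del]

section \<open>Total degree, forms and homogeneous components\<close>

definition tdeg :: "('n::finite \<Rightarrow>\<^sub>0 nat) \<Rightarrow> nat" where
  "tdeg t = (\<Sum>i\<in>UNIV. Poly_Mapping.lookup t i)"

lemma tdeg_add: "tdeg (s + t) = tdeg s + tdeg t"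
  by (simp add: tdeg_def lookup_add sum.distrib)

lemma tdeg_0 [simp]: "tdeg 0 = 0"
  by (simp add: tdeg_def)

lemma tdeg_single [simp]: "tdeg (Poly_Mapping.single i a) = a"
  by (simp add: tdeg_def Poly_Mapping.lookup_single when_def)

lemma homog_iff: "p \<in> homog l \<longleftrightarrow> (\<forall>t. Poly_Mapping.lookup p t \<noteq> 0 \<longrightarrow> int (tdeg t) = l)"
  by (auto simp: homog_def tdeg_def in_keys_iff)

lemma homog_0 [simp]: "0 \<in> homog l"
  by (simp add: homog_iff)

lemma homog_add: "p \<in> homog l \<Longrightarrow> q \<in> homog l \<Longrightarrow> p + q \<in> homog l"
  by (auto simp: homog_iff lookup_add) (metis add.right_neutral)

lemma homog_uminus: "p \<in> homog l \<Longrightarrow> - p \<in> homog l"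
  by (auto simp: homog_iff)

lemma homog_diff: "p \<in> homog l \<Longrightarrow> q \<in> homog l \<Longrightarrow> p - q \<in> homog l"
  using homog_add[of p l "- q"] homog_uminus[of q l] by simp

lemma homog_single: "int (tdeg t) = l \<Longrightarrow> Poly_Mapping.single t c \<in> homog l"
  by (auto simp: homog_iff Poly_Mapping.lookup_single when_def)

lemma homog_1 [simp]: "1 \<in> homog 0"
  using homog_single[of 0 0 1] by simp

lemma homog_Const [simp]: "Const c \<in> homog 0"
  by (simp add: Const_def homog_single)

lemma homog_Var [simp]: "Var i \<in> homog 1"
  by (simp add: Var_def homog_single)

lemma homog_mult: assumes "p \<in> homog a" "q \<in> homog b" shows "p * q \<in> homog (a + b)"
  unfolding homog_def
proof (intro CollectI ballI)
  fix t assume "t \<in> Poly_Mapping.keys (p * q)"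
  then obtain x y where "x \<in> Poly_Mapping.keys p" "y \<in> Poly_Mapping.keys q" "t = x + y"
    using keys_mult[of p q] by blast
  then show "int (\<Sum>i\<in>UNIV. Poly_Mapping.lookup t i) = a + b"
    using assms by (auto simp: homog_def lookup_add sum.distrib)
qed

lemma homog_mult': "p \<in> homog a \<Longrightarrow> q \<in> homog b \<Longrightarrow> c = a + b \<Longrightarrow> p * q \<in> homog c"
  using homog_mult by blast

lemma homog_power: "p \<in> homog a \<Longrightarrow> p ^ n \<in> homog (int n * a)"
  by (induction n) (auto simp: algebra_simps intro: homog_mult')

lemma homog_Const_mult: "p \<in> homog l \<Longrightarrow> Const c * p \<in> homog l"
  using homog_mult[of "Const c" 0 p l] by simp

lemma homog_sum: "(\<And>i. i \<in> T \<Longrightarrow> f i \<in> homog l) \<Longrightarrow> sum f T \<in> homog l"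
  by (induction T rule: infinite_finite_induct) (auto intro: homog_add)

lemma homog_prod: "finite T \<Longrightarrow> (\<And>i. i \<in> T \<Longrightarrow> f i \<in> homog (l i)) \<Longrightarrow> prod f T \<in> homog (sum l T)"
  by (induction T rule: finite_induct) (auto intro: homog_mult)

lemma homog_neg: "l < 0 \<Longrightarrow> p \<in> homog l \<longleftrightarrow> p = 0"
proof
  assume "l < 0" "p \<in> homog l"
  then show "p = 0" by (intro poly_mapping_eqI) (auto simp: homog_iff)
qed simp

lemma homog_0_Const: assumes "p \<in> homog 0" shows "\<exists>c. p = Const c"
proof -
  have "tdeg t = 0 \<Longrightarrow> t = 0" for t :: "'a \<Rightarrow>\<^sub>0 nat" by (auto simp: tdeg_def intro: poly_mapping_eqI)
  then have "p = Const (Poly_Mapping.lookup p 0)"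
    using assms by (intro poly_mapping_eqI) (auto simp: homog_iff Const_def Poly_Mapping.lookup_single when_def)
  then show ?thesis by blast
qed

lemma subspace_homog: "kv.subspace (homog l)"
  by (auto simp: kv.subspace_def intro: homog_add homog_Const_mult)

text \<open>The homogeneous component of degree \<open>l\<close>. The degree is an integer so that
  shifts such as \<open>hc (l - e)\<close> need no case distinction; components of negative degree
  are zero.\<close>

lift_definition hc :: "int \<Rightarrow> ('n::finite, 'k::field) mpoly \<Rightarrow> ('n, 'k) mpoly" is
  "\<lambda>l p t. if int (tdeg t) = l then p t else 0"
  by (rule finite_subset[rotated]) auto

lemma lookup_hc: "Poly_Mapping.lookup (hc l p) t = (if int (tdeg t) = l then Poly_Mapping.lookup p t else 0)"
  by transfer simp

lemma hc_homog: "hc l p \<in> homog l"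
  by (simp add: homog_iff lookup_hc)

lemma hc_id: "p \<in> homog l \<Longrightarrow> hc l p = p"
  by (intro poly_mapping_eqI) (auto simp: lookup_hc homog_iff)

lemma hc_other: "p \<in> homog l \<Longrightarrow> l \<noteq> l' \<Longrightarrow> hc l' p = 0"
  by (intro poly_mapping_eqI) (auto simp: lookup_hc homog_iff)

lemma hc_0 [simp]: "hc l 0 = 0"
  by (simp add: hc_id)

lemma hc_add: "hc l (p + q) = hc l p + hc l q"
  by (intro poly_mapping_eqI) (simp add: lookup_hc lookup_add)

lemma hc_diff: "hc l (p - q) = hc l p - hc l q"
  by (intro poly_mapping_eqI) (simp add: lookup_hc lookup_minus)

lemma hc_sum: "hc l (sum f T) = (\<Sum>i\<in>T. hc l (f i))"
  by (induction T rule: infinite_finite_induct) (auto simp: hc_add)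

lemma hc_decomp: "\<exists>L. finite L \<and> p = (\<Sum>l\<in>L. hc l p)"
proof -
  let ?L = "(\<lambda>t. int (tdeg t)) ` Poly_Mapping.keys p"
  have "p = (\<Sum>l\<in>?L. hc l p)"
  proof (rule poly_mapping_eqI)
    fix t
    show "Poly_Mapping.lookup p t = Poly_Mapping.lookup (\<Sum>l\<in>?L. hc l p) t"
      by (auto simp: lookup_sum lookup_hc in_keys_iff)
  qed
  then show ?thesis by (intro exI[of _ ?L]) auto
qed

lemma hc_mult: assumes "q \<in> homog e" shows "hc l (q * p) = q * hc (l - e) p"
proof -
  obtain L where L: "finite L" "p = (\<Sum>l\<in>L. hc l p)" using hc_decomp by blast
  have *: "hc l (q * hc j p) = (if j = l - e then q * hc j p else 0)" for j
    using homog_mult[OF assms hc_homog[of j p]] hc_id hc_other by (auto simp: algebra_simps)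
  have **: "hc (l - e) (hc j p) = (if j = l - e then hc j p else 0)" for j
    using hc_homog[of j p] hc_id hc_other by auto
  have "hc l (q * p) = (\<Sum>j\<in>L. hc l (q * hc j p))"
    by (subst L(2)) (simp add: hc_sum sum_distrib_left)
  also have "\<dots> = (\<Sum>j\<in>L. q * hc (l - e) (hc j p))" by (intro sum.cong) (auto simp: * **)
  also have "\<dots> = q * hc (l - e) p" by (subst (2) L(2)) (simp add: hc_sum sum_distrib_left)
  finally show ?thesis .
qed

lemma hc_Const_mult: "hc l (Const c * p) = Const c * hc l p"
  using hc_mult[OF homog_Const] by simp

text \<open>Homogeneity as stability under taking components, the form that the arguments use;
  \<open>homogeneous_ideal_iff\<close> identifies it with generation by forms.\<close>

definition hideal :: "('n::finite, 'k::field) mpoly set \<Rightarrow> bool" where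
  "hideal I \<longleftrightarrow> idl.subspace I \<and> (\<forall>p\<in>I. \<forall>l. hc l p \<in> I)"

lemma ideal_class_ring_iff: "ideal I (class_ring :: 'a::comm_ring_1 ring) \<longleftrightarrow> idl.subspace I"
proof
  assume "ideal I (class_ring :: 'a ring)"
  then interpret ideal I "class_ring :: 'a ring" .
  show "idl.subspace I"
    using zero_closed a_closed I_l_closed by (auto simp: idl.subspace_def)
next
  assume I: "idl.subspace I"
  show "ideal I (class_ring :: 'a ring)"
  proof (rule idealI)
    show "subgroup I (add_monoid (class_ring :: 'a ring))"
    proof
      fix x assume "x \<in> I"
      moreover have "inv\<^bsub>add_monoid (class_ring :: 'a ring)\<^esub> x = - x"
        using fun_cong[OF class_ring_simps(8), of x] by (simp add: a_inv_def)
      ultimately show "inv\<^bsub>add_monoid (class_ring :: 'a ring)\<^esub> x \<in> I" using idl.subspace_neg[OF I] by simp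
    qed (use I in \<open>auto simp: idl.subspace_def\<close>)
  next
    fix a x assume "a \<in> I" "x \<in> carrier (class_ring :: 'a ring)"
    then have "x * a \<in> I" using I by (auto simp: idl.subspace_def)
    then show "x \<otimes>\<^bsub>class_ring\<^esub> a \<in> I" "a \<otimes>\<^bsub>class_ring\<^esub> x \<in> I" by (simp_all add: mult.commute)
  qed (rule class_ring.ring_axioms)
qed

lemma genideal_class_ring: "Idl\<^bsub>class_ring\<^esub> G = idl.span (G :: 'a::comm_ring_1 set)"
proof -
  have "Idl\<^bsub>class_ring\<^esub> G = \<Inter>{I. idl.subspace I \<and> G \<subseteq> I}"
    by (simp add: genideal_def ideal_class_ring_iff)
  also have "\<dots> = idl.span G" by (simp add: idl.span_def hull_def)
  finally show ?thesis .
qed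

lemma hideal_span: assumes "\<And>g. g \<in> G \<Longrightarrow> \<exists>l. g \<in> homog l" shows "hideal (idl.span G)"
  unfolding hideal_def
proof (intro conjI ballI allI)
  fix p l assume "p \<in> idl.span G"
  then show "hc l p \<in> idl.span G"
  proof (induction arbitrary: l rule: idl.span_induct_alt)
    case base then show ?case by (simp add: idl.span_zero)
  next
    case (step q g p)
    obtain e where "g \<in> homog e" using assms step by blast
    then have "hc l (q * g) = hc (l - e) q * g" using hc_mult[of g e l q] by (simp add: mult.commute)
    then show ?case using step by (simp add: hc_add idl.span_add idl.span_scale idl.span_base)
  qed
qed simp

lemma hideal_eq_span: assumes "hideal I" shows "idl.span {p \<in> I. \<exists>l. p \<in> homog l} = I"
proof (rule idl.span_subspace)
  show "I \<subseteq> idl.span {p \<in> I. \<exists>l. p \<in> homog l}"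
  proof
    fix p assume p: "p \<in> I"
    obtain L where "p = (\<Sum>l\<in>L. hc l p)" using hc_decomp by blast
    moreover have "(\<Sum>l\<in>L. hc l p) \<in> idl.span {p \<in> I. \<exists>l. p \<in> homog l}"
      using p assms hc_homog[of _ p] by (intro idl.span_sum idl.span_base) (auto simp: hideal_def)
    ultimately show "p \<in> idl.span {p \<in> I. \<exists>l. p \<in> homog l}" by simp
  qed
qed (use assms in \<open>auto simp: hideal_def\<close>)

lemma homogeneous_ideal_iff: "homogeneous_ideal I \<longleftrightarrow> hideal I"
  unfolding homogeneous_ideal_def ideal_class_ring_iff genideal_class_ring
  using hideal_eq_span[of I] hideal_span[of "{p \<in> I. \<exists>l. p \<in> homog l}"] by (auto simp: hideal_def)

lemma hideal_subspace: "hideal I \<Longrightarrow> idl.subspace I" and hideal_hc: "hideal I \<Longrightarrow> p \<in> I \<Longrightarrow> hc l p \<in> I"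
  by (auto simp: hideal_def)

lemma hideal_mem_iff: assumes "hideal I" shows "p \<in> I \<longleftrightarrow> (\<forall>l. hc l p \<in> I)"
proof
  assume h: "\<forall>l. hc l p \<in> I"
  obtain L where "p = (\<Sum>l\<in>L. hc l p)" using hc_decomp by blast
  moreover have "(\<Sum>l\<in>L. hc l p) \<in> I" using h by (intro idl.subspace_sum hideal_subspace assms) auto
  ultimately show "p \<in> I" by simp
qed (use assms hideal_hc in auto)

lemma ideal_kv_subspace: "idl.subspace I \<Longrightarrow> kv.subspace I"
  by (auto simp: kv.subspace_def idl.subspace_def)

lemma hideal_Un: "hideal I \<Longrightarrow> (\<And>g. g \<in> G \<Longrightarrow> \<exists>l. g \<in> homog l) \<Longrightarrow> hideal (idl.span (I \<union> G))"
proof -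
  assume I: "hideal I" and G: "\<And>g. g \<in> G \<Longrightarrow> \<exists>l. g \<in> homog l"
  have "idl.span I = idl.span {p \<in> I. \<exists>l. p \<in> homog l}"
    using arg_cong[OF hideal_eq_span[OF I], of idl.span] by (simp only: idl.span_span)
  then have "idl.span (I \<union> G) = idl.span ({p \<in> I. \<exists>l. p \<in> homog l} \<union> G)"
    by (simp only: idl.span_Un)
  then show ?thesis using G by (auto intro: hideal_span)
qed

lemma span_Un_singleton: "idl.subspace I \<Longrightarrow> x \<in> idl.span (insert a I) \<longleftrightarrow> (\<exists>q. x - q * a \<in> I)"
  unfolding idl.span_breakdown_eq by (subst idl.span_eq_iff[THEN iffD2]) auto

lemma lookup_le_tdeg: "Poly_Mapping.lookup t i \<le> tdeg t"
  unfolding tdeg_def by (rule member_le_sum) auto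

lemma finite_tdeg: "finite {t :: 'n::finite \<Rightarrow>\<^sub>0 nat. tdeg t \<le> l}"
proof (rule inj_on_finite[of Poly_Mapping.lookup _ "{f :: 'n \<Rightarrow> nat. \<forall>i. f i \<le> l}"])
  show "finite {f :: 'n \<Rightarrow> nat. \<forall>i. f i \<le> l}"
    using finite_set_of_finite_funs[of "UNIV :: 'n set" "{..l}" 0] by (simp add: Ball_def)
  show "inj_on Poly_Mapping.lookup {t :: 'n \<Rightarrow>\<^sub>0 nat. tdeg t \<le> l}"
    by (rule inj_onI) (simp only: poly_mapping_eq_iff)
  show "Poly_Mapping.lookup ` {t :: 'n \<Rightarrow>\<^sub>0 nat. tdeg t \<le> l} \<subseteq> {f. \<forall>i. f i \<le> l}"
    using lookup_le_tdeg le_trans by blast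
qed

lemma poly_mapping_sum_monoms:
  "p = (\<Sum>t\<in>Poly_Mapping.keys p. Const (Poly_Mapping.lookup p t) * Poly_Mapping.single t 1)"
proof (rule poly_mapping_eqI)
  fix t
  have "Poly_Mapping.lookup (\<Sum>t\<in>Poly_Mapping.keys p. Const (Poly_Mapping.lookup p t) * Poly_Mapping.single t 1) t
    = (\<Sum>s\<in>Poly_Mapping.keys p. if s = t then Poly_Mapping.lookup p t else 0)"
    unfolding lookup_sum by (rule sum.cong) (auto simp: lookup_Const_mult Poly_Mapping.lookup_single when_def)
  then show "Poly_Mapping.lookup p t = Poly_Mapping.lookup (\<Sum>t\<in>Poly_Mapping.keys p. Const (Poly_Mapping.lookup p t) * Poly_Mapping.single t 1) t"
    by (simp add: in_keys_iff)
qed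

lemma qbasis_homog:
  "kv.qbasis (homog l) {0 :: ('n::finite, 'k::field) mpoly} {t. int (tdeg t) = l} (\<lambda>t. Poly_Mapping.single t 1)"
proof -
  let ?T = "{t :: 'n \<Rightarrow>\<^sub>0 nat. int (tdeg t) = l}"
  have fin: "finite ?T" by (rule finite_subset[OF _ finite_tdeg[of "nat l"]]) auto
  have lk: "Poly_Mapping.lookup (\<Sum>t\<in>?T. Const (c t) * Poly_Mapping.single t 1) s = (if s \<in> ?T then c s else 0)" for c :: "_ \<Rightarrow> 'k" and s
  proof -
    have "Poly_Mapping.lookup (\<Sum>t\<in>?T. Const (c t) * Poly_Mapping.single t 1) s = (\<Sum>t\<in>?T. if t = s then c s else 0)"
      unfolding lookup_sum by (rule sum.cong) (auto simp: lookup_Const_mult Poly_Mapping.lookup_single when_def)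
    then show ?thesis using fin by simp
  qed
  show ?thesis
    unfolding kv.qbasis_def kv.indep_mod_def kv.spans_mod_def
  proof (intro conjI ballI allI impI fin)
    fix c and t assume "(\<Sum>i\<in>?T. Const (c i :: 'k) * Poly_Mapping.single i 1) \<in> {0}" "t \<in> ?T"
    then show "c t = 0" using lk[of c t] by simp
  next
    fix v :: "('n, 'k) mpoly" assume v: "v \<in> homog l"
    have "v = (\<Sum>i\<in>?T. Const (Poly_Mapping.lookup v i) * Poly_Mapping.single i 1)"
      by (rule poly_mapping_eqI) (use v in \<open>auto simp: lk homog_iff\<close>)
    then show "\<exists>c. v - (\<Sum>i\<in>?T. Const (c i) * Poly_Mapping.single i 1) \<in> {0}"
      by (intro exI[of _ "Poly_Mapping.lookup v"]) simp
  qed (auto simp: homog_single)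
qed

lemma qdim_homog_exists:
  assumes "kv.subspace V" "kv.subspace W" "V \<subseteq> homog l"
  shows "\<exists>n. kv.qdim V W n"
  using kv.qdim_sub[OF assms(1,2) kv.subspace_single_0 _ assms(3) kv.qdimI[OF qbasis_homog refl]]
    kv.subspace_0[OF assms(2)] by auto

section \<open>Regular sequences that are monic in complementary variables\<close>

lemma lookup_monom_mult:
  "Poly_Mapping.lookup (Poly_Mapping.single s 1 * p) (s + t) = Poly_Mapping.lookup (p :: ('n::finite, 'k::field) mpoly) t"
proof -
  have "(1 when s = l) * Sum_any (\<lambda>q. Poly_Mapping.lookup p q when s + t = l + q)
      = (Poly_Mapping.lookup p t when l = s)" for l
    by (cases "l = s") auto
  then show ?thesis
    by (simp add: lookup_mult Poly_Mapping.lookup_single)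
qed

lemma lookup_monom_mult_nonzero:
  assumes "Poly_Mapping.lookup (Poly_Mapping.single s 1 * p) u \<noteq> 0"
  shows "\<exists>t. u = s + t \<and> Poly_Mapping.lookup (p :: ('n::finite, 'k::field) mpoly) t \<noteq> 0"
proof -
  have "u \<in> Poly_Mapping.keys (Poly_Mapping.single s 1 * p)" using assms by (simp add: in_keys_iff)
  then show ?thesis using keys_mult[of "Poly_Mapping.single s 1" p] by (auto simp: in_keys_iff split: if_splits)
qed

lemma Var_power: "Var i ^ a = (Poly_Mapping.single (Poly_Mapping.single i a) 1 :: ('n::finite, 'k::field) mpoly)"
  by (induction a) (simp_all add: Var_def mult_single single_add[symmetric] add.commute)

lemma homog_Var_sum:
  fixes p :: "('n::finite, 'k::field) mpoly"
  assumes "p \<in> homog (int (Suc l))"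
  shows "\<exists>q. (\<forall>i. q i \<in> homog (int l)) \<and> p = (\<Sum>i\<in>UNIV. Var i * q i)"
proof -
  define V :: "('n, 'k) mpoly set" where "V = {p. \<exists>q. (\<forall>i. q i \<in> homog (int l)) \<and> p = (\<Sum>i\<in>UNIV. Var i * q i)}"
  have VI: "(\<And>i. q i \<in> homog (int l)) \<Longrightarrow> (\<Sum>i\<in>UNIV. Var i * q i) \<in> V" for q
    unfolding V_def by blast
  have V: "kv.subspace V"
    unfolding kv.subspace_def
  proof (intro conjI ballI allI)
    show "0 \<in> V" using VI[of "\<lambda>_. 0"] by simp
  next
    fix x y assume "x \<in> V" "y \<in> V"
    then obtain q r where q: "\<And>i. q i \<in> homog (int l)" "x = (\<Sum>i\<in>UNIV. Var i * q i)"
      and r: "\<And>i. r i \<in> homog (int l)" "y = (\<Sum>i\<in>UNIV. Var i * r i)" by (auto simp: V_def)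
    have "(\<Sum>i\<in>UNIV. Var i * (q i + r i)) \<in> V" by (rule VI) (rule homog_add[OF q(1) r(1)])
    then show "x + y \<in> V" by (simp only: q(2) r(2) distrib_left sum.distrib)
  next
    fix c x assume "x \<in> V"
    then obtain q where q: "\<And>i. q i \<in> homog (int l)" "x = (\<Sum>i\<in>UNIV. Var i * q i)" by (auto simp: V_def)
    have "(\<Sum>i\<in>UNIV. Var i * (Const c * q i)) \<in> V" by (rule VI) (rule homog_Const_mult[OF q(1)])
    then show "Const c * x \<in> V" by (simp only: q(2) sum_distrib_left mult.left_commute)
  qed
  have mono: "Poly_Mapping.single t 1 \<in> V" if "tdeg t = Suc l" for t
  proof -
    have "\<exists>j. Poly_Mapping.lookup t j \<noteq> 0"
    proof (rule ccontr)
      assume "\<not> ?thesis"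
      then have "t = 0" by (auto intro: poly_mapping_eqI)
      then show False using that by simp
    qed
    then obtain j where j: "Poly_Mapping.lookup t j \<noteq> 0" by blast
    define s where "s = t - Poly_Mapping.single j 1"
    have t: "t = Poly_Mapping.single j 1 + s"
      using j unfolding s_def
      by (intro poly_mapping_eqI) (auto simp: lookup_add lookup_minus Poly_Mapping.lookup_single when_def)
    define q where "q i = (if i = j then Poly_Mapping.single s (1::'k) else 0)" for i
    have "tdeg s = l" using that t by (simp add: tdeg_add)
    then have "\<forall>i. q i \<in> homog (int l)" by (auto simp: q_def homog_single)
    moreover have "(\<Sum>i\<in>UNIV. Var i * q i) = (\<Sum>i\<in>UNIV. if i = j then Var j * Poly_Mapping.single s 1 else 0)"
      by (rule sum.cong) (auto simp: q_def)
    then have "(\<Sum>i\<in>UNIV. Var i * q i) = Poly_Mapping.single t 1"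
      by (simp add: Var_def mult_single t)
    ultimately show ?thesis using VI[of q] by simp
  qed
  have "p = (\<Sum>t\<in>Poly_Mapping.keys p. Const (Poly_Mapping.lookup p t) * Poly_Mapping.single t 1)"
    by (rule poly_mapping_sum_monoms)
  moreover have "(\<Sum>t\<in>Poly_Mapping.keys p. Const (Poly_Mapping.lookup p t) * Poly_Mapping.single t 1) \<in> V"
  proof (intro kv.subspace_sum[OF V] kv.subspace_scale[OF V])
    fix t assume "t \<in> Poly_Mapping.keys p"
    then have "tdeg t = Suc l" using assms by (auto simp: homog_iff in_keys_iff)
    with mono show "Poly_Mapping.single t 1 \<in> V" .
  qed
  ultimately have "p \<in> V" by simp
  then show ?thesis by (auto simp: V_def)
qed

text \<open>Two linear forms sit at \<open>i0\<close> and \<open>i1\<close>; at every other index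
  there is a form equal to \<open>Var i ^ M\<close> modulo these two. By \<open>Var_span\<close> the
  two linear forms and the remaining variables are linear coordinates. The polynomial ring is then
  free over the subring generated by all \<open>f i\<close>, with the monomials of exponents below
  \<open>D i\<close> as a basis; the map \<open>Phi\<close> below expresses this in terms of vector
  spaces.\<close>

locale monic_family =
  fixes i0 i1 :: "'n::finite" and M :: nat and f :: "'n \<Rightarrow> ('n, 'k::field) mpoly"
  assumes i01: "i0 \<noteq> i1" and M: "M > 0"
    and f_i0: "f i0 \<in> homog 1" and f_i1: "f i1 \<in> homog 1"
    and f_monic: "\<And>i. i \<noteq> i0 \<Longrightarrow> i \<noteq> i1 \<Longrightarrow>
       \<exists>a\<in>homog (int M - 1). \<exists>b\<in>homog (int M - 1). f i = Var i ^ M + f i0 * a + f i1 * b"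
    and Var_span: "\<And>j. \<exists>c d e. Var j = Const c * f i0 + Const d * f i1 + (\<Sum>i\<in>-{i0,i1}. Const (e i) * Var i)"
begin

definition D :: "'n \<Rightarrow> nat" where "D i = (if i = i0 \<or> i = i1 then 1 else M)"

lemma D_pos: "D i > 0"
  using M by (simp add: D_def)

lemma f_homog: "f i \<in> homog (int (D i))"
proof (cases "i = i0 \<or> i = i1")
  case True
  then show ?thesis using f_i0 f_i1 by (auto simp: D_def)
next
  case False
  then obtain a b where ab: "a \<in> homog (int M - 1)" "b \<in> homog (int M - 1)" "f i = Var i ^ M + f i0 * a + f i1 * b"
    using f_monic by blast
  have "f i0 * a \<in> homog (int M)" "f i1 * b \<in> homog (int M)"
    using ab f_i0 f_i1 by (auto intro: homog_mult')
  then show ?thesis using ab(3) homog_power[OF homog_Var, of i M] False by (auto simp: D_def intro!: homog_add)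
qed

text \<open>Each exponent is divided by \<open>D i\<close>: the quotient becomes a power of
  \<open>f i\<close> and the remainder stays on the variable. The degree is unchanged because
  \<open>f i\<close> has degree \<open>D i\<close>.\<close>

definition mon :: "('n \<Rightarrow>\<^sub>0 nat) \<Rightarrow> ('n, 'k) mpoly" where
  "mon t = (\<Prod>i\<in>UNIV. Var i ^ (Poly_Mapping.lookup t i mod D i) * f i ^ (Poly_Mapping.lookup t i div D i))"

lemma mon_homog: "mon t \<in> homog (int (tdeg t))"
proof -
  have "Var i ^ (Poly_Mapping.lookup t i mod D i) * f i ^ (Poly_Mapping.lookup t i div D i) \<in> homog (int (Poly_Mapping.lookup t i))" for i
  proof (rule homog_mult'[OF homog_power[OF homog_Var] homog_power[OF f_homog]])
    show "int (Poly_Mapping.lookup t i) =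
      int (Poly_Mapping.lookup t i mod D i) * 1 + int (Poly_Mapping.lookup t i div D i) * int (D i)"
      using arg_cong[OF mod_div_mult_eq[of "Poly_Mapping.lookup t i" "D i", symmetric], of int]
      by (simp only: of_nat_add of_nat_mult mult_1_right)
  qed
  then show ?thesis unfolding mon_def tdeg_def of_nat_sum by (intro homog_prod) auto
qed

lemma mon_add_single: "mon (Poly_Mapping.single j (a * D j) + t) = f j ^ a * mon t"
proof -
  let ?g = "\<lambda>t i. Var i ^ (Poly_Mapping.lookup t i mod D i) * f i ^ (Poly_Mapping.lookup t i div D i)"
  let ?s = "Poly_Mapping.single j (a * D j) + t"
  have "mon ?s = ?g ?s j * (\<Prod>i\<in>UNIV-{j}. ?g ?s i)"
    unfolding mon_def by (rule prod.remove) auto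
  also have "(\<Prod>i\<in>UNIV-{j}. ?g ?s i) = (\<Prod>i\<in>UNIV-{j}. ?g t i)"
    by (rule prod.cong) (auto simp: lookup_add Poly_Mapping.lookup_single when_def)
  also have "?g ?s j = f j ^ a * ?g t j"
    using D_pos[of j] by (simp add: lookup_add power_add mult.left_commute)
  also have "f j ^ a * ?g t j * (\<Prod>i\<in>UNIV-{j}. ?g t i) = f j ^ a * (?g t j * (\<Prod>i\<in>UNIV-{j}. ?g t i))"
    by (rule mult.assoc)
  also have "?g t j * (\<Prod>i\<in>UNIV-{j}. ?g t i) = mon t"
    unfolding mon_def by (rule prod.remove[symmetric]) auto
  finally show ?thesis .
qed

text \<open>The linear map sending the monomial of exponent \<open>t\<close> to
  \<open>mon t\<close>; it turns out to be bijective. It is not multiplicative in general, but it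
  turns multiplication by \<open>Var j ^ (a * D j)\<close> into multiplication by
  \<open>f j ^ a\<close>, which carries statements on monomial ideals over to ideals of powers of
  the \<open>f j\<close>.\<close>

definition Phi :: "('n, 'k) mpoly \<Rightarrow> ('n, 'k) mpoly" where
  "Phi p = (\<Sum>t\<in>Poly_Mapping.keys p. Const (Poly_Mapping.lookup p t) * mon t)"

lemma Phi_add: "Phi (p + q) = Phi p + Phi q"
  unfolding Phi_def by (rule setsum_keys_plus_distrib) (simp_all add: Const_add distrib_right)

lemma Phi_superset: assumes "finite T" "Poly_Mapping.keys p \<subseteq> T"
  shows "Phi p = (\<Sum>t\<in>T. Const (Poly_Mapping.lookup p t) * mon t)"
  unfolding Phi_def by (rule sum.mono_neutral_left) (use assms in \<open>auto simp: in_keys_iff\<close>)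

lemma Phi_0 [simp]: "Phi 0 = 0"
  by (simp add: Phi_def)

lemma Phi_Const_mult: "Phi (Const c * p) = Const c * Phi p"
proof -
  have "Poly_Mapping.keys (Const c * p) \<subseteq> Poly_Mapping.keys p" by (auto simp: in_keys_iff lookup_Const_mult)
  then have "Phi (Const c * p) = (\<Sum>t\<in>Poly_Mapping.keys p. Const (Poly_Mapping.lookup (Const c * p) t) * mon t)"
    by (rule Phi_superset[OF finite_keys])
  also have "\<dots> = Const c * Phi p"
    unfolding Phi_def lookup_Const_mult Const_mult mult.assoc by (rule sum_distrib_left[symmetric])
  finally show ?thesis .
qed

lemma Phi_sum: "Phi (sum g T) = (\<Sum>i\<in>T. Phi (g i))"
  by (induction T rule: infinite_finite_induct) (auto simp: Phi_add)

lemma Phi_uminus: "Phi (- p) = - Phi p"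
  using Phi_Const_mult[of "-1" p] by (simp add: Const_uminus)

lemma Phi_diff: "Phi (p - q) = Phi p - Phi q"
  using Phi_add[of p "- q"] Phi_uminus[of q] by simp

lemma Phi_monom: "Phi (Poly_Mapping.single t 1) = mon t"
  by (simp add: Phi_def)

lemma Phi_homog: "p \<in> homog l \<Longrightarrow> Phi p \<in> homog l"
  unfolding Phi_def
proof (intro homog_sum homog_Const_mult)
  fix t assume "p \<in> homog l" "t \<in> Poly_Mapping.keys p"
  then have "int (tdeg t) = l" by (auto simp: homog_iff in_keys_iff)
  then show "mon t \<in> homog l" using mon_homog[of t] by simp
qed

lemma Phi_f_mult: "Phi (Var j ^ (a * D j) * p) = f j ^ a * Phi p"
proof -
  have "Phi (Var j ^ (a * D j) * p)
    = Phi (Var j ^ (a * D j) * (\<Sum>t\<in>Poly_Mapping.keys p. Const (Poly_Mapping.lookup p t) * Poly_Mapping.single t 1))"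
    using poly_mapping_sum_monoms[of p] by simp
  also have "\<dots> = (\<Sum>t\<in>Poly_Mapping.keys p. Phi (Const (Poly_Mapping.lookup p t) * (Var j ^ (a * D j) * Poly_Mapping.single t 1)))"
    by (simp only: sum_distrib_left Phi_sum mult.left_commute)
  also have "\<dots> = (\<Sum>t\<in>Poly_Mapping.keys p. Const (Poly_Mapping.lookup p t) * (f j ^ a * mon t))"
    by (simp add: Phi_Const_mult Var_power mult_single Phi_monom mon_add_single)
  also have "\<dots> = f j ^ a * Phi p"
    by (simp add: Phi_def sum_distrib_left mult_ac)
  finally show ?thesis .
qed

text \<open>By \<open>Var_span\<close> every variable is a combination of \<open>f i0\<close>,
  \<open>f i1\<close> and the variables outside \<open>{i0, i1}\<close>; peeling off one variable at
  a time collects the multiples of the two linear forms.\<close>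

lemma homog_Y_decomp:
  assumes "p \<in> homog (int l)"
  shows "\<exists>a\<in>homog (int l - 1). \<exists>b\<in>homog (int l - 1). \<exists>r\<in>homog (int l).
     (\<forall>t. Poly_Mapping.lookup r t \<noteq> 0 \<longrightarrow> Poly_Mapping.lookup t i0 = 0 \<and> Poly_Mapping.lookup t i1 = 0) \<and>
     p = f i0 * a + f i1 * b + r"
  using assms
proof (induction l arbitrary: p)
  case 0
  then have "tdeg t = 0" if "Poly_Mapping.lookup p t \<noteq> 0" for t using that by (auto simp: homog_iff)
  then have "Poly_Mapping.lookup t i = 0" if "Poly_Mapping.lookup p t \<noteq> 0" for t i
    using that lookup_le_tdeg[of t i] by fastforce
  then show ?case using 0 by (intro bexI[of _ 0] bexI[of _ p]) auto
next
  case (Suc l)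
  define P where "P p \<longleftrightarrow> (\<exists>a\<in>homog (int l). \<exists>b\<in>homog (int l). \<exists>r\<in>homog (int (Suc l)).
     (\<forall>t. Poly_Mapping.lookup r t \<noteq> 0 \<longrightarrow> Poly_Mapping.lookup t i0 = 0 \<and> Poly_Mapping.lookup t i1 = 0) \<and>
     p = f i0 * a + f i1 * b + r)" for p
  have P0: "P 0" unfolding P_def by (intro bexI[of _ 0]) auto
  have Padd: "P (x + y)" if xy: "P x" "P y" for x y
  proof -
    from xy(1) obtain a b r where x: "a \<in> homog (int l)" "b \<in> homog (int l)" "r \<in> homog (int (Suc l))"
      "\<forall>t. Poly_Mapping.lookup r t \<noteq> 0 \<longrightarrow> Poly_Mapping.lookup t i0 = 0 \<and> Poly_Mapping.lookup t i1 = 0"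
      "x = f i0 * a + f i1 * b + r" unfolding P_def by blast
    from xy(2) obtain a' b' r' where y: "a' \<in> homog (int l)" "b' \<in> homog (int l)" "r' \<in> homog (int (Suc l))"
      "\<forall>t. Poly_Mapping.lookup r' t \<noteq> 0 \<longrightarrow> Poly_Mapping.lookup t i0 = 0 \<and> Poly_Mapping.lookup t i1 = 0"
      "y = f i0 * a' + f i1 * b' + r'" unfolding P_def by blast
    have "Poly_Mapping.lookup t i0 = 0 \<and> Poly_Mapping.lookup t i1 = 0" if "Poly_Mapping.lookup (r + r') t \<noteq> 0" for t
      using that x(4) y(4) by (cases "Poly_Mapping.lookup r t = 0") (auto simp: lookup_add)
    moreover have "x + y = f i0 * (a + a') + f i1 * (b + b') + (r + r')"
      using x(5) y(5) by (simp add: algebra_simps)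
    ultimately show ?thesis unfolding P_def using x(1-3) y(1-3) homog_add by blast
  qed
  have Psum: "P (sum g T)" if "\<And>i. i \<in> T \<Longrightarrow> P (g i)" for g and T :: "'n set"
    using that by (induction T rule: infinite_finite_induct) (auto intro: P0 Padd)
  have P1: "P (f i0 * q)" "P (f i1 * q)" if "q \<in> homog (int l)" for q
  proof -
    have "\<forall>t. Poly_Mapping.lookup 0 t \<noteq> 0 \<longrightarrow> Poly_Mapping.lookup t i0 = 0 \<and> Poly_Mapping.lookup t i1 = 0"
      "f i0 * q = f i0 * q + f i1 * 0 + 0" "f i1 * q = f i0 * 0 + f i1 * q + 0" by simp_all
    then show "P (f i0 * q)" "P (f i1 * q)" unfolding P_def using that homog_0 by blast+
  qed
  have P2: "P (Var i * q)" if q: "q \<in> homog (int l)" and i: "i \<notin> {i0, i1}" for q i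
  proof -
    from Suc.IH[OF q] obtain a b r where abr: "a \<in> homog (int l - 1)" "b \<in> homog (int l - 1)" "r \<in> homog (int l)"
      "\<forall>t. Poly_Mapping.lookup r t \<noteq> 0 \<longrightarrow> Poly_Mapping.lookup t i0 = 0 \<and> Poly_Mapping.lookup t i1 = 0"
      "q = f i0 * a + f i1 * b + r" by blast
    have "Poly_Mapping.lookup t i0 = 0 \<and> Poly_Mapping.lookup t i1 = 0"
      if "Poly_Mapping.lookup (Var i * r) t \<noteq> 0" for t
      using lookup_monom_mult_nonzero[OF that[unfolded Var_def]] abr(4) i
      by (auto simp: lookup_add Poly_Mapping.lookup_single)
    moreover have "Var i * q = f i0 * (Var i * a) + f i1 * (Var i * b) + Var i * r"
      by (simp add: abr(5) algebra_simps)
    moreover have "Var i * a \<in> homog (int l)" "Var i * b \<in> homog (int l)" "Var i * r \<in> homog (int (Suc l))"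
      using homog_mult[OF homog_Var abr(1), of i] homog_mult[OF homog_Var abr(2), of i] homog_mult[OF homog_Var abr(3), of i]
      by (simp_all add: add.commute)
    ultimately show ?thesis unfolding P_def by blast
  qed
  have P3: "P (Var i * q)" if q: "q \<in> homog (int l)" for q i
  proof -
    obtain c d e where "Var i = Const c * f i0 + Const d * f i1 + (\<Sum>i\<in>-{i0,i1}. Const (e i) * Var i)"
      using Var_span by blast
    then have "Var i * q = f i0 * (Const c * q) + f i1 * (Const d * q) + (\<Sum>i\<in>-{i0,i1}. Var i * (Const (e i) * q))"
      by (simp add: distrib_right distrib_left sum_distrib_right sum_distrib_left mult_ac)
    also have "P \<dots>"
      by (intro Padd P1 Psum P2 homog_Const_mult q) auto
    finally show ?thesis .
  qed
  from homog_Var_sum[OF Suc.prems] obtain q where "\<forall>i. q i \<in> homog (int l)" "p = (\<Sum>i\<in>UNIV. Var i * q i)" by blast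
  then have "P p" using Psum P3 by auto
  then show ?case by (simp add: P_def)
qed

text \<open>Strong induction on the degree. Multiples of any \<open>f j\<close> are in the image by
  induction, since \<open>D j > 0\<close>. Modulo \<open>f i0\<close> and \<open>f i1\<close> only
  monomials in the other variables remain: one with an exponent at least \<open>M\<close> is a
  multiple of some \<open>f i\<close> modulo the two linear forms, and the others are fixed by
  \<open>Phi\<close>.\<close>

lemma Phi_surj: "p \<in> homog (int l) \<Longrightarrow> \<exists>q\<in>homog (int l). Phi q = p"
proof (induction l arbitrary: p rule: less_induct)
  case (less l)
  define V where "V = Phi ` homog (int l)"
  have V: "kv.subspace V"
    unfolding kv.subspace_def
  proof (intro conjI ballI allI)
    show "0 \<in> V" unfolding V_def using imageI[OF homog_0, of Phi] by simp
    show "x + y \<in> V" if xy: "x \<in> V" "y \<in> V" for x y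
    proof -
      obtain x' y' where "x' \<in> homog (int l)" "Phi x' = x" "y' \<in> homog (int l)" "Phi y' = y"
        using xy unfolding V_def by blast
      then show ?thesis unfolding V_def using imageI[OF homog_add, of x' "int l" y' Phi] by (simp add: Phi_add)
    qed
    show "Const c * x \<in> V" if x: "x \<in> V" for c x
    proof -
      obtain x' where "x' \<in> homog (int l)" "Phi x' = x" using x unfolding V_def by blast
      then show ?thesis unfolding V_def using imageI[OF homog_Const_mult, of x' "int l" Phi c] by (simp add: Phi_Const_mult)
    qed
  qed
  have fV: "f j * q \<in> V" if "q \<in> homog (int l - int (D j))" for q j
  proof (cases "int l - int (D j) < 0")
    case True
    then have "q = 0" using that homog_neg by blast
    then show ?thesis using kv.subspace_0[OF V] by simp
  next
    case False
    define k where "k = l - D j"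
    have k: "int l - int (D j) = int k" "k < l" using D_pos[of j] False by (auto simp: k_def)
    have "q \<in> homog (int k)" using that k(1) by simp
    from less.IH[OF k(2) this] obtain q' where "q' \<in> homog (int k)" "Phi q' = q" by blast
    then have "f j * q = Phi (Var j ^ (1 * D j) * q')"
      using Phi_f_mult[of j 1 q'] by simp
    moreover have "Var j ^ (1 * D j) * q' \<in> homog (int l)"
      using homog_mult'[OF homog_power[OF homog_Var, of j "D j"] \<open>q' \<in> homog (int k)\<close>, of "int l"] k(1) by simp
    ultimately have "f j * q \<in> Phi ` homog (int l)" by blast
    then show ?thesis unfolding V_def .
  qed
  have Y0: "f i0 * q \<in> V" and Y1: "f i1 * q \<in> V" if "q \<in> homog (int l - 1)" for q
    using fV[of q i0] fV[of q i1] that by (auto simp: D_def)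
  have mono: "Poly_Mapping.single t 1 \<in> V"
    if t: "tdeg t = l" "Poly_Mapping.lookup t i0 = 0" "Poly_Mapping.lookup t i1 = 0" for t
  proof (cases "\<exists>i. i \<notin> {i0,i1} \<and> M \<le> Poly_Mapping.lookup t i")
    case True
    then obtain i where i: "i \<noteq> i0" "i \<noteq> i1" "M \<le> Poly_Mapping.lookup t i" by blast
    define s where "s = t - Poly_Mapping.single i M"
    have ts: "t = Poly_Mapping.single i M + s"
      using i unfolding s_def
      by (intro poly_mapping_eqI) (auto simp: lookup_add lookup_minus Poly_Mapping.lookup_single when_def)
    let ?s = "Poly_Mapping.single s (1::'k)"
    have s: "?s \<in> homog (int l - int M)" using ts t(1) by (intro homog_single) (simp add: tdeg_add)
    obtain a b where ab: "a \<in> homog (int M - 1)" "b \<in> homog (int M - 1)" "f i = Var i ^ M + f i0 * a + f i1 * b"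
      using f_monic i by blast
    have "Poly_Mapping.single t 1 = Var i ^ M * ?s"
      by (simp add: Var_power mult_single ts)
    also have "\<dots> = f i * ?s - f i0 * (a * ?s) - f i1 * (b * ?s)"
      by (simp add: ab(3) algebra_simps)
    also have "\<dots> \<in> V"
      using s i by (intro kv.subspace_diff[OF V] fV Y0 Y1 homog_mult'[OF ab(1) s] homog_mult'[OF ab(2) s]) (auto simp: D_def)
    finally show ?thesis .
  next
    case False
    have "mon t = (\<Prod>i\<in>UNIV. Var i ^ Poly_Mapping.lookup t i)"
      unfolding mon_def
    proof (rule prod.cong)
      fix i
      show "Var i ^ (Poly_Mapping.lookup t i mod D i) * f i ^ (Poly_Mapping.lookup t i div D i) = Var i ^ Poly_Mapping.lookup t i"
        using False t(2,3) by (cases "i = i0 \<or> i = i1") (auto simp: D_def not_le)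
    qed simp
    also have "\<dots> = Poly_Mapping.single t 1"
    proof -
      have "(\<Prod>i\<in>T. Var i ^ Poly_Mapping.lookup t i)
          = (Poly_Mapping.single (\<Sum>i\<in>T. Poly_Mapping.single i (Poly_Mapping.lookup t i)) 1 :: ('n, 'k) mpoly)" if "finite T" for T
        using that by (induction T) (auto simp: Var_power mult_single)
      moreover have "(\<Sum>i\<in>UNIV. Poly_Mapping.single i (Poly_Mapping.lookup t i)) = t"
        by (rule poly_mapping_eqI) (simp add: lookup_sum Poly_Mapping.lookup_single when_def)
      ultimately show ?thesis by simp
    qed
    finally have "Poly_Mapping.single t 1 = Phi (Poly_Mapping.single t 1)" by (simp add: Phi_monom)
    moreover have "Poly_Mapping.single t (1::'k) \<in> homog (int l)" using t(1) by (simp add: homog_single)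
    ultimately show ?thesis unfolding V_def by blast
  qed
  obtain a b r where abr: "a \<in> homog (int l - 1)" "b \<in> homog (int l - 1)" "r \<in> homog (int l)"
      "\<forall>t. Poly_Mapping.lookup r t \<noteq> 0 \<longrightarrow> Poly_Mapping.lookup t i0 = 0 \<and> Poly_Mapping.lookup t i1 = 0"
      "p = f i0 * a + f i1 * b + r" using homog_Y_decomp[OF less.prems] by blast
  have "(\<Sum>t\<in>Poly_Mapping.keys r. Const (Poly_Mapping.lookup r t) * Poly_Mapping.single t 1) \<in> V"
    using abr(3,4) by (intro kv.subspace_sum[OF V] kv.subspace_scale[OF V] mono) (auto simp: in_keys_iff homog_iff)
  then have "r \<in> V" using poly_mapping_sum_monoms[of r] by simp
  then have "p \<in> V" using abr by (auto intro!: kv.subspace_add[OF V] Y0 Y1)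
  then show ?case by (auto simp: V_def)
qed

lemma Phi_surj': "\<exists>q. Phi q = p"
proof -
  obtain L where L: "finite L" "p = (\<Sum>l\<in>L. hc l p)" using hc_decomp by blast
  have "\<exists>q. Phi q = hc l p" for l
  proof (cases "l < 0")
    case True
    then have "hc l p = 0" using homog_neg hc_homog by blast
    then show ?thesis by (auto intro!: exI[of _ 0])
  next
    case False
    then show ?thesis using Phi_surj[of "hc l p" "nat l"] hc_homog[of l p] by auto
  qed
  then obtain q where "\<And>l. Phi (q l) = hc l p" by metis
  then have "Phi (\<Sum>l\<in>L. q l) = p" using L by (simp add: Phi_sum)
  then show ?thesis by blast
qed

text \<open>A surjective endomorphism of the finite-dimensional space of forms of degree
  \<open>l\<close> is injective. Concretely, a kernel element with a nonzero coefficient at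
  \<open>t0\<close> would allow \<open>mon t0\<close> to be omitted from a spanning family that is
  already as small as possible.\<close>

lemma Phi_inj_homog: assumes "p \<in> homog (int l)" "Phi p = 0" shows "p = 0"
proof (rule ccontr)
  assume "p \<noteq> 0"
  let ?T = "{t :: 'n \<Rightarrow>\<^sub>0 nat. int (tdeg t) = int l}"
  have fin: "finite ?T" by (rule finite_subset[OF _ finite_tdeg[of l]]) auto
  from \<open>p \<noteq> 0\<close> obtain t0 where t0: "Poly_Mapping.lookup p t0 \<noteq> 0"
    using poly_mapping_eqI[of p 0] by auto
  then have t0T: "t0 \<in> ?T" using assms by (auto simp: homog_iff)
  have PhiT: "Phi q = (\<Sum>t\<in>?T. Const (Poly_Mapping.lookup q t) * mon t)" if "q \<in> homog (int l)" for q
    using that by (intro Phi_superset fin) (auto simp: homog_iff in_keys_iff)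
  have "kv.spans_mod (homog (int l)) {0} (?T - {t0}) mon"
    unfolding kv.spans_mod_def
  proof (intro conjI ballI)
    show "finite (?T - {t0})" using fin by simp
    show "mon t \<in> homog (int l)" if "t \<in> ?T - {t0}" for t using that mon_homog[of t] by auto
    fix v :: "('n, 'k) mpoly" assume v: "v \<in> homog (int l)"
    then obtain q where q: "q \<in> homog (int l)" "Phi q = v" using Phi_surj by blast
    \<comment> \<open>Subtracting a multiple of the kernel element \<open>p\<close> removes the
      coefficient at \<open>t0\<close> and leaves the image unchanged.\<close>
    define q' where "q' = q - Const (Poly_Mapping.lookup q t0 / Poly_Mapping.lookup p t0) * p"
    have q': "q' \<in> homog (int l)" "Phi q' = v"
      using q assms by (auto simp: q'_def Phi_diff Phi_Const_mult intro!: homog_diff homog_Const_mult)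
    have z: "Poly_Mapping.lookup q' t0 = 0" using t0 by (simp add: q'_def lookup_minus lookup_Const_mult)
    have "(\<Sum>t\<in>?T. Const (Poly_Mapping.lookup q' t) * mon t) = (\<Sum>t\<in>?T - {t0}. Const (Poly_Mapping.lookup q' t) * mon t)"
      using fin t0T z by (subst sum.remove[of _ t0]) auto
    then have "v - (\<Sum>t\<in>?T - {t0}. Const (Poly_Mapping.lookup q' t) * mon t) \<in> {0}"
      using PhiT[OF q'(1)] q'(2) by simp
    then show "\<exists>c. v - (\<Sum>t\<in>?T - {t0}. Const (c t) * mon t) \<in> {0}" by (rule exI[where x = "Poly_Mapping.lookup q'"])
  qed
  moreover have "kv.indep_mod {0} ?T (\<lambda>t. Poly_Mapping.single t (1::'k))"
    using qbasis_homog[where l = "int l"] by (auto simp: kv.qbasis_def)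
  ultimately have "card ?T \<le> card (?T - {t0})"
    by (intro kv.indep_mod_card_le[OF kv.subspace_single_0]) (auto simp: homog_single)
  then show False using card_Diff1_less[OF fin t0T] by simp
qed

lemma hc_Phi: "hc l (Phi p) = Phi (hc l p)"
proof -
  obtain L where L: "finite L" "p = (\<Sum>l\<in>L. hc l p)" using hc_decomp by blast
  have *: "hc l (Phi (hc j p)) = Phi (hc l (hc j p))" for j
  proof (cases "j = l")
    case True
    then show ?thesis using hc_id[OF hc_homog[of l p]] hc_id[OF Phi_homog[OF hc_homog[of l p]]] by simp
  next
    case False
    then show ?thesis using hc_other[OF hc_homog[of j p] False] hc_other[OF Phi_homog[OF hc_homog[of j p]] False] by simp
  qed
  have "hc l (Phi p) = (\<Sum>j\<in>L. hc l (Phi (hc j p)))" by (subst L(2)) (simp add: Phi_sum hc_sum)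
  also have "\<dots> = Phi (hc l (\<Sum>j\<in>L. hc j p))" by (simp add: * Phi_sum hc_sum)
  finally show ?thesis using L(2) by simp
qed

lemma Phi_inj: assumes "Phi p = 0" shows "p = 0"
proof -
  have "hc l p = 0" for l
  proof (cases "l < 0")
    case True
    then show ?thesis using homog_neg hc_homog by blast
  next
    case False
    have "Phi (hc l p) = 0" using assms hc_Phi[of l p] by simp
    then show ?thesis using Phi_inj_homog[of "hc l p" "nat l"] hc_homog[of l p] False by simp
  qed
  then show ?thesis using hc_decomp[of p] by auto
qed

text \<open>The monomial ideal generated by the \<open>Var j ^ (a j * D j)\<close> with
  \<open>j\<close> in \<open>B\<close>, described by the supports of its elements;
  \<open>Phi\<close> maps it onto \<open>pideal B a\<close>.\<close>

definition monideal :: "'n set \<Rightarrow> ('n \<Rightarrow> nat) \<Rightarrow> ('n, 'k) mpoly set" where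
  "monideal B a = {p. \<forall>t. Poly_Mapping.lookup p t \<noteq> 0 \<longrightarrow> (\<exists>j\<in>B. a j * D j \<le> Poly_Mapping.lookup t j)}"

definition pideal :: "'n set \<Rightarrow> ('n \<Rightarrow> nat) \<Rightarrow> ('n, 'k) mpoly set" where
  "pideal B a = idl.span ((\<lambda>j. f j ^ a j) ` B)"

lemma monideal_add: "p \<in> monideal B a \<Longrightarrow> q \<in> monideal B a \<Longrightarrow> p + q \<in> monideal B a"
proof -
  assume "p \<in> monideal B a" "q \<in> monideal B a"
  moreover have "Poly_Mapping.lookup p t \<noteq> 0 \<or> Poly_Mapping.lookup q t \<noteq> 0" if "Poly_Mapping.lookup (p + q) t \<noteq> 0" for t
    using that by (auto simp: lookup_add)
  ultimately show ?thesis unfolding monideal_def by blast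
qed

lemma Phi_monideal: "Phi ` monideal B a = pideal B a"
proof
  show "Phi ` monideal B a \<subseteq> pideal B a"
  proof (rule image_subsetI)
    fix p assume p: "p \<in> monideal B a"
    show "Phi p \<in> pideal B a"
      unfolding Phi_def pideal_def
    proof (rule idl.span_sum, rule idl.span_scale)
      fix t assume "t \<in> Poly_Mapping.keys p"
      then obtain j where j: "j \<in> B" "a j * D j \<le> Poly_Mapping.lookup t j"
        using p by (auto simp: monideal_def in_keys_iff)
      have "t = Poly_Mapping.single j (a j * D j) + (t - Poly_Mapping.single j (a j * D j))"
        using j by (intro poly_mapping_eqI) (auto simp: lookup_add lookup_minus Poly_Mapping.lookup_single when_def)
      then have "mon t = f j ^ a j * mon (t - Poly_Mapping.single j (a j * D j))"
        using mon_add_single[of j "a j" "t - Poly_Mapping.single j (a j * D j)"] by simp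
      also have "\<dots> = mon (t - Poly_Mapping.single j (a j * D j)) * f j ^ a j" by (rule mult.commute)
      also have "\<dots> \<in> idl.span ((\<lambda>j. f j ^ a j) ` B)" using j by (intro idl.span_scale idl.span_base) auto
      finally show "mon t \<in> idl.span ((\<lambda>j. f j ^ a j) ` B)" .
    qed
  qed
  show "pideal B a \<subseteq> Phi ` monideal B a"
  proof
    fix p assume "p \<in> pideal B a"
    then show "p \<in> Phi ` monideal B a"
      unfolding pideal_def
    proof (induction rule: idl.span_induct_alt)
      case base
      have "0 \<in> monideal B a" by (simp add: monideal_def)
      then show ?case by (auto simp: image_iff intro!: bexI[of _ 0])
    next
      case (step c x y)
      then obtain j where j: "j \<in> B" "x = f j ^ a j" by blast
      obtain c' where c': "Phi c' = c" using Phi_surj'[of c] by auto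
      obtain y' where y': "y' \<in> monideal B a" "Phi y' = y" using step by blast
      have "Var j ^ (a j * D j) * c' \<in> monideal B a"
        unfolding monideal_def Var_power
      proof (intro CollectI allI impI)
        fix t assume "Poly_Mapping.lookup (Poly_Mapping.single (Poly_Mapping.single j (a j * D j)) 1 * c') t \<noteq> 0"
        from lookup_monom_mult_nonzero[OF this] show "\<exists>j\<in>B. a j * D j \<le> Poly_Mapping.lookup t j"
          using j by (intro bexI[of _ j]) (auto simp: lookup_add)
      qed
      from monideal_add[OF this y'(1)] have "Phi (Var j ^ (a j * D j) * c' + y') \<in> Phi ` monideal B a" by simp
      also have "Phi (Var j ^ (a j * D j) * c' + y') = c * x + y"
        using Phi_f_mult[of j "a j" c'] by (simp add: Phi_add c' y' j mult.commute[of c])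
      finally show ?case .
    qed
  qed
qed

text \<open>Pulled back along \<open>Phi\<close>, the multiplier becomes a power of the variable
  \<open>i\<close>, which does not change the exponents at indices in \<open>B\<close>. Hence the
  powers of the \<open>f i\<close> are regular in any order.\<close>

lemma pideal_regular:
  assumes "i \<notin> B" "f i ^ e * p \<in> pideal B a" shows "p \<in> pideal B a"
proof -
  obtain p' where p': "Phi p' = p" using Phi_surj'[of p] by auto
  obtain q where q: "q \<in> monideal B a" "Phi q = f i ^ e * p" using assms(2) unfolding Phi_monideal[symmetric] by auto
  have "Phi (q - Var i ^ (e * D i) * p') = 0" using q p' by (simp add: Phi_diff Phi_f_mult)
  from Phi_inj[OF this] have *: "Var i ^ (e * D i) * p' \<in> monideal B a" using q by simp
  have "p' \<in> monideal B a"
    unfolding monideal_def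
  proof (intro CollectI allI impI)
    fix t assume "Poly_Mapping.lookup p' t \<noteq> 0"
    then have "Poly_Mapping.lookup (Var i ^ (e * D i) * p') (Poly_Mapping.single i (e * D i) + t) \<noteq> 0"
      unfolding Var_power lookup_monom_mult .
    then obtain j where "j \<in> B" "a j * D j \<le> Poly_Mapping.lookup (Poly_Mapping.single i (e * D i) + t) j"
      using * unfolding monideal_def by blast
    then show "\<exists>j\<in>B. a j * D j \<le> Poly_Mapping.lookup t j"
      using assms(1) by (intro bexI[of _ j]) (auto simp: lookup_add Poly_Mapping.lookup_single when_def split: if_splits)
  qed
  then show ?thesis unfolding Phi_monideal[symmetric] using p' by auto
qed

text \<open>By pigeonhole, a monomial of such a degree has some exponent at least
  \<open>a j * D j\<close>. The bound is not sharp; it serves to show that the quotient has finite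
  length.\<close>

lemma pideal_large:
  assumes "p \<in> homog l" "l \<ge> (\<Sum>i\<in>UNIV. int (a i * D i))" shows "p \<in> pideal UNIV a"
proof -
  have l: "l \<ge> 0" using assms(2) sum_nonneg[of UNIV "\<lambda>i. int (a i * D i)"] by simp
  then obtain q where q: "q \<in> homog l" "Phi q = p" using Phi_surj[of p "nat l"] assms by auto
  have "q \<in> monideal UNIV a"
    unfolding monideal_def
  proof (intro CollectI allI impI, rule ccontr)
    fix t assume t: "Poly_Mapping.lookup q t \<noteq> 0" "\<not> (\<exists>j\<in>UNIV. a j * D j \<le> Poly_Mapping.lookup t j)"
    then have "tdeg t < (\<Sum>i\<in>UNIV. a i * D i)"
      unfolding tdeg_def by (intro sum_strict_mono) (auto simp: not_le)
    then have "int (tdeg t) < (\<Sum>i\<in>UNIV. int (a i * D i))"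
      by (metis of_nat_less_iff of_nat_sum)
    moreover have "int (tdeg t) = l" using t(1) q by (auto simp: homog_iff)
    ultimately show False using assms(2) by simp
  qed
  then show ?thesis unfolding Phi_monideal[symmetric] using q by auto
qed

lemma hideal_pideal: "hideal (pideal B a)"
  unfolding pideal_def using homog_power[OF f_homog] by (intro hideal_span) blast

lemma subspace_pideal: "idl.subspace (pideal B a)"
  by (simp add: pideal_def)

end

section \<open>One-dimensional socles\<close>

text \<open>When the quotient by \<open>Q\<close> is graded, nonzero and of finite length, its socle
  is nonzero, so these two conditions say that the socle is the line spanned by
  \<open>w\<close>.\<close>

definition socle_generator :: "('n::finite, 'k::field) mpoly set \<Rightarrow> ('n, 'k) mpoly \<Rightarrow> bool" where
  "socle_generator Q w \<longleftrightarrow> w \<notin> Q \<and> (\<forall>x. (\<forall>i. Var i * x \<in> Q) \<longrightarrow> (\<exists>c. x - Const c * w \<in> Q))"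

lemma homog_mult_mem:
  assumes I: "idl.subspace I" and p: "p \<in> homog l" "l > 0" and x: "\<And>i. Var i * x \<in> I"
  shows "p * x \<in> I"
proof -
  from p obtain q where q: "p = (\<Sum>i\<in>UNIV. Var i * q i)"
    using homog_Var_sum[of p "nat l - 1"] by auto
  have "(\<Sum>i\<in>UNIV. q i * (Var i * x)) \<in> I"
    by (intro idl.subspace_sum[OF I] idl.subspace_scale[OF I] x)
  also have "(\<Sum>i\<in>UNIV. q i * (Var i * x)) = p * x"
    by (simp add: q sum_distrib_right sum_distrib_left mult_ac)
  finally show ?thesis .
qed

context monic_family
begin

lemma pideal_insert: "x \<in> pideal UNIV a \<longleftrightarrow> (\<exists>q. x - q * f j ^ a j \<in> pideal (UNIV - {j}) a)"
proof -
  have "(\<lambda>j. f j ^ a j) ` UNIV = insert (f j ^ a j) ((\<lambda>j. f j ^ a j) ` (UNIV - {j}))" by auto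
  then show ?thesis unfolding pideal_def by (simp only: idl.span_breakdown_eq)
qed

lemma pideal_mono: "B \<subseteq> C \<Longrightarrow> pideal B a \<subseteq> pideal C a"
  unfolding pideal_def by (intro idl.span_mono) auto

text \<open>Since \<open>f j\<close> is regular modulo the ideal \<open>?J\<close> of the other
  powers, multiplication by \<open>f j ^ (k - 1)\<close> embeds the quotient by
  \<open>(?J, f j)\<close> into that by \<open>(?J, f j ^ k)\<close>. An element killed by the
  variables is killed by \<open>f j\<close>, hence lies in the image, so the two socles
  correspond.\<close>

lemma socle_step:
  assumes s: "socle_generator (pideal UNIV a) w" and a: "a j = 1" and k: "k > 0"
  shows "socle_generator (pideal UNIV (a(j := k))) (f j ^ (k - 1) * w)"
proof -
  let ?J = "pideal (UNIV - {j}) a" and ?a = "a(j := k)"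
  have J: "pideal (UNIV - {j}) ?a = ?J" unfolding pideal_def by (rule arg_cong[where f = idl.span]) auto
  have sJ: "idl.subspace ?J" by (rule subspace_pideal)
  have fk: "f j ^ k = f j ^ (k - 1) * f j" using k by (cases k) (auto simp: mult.commute)
  have Q: "x \<in> pideal UNIV a \<longleftrightarrow> (\<exists>q. x - q * f j \<in> ?J)" for x
    using pideal_insert[of x a j] a by simp
  have Q': "x \<in> pideal UNIV ?a \<longleftrightarrow> (\<exists>q. x - q * f j ^ k \<in> ?J)" for x
    using pideal_insert[of x ?a j] J by simp
  have reg: "f j ^ e * x \<in> ?J \<Longrightarrow> x \<in> ?J" for e x
    using pideal_regular[of j "UNIV - {j}"] by blast
  have w: "w \<notin> pideal UNIV a"
    and soc: "\<And>x. (\<And>i. Var i * x \<in> pideal UNIV a) \<Longrightarrow> \<exists>c. x - Const c * w \<in> pideal UNIV a"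
    using s by (auto simp: socle_generator_def)
  show ?thesis
    unfolding socle_generator_def
  proof (intro conjI allI impI notI)
    assume "f j ^ (k - 1) * w \<in> pideal UNIV ?a"
    then obtain q where "f j ^ (k - 1) * w - q * f j ^ k \<in> ?J" using Q' by blast
    also have "f j ^ (k - 1) * w - q * f j ^ k = f j ^ (k - 1) * (w - q * f j)"
      by (simp add: fk algebra_simps)
    finally have "w - q * f j \<in> ?J" using reg by blast
    then show False using w Q by blast
  next
    fix x assume x: "\<forall>i. Var i * x \<in> pideal UNIV ?a"
    have "f j * x \<in> pideal UNIV ?a"
      using x D_pos[of j] by (intro homog_mult_mem[OF subspace_pideal f_homog]) auto
    then obtain q where "f j * x - q * f j ^ k \<in> ?J" using Q' by blast
    also have "f j * x - q * f j ^ k = f j ^ 1 * (x - q * f j ^ (k - 1))"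
      by (simp add: fk algebra_simps)
    finally have q: "x - q * f j ^ (k - 1) \<in> ?J" using reg by blast
    have "Var i * q \<in> pideal UNIV a" for i
    proof -
      obtain r where r: "Var i * x - r * f j ^ k \<in> ?J" using x Q' by blast
      have "(Var i * x - r * f j ^ k) - Var i * (x - q * f j ^ (k - 1)) \<in> ?J"
        by (intro idl.subspace_diff[OF sJ] r idl.subspace_scale[OF sJ] q)
      also have "(Var i * x - r * f j ^ k) - Var i * (x - q * f j ^ (k - 1)) = f j ^ (k - 1) * (Var i * q - r * f j)"
        by (simp add: fk algebra_simps)
      finally show ?thesis using reg Q by blast
    qed
    from soc[OF this] obtain c where "q - Const c * w \<in> pideal UNIV a" by blast
    then obtain r where "q - Const c * w - r * f j \<in> ?J" using Q by blast
    then have "(x - q * f j ^ (k - 1)) + f j ^ (k - 1) * (q - Const c * w - r * f j) \<in> ?J"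
      by (intro idl.subspace_add[OF sJ] q idl.subspace_scale[OF sJ])
    also have "(x - q * f j ^ (k - 1)) + f j ^ (k - 1) * (q - Const c * w - r * f j)
      = x - Const c * (f j ^ (k - 1) * w) - r * f j ^ k"
      by (simp add: fk algebra_simps)
    finally show "\<exists>c. x - Const c * (f j ^ (k - 1) * w) \<in> pideal UNIV ?a" using Q' by blast
  qed
qed

lemma socle_powers:
  assumes s: "socle_generator (pideal UNIV (\<lambda>_. 1)) w" and a: "\<And>j. a j > 0"
  shows "socle_generator (pideal UNIV a) ((\<Prod>j\<in>UNIV. f j ^ (a j - 1)) * w)"
proof -
  have "socle_generator (pideal UNIV (\<lambda>j. if j \<in> T then a j else 1)) ((\<Prod>j\<in>T. f j ^ (a j - 1)) * w)" if "finite T" for T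
    using that
  proof (induction T)
    case empty
    then show ?case using s by simp
  next
    case (insert j T)
    have "(\<lambda>j. if j \<in> T then a j else 1)(j := a j) = (\<lambda>i. if i \<in> insert j T then a i else 1)" by auto
    then show ?case using socle_step[OF insert.IH _ a[of j], of j] insert.hyps
      by (simp add: mult.assoc)
  qed
  from this[of UNIV] show ?thesis by simp
qed

end

text \<open>For the two linear forms together with the remaining variables the ideal is the maximal
  one, with socle generator \<open>1\<close>. Raising those variables to the power \<open>M\<close>
  by \<open>socle_powers\<close> gives the same ideal as the \<open>f i\<close>, which differ from
  \<open>Var i ^ M\<close> by multiples of the linear forms. Each of the
  \<open>card UNIV - 2\<close> variables contributes \<open>M - 1\<close> to the degree.\<close>

lemma (in monic_family) linear_socle:
  "\<exists>w. socle_generator (pideal UNIV (\<lambda>_. 1)) w \<and> w \<in> homog ((int (card (UNIV :: 'n set)) - 2) * (int M - 1))"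
proof -
  define f2 where "f2 i = (if i = i0 \<or> i = i1 then f i else Var i)" for i
  interpret L: monic_family i0 i1 1 f2
  proof
    show "f2 i0 \<in> homog 1" "f2 i1 \<in> homog 1" using f_i0 f_i1 by (auto simp: f2_def)
    show "\<exists>a\<in>homog (int 1 - 1). \<exists>b\<in>homog (int 1 - 1). f2 i = Var i ^ 1 + f2 i0 * a + f2 i1 * b"
      if "i \<noteq> i0" "i \<noteq> i1" for i
      using that by (intro bexI[of _ 0]) (auto simp: f2_def)
    show "\<exists>c d e. Var j = Const c * f2 i0 + Const d * f2 i1 + (\<Sum>i\<in>-{i0,i1}. Const (e i) * Var i)" for j
      using Var_span[of j] by (simp add: f2_def)
  qed (use i01 in auto)
  let ?m = "L.pideal UNIV (\<lambda>_. 1)"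
  have Var_m: "Var j \<in> ?m" for j
  proof -
    obtain c d e where "Var j = Const c * f i0 + Const d * f i1 + (\<Sum>i\<in>-{i0,i1}. Const (e i) * Var i)"
      using Var_span by blast
    also have "\<dots> = Const c * f2 i0 + Const d * f2 i1 + (\<Sum>i\<in>-{i0,i1}. Const (e i) * f2 i)"
      by (auto simp: f2_def intro!: sum.cong)
    also have "\<dots> \<in> ?m"
      unfolding L.pideal_def by (intro idl.span_add idl.span_sum idl.span_scale idl.span_base) auto
    finally show ?thesis .
  qed
  have m_pos: "homog l \<subseteq> ?m" if "l > 0" for l
  proof
    fix p :: "('n, 'k) mpoly" assume p: "p \<in> homog l"
    have "p * 1 \<in> ?m" by (rule homog_mult_mem[OF L.subspace_pideal p that]) (use Var_m in simp)
    then show "p \<in> ?m" by simp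
  qed
  have hc0: "hc 0 p = 0" if "p \<in> ?m" for p
    using that unfolding L.pideal_def
  proof (induction rule: idl.span_induct_alt)
    case (step c x y)
    then obtain j where j: "x = f2 j" by auto
    have "hc 0 (x * c) = x * hc (0 - int (L.D j)) c" unfolding j by (rule hc_mult[OF L.f_homog])
    moreover have "hc (0 - int (L.D j)) c = 0" using hc_homog homog_neg L.D_pos[of j] by (metis diff_0 neg_less_0_iff_less of_nat_0_less_iff)
    ultimately show ?case using step by (simp add: hc_add mult.commute)
  qed simp
  have "socle_generator ?m 1"
    unfolding socle_generator_def
  proof (intro conjI allI impI notI)
    assume "1 \<in> ?m"
    moreover have "hc 0 1 = (1 :: ('n, 'k) mpoly)" by (rule hc_id[OF homog_1])
    ultimately show False using hc0[of 1] by simp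
  next
    fix x :: "('n, 'k) mpoly"
    obtain c where c: "hc 0 x = Const c" using homog_0_Const[OF hc_homog] by blast
    have "hc l (x - Const c * 1) \<in> ?m" for l
    proof -
      consider "l < 0" | "l = 0" | "l > 0" by linarith
      then show ?thesis
      proof cases
        case 1 then show ?thesis using hc_homog[of l "x - Const c * 1"] homog_neg idl.subspace_0[OF L.subspace_pideal] by metis
      next
        case 2
        have "hc 0 (Const c) = (Const c :: ('n, 'k) mpoly)" by (rule hc_id[OF homog_Const])
        with 2 have "hc l (x - Const c * 1) = 0" using c by (simp add: hc_diff)
        then show ?thesis using idl.subspace_0[OF L.subspace_pideal] by simp
      next
        case 3 then show ?thesis using m_pos hc_homog by blast
      qed
    qed
    then show "\<exists>c. x - Const c * 1 \<in> ?m" using hideal_mem_iff[OF L.hideal_pideal] by blast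
  qed
  define a where "a i = (if i = i0 \<or> i = i1 then 1 else M)" for i
  have "socle_generator (L.pideal UNIV a) ((\<Prod>j\<in>UNIV. f2 j ^ (a j - 1)) * 1)"
    using \<open>socle_generator ?m 1\<close> M by (intro L.socle_powers) (auto simp: a_def)
  moreover have "L.pideal UNIV a = pideal UNIV (\<lambda>_. 1)"
  proof -
    have g0: "f i0 \<in> L.pideal UNIV a" "f i1 \<in> L.pideal UNIV a"
      unfolding L.pideal_def by (rule idl.span_base, rule image_eqI[of _ _ i0], simp_all add: f2_def a_def)
        (rule idl.span_base, rule image_eqI[of _ _ i1], simp_all add: f2_def a_def)
    have h0: "f i \<in> pideal UNIV (\<lambda>_. 1)" for i
      unfolding pideal_def by (rule idl.span_base, rule image_eqI[of _ _ i]) simp_all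
    have "f i \<in> L.pideal UNIV a" for i
    proof (cases "i = i0 \<or> i = i1")
      case False
      then obtain x y where xy: "f i = Var i ^ M + f i0 * x + f i1 * y" using f_monic by blast
      have "Var i ^ M \<in> L.pideal UNIV a"
        unfolding L.pideal_def using False by (intro idl.span_base image_eqI[of _ _ i]) (simp_all add: f2_def a_def)
      then have "Var i ^ M + x * f i0 + y * f i1 \<in> L.pideal UNIV a"
        by (intro idl.subspace_add[OF L.subspace_pideal] idl.subspace_scale[OF L.subspace_pideal] g0)
      then show ?thesis by (simp add: xy mult.commute)
    qed (use g0 in auto)
    then have 1: "pideal UNIV (\<lambda>_. 1) \<subseteq> L.pideal UNIV a"
      unfolding pideal_def by (intro idl.span_minimal L.subspace_pideal) auto
    have "f2 i ^ a i \<in> pideal UNIV (\<lambda>_. 1)" for i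
    proof (cases "i = i0 \<or> i = i1")
      case True
      then show ?thesis using h0[of i] by (simp add: f2_def a_def)
    next
      case False
      then obtain x y where xy: "f i = Var i ^ M + f i0 * x + f i1 * y" using f_monic by blast
      have "f i - x * f i0 - y * f i1 \<in> pideal UNIV (\<lambda>_. 1)"
        by (intro idl.subspace_diff[OF subspace_pideal] idl.subspace_scale[OF subspace_pideal] h0)
      then show ?thesis using False by (simp add: xy f2_def a_def mult.commute)
    qed
    then have "L.pideal UNIV a \<subseteq> pideal UNIV (\<lambda>_. 1)"
      unfolding L.pideal_def by (intro idl.span_minimal subspace_pideal) auto
    with 1 show ?thesis by blast
  qed
  moreover have "(\<Prod>j\<in>UNIV. f2 j ^ (a j - 1)) * 1 \<in> homog ((int (card (UNIV :: 'n set)) - 2) * (int M - 1))"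
  proof -
    have "(\<Prod>j\<in>UNIV. f2 j ^ (a j - 1)) \<in> homog (\<Sum>j\<in>UNIV. int (a j - 1) * int (L.D j))"
      by (intro homog_prod homog_power L.f_homog) auto
    also have "(\<Sum>j\<in>UNIV. int (a j - 1) * int (L.D j)) = (\<Sum>j\<in>-{i0,i1}. int M - 1)"
      using M by (intro sum.mono_neutral_cong_right) (auto simp: a_def L.D_def[simplified])
    also have "\<dots> = (int (card (UNIV :: 'n set)) - 2) * (int M - 1)"
    proof -
      have "card {i0, i1} \<le> card (UNIV :: 'n set)" by (rule card_mono) auto
      then have "int (card (-{i0,i1})) = int (card (UNIV :: 'n set)) - 2"
        using i01 by (simp add: Compl_eq_Diff_UNIV card_Diff_subset)
      then show ?thesis by simp
    qed
    finally show ?thesis by simp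
  qed
  ultimately show ?thesis by auto
qed

text \<open>Raising the two linear forms to the power \<open>N\<close> adds \<open>N - 1\<close> to
  the socle degree for each of them.\<close>

lemma (in monic_family) power_socle:
  assumes N: "N > 0"
  shows "\<exists>w. socle_generator (pideal UNIV (\<lambda>i. if i = i0 \<or> i = i1 then N else 1)) w \<and>
    w \<in> homog ((int (card (UNIV :: 'n set)) - 2) * (int M - 1) + 2 * (int N - 1))"
proof -
  obtain w where w: "socle_generator (pideal UNIV (\<lambda>_. 1)) w" "w \<in> homog ((int (card (UNIV :: 'n set)) - 2) * (int M - 1))"
    using linear_socle by blast
  define a where "a i = (if i = i0 \<or> i = i1 then N else 1)" for i
  have "socle_generator (pideal UNIV a) ((\<Prod>j\<in>UNIV. f j ^ (a j - 1)) * w)"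
    using N by (intro socle_powers w) (auto simp: a_def)
  moreover have "(\<Prod>j\<in>UNIV. f j ^ (a j - 1)) \<in> homog (\<Sum>j\<in>UNIV. int (a j - 1) * int (D j))"
    by (intro homog_prod homog_power f_homog) auto
  moreover have "(\<Sum>j\<in>UNIV. int (a j - 1) * int (D j)) = (\<Sum>j\<in>{i0,i1}. int N - 1)"
    using N by (intro sum.mono_neutral_cong_right) (auto simp: a_def D_def)
  then have "(\<Sum>j\<in>UNIV. int (a j - 1) * int (D j)) = 2 * (int N - 1)"
    using i01 by simp
  ultimately have "(\<Prod>j\<in>UNIV. f j ^ (a j - 1)) * w \<in> homog ((int (card (UNIV :: 'n set)) - 2) * (int M - 1) + 2 * (int N - 1))"
    and "socle_generator (pideal UNIV a) ((\<Prod>j\<in>UNIV. f j ^ (a j - 1)) * w)"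
    by (auto intro: homog_mult'[OF _ w(2)])
  then show ?thesis unfolding a_def[abs_def] by blast
qed

section \<open>The pairing of a graded Artinian Gorenstein ring\<close>

locale gorenstein_artinian =
  fixes Q :: "('n::finite, 'k::field) mpoly set" and w :: "('n, 'k) mpoly" and s L :: int
  assumes Q: "hideal Q" and w_homog: "w \<in> homog s" and soc: "socle_generator Q w"
    and large: "\<And>l. l \<ge> L \<Longrightarrow> homog l \<subseteq> Q"
begin

lemma Qs: "idl.subspace Q"
  using Q by (rule hideal_subspace)

text \<open>Choose a multiplier \<open>q\<close> of the largest degree with \<open>q * y\<close>
  outside \<open>Q\<close>; it exists because high degrees lie in \<open>Q\<close>. Then every
  variable sends \<open>q * y\<close> into \<open>Q\<close>, so it is a socle element, and comparing
  components puts it in degree \<open>s\<close>.\<close>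

lemma multiple_in_socle:
  assumes y: "y \<in> homog e" "y \<notin> Q"
  shows "\<exists>q\<in>homog (s - e). \<exists>c. c \<noteq> 0 \<and> q * y - Const c * w \<in> Q"
proof -
  define P where "P l \<longleftrightarrow> (\<exists>q\<in>homog (int l). q * y \<notin> Q)" for l :: nat
  have P0: "P 0" unfolding P_def using y by (intro bexI[of _ 1]) auto
  have bd: "l \<le> nat (L - e)" if Pl: "P l" for l
  proof (rule ccontr)
    assume "\<not> ?thesis"
    then have "int l + e \<ge> L" by linarith
    moreover obtain q where "q \<in> homog (int l)" "q * y \<notin> Q" using Pl by (auto simp: P_def)
    ultimately show False using large[of "int l + e"] homog_mult[of q "int l" y e] y(1) by blast
  qed
  define l where "l = Greatest P"
  have Pl: "P l" unfolding l_def by (rule GreatestI_nat[of P 0 "nat (L - e)"]) (use P0 bd in auto)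
  have nP: "\<not> P (Suc l)" using Greatest_le_nat[of P "Suc l" "nat (L - e)"] bd unfolding l_def by force
  obtain q where q: "q \<in> homog (int l)" "q * y \<notin> Q" using Pl by (auto simp: P_def)
  have "Var i * (q * y) \<in> Q" for i
  proof -
    have "Var i * q \<in> homog (int (Suc l))" using homog_mult[OF homog_Var q(1), of i] by (simp add: add.commute)
    then have "(Var i * q) * y \<in> Q" using nP by (auto simp: P_def)
    then show ?thesis by (simp add: mult.assoc)
  qed
  then obtain c where c: "q * y - Const c * w \<in> Q" using soc by (auto simp: socle_generator_def)
  have z: "q * y \<in> homog (int l + e)" by (rule homog_mult[OF q(1) y(1)])
  have "int l + e = s"
  proof (rule ccontr)
    assume ne: "int l + e \<noteq> s"
    have "hc (int l + e) (q * y - Const c * w) = q * y"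
      using hc_id[OF z] hc_other[OF homog_Const_mult[OF w_homog], of "int l + e" c] ne by (simp add: hc_diff)
    then show False using hideal_hc[OF Q c, of "int l + e"] q(2) by simp
  qed
  then have "int l = s - e" by simp
  moreover have "c \<noteq> 0" using c q(2) by auto
  ultimately show ?thesis using q(1) c by auto
qed

lemma top_degree: assumes v: "v \<in> homog s" shows "\<exists>!c. v - Const c * w \<in> Q"
proof (rule ex_ex1I)
  show "\<exists>c. v - Const c * w \<in> Q"
  proof (cases "v \<in> Q")
    case True
    then show ?thesis by (intro exI[of _ 0]) simp
  next
    case False
    from multiple_in_socle[OF v this] obtain q c where q: "q \<in> homog 0" "c \<noteq> 0" "q * v - Const c * w \<in> Q" by auto
    obtain d where d: "q = Const d" using homog_0_Const[OF q(1)] by blast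
    have "d \<noteq> 0"
    proof
      assume "d = 0"
      then have "Const (- (1 / c)) * (q * v - Const c * w) \<in> Q" using q d by (intro idl.subspace_scale[OF Qs])
      also have "Const (- (1 / c)) * (q * v - Const c * w) = w"
        using \<open>d = 0\<close> q(2) by (simp add: d Const_uminus mult.assoc[symmetric] Const_mult[symmetric])
      finally show False using soc by (simp add: socle_generator_def)
    qed
    have "Const (1 / d) * (q * v - Const c * w) \<in> Q" by (intro idl.subspace_scale[OF Qs] q)
    also have "Const (1 / d) * (q * v - Const c * w) = v - Const (c / d) * w"
      using \<open>d \<noteq> 0\<close> by (simp add: d right_diff_distrib mult.assoc[symmetric] Const_mult[symmetric])
    finally show ?thesis by blast
  qed
  fix c d assume cd: "v - Const c * w \<in> Q" "v - Const d * w \<in> Q"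
  show "c = d"
  proof (rule ccontr)
    assume "c \<noteq> d"
    have "Const (1 / (d - c)) * ((v - Const c * w) - (v - Const d * w)) \<in> Q"
      by (intro idl.subspace_scale[OF Qs] idl.subspace_diff[OF Qs] cd)
    also have "(v - Const c * w) - (v - Const d * w) = Const (d - c) * w"
      by (simp add: left_diff_distrib Const_add Const_uminus diff_conv_add_uminus[of d c] del: add_uminus_conv_diff)
        (simp add: algebra_simps)
    also have "Const (1 / (d - c)) * (Const (d - c) * w) = w"
      using \<open>c \<noteq> d\<close> by (simp add: mult.assoc[symmetric] Const_mult[symmetric])
    finally show False using soc by (simp add: socle_generator_def)
  qed
qed

text \<open>The coordinate of the degree \<open>s\<close> component along the socle. Ignoring the
  other components makes it a linear functional on the whole ring, and \<open>sigma (x * y)\<close>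
  is the duality pairing.\<close>

definition sigma :: "('n, 'k) mpoly \<Rightarrow> 'k" where
  "sigma v = (THE c. hc s v - Const c * w \<in> Q)"

lemma sigma_mem: "hc s v - Const (sigma v) * w \<in> Q"
  unfolding sigma_def by (rule theI'[OF top_degree[OF hc_homog]])

lemma sigma_eqI: "hc s v - Const c * w \<in> Q \<Longrightarrow> sigma v = c"
  using top_degree[OF hc_homog, of v] sigma_mem[of v] by blast

lemma sigma_add: "sigma (x + y) = sigma x + sigma y"
proof (rule sigma_eqI)
  have "(hc s x - Const (sigma x) * w) + (hc s y - Const (sigma y) * w) \<in> Q"
    by (intro idl.subspace_add[OF Qs] sigma_mem)
  then show "hc s (x + y) - Const (sigma x + sigma y) * w \<in> Q"
    by (simp add: hc_add Const_add algebra_simps)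
qed

lemma sigma_Const_mult: "sigma (Const c * x) = c * sigma x"
proof (rule sigma_eqI)
  have "Const c * (hc s x - Const (sigma x) * w) \<in> Q"
    by (intro idl.subspace_scale[OF Qs] sigma_mem)
  then show "hc s (Const c * x) - Const (c * sigma x) * w \<in> Q"
    by (simp add: hc_Const_mult Const_mult right_diff_distrib mult.assoc)
qed

lemma sigma_Q: "x \<in> Q \<Longrightarrow> sigma x = 0"
  by (rule sigma_eqI) (simp add: hideal_hc[OF Q])

lemma sigma_0 [simp]: "sigma 0 = 0"
  by (rule sigma_Q) (rule idl.subspace_0[OF Qs])

lemma sigma_sum: "sigma (sum g T) = (\<Sum>i\<in>T. sigma (g i))"
  by (induction T rule: infinite_finite_induct) (auto simp: sigma_add)

lemma sigma_diff: "sigma (x - y) = sigma x - sigma y"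
  using sigma_add[of "x - y" y] by simp

lemma sigma_nondegenerate:
  assumes y: "y \<in> homog e" and z: "\<And>q. q \<in> homog (s - e) \<Longrightarrow> sigma (q * y) = 0"
  shows "y \<in> Q"
proof (rule ccontr)
  assume "y \<notin> Q"
  from multiple_in_socle[OF y this] obtain q c where q: "q \<in> homog (s - e)" "c \<noteq> 0" "q * y - Const c * w \<in> Q" by blast
  have "q * y \<in> homog s" using homog_mult[OF q(1) y] by simp
  then have "sigma (q * y) = c" by (intro sigma_eqI) (simp add: hc_id q)
  then show False using z[OF q(1)] q(2) by simp
qed

text \<open>The functionals that pair \<open>x\<close> with a monomial of degree
  \<open>s - e\<close> have their common kernel in \<open>Q\<close>, by nondegeneracy. So
  \<open>functional_in_span\<close> writes \<open>m\<close> as a combination of them, and the same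
  combination of monomials is \<open>y\<close>.\<close>

lemma sigma_represents:
  assumes add: "\<And>x y. x \<in> homog e \<Longrightarrow> y \<in> homog e \<Longrightarrow> m (x + y) = m x + m y"
    and scale: "\<And>c x. x \<in> homog e \<Longrightarrow> m (Const c * x) = c * m x"
    and van: "\<And>x. x \<in> homog e \<Longrightarrow> x \<in> Q \<Longrightarrow> m x = 0"
  shows "\<exists>y\<in>homog (s - e). \<forall>x\<in>homog e. m x = sigma (x * y)"
proof -
  let ?T = "{t :: 'n \<Rightarrow>\<^sub>0 nat. int (tdeg t) = s - e}"
  let ?l = "\<lambda>t x. sigma (x * Poly_Mapping.single t (1::'k))"
  have fin: "finite ?T" by (rule finite_subset[OF _ finite_tdeg[of "nat (s - e)"]]) auto
  have "\<exists>c. \<forall>x\<in>homog e. m x = (\<Sum>t\<in>?T. c t * ?l t x)"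
  proof (rule kv.functional_in_span[OF fin subspace_homog])
    fix x :: "('n, 'k) mpoly" assume x: "x \<in> homog e" "\<And>t. t \<in> ?T \<Longrightarrow> ?l t x = 0"
    have "x \<in> Q"
    proof (rule sigma_nondegenerate[OF x(1)])
      fix q :: "('n, 'k) mpoly" assume q: "q \<in> homog (s - e)"
      have "q * x = (\<Sum>t\<in>Poly_Mapping.keys q. Const (Poly_Mapping.lookup q t) * Poly_Mapping.single t 1) * x"
        using poly_mapping_sum_monoms[of q] by simp
      also have "\<dots> = (\<Sum>t\<in>Poly_Mapping.keys q. Const (Poly_Mapping.lookup q t) * (x * Poly_Mapping.single t 1))"
        by (simp only: sum_distrib_right mult.assoc mult.commute[of x])
      finally have "sigma (q * x) = (\<Sum>t\<in>Poly_Mapping.keys q. Poly_Mapping.lookup q t * ?l t x)"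
        by (simp add: sigma_sum sigma_Const_mult)
      also have "\<dots> = 0"
        using x(2) q by (intro sum.neutral) (auto simp: homog_iff in_keys_iff)
      finally show "sigma (q * x) = 0" .
    qed
    then show "m x = 0" using van x(1) by blast
  qed (auto simp: distrib_right sigma_add add scale mult.assoc sigma_Const_mult)
  then obtain c where c: "\<And>x. x \<in> homog e \<Longrightarrow> m x = (\<Sum>t\<in>?T. c t * ?l t x)" by blast
  define y where "y = (\<Sum>t\<in>?T. Const (c t) * Poly_Mapping.single t 1)"
  have "y \<in> homog (s - e)" unfolding y_def by (intro homog_sum homog_Const_mult homog_single) auto
  moreover have "m x = sigma (x * y)" if "x \<in> homog e" for x
    unfolding c[OF that] y_def sum_distrib_left sigma_sum mult.left_commute[of x] sigma_Const_mult ..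
  ultimately show ?thesis by blast
qed

end

section \<open>Linkage: Ext from a free resolution and a regular sequence\<close>

locale resolution =
  fixes I :: "('n::finite, 'k::field) mpoly set" and r :: "nat \<Rightarrow> nat" and e :: "nat \<Rightarrow> nat \<Rightarrow> int"
    and D :: "nat \<Rightarrow> nat \<Rightarrow> nat \<Rightarrow> ('n, 'k) mpoly"
  assumes res: "graded_free_resolution I r e D" and I: "hideal I"
begin

lemma r0: "r 0 = 1" and e0: "e 0 0 = 0"
  and D_homog: "j < r i \<Longrightarrow> j' < r (Suc i) \<Longrightarrow> D i j j' \<in> homog (e (Suc i) j' - e i j)"
  and I_image: "(\<lambda>v. matrix_apply (r 0) (r 1) (D 0) v 0) ` free_vectors (r 1) = I"
  and exact: "{v \<in> free_vectors (r (Suc i)). matrix_apply (r i) (r (Suc i)) (D i) v = 0} =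
        matrix_apply (r (Suc i)) (r (Suc (Suc i))) (D (Suc i)) ` free_vectors (r (Suc (Suc i)))"
  using res unfolding graded_free_resolution_def by blast+

lemma D_comp: assumes "i < r j" "k < r (Suc (Suc j))"
  shows "(\<Sum>l<r (Suc j). D j i l * D (Suc j) l k) = 0"
proof -
  let ?u = "\<lambda>l. if l = k then 1 else 0 :: ('n, 'k) mpoly"
  let ?v = "matrix_apply (r (Suc j)) (r (Suc (Suc j))) (D (Suc j)) ?u"
  have "?u \<in> free_vectors (r (Suc (Suc j)))" using assms by (auto simp: free_vectors_def)
  then have "?v \<in> {v \<in> free_vectors (r (Suc j)). matrix_apply (r j) (r (Suc j)) (D j) v = 0}"
    unfolding exact by (rule imageI)
  then have "matrix_apply (r j) (r (Suc j)) (D j) ?v i = 0" by (simp add: fun_eq_iff)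
  moreover have "?v l = D (Suc j) l k" if "l < r (Suc j)" for l
  proof -
    have "(\<Sum>m<r (Suc (Suc j)). D (Suc j) l m * ?u m) = (\<Sum>m<r (Suc (Suc j)). if m = k then D (Suc j) l k else 0)"
      by (rule sum.cong) auto
    then show ?thesis using that assms by (simp add: matrix_apply_def)
  qed
  moreover have "matrix_apply (r j) (r (Suc j)) (D j) ?v i = (\<Sum>l<r (Suc j). D j i l * ?v l)"
    using assms(1) by (simp only: matrix_apply_def if_True)
  moreover have "(\<Sum>l<r (Suc j). D j i l * ?v l) = (\<Sum>l<r (Suc j). D j i l * D (Suc j) l k)"
    by (rule sum.cong) (use calculation(2) in auto)
  ultimately show ?thesis by simp
qed

lemma D_exact:
  assumes "\<And>i. i < r j \<Longrightarrow> (\<Sum>l<r (Suc j). D j i l * v l) = 0"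
  shows "\<exists>u. \<forall>l<r (Suc j). v l = (\<Sum>k<r (Suc (Suc j)). D (Suc j) l k * u k)"
proof -
  let ?v = "\<lambda>l. if l < r (Suc j) then v l else 0"
  have "matrix_apply (r j) (r (Suc j)) (D j) ?v = 0"
    using assms by (auto simp: matrix_apply_def fun_eq_iff)
  then have "?v \<in> {v \<in> free_vectors (r (Suc j)). matrix_apply (r j) (r (Suc j)) (D j) v = 0}"
    by (auto simp: free_vectors_def)
  then obtain u where u: "?v = matrix_apply (r (Suc j)) (r (Suc (Suc j))) (D (Suc j)) u"
    unfolding exact by (elim imageE)
  have "v l = (\<Sum>k<r (Suc (Suc j)). D (Suc j) l k * u k)" if "l < r (Suc j)" for l
    using fun_cong[OF u, of l] that by (simp add: matrix_apply_def)
  then show ?thesis by blast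
qed

text \<open>Multiplication by an element of \<open>I\<close> is null-homotopic on the resolution.\<close>

definition prev :: "nat \<Rightarrow> (nat \<Rightarrow> nat \<Rightarrow> ('n, 'k) mpoly) \<Rightarrow> nat \<Rightarrow> nat \<Rightarrow> ('n, 'k) mpoly" where
  "prev j s i k = (case j of 0 \<Rightarrow> 0 | Suc b \<Rightarrow> \<Sum>l<r b. s i l * D b l k)"

text \<open>Here \<open>s\<close> goes from \<open>F_(j-1)\<close> to \<open>F_j\<close> and
  \<open>s'\<close> from \<open>F_j\<close> to \<open>F_(j+1)\<close>; the equation is the matrix
  form of \<open>t = D s' + s D\<close> on \<open>F_j\<close>.\<close>

definition homotopy :: "('n, 'k) mpoly \<Rightarrow> nat \<Rightarrow> (nat \<Rightarrow> nat \<Rightarrow> ('n, 'k) mpoly) \<Rightarrow> (nat \<Rightarrow> nat \<Rightarrow> ('n, 'k) mpoly) \<Rightarrow> bool" where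
  "homotopy t j s s' \<longleftrightarrow> (\<forall>i<r j. \<forall>k<r j.
     (if i = k then t else 0) = (\<Sum>l<r (Suc j). D j i l * s' l k) + prev j s i k)"

text \<open>The usual inductive lifting: the columns of \<open>t - s' D\<close> are cycles by the
  relation one stage lower together with \<open>D_comp\<close>, so exactness writes them as images
  under the next differential.\<close>

lemma homotopy_exists:
  assumes t: "t \<in> I" shows "\<exists>s s'. homotopy t j s s'"
proof (induction j)
  case 0
  from t I_image obtain v where "t = matrix_apply (r 0) (r 1) (D 0) v 0" by blast
  then have "t = (\<Sum>l<r 1. D 0 0 l * v l)" by (simp add: matrix_apply_def r0)
  then have "homotopy t 0 (\<lambda>_ _. 0) (\<lambda>l _. v l)"
    by (simp add: homotopy_def prev_def r0)
  then show ?case by blast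
next
  case (Suc j)
  then obtain s s' where h: "homotopy t j s s'" by blast
  let ?v = "\<lambda>k i. (if i = k then t else 0) - (\<Sum>l<r j. s' i l * D j l k)"
  have "\<forall>k\<in>{..<r (Suc j)}. \<exists>u. \<forall>i<r (Suc j). ?v k i = (\<Sum>m<r (Suc (Suc j)). D (Suc j) i m * u m)"
  proof (intro ballI D_exact)
    fix k a assume "k \<in> {..<r (Suc j)}" and a: "a < r j"
    then have k: "k < r (Suc j)" by simp
    have "(\<Sum>l<r (Suc j). D j a l * (if l = k then t else 0)) = D j a k * t"
    proof -
      have "(\<Sum>l<r (Suc j). D j a l * (if l = k then t else 0)) = (\<Sum>l<r (Suc j). if l = k then D j a k * t else 0)"
        by (rule sum.cong) auto
      then show ?thesis using k by simp
    qed
    moreover have "(\<Sum>l<r (Suc j). D j a l * (\<Sum>b<r j. s' l b * D j b k)) = D j a k * t"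
    proof -
      have "(\<Sum>l<r (Suc j). D j a l * (\<Sum>b<r j. s' l b * D j b k))
          = (\<Sum>l<r (Suc j). \<Sum>b<r j. D j a l * s' l b * D j b k)"
        by (simp add: sum_distrib_left mult.assoc)
      also have "\<dots> = (\<Sum>b<r j. (\<Sum>l<r (Suc j). D j a l * s' l b) * D j b k)"
        by (subst sum.swap) (simp add: sum_distrib_right)
      also have "\<dots> = (\<Sum>b<r j. ((if a = b then t else 0) - prev j s a b) * D j b k)"
      proof (rule sum.cong)
        fix b assume "b \<in> {..<r j}"
        then have "(if a = b then t else 0) = (\<Sum>l<r (Suc j). D j a l * s' l b) + prev j s a b"
          using h a by (simp add: homotopy_def)
        then show "(\<Sum>l<r (Suc j). D j a l * s' l b) * D j b k = ((if a = b then t else 0) - prev j s a b) * D j b k"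
          by simp
      qed simp
      also have "\<dots> = (\<Sum>b<r j. (if a = b then t else 0) * D j b k) - (\<Sum>b<r j. prev j s a b * D j b k)"
        by (simp add: left_diff_distrib sum_subtractf)
      also have "(\<Sum>b<r j. (if a = b then t else 0) * D j b k) = (\<Sum>b<r j. if b = a then D j a k * t else 0)"
        by (rule sum.cong) auto
      also have "\<dots> = D j a k * t" using a by simp
      also have "(\<Sum>b<r j. prev j s a b * D j b k) = 0"
      proof (cases j)
        case (Suc c)
        have "(\<Sum>b<r j. prev j s a b * D j b k) = (\<Sum>b<r (Suc c). \<Sum>l<r c. s a l * (D c l b * D (Suc c) b k))"
          by (simp add: Suc prev_def sum_distrib_right mult.assoc)
        also have "\<dots> = (\<Sum>l<r c. s a l * (\<Sum>b<r (Suc c). D c l b * D (Suc c) b k))"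
          by (subst sum.swap) (simp add: sum_distrib_left)
        also have "\<dots> = 0" using k Suc by (simp add: D_comp)
        finally show ?thesis .
      qed (simp add: prev_def)
      finally show ?thesis by simp
    qed
    ultimately show "(\<Sum>l<r (Suc j). D j a l * ?v k l) = 0"
      by (simp add: right_diff_distrib sum_subtractf)
  qed
  from bchoice[OF this] obtain u where u: "\<forall>k\<in>{..<r (Suc j)}. \<forall>i<r (Suc j).
      ?v k i = (\<Sum>m<r (Suc (Suc j)). D (Suc j) i m * u k m)" ..
  have "homotopy t (Suc j) s' (\<lambda>m k. u k m)"
    unfolding homotopy_def
  proof (intro allI impI)
    fix i k assume "i < r (Suc j)" "k < r (Suc j)"
    then have "?v k i = (\<Sum>m<r (Suc (Suc j)). D (Suc j) i m * u k m)" using u by simp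
    then show "(if i = k then t else 0) = (\<Sum>l<r (Suc (Suc j)). D (Suc j) i l * u k l) + prev (Suc j) s' i k"
      by (simp add: prev_def algebra_simps)
  qed
  then show ?case by blast
qed

text \<open>The complex is \<open>Hom(F, A\<^sub>n/J)\<close>, with cochains represented by vectors over \<open>A\<^sub>n\<close>.\<close>

definition tdiff :: "nat \<Rightarrow> (nat \<Rightarrow> ('n, 'k) mpoly) \<Rightarrow> nat \<Rightarrow> ('n, 'k) mpoly" where
  "tdiff j u k = (\<Sum>i<r j. D j i k * u i)"

definition cocycle :: "('n, 'k) mpoly set \<Rightarrow> nat \<Rightarrow> (nat \<Rightarrow> ('n, 'k) mpoly) \<Rightarrow> bool" where
  "cocycle J j v \<longleftrightarrow> (\<forall>k<r (Suc j). tdiff j v k \<in> J)"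

definition coboundary :: "('n, 'k) mpoly set \<Rightarrow> nat \<Rightarrow> (nat \<Rightarrow> ('n, 'k) mpoly) \<Rightarrow> bool" where
  "coboundary J j v \<longleftrightarrow> (case j of 0 \<Rightarrow> \<forall>k<r 0. v k \<in> J | Suc b \<Rightarrow> \<exists>u. \<forall>k<r (Suc b). v k - tdiff b u k \<in> J)"

lemma tdiff_add: "tdiff j (\<lambda>i. u i + v i) k = tdiff j u k + tdiff j v k"
  by (simp add: tdiff_def distrib_left sum.distrib)

lemma tdiff_diff: "tdiff j (\<lambda>i. u i - v i) k = tdiff j u k - tdiff j v k"
  by (simp add: tdiff_def right_diff_distrib sum_subtractf)

lemma tdiff_mult: "tdiff j (\<lambda>i. p * u i) k = p * tdiff j u k"
  by (simp add: tdiff_def sum_distrib_left mult.left_commute)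

lemma tdiff_T: assumes "k < r (Suc (Suc j))" shows "tdiff (Suc j) (tdiff j u) k = 0"
proof -
  have "tdiff (Suc j) (tdiff j u) k = (\<Sum>i<r (Suc j). \<Sum>l<r j. u l * (D j l i * D (Suc j) i k))"
    by (simp add: tdiff_def sum_distrib_left mult_ac)
  also have "\<dots> = (\<Sum>l<r j. u l * (\<Sum>i<r (Suc j). D j l i * D (Suc j) i k))"
    by (subst sum.swap) (simp add: sum_distrib_left)
  also have "\<dots> = 0" using assms by (simp add: D_comp)
  finally show ?thesis .
qed

lemma tdiff_mem: "idl.subspace J \<Longrightarrow> (\<And>i. i < r j \<Longrightarrow> v i \<in> J) \<Longrightarrow> tdiff j v k \<in> J"
  unfolding tdiff_def by (intro idl.subspace_sum idl.subspace_scale) auto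

lemma tdiff_cong_mod: "idl.subspace J \<Longrightarrow> (\<And>i. i < r j \<Longrightarrow> u i - v i \<in> J) \<Longrightarrow> tdiff j u k - tdiff j v k \<in> J"
  using tdiff_mem[of J j "\<lambda>i. u i - v i" k] by (simp add: tdiff_diff)

text \<open>Ext is annihilated by \<open>I\<close>: transposing the homotopy writes
  \<open>t v\<close> as a combination of the entries of \<open>tdiff j v\<close>, which lie in
  \<open>J\<close>, plus a coboundary.\<close>

lemma mult_coboundary:
  assumes J: "idl.subspace J" and t: "t \<in> I" and v: "cocycle J j v"
  shows "coboundary J j (\<lambda>k. t * v k)"
proof -
  obtain s s' where h: "homotopy t j s s'" using homotopy_exists[OF t] by blast
  have key: "t * v k = (\<Sum>l<r (Suc j). s' l k * tdiff j v l) + (\<Sum>i<r j. prev j s i k * v i)" if k: "k < r j" for k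
  proof -
    have "t * v k = (\<Sum>i<r j. (if i = k then t else 0) * v i)"
    proof -
      have "(\<Sum>i<r j. (if i = k then t else 0) * v i) = (\<Sum>i<r j. if i = k then t * v k else 0)"
        by (rule sum.cong) auto
      then show ?thesis using k by simp
    qed
    also have "\<dots> = (\<Sum>i<r j. ((\<Sum>l<r (Suc j). D j i l * s' l k) + prev j s i k) * v i)"
      using h k by (intro sum.cong) (auto simp: homotopy_def)
    also have "\<dots> = (\<Sum>i<r j. \<Sum>l<r (Suc j). s' l k * (D j i l * v i)) + (\<Sum>i<r j. prev j s i k * v i)"
      by (simp add: distrib_right distrib_left sum.distrib sum_distrib_right sum_distrib_left mult_ac)
    also have "(\<Sum>i<r j. \<Sum>l<r (Suc j). s' l k * (D j i l * v i)) = (\<Sum>l<r (Suc j). s' l k * tdiff j v l)"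
      by (subst sum.swap) (simp add: tdiff_def sum_distrib_left)
    finally show ?thesis .
  qed
  have m: "(\<Sum>l<r (Suc j). s' l k * tdiff j v l) \<in> J" for k
    using v by (intro idl.subspace_sum[OF J] idl.subspace_scale[OF J]) (auto simp: cocycle_def)
  show ?thesis
  proof (cases j)
    case 0
    then show ?thesis using key m by (simp add: coboundary_def prev_def)
  next
    case (Suc b)
    have "(\<Sum>i<r j. prev j s i k * v i) = tdiff b (\<lambda>l. \<Sum>i<r j. s i l * v i) k" for k
    proof -
      have "(\<Sum>i<r j. prev j s i k * v i) = (\<Sum>i<r j. \<Sum>l<r b. D b l k * (s i l * v i))"
        by (simp add: Suc prev_def sum_distrib_right sum_distrib_left mult_ac)
      also have "\<dots> = tdiff b (\<lambda>l. \<Sum>i<r j. s i l * v i) k"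
        by (subst sum.swap) (simp add: tdiff_def sum_distrib_left)
      finally show ?thesis .
    qed
    then have "t * v k - tdiff b (\<lambda>l. \<Sum>i<r j. s i l * v i) k \<in> J" if "k < r j" for k
      using key[OF that] m[of k] by simp
    then show ?thesis using Suc by (auto simp: coboundary_def)
  qed
qed

text \<open>The elements are taken in \<open>I\<close> because the dimension shift rests on
  multiplication by them being zero on Ext, and homogeneous so that the successive ideals stay
  homogeneous.\<close>

fun regular_on :: "('n, 'k) mpoly set \<Rightarrow> ('n, 'k) mpoly list \<Rightarrow> bool" where
  "regular_on J [] \<longleftrightarrow> True"
| "regular_on J (t # ts) \<longleftrightarrow> t \<in> I \<and> (\<exists>l. t \<in> homog l) \<and> (\<forall>p. t * p \<in> J \<longrightarrow> p \<in> J) \<and>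
     regular_on (idl.span (insert t J)) ts"

text \<open>The module \<open>Ext^j(A_X, A_n/J)\<close> is cyclic, generated by the class of the
  homogeneous cochain \<open>v\<close>, with annihilator exactly \<open>I\<close>.\<close>

definition generator :: "('n, 'k) mpoly set \<Rightarrow> nat \<Rightarrow> (nat \<Rightarrow> ('n, 'k) mpoly) \<Rightarrow> bool" where
  "generator J j v \<longleftrightarrow> cocycle J j v \<and> (\<exists>l. \<forall>i<r j. v i \<in> homog (l + e j i)) \<and>
     (\<forall>u. cocycle J j u \<longrightarrow> (\<exists>p. coboundary J j (\<lambda>i. u i - p * v i))) \<and>
     (\<forall>p. coboundary J j (\<lambda>i. p * v i) \<longleftrightarrow> p \<in> I)"

lemma mem_span_insert: "idl.subspace J \<Longrightarrow> x \<in> idl.span (insert t J) \<longleftrightarrow> (\<exists>q. x - t * q \<in> J)"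
  by (simp add: span_Un_singleton mult.commute)

text \<open>The connecting map of \<open>0 -> P/J -> P/J -> P/(J, t) -> 0\<close>, where
  \<open>P\<close> is the polynomial ring and the first arrow is multiplication by \<open>t\<close>:
  apply the differential to a lift and divide by \<open>t\<close>.\<close>

lemma cocycle_lift:
  assumes J: "idl.subspace J" and w: "cocycle (idl.span (insert t J)) j w"
    and reg: "\<And>p. t * p \<in> J \<Longrightarrow> p \<in> J"
  shows "\<exists>u. cocycle J (Suc j) u \<and> (\<forall>k<r (Suc j). tdiff j w k - t * u k \<in> J)"
proof -
  have "\<forall>k. \<exists>q. k < r (Suc j) \<longrightarrow> tdiff j w k - t * q \<in> J"
    using w by (auto simp: cocycle_def mem_span_insert[OF J])
  then obtain u where u: "\<And>k. k < r (Suc j) \<Longrightarrow> tdiff j w k - t * u k \<in> J" by metis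
  have "cocycle J (Suc j) u"
    unfolding cocycle_def
  proof (intro allI impI)
    fix k assume k: "k < r (Suc (Suc j))"
    have "tdiff (Suc j) (tdiff j w) k - tdiff (Suc j) (\<lambda>i. t * u i) k \<in> J"
      by (rule tdiff_cong_mod[OF J u])
    then have "- (t * tdiff (Suc j) u k) \<in> J" by (simp add: tdiff_T[OF k] tdiff_mult)
    then show "tdiff (Suc j) u k \<in> J" using idl.subspace_neg[OF J, of "- (t * tdiff (Suc j) u k)"] reg by simp
  qed
  with u show ?thesis by blast
qed

text \<open>The connecting map sends coboundaries to coboundaries; this is the form before the
  division by \<open>t\<close>.\<close>

lemma coboundary_lift:
  assumes J: "idl.subspace J" and c: "coboundary (idl.span (insert t J)) j w"
  shows "\<exists>x. \<forall>k<r (Suc j). tdiff j w k - t * tdiff j x k \<in> J"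
proof -
  have "\<exists>x y. (\<forall>i<r j. w i - y i - t * x i \<in> J) \<and> (\<forall>k<r (Suc j). tdiff j y k = 0)"
  proof (cases j)
    case 0
    then have "\<forall>i. \<exists>q. i < r j \<longrightarrow> w i - t * q \<in> J"
      using c by (auto simp: coboundary_def mem_span_insert[OF J])
    then obtain x where "\<And>i. i < r j \<Longrightarrow> w i - t * x i \<in> J" by metis
    then show ?thesis by (intro exI[of _ x] exI[of _ "\<lambda>_. 0"]) (simp add: tdiff_def)
  next
    case (Suc b)
    then obtain u where "\<And>k. k < r j \<Longrightarrow> w k - tdiff b u k \<in> idl.span (insert t J)"
      using c by (auto simp: coboundary_def)
    then have "\<forall>i. \<exists>q. i < r j \<longrightarrow> w i - tdiff b u i - t * q \<in> J"
      by (auto simp: mem_span_insert[OF J])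
    then obtain x where "\<And>i. i < r j \<Longrightarrow> w i - tdiff b u i - t * x i \<in> J" by metis
    then show ?thesis using tdiff_T[of _ b u] Suc by (intro exI[of _ x] exI[of _ "tdiff b u"]) simp
  qed
  then obtain x y where xy: "\<And>i. i < r j \<Longrightarrow> w i - y i - t * x i \<in> J" "\<And>k. k < r (Suc j) \<Longrightarrow> tdiff j y k = 0" by blast
  have "tdiff j w k - t * tdiff j x k \<in> J" if "k < r (Suc j)" for k
  proof -
    have "tdiff j (\<lambda>i. w i - y i - t * x i) k \<in> J" by (rule tdiff_mem[OF J xy(1)])
    then show ?thesis using xy(2)[OF that] by (simp add: tdiff_diff tdiff_mult)
  qed
  then show ?thesis by blast
qed

text \<open>This is the vanishing of Ext below the depth. By \<open>mult_coboundary\<close>,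
  \<open>t v\<close> is the coboundary of some \<open>w\<close> modulo \<open>J\<close>, and
  \<open>w\<close> is a cocycle modulo \<open>(J, t)\<close> one index lower. Induction makes it a
  coboundary there; lifting that and cancelling \<open>t\<close> exhibits \<open>v\<close> as a
  coboundary.\<close>

lemma vanishing:
  "hideal J \<Longrightarrow> regular_on J ts \<Longrightarrow> j < length ts \<Longrightarrow> cocycle J j v \<Longrightarrow> coboundary J j v"
proof (induction ts arbitrary: J j v)
  case (Cons t ts)
  have J: "idl.subspace J" using Cons.prems(1) by (rule hideal_subspace)
  have reg: "t \<in> I" "\<And>p. t * p \<in> J \<Longrightarrow> p \<in> J" "regular_on (idl.span (insert t J)) ts" "\<exists>l. t \<in> homog l"
    using Cons.prems(2) by auto
  have hJ': "hideal (idl.span (insert t J))" using hideal_Un[OF Cons.prems(1), of "{t}"] reg(4) by auto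
  have tv: "coboundary J j (\<lambda>k. t * v k)" by (rule mult_coboundary[OF J reg(1) Cons.prems(4)])
  show ?case
  proof (cases j)
    case 0
    then show ?thesis using tv reg(2) by (auto simp: coboundary_def)
  next
    case (Suc b)
    then obtain w where w: "\<And>k. k < r (Suc b) \<Longrightarrow> t * v k - tdiff b w k \<in> J" using tv by (auto simp: coboundary_def)
    have "cocycle (idl.span (insert t J)) b w"
      unfolding cocycle_def mem_span_insert[OF J]
    proof (intro allI impI)
      fix k assume "k < r (Suc b)"
      from idl.subspace_neg[OF J w[OF this]] show "\<exists>q. tdiff b w k - t * q \<in> J" by auto
    qed
    then have "coboundary (idl.span (insert t J)) b w"
      using Cons.IH[OF hJ' reg(3)] Cons.prems(3) Suc by auto
    from coboundary_lift[OF J this] obtain x where x: "\<And>k. k < r (Suc b) \<Longrightarrow> tdiff b w k - t * tdiff b x k \<in> J" by blast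
    have "v k - tdiff b x k \<in> J" if "k < r (Suc b)" for k
    proof (rule reg(2))
      show "t * (v k - tdiff b x k) \<in> J"
        using idl.subspace_add[OF J w[OF that] x[OF that]] by (simp add: algebra_simps)
    qed
    then show ?thesis using Suc by (auto simp: coboundary_def)
  qed
qed simp

text \<open>The connecting map from \<open>Ext^j\<close> with coefficients modulo
  \<open>(J, t)\<close> to \<open>Ext^(j+1)\<close> with coefficients modulo \<open>J\<close> is an
  isomorphism: injective because \<open>Ext^j\<close> modulo \<open>J\<close> vanishes, surjective
  because \<open>t\<close> kills \<open>Ext^(j+1)\<close>. The new generator is the preimage of the
  old one.\<close>

lemma generator_step:
  assumes hJ: "hideal J" and t: "t \<in> I" "t \<in> homog l" and reg: "\<And>p. t * p \<in> J \<Longrightarrow> p \<in> J"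
    and van: "\<And>v. cocycle J j v \<Longrightarrow> coboundary J j v" and gen: "generator J (Suc j) v"
  shows "\<exists>w. generator (idl.span (insert t J)) j w"
proof -
  let ?J = "idl.span (insert t J)"
  have J: "idl.subspace J" using hJ by (rule hideal_subspace)
  from gen obtain d where v: "cocycle J (Suc j) v" "\<And>i. i < r (Suc j) \<Longrightarrow> v i \<in> homog (d + e (Suc j) i)"
    "\<And>u. cocycle J (Suc j) u \<Longrightarrow> \<exists>p. coboundary J (Suc j) (\<lambda>i. u i - p * v i)"
    "\<And>p. coboundary J (Suc j) (\<lambda>i. p * v i) \<longleftrightarrow> p \<in> I"
    unfolding generator_def by blast
  have "coboundary J (Suc j) (\<lambda>k. t * v k)" by (rule mult_coboundary[OF J t(1) v(1)])
  then obtain w' where w': "\<And>k. k < r (Suc j) \<Longrightarrow> t * v k - tdiff j w' k \<in> J" by (auto simp: coboundary_def)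
  \<comment> \<open>Only the component in the degree forced by \<open>t * v\<close> is kept, so that
    \<open>w\<close> is homogeneous.\<close>
  define w where "w i = hc (l + d + e j i) (w' i)" for i
  have Tw: "tdiff j w k = hc (l + d + e (Suc j) k) (tdiff j w' k)" if k: "k < r (Suc j)" for k
    unfolding tdiff_def w_def hc_sum
  proof (rule sum.cong)
    fix i assume "i \<in> {..<r j}"
    then have "hc (l + d + e (Suc j) k) (D j i k * w' i) = D j i k * hc (l + d + e (Suc j) k - (e (Suc j) k - e j i)) (w' i)"
      using D_homog k by (intro hc_mult) auto
    then show "D j i k * hc (l + d + e j i) (w' i) = hc (l + d + e (Suc j) k) (D j i k * w' i)"
      by (simp add: algebra_simps)
  qed simp
  have w: "t * v k - tdiff j w k \<in> J" if k: "k < r (Suc j)" for k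
  proof -
    have "t * v k \<in> homog (l + d + e (Suc j) k)" using homog_mult[OF t(2) v(2)[OF k]] by (simp add: add.assoc)
    then have "t * v k - tdiff j w k = hc (l + d + e (Suc j) k) (t * v k - tdiff j w' k)"
      using Tw[OF k] by (simp add: hc_diff hc_id)
    then show ?thesis using hideal_hc[OF hJ w'[OF k]] by simp
  qed
  have cw: "cocycle ?J j w"
    unfolding cocycle_def mem_span_insert[OF J]
  proof (intro allI impI)
    fix k assume "k < r (Suc j)"
    from idl.subspace_neg[OF J w[OF this]] show "\<exists>q. tdiff j w k - t * q \<in> J" by auto
  qed
  \<comment> \<open>Injectivity of the connecting map: if the image of \<open>u\<close> is a
    coboundary, then \<open>u - t x\<close> is a cocycle modulo \<open>J\<close> and hence a
    coboundary by \<open>van\<close>.\<close>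
  have lift_back: "coboundary ?J j u"
    if "\<And>k. k < r (Suc j) \<Longrightarrow> tdiff j u k - t * tdiff j x k \<in> J" for u x
  proof -
    have "cocycle J j (\<lambda>i. u i - t * x i)" using that by (simp add: cocycle_def tdiff_diff tdiff_mult)
    then have c: "coboundary J j (\<lambda>i. u i - t * x i)" by (rule van)
    show ?thesis
    proof (cases j)
      case 0
      then show ?thesis using c by (auto simp: coboundary_def mem_span_insert[OF J])
    next
      case (Suc b)
      then obtain y where "\<And>k. k < r (Suc b) \<Longrightarrow> u k - t * x k - tdiff b y k \<in> J" using c by (auto simp: coboundary_def)
      then have "\<And>k. k < r (Suc b) \<Longrightarrow> (u k - tdiff b y k) - t * x k \<in> J" by (simp add: algebra_simps)
      then show ?thesis using Suc by (auto simp: coboundary_def mem_span_insert[OF J])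
    qed
  qed
  have g2: "\<exists>p. coboundary ?J j (\<lambda>i. u i - p * w i)" if u: "cocycle ?J j u" for u
  proof -
    from cocycle_lift[OF J u reg] obtain u' where u': "cocycle J (Suc j) u'" "\<And>k. k < r (Suc j) \<Longrightarrow> tdiff j u k - t * u' k \<in> J" by blast
    from v(3)[OF u'(1)] obtain p x where px: "\<And>k. k < r (Suc j) \<Longrightarrow> u' k - p * v k - tdiff j x k \<in> J"
      by (auto simp: coboundary_def)
    have "tdiff j (\<lambda>i. u i - p * w i) k - t * tdiff j x k \<in> J" if k: "k < r (Suc j)" for k
    proof -
      have "(tdiff j u k - t * u' k) + t * (u' k - p * v k - tdiff j x k) + p * (t * v k - tdiff j w k) \<in> J"
        by (intro idl.subspace_add[OF J] idl.subspace_scale[OF J] u'(2) px w k)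
      then show ?thesis by (simp add: tdiff_diff tdiff_mult algebra_simps)
    qed
    from lift_back[OF this] show ?thesis by blast
  qed
  have g3: "coboundary ?J j (\<lambda>i. p * w i) \<longleftrightarrow> p \<in> I" for p
  proof
    assume "p \<in> I"
    then obtain x where x: "\<And>k. k < r (Suc j) \<Longrightarrow> p * v k - tdiff j x k \<in> J"
      using v(4)[of p] by (auto simp: coboundary_def)
    have "tdiff j (\<lambda>i. p * w i) k - t * tdiff j x k \<in> J" if k: "k < r (Suc j)" for k
    proof -
      have "t * (p * v k - tdiff j x k) - p * (t * v k - tdiff j w k) \<in> J"
        by (intro idl.subspace_diff[OF J] idl.subspace_scale[OF J] x w k)
      then show ?thesis by (simp add: tdiff_mult algebra_simps)
    qed
    from lift_back[OF this] show "coboundary ?J j (\<lambda>i. p * w i)" .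
  next
    assume "coboundary ?J j (\<lambda>i. p * w i)"
    from coboundary_lift[OF J this] obtain x where x: "\<And>k. k < r (Suc j) \<Longrightarrow> tdiff j (\<lambda>i. p * w i) k - t * tdiff j x k \<in> J" by blast
    have "p * v k - tdiff j x k \<in> J" if k: "k < r (Suc j)" for k
    proof (rule reg)
      have "p * (t * v k - tdiff j w k) + (tdiff j (\<lambda>i. p * w i) k - t * tdiff j x k) \<in> J"
        by (intro idl.subspace_add[OF J] idl.subspace_scale[OF J] x w k)
      then show "t * (p * v k - tdiff j x k) \<in> J" by (simp add: tdiff_mult algebra_simps)
    qed
    then show "p \<in> I" using v(4)[of p] by (auto simp: coboundary_def)
  qed
  have "\<forall>i<r j. w i \<in> homog (l + d + e j i)" by (simp add: w_def hc_homog)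
  then show ?thesis unfolding generator_def using cw g2 g3 by blast
qed

lemma generator_descend:
  "hideal J \<Longrightarrow> regular_on J ts \<Longrightarrow> generator J (length ts) v \<Longrightarrow> \<exists>w. generator (idl.span (J \<union> set ts)) 0 w"
proof (induction ts arbitrary: J v)
  case Nil
  have e: "idl.span (J \<union> set []) = J" using hideal_subspace[OF Nil.prems(1)] by simp
  show ?case unfolding e using Nil.prems(3) by auto
next
  case (Cons t ts)
  obtain l where t: "t \<in> I" "t \<in> homog l" "\<And>p. t * p \<in> J \<Longrightarrow> p \<in> J" "regular_on (idl.span (insert t J)) ts"
    using Cons.prems(2) by auto
  have hJ': "hideal (idl.span (insert t J))" using hideal_Un[OF Cons.prems(1), of "{t}"] t(2) by auto
  obtain w where "generator (idl.span (insert t J)) (length ts) w"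
    using generator_step[OF Cons.prems(1) t(1-3) vanishing[OF Cons.prems(1,2)], of "length ts" v] Cons.prems(3) by auto
  from Cons.IH[OF hJ' t(4) this] obtain w' where "generator (idl.span (idl.span (insert t J) \<union> set ts)) 0 w'" by blast
  moreover have "idl.span (idl.span (insert t J) \<union> set ts) = idl.span (J \<union> set (t # ts))"
  proof -
    have "idl.span (idl.span (insert t J) \<union> set ts) = idl.span (insert t J \<union> set ts)"
      by (simp only: idl.span_Un idl.span_span)
    then show ?thesis by simp
  qed
  ultimately show ?case by auto
qed

text \<open>The module \<open>Ext^0(A_X, A_n/J)\<close> is
  \<open>Hom(A_X, A_n/J) = (J : I)/J\<close>. So the generator is a single form \<open>g\<close>
  with \<open>(J : I) = (J, g)\<close>, and the condition on the annihilator is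
  \<open>(J : g) = I\<close>.\<close>

lemma generator_0:
  assumes "generator J 0 w"
  shows "\<exists>l. \<exists>g\<in>homog l. (\<forall>i\<in>I. i * g \<in> J) \<and> (\<forall>u. (\<forall>i\<in>I. i * u \<in> J) \<longrightarrow> (\<exists>p. u - p * g \<in> J)) \<and>
    (\<forall>p. p * g \<in> J \<longleftrightarrow> p \<in> I)"
proof -
  have cob: "coboundary J 0 v \<longleftrightarrow> v 0 \<in> J" for v by (simp add: coboundary_def r0)
  have coc: "cocycle J 0 (\<lambda>_. u)" if "\<forall>i\<in>I. i * u \<in> J" for u
    unfolding cocycle_def
  proof (intro allI impI)
    fix k assume k: "k < r (Suc 0)"
    let ?u = "\<lambda>l. if l = k then 1 else 0 :: ('n, 'k) mpoly"
    have "matrix_apply (r 0) (r 1) (D 0) ?u 0 \<in> I"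
      unfolding I_image[symmetric] using k by (intro imageI) (auto simp: free_vectors_def)
    also have "matrix_apply (r 0) (r 1) (D 0) ?u 0 = (\<Sum>l<r 1. D 0 0 l * ?u l)"
      unfolding matrix_apply_def r0 by (rule if_P) simp
    also have "\<dots> = (\<Sum>l<r 1. if l = k then D 0 0 k else 0)"
      by (rule sum.cong) auto
    also have "\<dots> = D 0 0 k" using k by simp
    finally show "tdiff 0 (\<lambda>_. u) k \<in> J" using that by (simp add: tdiff_def r0)
  qed
  from assms obtain l where w: "\<And>i. i < r 0 \<Longrightarrow> w i \<in> homog (l + e 0 i)"
    "\<And>u. cocycle J 0 u \<Longrightarrow> \<exists>p. coboundary J 0 (\<lambda>i. u i - p * w i)"
    "\<And>p. coboundary J 0 (\<lambda>i. p * w i) \<longleftrightarrow> p \<in> I" unfolding generator_def by blast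
  have "w 0 \<in> homog l" using w(1)[of 0] by (simp add: r0 e0)
  moreover have "\<forall>p. p * w 0 \<in> J \<longleftrightarrow> p \<in> I" using w(3) unfolding cob by blast
  moreover have "\<forall>u. (\<forall>i\<in>I. i * u \<in> J) \<longrightarrow> (\<exists>p. u - p * w 0 \<in> J)"
  proof (intro allI impI)
    fix u assume "\<forall>i\<in>I. i * u \<in> J"
    from w(2)[OF coc[OF this]] show "\<exists>p. u - p * w 0 \<in> J" by (simp add: cob)
  qed
  ultimately show ?thesis by blast
qed

end

section \<open>Cosets and the dimension of a vector space given by a record\<close>

definition cs :: "'a::ab_group_add set \<Rightarrow> 'a \<Rightarrow> 'a set" where
  "cs W v = {v + w | w. w \<in> W}"

lemma cs_eq_iff:
  assumes "0 \<in> W" "\<And>x y. x \<in> W \<Longrightarrow> y \<in> W \<Longrightarrow> x + y \<in> W" "\<And>x. x \<in> W \<Longrightarrow> - x \<in> W"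
  shows "cs W x = cs W y \<longleftrightarrow> x - y \<in> W"
proof
  assume "cs W x = cs W y"
  moreover have "x \<in> cs W x" using assms(1) by (force simp: cs_def)
  ultimately obtain w where "w \<in> W" "x = y + w" by (auto simp: cs_def)
  then show "x - y \<in> W" by simp
next
  have sub: "cs W x \<subseteq> cs W y" if "x - y \<in> W" for x y
  proof
    fix z assume "z \<in> cs W x"
    then obtain w where "w \<in> W" "z = x + w" by (auto simp: cs_def)
    then have "z = y + ((x - y) + w)" "(x - y) + w \<in> W" using that assms(2) by auto
    then show "z \<in> cs W y" unfolding cs_def by blast
  qed
  assume "x - y \<in> W"
  moreover from this have "y - x \<in> W" using assms(3)[of "x - y"] by simp
  ultimately show "cs W x = cs W y" using sub by blast
qed

lemma cs_add:
  assumes "0 \<in> W" "\<And>x y. x \<in> W \<Longrightarrow> y \<in> W \<Longrightarrow> x + y \<in> W"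
  shows "{a + b | a b. a \<in> cs W x \<and> b \<in> cs W y} = cs W (x + y)"
proof
  show "{a + b | a b. a \<in> cs W x \<and> b \<in> cs W y} \<subseteq> cs W (x + y)"
  proof
    fix z assume "z \<in> {a + b | a b. a \<in> cs W x \<and> b \<in> cs W y}"
    then obtain v w where "v \<in> W" "w \<in> W" "z = (x + v) + (y + w)" by (auto simp: cs_def)
    then have "z = (x + y) + (v + w)" "v + w \<in> W" using assms(2) by (auto simp: algebra_simps)
    then show "z \<in> cs W (x + y)" unfolding cs_def by blast
  qed
  show "cs W (x + y) \<subseteq> {a + b | a b. a \<in> cs W x \<and> b \<in> cs W y}"
  proof
    fix z assume "z \<in> cs W (x + y)"
    then obtain w where "w \<in> W" "z = (x + 0) + (y + w)" by (auto simp: cs_def algebra_simps)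
    then show "z \<in> {a + b | a b. a \<in> cs W x \<and> b \<in> cs W y}" unfolding cs_def using assms(1) by blast
  qed
qed

lemma cs_smult:
  assumes "0 \<in> W" "\<And>x y. x \<in> W \<Longrightarrow> y \<in> W \<Longrightarrow> x + y \<in> W" "\<And>w. w \<in> W \<Longrightarrow> scale r w \<in> W"
    "\<And>v w. scale r (v + w) = scale r v + scale r w"
  shows "{scale r a + w | a w. a \<in> cs W v \<and> w \<in> W} = cs W (scale r v)"
proof
  show "{scale r a + w | a w. a \<in> cs W v \<and> w \<in> W} \<subseteq> cs W (scale r v)"
  proof
    fix z assume "z \<in> {scale r a + w | a w. a \<in> cs W v \<and> w \<in> W}"
    then obtain u w where "u \<in> W" "w \<in> W" "z = scale r (v + u) + w" by (auto simp: cs_def)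
    then have "z = scale r v + (scale r u + w)" "scale r u + w \<in> W" using assms by (auto simp: add.assoc)
    then show "z \<in> cs W (scale r v)" unfolding cs_def by blast
  qed
  show "cs W (scale r v) \<subseteq> {scale r a + w | a w. a \<in> cs W v \<and> w \<in> W}"
  proof
    fix z assume "z \<in> cs W (scale r v)"
    then obtain w where "w \<in> W" "z = scale r v + w" by (auto simp: cs_def)
    moreover have "v \<in> cs W v" unfolding cs_def using assms(1) by force
    ultimately show "z \<in> {scale r a + w | a w. a \<in> cs W v \<and> w \<in> W}" by blast
  qed
qed

lemma field_class_ring: "field (class_ring :: 'k::field ring)"
proof -
  have "\<exists>y. x * y = 1" if "x \<noteq> 0" for x :: 'k using that by (intro exI[of _ "inverse x"]) simp
  then show ?thesis
    by unfold_locales (auto simp: Units_def mult.commute algebra_simps class_ring_simps dest: mult_left_cancel)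
qed

text \<open>Through the map from \<open>V\<close>, the record \<open>M\<close> is the quotient
  \<open>V/W\<close>. The module axioms are transported before the basis, since
  \<open>vectorspace.dim\<close> has its properties only for a record known to be a vector space.
  The lemma serves both for the Hilbert function and for the sections of the divisor sheaf.\<close>

lemma dim_transport:
  fixes M :: "('k::field, 'c) module" and \<Psi> :: "('n::finite, 'k) mpoly \<Rightarrow> 'c"
  assumes V: "kv.subspace V" and W: "kv.subspace W" and q: "kv.qdim V W n"
    and im: "\<Psi> ` V = carrier M" and z: "\<Psi> 0 = \<zero>\<^bsub>M\<^esub>"
    and add: "\<And>x y. x \<in> V \<Longrightarrow> y \<in> V \<Longrightarrow> \<Psi> x \<oplus>\<^bsub>M\<^esub> \<Psi> y = \<Psi> (x + y)"
    and sm: "\<And>c x. x \<in> V \<Longrightarrow> c \<odot>\<^bsub>M\<^esub> \<Psi> x = \<Psi> (Const c * x)"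
    and ker: "\<And>x y. x \<in> V \<Longrightarrow> y \<in> V \<Longrightarrow> \<Psi> x = \<Psi> y \<longleftrightarrow> x - y \<in> W"
  shows "vectorspace.dim (class_ring :: 'k ring) M = n"
proof -
  have V0: "0 \<in> V" and Va: "\<And>x y. x \<in> V \<Longrightarrow> y \<in> V \<Longrightarrow> x + y \<in> V"
    and Vs: "\<And>c x. x \<in> V \<Longrightarrow> Const c * x \<in> V"
    using kv.subspace_0[OF V] kv.subspace_add[OF V] kv.subspace_scale[OF V] by auto
  have car: "x \<in> carrier M \<longleftrightarrow> (\<exists>v\<in>V. x = \<Psi> v)" for x unfolding im[symmetric] by auto
  have car': "\<And>v. v \<in> V \<Longrightarrow> \<Psi> v \<in> carrier M" using car by blast
  have mod: "module (class_ring :: 'k ring) M"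
  proof (rule module_criteria)
    show "cring (class_ring :: 'k ring)" by (rule class_cring.cring_axioms)
    show "\<zero>\<^bsub>M\<^esub> \<in> carrier M" using car' V0 z by metis
    show "\<forall>v w. v \<in> carrier M \<and> w \<in> carrier M \<longrightarrow> v \<oplus>\<^bsub>M\<^esub> w \<in> carrier M"
      unfolding car by (auto simp: add Va)
    show "\<forall>v\<in>carrier M. \<exists>neg_v\<in>carrier M. v \<oplus>\<^bsub>M\<^esub> neg_v = \<zero>\<^bsub>M\<^esub>"
    proof
      fix v assume "v \<in> carrier M"
      then obtain x where x: "x \<in> V" "v = \<Psi> x" using car by blast
      then have mx: "- x \<in> V" using kv.subspace_neg[OF V] by blast
      have "v \<oplus>\<^bsub>M\<^esub> \<Psi> (- x) = \<zero>\<^bsub>M\<^esub>" using add[OF x(1) mx] x z by simp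
      then show "\<exists>neg_v\<in>carrier M. v \<oplus>\<^bsub>M\<^esub> neg_v = \<zero>\<^bsub>M\<^esub>" using car'[OF mx] by blast
    qed
  qed (auto simp: car add sm Va Vs V0 z[symmetric] add_ac Const_mult Const_add distrib_left distrib_right mult.assoc)
  interpret vectorspace "class_ring :: 'k ring" M
    using mod field_class_ring by (simp add: vectorspace_def)
  from q obtain b where b: "kv.indep_mod W {..<n} b" "kv.spans_mod V W {..<n} b" by (auto simp: kv.qdim_def kv.qbasis_def)
  have bV: "b i \<in> V" if "i < n" for i using b(2) that by (auto simp: kv.spans_mod_def)
  have sV: "(\<Sum>i\<in>T. Const (c i) * b i) \<in> V" if "T \<subseteq> {..<n}" for c T
    using that bV by (intro kv.subspace_sum[OF V] Vs) auto
  have lin: "(\<Oplus>\<^bsub>M\<^esub>i\<in>T. c i \<odot>\<^bsub>M\<^esub> \<Psi> (b i)) = \<Psi> (\<Sum>i\<in>T. Const (c i) * b i)" if "T \<subseteq> {..<n}" for c T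
  proof -
    have "finite T" using that finite_subset by blast
    then show ?thesis using that
    proof (induction T)
      case (insert i T)
      have "(\<Oplus>\<^bsub>M\<^esub>i\<in>insert i T. c i \<odot>\<^bsub>M\<^esub> \<Psi> (b i)) = c i \<odot>\<^bsub>M\<^esub> \<Psi> (b i) \<oplus>\<^bsub>M\<^esub> (\<Oplus>\<^bsub>M\<^esub>i\<in>T. c i \<odot>\<^bsub>M\<^esub> \<Psi> (b i))"
      proof (rule finsum_insert)
        have cl: "c k \<odot>\<^bsub>M\<^esub> \<Psi> (b k) \<in> carrier M" if "k < n" for k
          using that by (simp add: sm bV Vs car')
        show "(\<lambda>i. c i \<odot>\<^bsub>M\<^esub> \<Psi> (b i)) \<in> T \<rightarrow> carrier M" "c i \<odot>\<^bsub>M\<^esub> \<Psi> (b i) \<in> carrier M"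
          using insert.prems cl by auto
      qed (use insert.hyps in auto)
      then show ?case using insert sV[of T c] by (simp add: sm bV add Vs)
    qed (simp add: z)
  qed
  define g where "g i = \<Psi> (b i)" for i
  have inj: "inj_on g {..<n}"
  proof (rule inj_onI, rule ccontr)
    fix i j assume ij: "i \<in> {..<n}" "j \<in> {..<n}" "g i = g j" "i \<noteq> j"
    define c :: "nat \<Rightarrow> 'k" where "c k = (if k = i then 1 else if k = j then -1 else 0)" for k
    have "(\<Sum>k<n. Const (c k) * b k) = (\<Sum>k\<in>{i,j}. Const (c k) * b k)"
      using ij by (intro sum.mono_neutral_right) (auto simp: c_def)
    also have "\<dots> = b i - b j" using ij(4) by (simp add: c_def Const_uminus)
    also have "\<dots> \<in> W" using ij(1-3) ker[OF bV bV] by (simp add: g_def)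
    finally have "\<forall>k\<in>{..<n}. c k = 0" using b(1) unfolding kv.indep_mod_def by blast
    then have "c i = 0" using ij(1) by blast
    then show False by (simp add: c_def)
  qed
  let ?A = "g ` {..<n}"
  have Ac: "?A \<subseteq> carrier M" using bV car' by (auto simp: g_def)
  have lc: "lincomb a ?A = \<Psi> (\<Sum>i<n. Const (a (g i)) * b i)" for a
  proof -
    have "lincomb a ?A = (\<Oplus>\<^bsub>M\<^esub>i\<in>{..<n}. a (g i) \<odot>\<^bsub>M\<^esub> g i)"
      unfolding lincomb_def using inj Ac by (intro finsum_reindex) (auto intro!: smult_closed)
    then show ?thesis using lin[of "{..<n}" "\<lambda>i. a (g i)"] by (simp add: g_def)
  qed
  have "basis ?A"
    unfolding basis_def
  proof (intro conjI Ac)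
    show "lin_indpt ?A"
    proof (rule finite_lin_indpt2)
      fix a assume "lincomb a ?A = \<zero>\<^bsub>M\<^esub>"
      then have "\<Psi> (\<Sum>i<n. Const (a (g i)) * b i) = \<Psi> 0" using lc z by simp
      then have "(\<Sum>i<n. Const (a (g i)) * b i) \<in> W" using ker[OF sV V0] by simp
      then have "\<forall>i\<in>{..<n}. a (g i) = 0"
        using spec[OF conjunct2[OF b(1)[unfolded kv.indep_mod_def]], of "\<lambda>i. a (g i)"] by blast
      then show "\<forall>v\<in>?A. a v = \<zero>\<^bsub>class_ring\<^esub>" by simp
    qed (use Ac in auto)
    have "carrier M \<subseteq> span ?A"
    proof
      fix x assume "x \<in> carrier M"
      then obtain v where v: "v \<in> V" "x = \<Psi> v" using car by blast
      then obtain c where c: "v - (\<Sum>i<n. Const (c i) * b i) \<in> W" using b(2) by (auto simp: kv.spans_mod_def)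
      define a where "a = c \<circ> the_inv_into {..<n} g"
      have "(\<Sum>i<n. Const (a (g i)) * b i) = (\<Sum>i<n. Const (c i) * b i)"
        by (rule sum.cong) (simp_all add: a_def the_inv_into_f_f[OF inj])
      then have "x = lincomb a ?A" using lc[of a] c ker[OF v(1) sV] v(2) by simp
      then show "x \<in> span ?A" unfolding span_def by (auto intro!: exI[of _ a] exI[of _ ?A])
    qed
    moreover have "span ?A \<subseteq> carrier M" using Ac by (rule span_is_subset2)
    ultimately show "gen_set ?A" by blast
  qed
  then have "dim = card ?A" by (intro dim_basis) auto
  then show ?thesis using card_image[OF inj] by simp
qed

lemma dim_quotient_module:
  assumes V: "kv.subspace V" and W: "kv.subspace W" and q: "kv.qdim V W n" and sub: "W \<subseteq> V"
  shows "vectorspace.dim (class_ring :: 'k::field ring)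
    (quotient_module (\<lambda>c (p :: ('n::finite, 'k) mpoly). Const c * p) V W) = n"
proof (rule dim_transport[OF V W q, of "cs W"])
  have w: "0 \<in> W" "\<And>x y. x \<in> W \<Longrightarrow> y \<in> W \<Longrightarrow> x + y \<in> W" "\<And>x. x \<in> W \<Longrightarrow> - x \<in> W" "\<And>c x. x \<in> W \<Longrightarrow> Const c * x \<in> W"
    using kv.subspace_0[OF W] kv.subspace_add[OF W] kv.subspace_neg[OF W] kv.subspace_scale[OF W] by auto
  let ?M = "quotient_module (\<lambda>c (p :: ('n, 'k) mpoly). Const c * p) V W"
  show "cs W ` V = carrier ?M" by (auto simp: quotient_module_def cs_def)
  show "cs W 0 = \<zero>\<^bsub>?M\<^esub>" by (auto simp: quotient_module_def cs_def)
  show "cs W x \<oplus>\<^bsub>?M\<^esub> cs W y = cs W (x + y)" for x y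
    using cs_add[OF w(1,2), of x y] by (simp add: quotient_module_def)
  show "c \<odot>\<^bsub>?M\<^esub> cs W x = cs W (Const c * x)" for c x
    using cs_smult[OF w(1,2), of "\<lambda>c p. Const c * p" c x] w(4) by (simp add: quotient_module_def distrib_left)
  show "cs W x = cs W y \<longleftrightarrow> x - y \<in> W" for x y by (rule cs_eq_iff[OF w(1-3)])
qed

lemma qdim_hilbert_fun:
  assumes "idl.subspace I"
  shows "kv.qdim (homog l) (I \<inter> homog l) (hilbert_fun I l)"
proof -
  have s: "kv.subspace (I \<inter> homog l)" by (intro kv.subspace_inter ideal_kv_subspace assms subspace_homog)
  obtain n where n: "kv.qdim (homog l) (I \<inter> homog l) n"
    using qdim_homog_exists[OF subspace_homog s] by blast
  then show ?thesis using dim_quotient_module[OF subspace_homog s n] by (simp add: hilbert_fun_def)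
qed

section \<open>The canonical module of a Gorenstein curve\<close>

lemma chain_above_le: "chain_above I P m \<Longrightarrow> k \<le> m \<Longrightarrow> chain_above I P k"
  unfolding chain_above_def
proof (elim exE conjE)
  fix c assume "k \<le> m" "c 0 = P" "\<forall>i\<le>m. c i \<in> Proj I" "\<forall>i<m. c i \<subset> c (Suc i)"
  then show "\<exists>c. c 0 = P \<and> (\<forall>i\<le>k. c i \<in> Proj I) \<and> (\<forall>i<k. c i \<subset> c (Suc i))"
    by (intro exI[of _ c]) auto
qed

text \<open>The canonical module carries its own dimension \<open>m\<close>, which has to be
  recognised as \<open>1\<close> to fix the index of Ext.\<close>

lemma has_dimension_unique: assumes "has_dimension I a" "has_dimension I b" shows "a = b"
proof -
  have "a \<le> b" if "has_dimension I a" "has_dimension I b" for a b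
  proof (rule ccontr)
    assume "\<not> a \<le> b"
    then have "Suc b \<le> a" by simp
    then show False using that chain_above_le[of I _ a "Suc b"] unfolding has_dimension_def by blast
  qed
  then show ?thesis using assms by (simp add: antisym)
qed

text \<open>The class of \<open>1\<close> in the twisted coordinate ring is homogeneous of degree
  \<open>- a\<close>, generates it and has annihilator \<open>I\<close>; its preimage under the
  isomorphism is the desired cocycle. As \<open>card UNIV\<close> is \<open>n + 1\<close>, the index
  of Ext on a curve is \<open>n - 1\<close>, which is \<open>card UNIV - 2\<close>.\<close>

lemma gorenstein_generator:
  fixes I :: "('n::finite, 'k::field) mpoly set"
  assumes I: "hideal I" and d: "has_dimension I 1" and g: "gorenstein I"
  shows "\<exists>r e D v. resolution I r e D \<and>
    resolution.generator I r e D {0} (card (UNIV :: 'n set) - 2) v"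
proof -
  from g obtain W a where W: "canonical_module I W" "graded_isomorphic class_ring W (twist a (coord_ring I))"
    unfolding gorenstein_def by blast
  from W(1) obtain m r e D where m: "has_dimension I m" "graded_free_resolution I r e D"
    "W = ext_module r e D (card (UNIV :: 'n set) - 1 - m) (- int (card (UNIV :: 'n set)))"
    unfolding canonical_module_def by blast
  have "m = 1" by (rule has_dimension_unique[OF m(1) d])
  define c where "c = card (UNIV :: 'n set) - 2"
  define n where "n = int (card (UNIV :: 'n set))"
  have W_ext: "W = ext_module r e D c (- n)" using m(3) \<open>m = 1\<close> by (simp add: c_def n_def numeral_2_eq_2)
  interpret resolution I r e D using m(2) I by unfold_locales
  let ?V = "{v \<in> free_vectors (r c). matrix_apply (r (Suc c)) (r c) (\<lambda>i j. D c j i) v = 0}"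
  let ?B = "case c of 0 \<Rightarrow> {0} | Suc b \<Rightarrow> matrix_apply (r c) (r b) (\<lambda>i j. D b j i) ` free_vectors (r b)"
  define B where "B = ?B"
  have mT: "matrix_apply (r (Suc j)) (r j) (\<lambda>i k. D j k i) v = (\<lambda>k. if k < r (Suc j) then tdiff j v k else 0)" for j v
    unfolding matrix_apply_def tdiff_def ..
  have V_iff: "v \<in> ?V \<longleftrightarrow> v \<in> free_vectors (r c) \<and> cocycle {0} c v" for v
    unfolding mT by (auto simp: cocycle_def fun_eq_iff)
  have B_iff: "v \<in> B \<longleftrightarrow> v \<in> free_vectors (r c) \<and> coboundary {0} c v" for v
  proof (cases c)
    case 0
    then show ?thesis by (auto simp: B_def coboundary_def free_vectors_def fun_eq_iff) (meson not_le)
  next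
    case (Suc b)
    have "v \<in> B \<longleftrightarrow> (\<exists>u\<in>free_vectors (r b). v = (\<lambda>k. if k < r (Suc b) then tdiff b u k else 0))"
      by (auto simp: B_def Suc mT)
    also have "\<dots> \<longleftrightarrow> v \<in> free_vectors (r c) \<and> coboundary {0} c v"
    proof
      assume "\<exists>u\<in>free_vectors (r b). v = (\<lambda>k. if k < r (Suc b) then tdiff b u k else 0)"
      then show "v \<in> free_vectors (r c) \<and> coboundary {0} c v"
        by (auto simp: Suc coboundary_def free_vectors_def)
    next
      assume v: "v \<in> free_vectors (r c) \<and> coboundary {0} c v"
      then obtain u where u: "\<And>k. k < r (Suc b) \<Longrightarrow> v k = tdiff b u k" by (auto simp: Suc coboundary_def)
      let ?u = "\<lambda>i. if i < r b then u i else 0"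
      have "tdiff b ?u k = tdiff b u k" for k by (simp add: tdiff_def)
      then have "v = (\<lambda>k. if k < r (Suc b) then tdiff b ?u k else 0)"
        using u v by (auto simp: fun_eq_iff Suc free_vectors_def)
      moreover have "?u \<in> free_vectors (r b)" by (simp add: free_vectors_def)
      ultimately show "\<exists>u\<in>free_vectors (r b). v = (\<lambda>k. if k < r (Suc b) then tdiff b u k else 0)" by blast
    qed
    finally show ?thesis .
  qed
  have cob_add: "coboundary {0} c (\<lambda>i. u i + v i)" if uv: "coboundary {0} c u" "coboundary {0} c v" for u v
  proof (cases c)
    case 0 then show ?thesis using uv by (simp add: coboundary_def)
  next
    case (Suc b)
    then obtain x y where "\<And>k. k < r (Suc b) \<Longrightarrow> u k - tdiff b x k = 0" "\<And>k. k < r (Suc b) \<Longrightarrow> v k - tdiff b y k = 0"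
      using uv by (auto simp: coboundary_def)
    then have "\<forall>k<r (Suc b). u k + v k - tdiff b (\<lambda>i. x i + y i) k \<in> {0}" by (simp add: tdiff_add)
    then show ?thesis using Suc by (auto simp: coboundary_def)
  qed
  have cob_mult: "coboundary {0} c (\<lambda>i. p * u i)" if u: "coboundary {0} c u" for u p
  proof (cases c)
    case 0 then show ?thesis using u by (simp add: coboundary_def)
  next
    case (Suc b)
    then obtain x where "\<And>k. k < r (Suc b) \<Longrightarrow> u k - tdiff b x k = 0"
      using u by (auto simp: coboundary_def)
    then have "\<forall>k<r (Suc b). p * u k - tdiff b (\<lambda>i. p * x i) k \<in> {0}" by (simp add: tdiff_mult)
    then show ?thesis using Suc by (auto simp: coboundary_def)
  qed
  have B0: "0 \<in> B" and Ba: "\<And>x y. x \<in> B \<Longrightarrow> y \<in> B \<Longrightarrow> x + y \<in> B"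
    and Bm: "\<And>p x. x \<in> B \<Longrightarrow> (\<lambda>i. p * x i) \<in> B"
  proof -
    show Bm: "(\<lambda>i. p * x i) \<in> B" if "x \<in> B" for p x
      using that cob_mult by (auto simp: B_iff free_vectors_def)
    show "x + y \<in> B" if "x \<in> B" "y \<in> B" for x y
      using that cob_add[of x y] by (auto simp: B_iff free_vectors_def plus_fun_def)
    have "coboundary {0} c (\<lambda>_. 0)" by (cases c) (auto simp: coboundary_def tdiff_def intro!: exI[of _ "\<lambda>_. 0"])
    then show "0 \<in> B" by (auto simp: B_iff free_vectors_def zero_fun_def)
  qed
  have Bn: "- x \<in> B" if "x \<in> B" for x
  proof -
    have "- x = (\<lambda>i. (-1) * x i)" by (auto simp: fun_eq_iff)
    then show ?thesis using Bm[OF that, of "-1"] by simp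
  qed
  have csB: "cs B x = cs B y \<longleftrightarrow> x - y \<in> B" for x y by (rule cs_eq_iff[OF B0 Ba Bn])
  have Is: "idl.subspace I" using I by (rule hideal_subspace)
  have I0: "0 \<in> I" and Ia: "\<And>x y. x \<in> I \<Longrightarrow> y \<in> I \<Longrightarrow> x + y \<in> I" and In: "\<And>x. x \<in> I \<Longrightarrow> - x \<in> I"
    and Im: "\<And>p x. x \<in> I \<Longrightarrow> p * x \<in> I"
    using idl.subspace_0[OF Is] idl.subspace_add[OF Is] idl.subspace_neg[OF Is] idl.subspace_scale[OF Is] by auto
  have csI: "cs I x = cs I y \<longleftrightarrow> x - y \<in> I" for x y by (rule cs_eq_iff[OF I0 Ia In])
  let ?N = "twist a (coord_ring I)"
  have W_carrier: "carrier W = cs B ` ?V"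
    unfolding W_ext ext_module_def graded_quotient_def quotient_module_def module.defs cs_def B_def by auto
  have W_smult: "p \<odot>\<^bsub>W\<^esub> cs B v = cs B (\<lambda>i. p * v i)" for p v
    using cs_smult[OF B0 Ba, of "\<lambda>p v j. p * v j" p v] Bm
    unfolding W_ext ext_module_def graded_quotient_def quotient_module_def module.defs B_def[symmetric]
    by (simp add: fun_eq_iff distrib_left)
  have W_gpart: "gpart W l = cs B ` (?V \<inter> {v. \<forall>j<r c. v j \<in> homog (- n + (l + e c j))})" for l
    unfolding W_ext ext_module_def graded_quotient_def quotient_module_def module.defs cs_def B_def by auto
  have N_carrier: "carrier ?N = range (cs I)"
    unfolding twist_def coord_ring_def graded_quotient_def quotient_module_def module.defs cs_def by auto
  have N_smult: "p \<odot>\<^bsub>?N\<^esub> cs I q = cs I (p * q)" for p q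
    using cs_smult[OF I0 Ia, of "(*)" p q] Im
    unfolding twist_def coord_ring_def graded_quotient_def quotient_module_def module.defs
    by (simp add: distrib_left)
  have N_gpart: "gpart ?N l = cs I ` homog (a + l)" for l
    unfolding twist_def coord_ring_def graded_quotient_def quotient_module_def module.defs cs_def by auto
  from W(2) obtain f where f: "f \<in> LinearCombinations.module_hom class_ring W ?N" "bij_betw f (carrier W) (carrier ?N)"
    "\<And>l. f ` gpart W l = gpart ?N l" unfolding graded_isomorphic_def by blast
  have "cs I 1 \<in> gpart ?N (- a)" unfolding N_gpart by simp
  then obtain v where v: "v \<in> ?V" "\<And>j. j < r c \<Longrightarrow> v j \<in> homog (- n + (- a + e c j))" "f (cs B v) = cs I 1"
    unfolding f(3)[symmetric] W_gpart by auto
  have Vm: "(\<lambda>i. p * u i) \<in> ?V" if "u \<in> ?V" for p u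
    using that unfolding V_iff by (auto simp: free_vectors_def cocycle_def tdiff_mult)
  have fv: "f (cs B (\<lambda>i. p * v i)) = cs I p" for p
  proof -
    have "cs B v \<in> carrier W" unfolding W_carrier using v(1) by (rule imageI)
    then have "f (p \<odot>\<^bsub>W\<^esub> cs B v) = p \<odot>\<^bsub>?N\<^esub> f (cs B v)"
      using f(1) unfolding LinearCombinations.module_hom_def by simp
    then show ?thesis by (simp only: W_smult v(3) N_smult mult_1_right)
  qed
  have inj: "x - y \<in> B" if "f (cs B x) = f (cs B y)" "x \<in> ?V" "y \<in> ?V" for x y
  proof -
    have "cs B x = cs B y"
      using bij_betw_imp_inj_on[OF f(2)] that unfolding W_carrier by (auto dest: inj_onD)
    then show ?thesis by (simp add: csB)
  qed
  have "generator {0} c v"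
    unfolding generator_def
  proof (intro conjI allI impI)
    show "cocycle {0} c v" using v(1) V_iff by blast
    show "\<exists>l. \<forall>i<r c. v i \<in> homog (l + e c i)"
      using v(2) by (intro exI[of _ "- n - a"]) (simp add: algebra_simps)
  next
    fix u assume u: "cocycle {0} c u"
    let ?u = "\<lambda>i. if i < r c then u i else 0"
    have "tdiff c ?u k = tdiff c u k" for k by (simp add: tdiff_def)
    then have uV: "?u \<in> ?V" unfolding V_iff using u by (simp add: cocycle_def free_vectors_def)
    then have "f (cs B ?u) \<in> carrier ?N" using bij_betw_apply[OF f(2)] unfolding W_carrier by blast
    then obtain p where "f (cs B ?u) = cs I p" unfolding N_carrier by blast
    then have "f (cs B ?u) = f (cs B (\<lambda>i. p * v i))" by (simp only: fv)
    from inj[OF this uV Vm[OF v(1)]] have "coboundary {0} c (?u - (\<lambda>i. p * v i))" by (simp add: B_iff)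
    then have "coboundary {0} c (\<lambda>i. u i - p * v i)" by (cases c) (auto simp: coboundary_def)
    then show "\<exists>p. coboundary {0} c (\<lambda>i. u i - p * v i)" ..
  next
    fix p
    have fr: "(\<lambda>i. p * v i) \<in> free_vectors (r c)" using Vm[OF v(1), of p] by blast
    have "coboundary {0} c (\<lambda>i. p * v i) \<longleftrightarrow> (\<lambda>i. p * v i) - (\<lambda>i. 0 * v i) \<in> B"
      using fr by (simp add: B_iff fun_diff_def)
    also have "\<dots> \<longleftrightarrow> cs I p = cs I 0"
      using inj[OF _ Vm[OF v(1)] Vm[OF v(1)], of p 0] csB fv by metis
    finally show "coboundary {0} c (\<lambda>i. p * v i) \<longleftrightarrow> p \<in> I" by (simp add: csI)
  qed
  then show ?thesis using resolution_axioms unfolding c_def by blast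
qed

section \<open>The coordinate ring as a free module over a polynomial ring in two variables\<close>

text \<open>The \<open>b i\<close> are polynomials representing the images of the unit vectors.
  Stating freeness through them lets membership in \<open>I\<close> replace the quotient
  record.\<close>

lemma characteristic_sequence_basis:
  fixes I :: "('n::finite, 'k::field) mpoly set"
  assumes I: "hideal I" and c: "characteristic_sequence I d m"
  shows "\<exists>Y0 Y1 b. Y0 \<in> homog 1 \<and> Y1 \<in> homog 1 \<and> (\<forall>P \<in> Proj I. \<not> (Y0 \<in> P \<and> Y1 \<in> P)) \<and>
    (\<forall>i<d. b i \<in> homog (int (m i))) \<and>
    (\<forall>l. \<forall>p\<in>homog l. \<exists>v. (\<forall>i<d. v i \<in> subalgebra_gen {Y0, Y1} \<inter> homog (l - int (m i))) \<and>
      p - (\<Sum>i<d. v i * b i) \<in> I) \<and>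
    (\<forall>v. (\<forall>i<d. v i \<in> subalgebra_gen {Y0, Y1}) \<longrightarrow> (\<Sum>i<d. v i * b i) \<in> I \<longrightarrow> (\<forall>i<d. v i = 0))"
proof -
  from c obtain Y0 Y1 where Y: "Y0 \<in> homog 1" "Y1 \<in> homog 1" "\<forall>P \<in> Proj I. \<not> (Y0 \<in> P \<and> Y1 \<in> P)"
    and iso: "graded_isomorphic (class_ring\<lparr>carrier := subalgebra_gen {Y0, Y1}\<rparr>)
          (graded_free_module (subalgebra_gen {Y0, Y1}) d m) (coord_ring I)"
    unfolding characteristic_sequence_def by blast
  let ?R = "subalgebra_gen {Y0, Y1}"
  let ?F = "graded_free_module ?R d m"
  from iso obtain f where f: "f \<in> LinearCombinations.module_hom (class_ring\<lparr>carrier := ?R\<rparr>) ?F (coord_ring I)"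
    "bij_betw f (carrier ?F) (carrier (coord_ring I))" "\<And>l. f ` gpart ?F l = gpart (coord_ring I) l"
    unfolding graded_isomorphic_def by blast
  have Is: "idl.subspace I" using I by (rule hideal_subspace)
  have I0: "0 \<in> I" and Ia: "\<And>x y. x \<in> I \<Longrightarrow> y \<in> I \<Longrightarrow> x + y \<in> I" and In: "\<And>x. x \<in> I \<Longrightarrow> - x \<in> I"
    and Im: "\<And>p x. x \<in> I \<Longrightarrow> p * x \<in> I"
    using idl.subspace_0[OF Is] idl.subspace_add[OF Is] idl.subspace_neg[OF Is] idl.subspace_scale[OF Is] by auto
  have csI: "cs I x = cs I y \<longleftrightarrow> x - y \<in> I" for x y by (rule cs_eq_iff[OF I0 Ia In])
  have R0: "0 \<in> ?R" and R1: "1 \<in> ?R" using subalgebra_gen.intros(1)[of 0 "{Y0, Y1}"] subalgebra_gen.intros(1)[of 1 "{Y0, Y1}"] by auto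
  have N_carrier: "carrier (coord_ring I) = range (cs I)"
    unfolding coord_ring_def graded_quotient_def quotient_module_def module.defs cs_def by auto
  have N_smult: "p \<odot>\<^bsub>coord_ring I\<^esub> cs I q = cs I (p * q)" for p q
    using cs_smult[OF I0 Ia, of "(*)" p q] Im
    unfolding coord_ring_def graded_quotient_def quotient_module_def module.defs
    by (simp add: distrib_left)
  have N_add: "cs I p \<oplus>\<^bsub>coord_ring I\<^esub> cs I q = cs I (p + q)" for p q
    using cs_add[OF I0 Ia, of p q]
    unfolding coord_ring_def graded_quotient_def quotient_module_def module.defs by simp
  have N_gpart: "gpart (coord_ring I) l = cs I ` homog l" for l
    unfolding coord_ring_def graded_quotient_def quotient_module_def module.defs cs_def by auto
  have F_carrier: "carrier ?F = {v \<in> free_vectors d. \<forall>i<d. v i \<in> ?R}"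
    and F_gpart: "gpart ?F l = {v \<in> free_vectors d. \<forall>i<d. v i \<in> ?R \<inter> homog (l - int (m i))}"
    and F_add: "u \<oplus>\<^bsub>?F\<^esub> v = u + v" and F_smult: "p \<odot>\<^bsub>?F\<^esub> v = (\<lambda>i. p * v i)" for l u v p
    by (simp_all add: graded_free_module_def)
  let ?e = "\<lambda>i j. if j = i then 1 else 0 :: ('n, 'k) mpoly"
  have "\<forall>i\<in>{..<d}. \<exists>b. b \<in> homog (int (m i)) \<and> f (?e i) = cs I b"
  proof
    fix i assume "i \<in> {..<d}"
    then have "?e i \<in> gpart ?F (int (m i))" unfolding F_gpart using R0 R1 by (auto simp: free_vectors_def)
    then have "f (?e i) \<in> gpart (coord_ring I) (int (m i))" unfolding f(3)[symmetric] by (rule imageI)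
    then show "\<exists>b. b \<in> homog (int (m i)) \<and> f (?e i) = cs I b" unfolding N_gpart by blast
  qed
  from bchoice[OF this] obtain b where b: "\<forall>i\<in>{..<d}. b i \<in> homog (int (m i)) \<and> f (?e i) = cs I (b i)" ..
  have fadd: "f (u + v) = f u \<oplus>\<^bsub>coord_ring I\<^esub> f v" if "u \<in> carrier ?F" "v \<in> carrier ?F" for u v
    using f(1) that unfolding LinearCombinations.module_hom_def F_add[symmetric] by auto
  have fmult: "f (\<lambda>i. p * v i) = p \<odot>\<^bsub>coord_ring I\<^esub> f v" if "p \<in> ?R" "v \<in> carrier ?F" for p v
    using f(1) that unfolding LinearCombinations.module_hom_def F_smult[symmetric] by auto
  have eF: "?e i \<in> carrier ?F" if "i < d" for i
    unfolding F_carrier using that R0 R1 by (auto simp: free_vectors_def)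
  have zF: "(\<lambda>_. 0) \<in> carrier ?F" unfolding F_carrier using R0 by (auto simp: free_vectors_def)
  have f0: "f (\<lambda>_. 0) = cs I 0"
  proof -
    obtain q where q: "f (\<lambda>_. 0) = cs I q" using bij_betw_apply[OF f(2) zF] N_carrier by auto
    have "f (\<lambda>_. 0) = cs I (0 * q)" using fmult[OF R0 zF] by (simp only: q N_smult mult_zero_left)
    then show ?thesis by simp
  qed
  have fsum: "f (\<lambda>j. if j < k then v j else 0) = cs I (\<Sum>i<k. v i * b i)" if "k \<le> d" "v \<in> carrier ?F" for k v
    using that(1)
  proof (induction k)
    case 0
    then show ?case using f0 by simp
  next
    case (Suc k)
    let ?u = "\<lambda>j. if j < k then v j else 0"
    have vk: "v k \<in> ?R" and uF: "?u \<in> carrier ?F"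
      using Suc.prems that(2) R0 by (auto simp: F_carrier free_vectors_def)
    have wF: "(\<lambda>i. v k * ?e k i) \<in> carrier ?F"
      using Suc.prems vk R0 by (auto simp: F_carrier free_vectors_def)
    have "(\<lambda>j. if j < Suc k then v j else 0) = ?u + (\<lambda>i. v k * ?e k i)" by (auto simp: fun_eq_iff less_Suc_eq)
    then have "f (\<lambda>j. if j < Suc k then v j else 0) = f ?u \<oplus>\<^bsub>coord_ring I\<^esub> (v k \<odot>\<^bsub>coord_ring I\<^esub> f (?e k))"
      using fadd[OF uF wF] fmult[OF vk eF, of k] Suc.prems by simp
    also have "f (?e k) = cs I (b k)" using b Suc.prems by simp
    also have "f ?u = cs I (\<Sum>i<k. v i * b i)" using Suc by simp
    finally show ?case by (simp add: N_smult N_add)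
  qed
  have fv: "f v = cs I (\<Sum>i<d. v i * b i)" if "v \<in> carrier ?F" for v
  proof -
    have "(\<lambda>j. if j < d then v j else 0) = v" using that by (auto simp: F_carrier free_vectors_def fun_eq_iff)
    then show ?thesis using fsum[OF order_refl that] by simp
  qed
  have "\<exists>v. (\<forall>i<d. v i \<in> ?R \<inter> homog (l - int (m i))) \<and> p - (\<Sum>i<d. v i * b i) \<in> I" if "p \<in> homog l" for p l
  proof -
    have "cs I p \<in> f ` gpart ?F l" unfolding f(3) N_gpart using that by (rule imageI)
    then obtain v where v: "v \<in> gpart ?F l" "cs I p = f v" by blast
    then have "v \<in> carrier ?F" by (auto simp: F_gpart F_carrier)
    then have "p - (\<Sum>i<d. v i * b i) \<in> I" using v(2) fv csI by simp
    then show ?thesis using v(1) unfolding F_gpart by blast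
  qed
  moreover have "\<forall>i<d. v i = 0" if v: "\<forall>i<d. v i \<in> ?R" "(\<Sum>i<d. v i * b i) \<in> I" for v
  proof -
    let ?v = "\<lambda>i. if i < d then v i else 0"
    have vF: "?v \<in> carrier ?F" using v(1) by (auto simp: F_carrier free_vectors_def)
    have "(\<Sum>i<d. ?v i * b i) = (\<Sum>i<d. v i * b i)" by (rule sum.cong) auto
    then have "f ?v = f (\<lambda>_. 0)" using fv[OF vF] v(2) f0 csI[of "\<Sum>i<d. v i * b i" 0] by simp
    then have "?v = (\<lambda>_. 0)" using bij_betw_imp_inj_on[OF f(2)] vF zF by (auto dest: inj_onD)
    note e = fun_cong[OF this]
    show ?thesis
    proof (intro allI impI)
      fix i assume "i < d"
      then show "v i = 0" using e[of i] by simp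
    qed
  qed
  moreover have "\<forall>i<d. b i \<in> homog (int (m i))" using b by auto
  ultimately show ?thesis using Y by blast
qed

lemma Const_sum: "Const (sum f T) = (\<Sum>i\<in>T. Const (f i))"
  by (induction T rule: infinite_finite_induct) (simp_all add: Const_add)

lemma poly_degree_le_1: "Polynomial.degree (q :: rat poly) \<le> 1 \<Longrightarrow> poly q x = Polynomial.coeff q 0 + Polynomial.coeff q 1 * x"
proof -
  assume "Polynomial.degree q \<le> 1"
  then have "poly q x = (\<Sum>i\<le>1. Polynomial.coeff q i * x ^ i)"
    unfolding poly_altdef by (intro sum.mono_neutral_left) (auto simp: coeff_eq_0)
  then show ?thesis by simp
qed

text \<open>The coordinate ring is graded free over the subring \<open>R\<close> with basis
  \<open>b i\<close> in degrees \<open>m i\<close>. The hypothesis \<open>deg\<close> enters to show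
  that \<open>Y0\<close> and \<open>Y1\<close> are linearly independent, so that \<open>R\<close> is
  a polynomial ring in two variables.\<close>

locale free_curve =
  fixes I :: "('n::{finite, linorder}, 'k::field) mpoly set" and Y0 Y1 :: "('n, 'k) mpoly"
    and b :: "nat \<Rightarrow> ('n, 'k) mpoly" and d :: nat and m :: "nat \<Rightarrow> nat"
  assumes I: "hideal I" and one: "1 \<notin> I" and Y0: "Y0 \<in> homog 1" and Y1: "Y1 \<in> homog 1"
    and cover: "\<And>P. P \<in> Proj I \<Longrightarrow> Y0 \<notin> P \<or> Y1 \<notin> P"
    and b: "\<And>i. i < d \<Longrightarrow> b i \<in> homog (int (m i))"
    and spans: "\<And>l p. p \<in> homog l \<Longrightarrow> \<exists>v. (\<forall>i<d. v i \<in> subalgebra_gen {Y0, Y1} \<inter> homog (l - int (m i))) \<and>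
      p - (\<Sum>i<d. v i * b i) \<in> I"
    and indep: "\<And>v i. (\<And>i. i < d \<Longrightarrow> v i \<in> subalgebra_gen {Y0, Y1}) \<Longrightarrow> (\<Sum>i<d. v i * b i) \<in> I \<Longrightarrow> i < d \<Longrightarrow> v i = 0"
    and m_mono: "\<And>i j. i \<le> j \<Longrightarrow> j < d \<Longrightarrow> m i \<le> m j"
    and deg: "has_degree I 1 d"
begin

abbreviation R :: "('n, 'k) mpoly set" where "R \<equiv> subalgebra_gen {Y0, Y1}"

lemma Is: "idl.subspace I"
  using I by (rule hideal_subspace)

lemma d_pos: "d > 0"
proof (rule ccontr)
  assume "\<not> d > 0"
  then show False using spans[OF homog_1] one by auto
qed

lemma R_form:
  assumes "p \<in> R" "p \<in> homog (int l)"
  shows "\<exists>c. p = (\<Sum>i\<le>l. Const (c i) * (Y0 ^ i * Y1 ^ (l - i)))"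
proof -
  let ?G = "{Y0 ^ i * Y1 ^ j | i j. True}"
  have mult: "p * q \<in> kv.span ?G" if "p \<in> kv.span ?G" "q \<in> kv.span ?G" for p q
    using that(1)
  proof (induction rule: kv.span_induct_alt)
    case (step c x y)
    then obtain i j where x: "x = Y0 ^ i * Y1 ^ j" by blast
    have "x * q \<in> kv.span ?G"
      using that(2)
    proof (induction rule: kv.span_induct_alt)
      case base
      have "0 \<in> kv.span ?G" by (rule kv.span_zero)
      then show ?case by simp
    next
      case (step c' x' y')
      then obtain i' j' where x': "x' = Y0 ^ i' * Y1 ^ j'" by blast
      have "x * x' = Y0 ^ (i + i') * Y1 ^ (j + j')" by (simp add: x x' power_add mult_ac)
      then have "x * x' \<in> kv.span ?G" by (intro kv.span_base) blast
      then have "Const c' * (x * x') + x * y' \<in> kv.span ?G" using step by (intro kv.span_add kv.span_scale)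
      then show ?case by (simp add: distrib_left mult.left_commute)
    qed
    then have "Const c * (x * q) + y * q \<in> kv.span ?G" using step by (intro kv.span_add kv.span_scale)
    then show ?case by (simp add: distrib_right mult.assoc)
  next
    case base
    have "0 \<in> kv.span ?G" by (rule kv.span_zero)
    then show ?case by simp
  qed
  have pG: "p \<in> kv.span ?G"
    using assms(1)
  proof induction
    case (1 c)
    have "Y0 ^ 0 * Y1 ^ 0 \<in> kv.span ?G" by (intro kv.span_base) blast
    then have "Const c * 1 \<in> kv.span ?G" using kv.span_scale by fastforce
    then show ?case by simp
  next
    case (2 p)
    then have "p = Y0 ^ 1 * Y1 ^ 0 \<or> p = Y0 ^ 0 * Y1 ^ 1" by auto
    then show ?case by (intro kv.span_base) blast
  next
    case (3 p q)
    then show ?case by (intro kv.span_add)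
  next
    case (4 p q)
    then show ?case by (intro mult)
  qed
  define V where "V = {p. \<exists>c. p = (\<Sum>i\<le>l. Const (c i) * (Y0 ^ i * Y1 ^ (l - i)))}"
  have "hc (int l) p \<in> V"
    using pG
  proof (induction rule: kv.span_induct_alt)
    case base
    have "0 = (\<Sum>i\<le>l. Const ((\<lambda>_. 0) i) * (Y0 ^ i * Y1 ^ (l - i)))" by simp
    then show ?case unfolding V_def hc_0 by (intro CollectI exI[of _ "\<lambda>_. 0"])
  next
    case (step c x y)
    then obtain i j where x: "x = Y0 ^ i * Y1 ^ j" by blast
    have xh: "x \<in> homog (int (i + j))"
      unfolding x using homog_mult[OF homog_power[OF Y0, of i] homog_power[OF Y1, of j]] by simp
    obtain e where e: "hc (int l) y = (\<Sum>i\<le>l. Const (e i) * (Y0 ^ i * Y1 ^ (l - i)))" using step by (auto simp: V_def)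
    show ?case
    proof (cases "i + j = l")
      case True
      have h: "hc (int l) (Const c * x + y) = Const c * x + hc (int l) y"
        using xh True by (simp add: hc_add hc_Const_mult hc_id)
      have cx: "Const c * x = (\<Sum>k\<le>l. Const (if k = i then c else 0) * (Y0 ^ k * Y1 ^ (l - k)))"
      proof -
        have "(\<Sum>k\<le>l. Const (if k = i then c else 0) * (Y0 ^ k * Y1 ^ (l - k))) = (\<Sum>k\<le>l. if k = i then Const c * x else 0)"
          using True by (intro sum.cong) (auto simp: x)
        then show ?thesis using True by simp
      qed
      have "hc (int l) (Const c * x + y) = (\<Sum>k\<le>l. Const ((if k = i then c else 0) + e k) * (Y0 ^ k * Y1 ^ (l - k)))"
        by (subst h, subst cx, subst e) (simp only: Const_add distrib_right sum.distrib)
      then show ?thesis unfolding V_def by (intro CollectI exI[of _ "\<lambda>k. (if k = i then c else 0) + e k"])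
    next
      case False
      then have "hc (int l) (Const c * x + y) = hc (int l) y"
        using hc_other[OF xh, of "int l"] by (simp add: hc_add hc_Const_mult)
      then show ?thesis using step by simp
    qed
  qed
  then show ?thesis using hc_id[OF assms(2)] by (simp add: V_def)
qed

text \<open>If \<open>Y0\<close> and \<open>Y1\<close> were multiples of one form \<open>Z\<close>,
  every graded piece of \<open>R\<close> would be spanned by a power of \<open>Z\<close>, and the
  Hilbert function of \<open>I\<close> would be at most \<open>d\<close>. But its Hilbert polynomial
  has degree one with leading coefficient \<open>d > 0\<close>.\<close>

lemma Y_indep: assumes ab: "Const x * Y0 + Const y * Y1 = 0" shows "x = 0 \<and> y = 0"
proof (rule ccontr)
  assume n: "\<not> (x = 0 \<and> y = 0)"
  have "\<exists>Z. \<exists>a c. Y0 = Const a * Z \<and> Y1 = Const c * Z"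
  proof (cases "x = 0")
    case True
    then have "Const (1 / y) * (Const x * Y0 + Const y * Y1) = Y1" using n
      by (simp add: mult.assoc[symmetric] Const_mult[symmetric])
    then have "Y1 = Const 0 * Y0" using ab by simp
    then show ?thesis by (intro exI[of _ Y0] exI[of _ 1] exI[of _ 0]) simp
  next
    case False
    then have "Const (1 / x) * (Const x * Y0 + Const y * Y1) = Y0 + Const (y / x) * Y1"
      by (simp add: distrib_left mult.assoc[symmetric] Const_mult[symmetric])
    then have "Y0 = Const (- (y / x)) * Y1" using ab by (simp add: Const_uminus eq_neg_iff_add_eq_0)
    then show ?thesis by (intro exI[of _ Y1] exI[of _ "- (y / x)"] exI[of _ 1]) simp
  qed
  then obtain Z a c where Z: "Y0 = Const a * Z" "Y1 = Const c * Z" by blast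
  have cp: "Const e ^ k = Const (e ^ k)" for e :: 'k and k by (induction k) (simp_all add: Const_mult)
  have RZ: "\<exists>e. p = Const e * Z ^ l" if p: "p \<in> R" "p \<in> homog (int l)" for p l
  proof -
    obtain e where "p = (\<Sum>i\<le>l. Const (e i) * (Y0 ^ i * Y1 ^ (l - i)))" using R_form[OF p] by blast
    also have "\<dots> = (\<Sum>i\<le>l. Const (e i * (a ^ i * c ^ (l - i))) * Z ^ l)"
    proof (rule sum.cong)
      fix i assume "i \<in> {..l}"
      then have "Z ^ l = Z ^ i * Z ^ (l - i)" by (simp add: power_add[symmetric])
      then show "Const (e i) * (Y0 ^ i * Y1 ^ (l - i)) = Const (e i * (a ^ i * c ^ (l - i))) * Z ^ l"
        by (simp add: Z power_mult_distrib cp Const_mult mult_ac)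
    qed simp
    also have "\<dots> = (\<Sum>i\<le>l. Const (e i * (a ^ i * c ^ (l - i)))) * Z ^ l" by (simp add: sum_distrib_right)
    also have "(\<Sum>i\<le>l. Const (e i * (a ^ i * c ^ (l - i)))) = Const (\<Sum>i\<le>l. e i * (a ^ i * c ^ (l - i)))"
      by (rule Const_sum[symmetric])
    finally show ?thesis by blast
  qed
  have bound: "hilbert_fun I (int l) \<le> d" for l
  proof -
    define g where "g i = hc (int l) (Z ^ (l - m i) * b i)" for i
    have "kv.spans_mod (homog (int l)) (I \<inter> homog (int l)) {..<d} g"
      unfolding kv.spans_mod_def
    proof (intro conjI ballI)
      show "g i \<in> homog (int l)" for i by (simp add: g_def hc_homog)
      fix p :: "('n, 'k) mpoly" assume p: "p \<in> homog (int l)"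
      then obtain v where v: "\<And>i. i < d \<Longrightarrow> v i \<in> R \<inter> homog (int l - int (m i))" "p - (\<Sum>i<d. v i * b i) \<in> I"
        using spans by blast
      have "\<forall>i\<in>{..<d}. \<exists>e. hc (int l) (v i * b i) = Const e * g i"
      proof
        fix i assume i: "i \<in> {..<d}"
        show "\<exists>e. hc (int l) (v i * b i) = Const e * g i"
        proof (cases "m i \<le> l")
          case True
          then have "v i \<in> homog (int (l - m i))" using v(1)[of i] i by (simp add: of_nat_diff)
          then obtain e where "v i = Const e * Z ^ (l - m i)" using RZ[of "v i" "l - m i"] v(1)[of i] i by auto
          then have "hc (int l) (v i * b i) = Const e * g i" by (simp add: g_def hc_Const_mult[symmetric] mult.assoc)
          then show ?thesis ..
        next
          case False
          then have "v i = 0" using v(1)[of i] i homog_neg[of "int l - int (m i)" "v i"] by auto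
          then show ?thesis by (intro exI[of _ 0]) simp
        qed
      qed
      from bchoice[OF this] obtain e where e: "\<forall>i\<in>{..<d}. hc (int l) (v i * b i) = Const (e i) * g i" ..
      have "hc (int l) (p - (\<Sum>i<d. v i * b i)) \<in> I" by (rule hideal_hc[OF I v(2)])
      also have "hc (int l) (p - (\<Sum>i<d. v i * b i)) = p - (\<Sum>i<d. Const (e i) * g i)"
        using e p by (simp add: hc_diff hc_sum hc_id)
      finally have "p - (\<Sum>i<d. Const (e i) * g i) \<in> I \<inter> homog (int l)"
        using p by (auto intro!: homog_diff homog_sum homog_Const_mult simp: g_def hc_homog)
      then show "\<exists>c. p - (\<Sum>i<d. Const (c i) * g i) \<in> I \<inter> homog (int l)" by (rule exI[of _ e])
    qed simp
    moreover obtain h where h: "kv.qbasis (homog (int l)) (I \<inter> homog (int l)) {..<hilbert_fun I (int l)} h"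
      using qdim_hilbert_fun[OF Is] unfolding kv.qdim_def by blast
    moreover have "kv.subspace (I \<inter> homog (int l))"
      by (intro kv.subspace_inter ideal_kv_subspace Is subspace_homog)
    ultimately have "card {..<hilbert_fun I (int l)} \<le> card {..<d}"
      by (intro kv.indep_mod_card_le[of "I \<inter> homog (int l)" _ h "homog (int l)" _ g])
        (auto simp: kv.qbasis_def kv.spans_mod_def)
    then show ?thesis by simp
  qed
  from deg obtain q l0 where q: "Polynomial.degree q \<le> 1" "\<And>l. l \<ge> l0 \<Longrightarrow> of_nat (hilbert_fun I (int l)) = poly q (of_nat l)"
    "of_nat d = (Polynomial.coeff q 1 :: rat)" unfolding has_degree_def by auto
  obtain N0 :: nat where N0: "\<bar>Polynomial.coeff q 0\<bar> \<le> of_nat N0"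
    using of_nat_ceiling by blast
  \<comment> \<open>Large enough for the Hilbert polynomial to apply and to exceed \<open>d\<close>,
    whatever its constant term.\<close>
  define l where "l = l0 + N0 + d + 1"
  have "of_nat (hilbert_fun I (int l)) = Polynomial.coeff q 0 + of_nat d * of_nat l"
    using q(2)[of l] poly_degree_le_1[OF q(1)] q(3) by (simp add: l_def)
  moreover have "Polynomial.coeff q 0 + of_nat d * of_nat l > of_nat d"
  proof -
    have "of_nat l \<le> of_nat d * (of_nat l :: rat)" using d_pos by (simp add: mult_le_cancel_right1)
    moreover have "of_nat l \<ge> \<bar>Polynomial.coeff q 0\<bar> + of_nat d + 1" using N0 by (simp add: l_def)
    ultimately show ?thesis by linarith
  qed
  ultimately have "of_nat (hilbert_fun I (int l)) > (of_nat d :: rat)" by simp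
  then show False using bound[of l] by simp
qed

lemma linear_form: assumes "p \<in> homog 1" shows "\<exists>a. p = (\<Sum>i\<in>UNIV. Const (a i) * Var i)"
proof -
  have "p \<in> homog (int (Suc 0))" using assms by simp
  from homog_Var_sum[OF this] obtain q where q: "\<forall>i. q i \<in> homog (int 0)" "p = (\<Sum>i\<in>UNIV. Var i * q i)" by blast
  have "\<forall>i. \<exists>c. q i = Const c" by (intro allI homog_0_Const) (use q(1) in simp)
  from choice[OF this] obtain a where a: "\<forall>i. q i = Const (a i)" ..
  have "p = (\<Sum>i\<in>UNIV. Const (a i) * Var i)" using q(2) a by (simp add: mult.commute)
  then show ?thesis by (rule exI[of _ a])
qed

text \<open>Linear independence gives a nonzero two by two minor of the coefficient matrix of
  \<open>Y0\<close> and \<open>Y1\<close>; Cramer's rule for its columns \<open>i0\<close>,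
  \<open>i1\<close> expresses \<open>Var i0\<close> and \<open>Var i1\<close> through
  \<open>Y0\<close>, \<open>Y1\<close> and the other variables.\<close>

lemma coordinates:
  "\<exists>i0 i1. i0 \<noteq> i1 \<and> (\<forall>j. \<exists>c d e. Var j = Const c * Y0 + Const d * Y1 + (\<Sum>i\<in>-{i0,i1}. Const (e i) * Var i))"
proof -
  obtain x where x: "Y0 = (\<Sum>i\<in>UNIV. Const (x i) * Var i)" using linear_form[OF Y0] by blast
  obtain y where y: "Y1 = (\<Sum>i\<in>UNIV. Const (y i) * Var i)" using linear_form[OF Y1] by blast
  have "\<exists>i. x i \<noteq> 0"
  proof (rule ccontr)
    assume "\<not> ?thesis"
    then have "Const 1 * Y0 + Const 0 * Y1 = 0" by (simp add: x)
    then show False using Y_indep by fastforce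
  qed
  then obtain i0 where i0: "x i0 \<noteq> 0" by blast
  have "\<exists>i. x i0 * y i - x i * y i0 \<noteq> 0"
  proof (rule ccontr)
    assume n: "\<not> ?thesis"
    have "Const (- y i0) * Y0 + Const (x i0) * Y1 = (\<Sum>i\<in>UNIV. Const (- y i0 * x i + x i0 * y i) * Var i)"
      unfolding x y by (simp only: sum_distrib_left sum.distrib Const_add Const_mult distrib_right mult.assoc)
    also have "\<dots> = (\<Sum>i\<in>UNIV. Const 0 * Var i)"
    proof (rule sum.cong)
      fix i
      have "- y i0 * x i + x i0 * y i = 0" using n by (simp add: mult.commute)
      then show "Const (- y i0 * x i + x i0 * y i) * Var i = Const 0 * (Var i :: ('n, 'k) mpoly)" by (simp only:)
    qed simp
    also have "\<dots> = 0" by simp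
    finally show False using Y_indep i0 by blast
  qed
  then obtain i1 where i1: "x i0 * y i1 - x i1 * y i0 \<noteq> 0" by blast
  have ne: "i0 \<noteq> i1" using i1 by auto
  define D where "D = x i0 * y i1 - x i1 * y i0"
  let ?S = "- {i0, i1}"
  have split: "(\<Sum>i\<in>UNIV. h i) = h i0 + h i1 + (\<Sum>i\<in>?S. h i)" for h :: "'n \<Rightarrow> ('n, 'k) mpoly"
  proof -
    have "(\<Sum>i\<in>UNIV. h i) = (\<Sum>i\<in>{i0,i1}. h i) + (\<Sum>i\<in>?S. h i)"
      by (subst sum.union_disjoint[symmetric]) (auto intro!: sum.cong)
    then show ?thesis using ne by simp
  qed
  have comb: "Const s * Y0 + Const t * Y1 = Const (s * x i0 + t * y i0) * Var i0 + Const (s * x i1 + t * y i1) * Var i1 +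
     (\<Sum>i\<in>?S. Const (s * x i + t * y i) * Var i)" for s t
    unfolding x y split by (simp only: sum_distrib_left sum.distrib Const_add Const_mult distrib_left distrib_right mult.assoc ac_simps)
  have neg: "- (\<Sum>i\<in>?S. Const (h i) * Var i) = (\<Sum>i\<in>?S. Const (- h i) * (Var i :: ('n, 'k) mpoly))" for h :: "'n \<Rightarrow> 'k"
    by (simp add: Const_uminus sum_negf)
  have "\<exists>c d e. Var j = Const c * Y0 + Const d * Y1 + (\<Sum>i\<in>?S. Const (e i) * Var i)" for j
  proof -
    consider "j = i0" | "j = i1" | "j \<in> ?S" by auto
    then show ?thesis
    proof cases
      case 1
      have "y i1 / D * x i0 + (- x i1 / D) * y i0 = 1" "y i1 / D * x i1 + (- x i1 / D) * y i1 = 0"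
      proof -
        have "y i1 / D * x i0 + (- x i1 / D) * y i0 = (x i0 * y i1 - x i1 * y i0) / D"
          by (simp add: diff_divide_distrib mult.commute)
        then show "y i1 / D * x i0 + (- x i1 / D) * y i0 = 1" using i1 unfolding D_def by simp
      qed (simp add: mult.commute)
      then have "Const (y i1 / D) * Y0 + Const (- x i1 / D) * Y1 = Var i0 +
          (\<Sum>i\<in>?S. Const (y i1 / D * x i + (- x i1 / D) * y i) * Var i)"
        by (simp only: comb Const_1 Const_0 mult_1_left mult_zero_left add_0_right)
      then have "Var j = Const (y i1 / D) * Y0 + Const (- x i1 / D) * Y1 +
          (\<Sum>i\<in>?S. Const (- (y i1 / D * x i + (- x i1 / D) * y i)) * Var i)"
        unfolding neg[symmetric] 1 by simp
      then show ?thesis by (rule exI[of _ "y i1 / D", OF exI[of _ "- x i1 / D", OF exI[of _ "\<lambda>i. - (y i1 / D * x i + (- x i1 / D) * y i)"]]])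
    next
      case 2
      have "(- y i0 / D) * x i0 + (x i0 / D) * y i0 = 0" "(- y i0 / D) * x i1 + (x i0 / D) * y i1 = 1"
      proof -
        have "(- y i0 / D) * x i1 + (x i0 / D) * y i1 = (x i0 * y i1 - x i1 * y i0) / D"
          by (simp add: diff_divide_distrib mult.commute)
        then show "(- y i0 / D) * x i1 + (x i0 / D) * y i1 = 1" using i1 unfolding D_def by simp
      qed (simp add: mult.commute)
      then have "Const (- y i0 / D) * Y0 + Const (x i0 / D) * Y1 = Var i1 +
          (\<Sum>i\<in>?S. Const ((- y i0 / D) * x i + (x i0 / D) * y i) * Var i)"
        by (simp only: comb Const_1 Const_0 mult_1_left mult_zero_left add_0_left)
      then have "Var j = Const (- y i0 / D) * Y0 + Const (x i0 / D) * Y1 +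
          (\<Sum>i\<in>?S. Const (- ((- y i0 / D) * x i + (x i0 / D) * y i)) * Var i)"
        unfolding neg[symmetric] 2 by simp
      then show ?thesis by (rule exI[of _ "- y i0 / D", OF exI[of _ "x i0 / D", OF exI[of _ "\<lambda>i. - ((- y i0 / D) * x i + (x i0 / D) * y i)"]]])
    next
      case 3
      have "(\<Sum>i\<in>?S. Const (if i = j then 1 else 0) * Var i) = (\<Sum>i\<in>?S. if i = j then Var j else (0 :: ('n, 'k) mpoly))"
        by (rule sum.cong) auto
      then have "Var j = Const 0 * Y0 + Const 0 * Y1 + (\<Sum>i\<in>?S. Const (if i = j then 1 else 0) * Var i)"
        using 3 by simp
      then show ?thesis by (rule exI[of _ 0, OF exI[of _ 0, OF exI[of _ "\<lambda>i. if i = j then 1 else 0"]]])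
    qed
  qed
  then show ?thesis using ne by blast
qed

text \<open>Above degree \<open>m (d - 1)\<close> every coordinate over \<open>R\<close> has
  positive degree, hence lies in the ideal of \<open>Y0\<close> and \<open>Y1\<close>.\<close>

lemma Y_spans:
  assumes p: "p \<in> homog l" and l: "l > int (m (d - 1))"
  shows "\<exists>x\<in>homog (l - 1). \<exists>y\<in>homog (l - 1). p - Y0 * x - Y1 * y \<in> I"
proof -
  obtain v where v: "\<And>i. i < d \<Longrightarrow> v i \<in> R \<inter> homog (l - int (m i))" "p - (\<Sum>i<d. v i * b i) \<in> I"
    using spans[OF p] by blast
  have "\<forall>i\<in>{..<d}. \<exists>xy. fst xy \<in> homog (l - int (m i) - 1) \<and> snd xy \<in> homog (l - int (m i) - 1) \<and> v i = Y0 * fst xy + Y1 * snd xy"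
  proof
    fix i assume i: "i \<in> {..<d}"
    have "m i \<le> m (d - 1)" using i by (intro m_mono) auto
    define k where "k = nat (l - int (m i)) - 1"
    have k: "l - int (m i) = int (Suc k)" using l \<open>m i \<le> m (d - 1)\<close> by (simp add: k_def)
    obtain c where c: "v i = (\<Sum>j\<le>Suc k. Const (c j) * (Y0 ^ j * Y1 ^ (Suc k - j)))"
      using R_form[of "v i" "Suc k"] v(1)[of i] i k by auto
    let ?x = "\<Sum>j\<le>k. Const (c (Suc j)) * (Y0 ^ j * Y1 ^ (k - j))"
    let ?y = "Const (c 0) * Y1 ^ k"
    have "v i = Const (c 0) * Y1 ^ Suc k + (\<Sum>j\<le>k. Const (c (Suc j)) * (Y0 ^ Suc j * Y1 ^ (k - j)))"
      unfolding c sum.atMost_Suc_shift by simp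
    then have "v i = Y0 * ?x + Y1 * ?y" by (simp add: sum_distrib_left mult_ac)
    moreover have "?x \<in> homog (int k)"
    proof (intro homog_sum homog_Const_mult)
      fix j assume "j \<in> {..k}"
      then show "Y0 ^ j * Y1 ^ (k - j) \<in> homog (int k)"
        using homog_mult[OF homog_power[OF Y0, of j] homog_power[OF Y1, of "k - j"]] by simp
    qed
    moreover have "?y \<in> homog (int k)" using homog_power[OF Y1, of k] by (intro homog_Const_mult) simp
    ultimately show "\<exists>xy. fst xy \<in> homog (l - int (m i) - 1) \<and> snd xy \<in> homog (l - int (m i) - 1) \<and> v i = Y0 * fst xy + Y1 * snd xy"
      using k by (intro exI[of _ "(?x, ?y)"]) simp
  qed
  from bchoice[OF this] obtain w where w: "\<forall>i\<in>{..<d}. fst (w i) \<in> homog (l - int (m i) - 1) \<and> snd (w i) \<in> homog (l - int (m i) - 1) \<and> v i = Y0 * fst (w i) + Y1 * snd (w i)" ..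
  have "(\<Sum>i<d. v i * b i) = Y0 * (\<Sum>i<d. fst (w i) * b i) + Y1 * (\<Sum>i<d. snd (w i) * b i)"
  proof -
    have "(\<Sum>i<d. v i * b i) = (\<Sum>i<d. Y0 * (fst (w i) * b i) + Y1 * (snd (w i) * b i))"
    proof (rule sum.cong)
      fix i assume "i \<in> {..<d}"
      then have "v i = Y0 * fst (w i) + Y1 * snd (w i)" using w by blast
      then show "v i * b i = Y0 * (fst (w i) * b i) + Y1 * (snd (w i) * b i)"
        by (simp only: distrib_right mult.assoc)
    qed simp
    then show ?thesis by (simp only: sum.distrib sum_distrib_left)
  qed
  moreover have "(\<Sum>i<d. fst (w i) * b i) \<in> homog (l - 1)" "(\<Sum>i<d. snd (w i) * b i) \<in> homog (l - 1)"
    using w b by (auto intro!: homog_sum homog_mult')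
  moreover have "p - Y0 * (\<Sum>i<d. fst (w i) * b i) - Y1 * (\<Sum>i<d. snd (w i) * b i) \<in> I"
    using v(2) calculation(1) by (simp add: algebra_simps)
  ultimately show ?thesis by blast
qed

text \<open>The coordinate ring is free over the domain \<open>R\<close>. Coordinates are available
  for forms only, so the general case goes through homogeneous components.\<close>

lemma R_regular:
  assumes u: "u \<in> R" "u \<in> homog k" "u \<noteq> 0" and p: "u * p \<in> I" shows "p \<in> I"
proof -
  have hom: "p \<in> I" if p: "p \<in> homog l" "u * p \<in> I" for p l
  proof -
    obtain v where v: "\<And>i. i < d \<Longrightarrow> v i \<in> R \<inter> homog (l - int (m i))" "p - (\<Sum>i<d. v i * b i) \<in> I"
      using spans[OF p(1)] by blast
    have "u * p - u * (p - (\<Sum>i<d. v i * b i)) \<in> I"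
      by (intro idl.subspace_diff[OF Is] idl.subspace_scale[OF Is] p v)
    then have s: "(\<Sum>i<d. (u * v i) * b i) \<in> I" by (simp add: right_diff_distrib sum_distrib_left mult.assoc)
    have "u * v i = 0" if "i < d" for i
      by (rule indep[OF _ s that]) (use v(1) u(1) in \<open>auto intro: subalgebra_gen.intros\<close>)
    then have "v i = 0" if "i < d" for i using u(3) that by auto
    then show ?thesis using v(2) by simp
  qed
  have "hc l p \<in> I" for l
  proof (rule hom[OF hc_homog])
    show "u * hc l p \<in> I" using hideal_hc[OF I p, of "l + k"] hc_mult[OF u(2), of "l + k" p] by simp
  qed
  then show ?thesis using hideal_mem_iff[OF I] by blast
qed

lemma Y_nonzero: "Y0 \<noteq> 0" "Y1 \<noteq> 0"
  using Y_indep[of 1 0] Y_indep[of 0 1] by auto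

lemma Y_in_R: "Y0 \<in> R" "Y1 \<in> R"
  by (auto intro: subalgebra_gen.intros)

lemma R_one: "1 \<in> R"
  using subalgebra_gen.intros(1)[of 1 "{Y0, Y1}"] by simp

lemma R_power: "p \<in> R \<Longrightarrow> p ^ n \<in> R"
  by (induction n) (auto intro: subalgebra_gen.intros R_one)

lemma R_diff: "p \<in> R \<Longrightarrow> q \<in> R \<Longrightarrow> p - q \<in> R"
proof -
  assume "p \<in> R" "q \<in> R"
  then have "p + Const (-1) * q \<in> R" by (intro subalgebra_gen.intros(1,3,4))
  then show ?thesis by (simp add: Const_uminus)
qed

lemma Y_power_regular: "Y0 ^ N * p \<in> I \<Longrightarrow> p \<in> I" "Y1 ^ N * p \<in> I \<Longrightarrow> p \<in> I"
proof -
  assume "Y0 ^ N * p \<in> I"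
  then show "p \<in> I"
    using R_regular[OF R_power[OF Y_in_R(1), of N] homog_power[OF Y0, of N]] Y_nonzero(1) by simp
next
  assume "Y1 ^ N * p \<in> I"
  then show "p \<in> I"
    using R_regular[OF R_power[OF Y_in_R(2), of N] homog_power[OF Y1, of N]] Y_nonzero(2) by simp
qed

text \<open>The case \<open>M = 1\<close> of a monic family makes \<open>Y0\<close>,
  \<open>Y1\<close> part of a coordinate system, which yields the facts about them in the polynomial
  ring itself.\<close>

lemma linear_family: "\<exists>i0 i1. monic_family i0 i1 1 (\<lambda>i. if i = i0 then Y0 else if i = i1 then Y1 else Var i)"
proof -
  obtain i0 i1 where i: "i0 \<noteq> i1" "\<And>j. \<exists>c d e. Var j = Const c * Y0 + Const d * Y1 + (\<Sum>i\<in>-{i0,i1}. Const (e i) * Var i)"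
    using coordinates by blast
  have "monic_family i0 i1 1 (\<lambda>i. if i = i0 then Y0 else if i = i1 then Y1 else Var i)"
  proof
    show "\<exists>c d e. Var j = Const c * (if i0 = i0 then Y0 else if i0 = i1 then Y1 else Var i0) +
        Const d * (if i1 = i0 then Y0 else if i1 = i1 then Y1 else Var i1) + (\<Sum>i\<in>-{i0,i1}. Const (e i) * Var i)" for j
      using i(2)[of j] i(1) by simp
  qed (use i(1) Y0 Y1 in \<open>auto intro!: bexI[of _ 0]\<close>)
  then show ?thesis by blast
qed

lemma Y_division_poly:
  assumes "Y1 ^ a * v = Y0 ^ c * w" shows "\<exists>z. v = Y0 ^ c * z"
proof -
  obtain i0 i1 where "monic_family i0 i1 1 (\<lambda>i. if i = i0 then Y0 else if i = i1 then Y1 else Var i)"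
    using linear_family by blast
  then interpret L: monic_family i0 i1 1 "\<lambda>i. if i = i0 then Y0 else if i = i1 then Y1 else Var i" .
  have P: "L.pideal {i0} (\<lambda>_. c) = range (\<lambda>k. k * Y0 ^ c)"
    by (simp add: L.pideal_def idl.span_singleton)
  have f1: "(if i1 = i0 then Y0 else if i1 = i1 then Y1 else Var i1) = Y1" using L.i01 by simp
  have "Y1 ^ a * v \<in> L.pideal {i0} (\<lambda>_. c)"
    unfolding P by (rule image_eqI[of _ _ w], subst mult.commute[of w], rule assms, rule UNIV_I)
  then have "v \<in> L.pideal {i0} (\<lambda>_. c)"
    using L.pideal_regular[of i1 "{i0}" a v "\<lambda>_. c"] L.i01 unfolding f1 by simp
  then obtain z where "v = z * Y0 ^ c" unfolding P by (rule imageE)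
  then have "v = Y0 ^ c * z" by (simp only: mult.commute)
  then show ?thesis by (rule exI)
qed

text \<open>Written in the basis, the relation holds exactly and not only modulo \<open>I\<close>,
  by independence, and \<open>Y_division_poly\<close> applies to each coordinate. This regularity of
  \<open>Y1\<close> modulo \<open>Y0 ^ c\<close> on the coordinate ring is its depth two property;
  it later glues data from the two charts.\<close>

lemma Y_division:
  assumes p: "p \<in> homog l" and q: "q \<in> homog k" and e: "Y1 ^ a * p - Y0 ^ c * q \<in> I"
  shows "\<exists>z\<in>homog (l - int c). p - Y0 ^ c * z \<in> I"
proof -
  obtain v where v: "\<And>i. i < d \<Longrightarrow> v i \<in> R \<inter> homog (l - int (m i))" "p - (\<Sum>i<d. v i * b i) \<in> I"
    using spans[OF p] by blast
  obtain w where w: "\<And>i. i < d \<Longrightarrow> w i \<in> R \<inter> homog (k - int (m i))" "q - (\<Sum>i<d. w i * b i) \<in> I"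
    using spans[OF q] by blast
  have "(Y1 ^ a * p - Y0 ^ c * q) - Y1 ^ a * (p - (\<Sum>i<d. v i * b i)) + Y0 ^ c * (q - (\<Sum>i<d. w i * b i)) \<in> I"
    by (intro idl.subspace_add[OF Is] idl.subspace_diff[OF Is] idl.subspace_scale[OF Is] e v w)
  also have "(Y1 ^ a * p - Y0 ^ c * q) - Y1 ^ a * (p - (\<Sum>i<d. v i * b i)) + Y0 ^ c * (q - (\<Sum>i<d. w i * b i))
    = (\<Sum>i<d. (Y1 ^ a * v i - Y0 ^ c * w i) * b i)"
    by (simp add: left_diff_distrib right_diff_distrib sum_distrib_left sum_subtractf mult.assoc)
  finally have s: "(\<Sum>i<d. (Y1 ^ a * v i - Y0 ^ c * w i) * b i) \<in> I" .
  have e: "Y1 ^ a * v i - Y0 ^ c * w i = 0" if "i < d" for i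
    by (rule indep[OF _ s that])
      (use v(1) w(1) in \<open>auto intro!: R_diff subalgebra_gen.intros(4) R_power Y_in_R\<close>)
  have "\<forall>i\<in>{..<d}. \<exists>z. v i = Y0 ^ c * z"
  proof (intro ballI)
    fix i assume i: "i \<in> {..<d}"
    have "Y1 ^ a * v i = Y0 ^ c * w i" using e[of i] i by (simp only: lessThan_iff right_minus_eq)
    then show "\<exists>z. v i = Y0 ^ c * z" by (rule Y_division_poly)
  qed
  from bchoice[OF this] obtain z where z: "\<forall>i\<in>{..<d}. v i = Y0 ^ c * z i" ..
  have "p - Y0 ^ c * (\<Sum>i<d. z i * b i) \<in> I"
    using v(2) z by (simp add: sum_distrib_left mult.assoc)
  from hideal_hc[OF I this, of l]
  have "p - Y0 ^ c * hc (l - int c) (\<Sum>i<d. z i * b i) \<in> I"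
    using p homog_power[OF Y0, of c] by (simp add: hc_diff hc_id hc_mult)
  then show ?thesis using hc_homog by blast
qed

lemma Y_monomials_indep:
  assumes s: "(\<Sum>i\<le>l. Const (c i) * (Y0 ^ i * Y1 ^ (l - i))) = 0" and i: "i \<le> l" shows "c i = 0"
proof -
  obtain i0 i1 where "monic_family i0 i1 1 (\<lambda>i. if i = i0 then Y0 else if i = i1 then Y1 else Var i)"
    using linear_family by blast
  then interpret L: monic_family i0 i1 1 "\<lambda>i. if i = i0 then Y0 else if i = i1 then Y1 else Var i" .
  let ?t = "\<lambda>i. Poly_Mapping.single i0 (i * L.D i0) + (Poly_Mapping.single i1 ((l - i) * L.D i1) + 0)"
  have "L.mon 0 = 1" unfolding L.mon_def by simp
  then have mon: "L.mon (?t i) = Y0 ^ i * Y1 ^ (l - i)" for i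
    using L.i01 by (simp only: L.mon_add_single) simp
  have D: "L.D i0 = 1" "L.D i1 = 1" unfolding L.D_def by simp_all
  have "L.Phi (\<Sum>i\<le>l. Const (c i) * Poly_Mapping.single (?t i) 1) = 0"
    using s by (simp only: L.Phi_sum L.Phi_Const_mult L.Phi_monom mon)
  from L.Phi_inj[OF this] have "Poly_Mapping.lookup (\<Sum>j\<le>l. Const (c j) * Poly_Mapping.single (?t j) 1) (?t i) = 0" by simp
  also have "Poly_Mapping.lookup (\<Sum>j\<le>l. Const (c j) * Poly_Mapping.single (?t j) 1) (?t i) = (\<Sum>j\<le>l. if j = i then c i else 0)"
    unfolding lookup_sum
  proof (rule sum.cong)
    fix j
    have "?t j = ?t i \<longleftrightarrow> j = i"
    proof
      assume "?t j = ?t i"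
      then have "Poly_Mapping.lookup (?t j) i0 = Poly_Mapping.lookup (?t i) i0" by simp
      then show "j = i" using L.i01 D by (simp add: lookup_add Poly_Mapping.lookup_single when_def)
    qed simp
    then show "Poly_Mapping.lookup (Const (c j) * Poly_Mapping.single (?t j) 1) (?t i) = (if j = i then c i else 0)"
      by (auto simp: lookup_Const_mult Poly_Mapping.lookup_single when_def)
  qed simp
  finally show ?thesis using i by simp
qed

text \<open>The degree \<open>l\<close> part of \<open>R\<close> has dimension \<open>l + 1\<close>,
  more than the quotient by \<open>J\<close>, so it meets \<open>J\<close>.\<close>

lemma section_exists:
  assumes J: "idl.subspace J" and h: "hilbert_fun J (int l) \<le> l"
  shows "\<exists>u\<in>R \<inter> homog (int l) \<inter> J. u \<noteq> 0"
proof -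
  let ?g = "\<lambda>i. Y0 ^ i * Y1 ^ (l - i)"
  have gh: "?g i \<in> homog (int l)" if "i \<le> l" for i
    using homog_mult[OF homog_power[OF Y0, of i] homog_power[OF Y1, of "l - i"]] that by simp
  obtain e where e: "kv.qbasis (homog (int l)) (J \<inter> homog (int l)) {..<hilbert_fun J (int l)} e"
    using qdim_hilbert_fun[OF J] unfolding kv.qdim_def by blast
  have sub: "kv.subspace (J \<inter> homog (int l))" by (intro kv.subspace_inter ideal_kv_subspace J subspace_homog)
  have "\<not> kv.indep_mod (J \<inter> homog (int l)) {..l} ?g"
  proof
    assume "kv.indep_mod (J \<inter> homog (int l)) {..l} ?g"
    then have "card {..l} \<le> card {..<hilbert_fun J (int l)}"
      using e gh by (intro kv.indep_mod_card_le[OF sub]) (auto simp: kv.qbasis_def)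
    then show False using h by simp
  qed
  then obtain c i where c: "(\<Sum>i\<le>l. Const (c i) * ?g i) \<in> J \<inter> homog (int l)" "i \<le> l" "c i \<noteq> 0"
    unfolding kv.indep_mod_def by auto
  have "(\<Sum>i\<in>T. Const (c i) * ?g i) \<in> R" if "finite T" for T
    using that
  proof (induction T)
    case empty
    then show ?case using subalgebra_gen.intros(1)[of 0 "{Y0, Y1}"] by simp
  next
    case (insert j T)
    have "Const (c j) * ?g j \<in> R" by (intro subalgebra_gen.intros(4) subalgebra_gen.intros(1) R_power Y_in_R)
    then show ?case using insert by (simp add: subalgebra_gen.intros(3))
  qed
  then have "(\<Sum>i\<le>l. Const (c i) * ?g i) \<in> R" by simp
  moreover have "(\<Sum>i\<le>l. Const (c i) * ?g i) \<noteq> 0" using Y_monomials_indep[of c l i] c by auto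
  ultimately show ?thesis using c(1) by blast
qed

text \<open>The monomials of degree \<open>l - m i\<close> in \<open>Y0\<close>, \<open>Y1\<close>,
  multiplied by \<open>b i\<close>, form a basis; the maximum with \<open>0\<close> accounts for the
  \<open>i\<close> with \<open>m i > l\<close>.\<close>

lemma hilbert_fun_eq: "int (hilbert_fun I l) = (\<Sum>i<d. max 0 (l - int (m i) + 1))"
proof -
  define K where "K i = (if int (m i) \<le> l then {..nat (l - int (m i))} else {})" for i
  define k where "k i = nat (l - int (m i))" for i
  let ?T = "Sigma {..<d} K"
  let ?g = "\<lambda>(i, j). Y0 ^ j * Y1 ^ (k i - j) * b i"
  have fK: "finite (K i)" for i by (simp add: K_def)
  have fin: "finite ?T" by (intro finite_SigmaI fK) auto
  have sum: "(\<Sum>t\<in>?T. Const (c t) * ?g t) = (\<Sum>i<d. (\<Sum>j\<in>K i. Const (c (i, j)) * (Y0 ^ j * Y1 ^ (k i - j))) * b i)" for c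
  proof -
    have "(\<Sum>i<d. (\<Sum>j\<in>K i. Const (c (i, j)) * (Y0 ^ j * Y1 ^ (k i - j))) * b i)
      = (\<Sum>i<d. \<Sum>j\<in>K i. Const (c (i, j)) * ?g (i, j))"
      by (simp add: sum_distrib_right mult.assoc)
    also have "\<dots> = (\<Sum>t\<in>?T. Const (c t) * ?g t)"
      by (subst sum.Sigma) (use fK in \<open>auto intro!: sum.cong\<close>)
    finally show ?thesis ..
  qed
  have KR: "(\<Sum>j\<in>K i. Const (c j) * (Y0 ^ j * Y1 ^ (k i - j))) \<in> R" for c i
    using fK[of i]
  proof (induction "K i" rule: finite_induct)
    case empty
    then show ?case using subalgebra_gen.intros(1)[of 0 "{Y0, Y1}"] by simp
  next
    case (insert x F)
    show ?case
    proof -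
      have "finite F \<Longrightarrow> (\<Sum>j\<in>F. Const (c j) * (Y0 ^ j * Y1 ^ (k i - j))) \<in> R" for F
      proof (induction F rule: finite_induct)
        case empty
        then show ?case using subalgebra_gen.intros(1)[of 0 "{Y0, Y1}"] by simp
      next
        case (insert j T)
        have "Const (c j) * (Y0 ^ j * Y1 ^ (k i - j)) \<in> R"
          by (intro subalgebra_gen.intros(4) subalgebra_gen.intros(1) R_power Y_in_R)
        then show ?case using insert by (simp add: subalgebra_gen.intros(3))
      qed
      then show ?thesis using fK by blast
    qed
  qed
  have gh: "?g t \<in> homog l" if "t \<in> ?T" for t
  proof -
    obtain i j where t0: "t = (i, j)" by (cases t)
    then have t: "t = (i, j)" "i < d" "j \<in> K i" using that by auto
    then have j: "int j \<le> l - int (m i)" "int (m i) \<le> l" by (auto simp: K_def split: if_splits)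
    have "Y0 ^ j * Y1 ^ (k i - j) \<in> homog (l - int (m i))"
      using homog_mult[OF homog_power[OF Y0, of j] homog_power[OF Y1, of "k i - j"]] j by (simp add: k_def)
    then show ?thesis using homog_mult[OF _ b[OF t(2)], of "Y0 ^ j * Y1 ^ (k i - j)" "l - int (m i)"] t(1) by simp
  qed
  have "kv.qbasis (homog l) (I \<inter> homog l) ?T ?g"
    unfolding kv.qbasis_def kv.indep_mod_def kv.spans_mod_def
  proof (intro conjI fin ballI allI impI gh)
    fix c t assume c: "(\<Sum>t\<in>?T. Const (c t) * ?g t) \<in> I \<inter> homog l" and t: "t \<in> ?T"
    obtain i j where t0: "t = (i, j)" by (cases t)
    then have ij: "t = (i, j)" "i < d" "j \<in> K i" using t by auto
    have "(\<Sum>i<d. (\<Sum>j\<in>K i. Const (c (i, j)) * (Y0 ^ j * Y1 ^ (k i - j))) * b i) \<in> I" using c by (simp add: sum)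
    from indep[OF KR this ij(2)] have "(\<Sum>j\<in>K i. Const (c (i, j)) * (Y0 ^ j * Y1 ^ (k i - j))) = 0" .
    moreover have "K i = {..k i}" using ij(3) by (auto simp: K_def k_def split: if_splits)
    ultimately show "c t = 0" using Y_monomials_indep[of "\<lambda>j. c (i, j)" "k i" j] ij by simp
  next
    fix p :: "('n, 'k) mpoly" assume p: "p \<in> homog l"
    obtain v where v: "\<And>i. i < d \<Longrightarrow> v i \<in> R \<inter> homog (l - int (m i))" "p - (\<Sum>i<d. v i * b i) \<in> I"
      using spans[OF p] by blast
    have "\<forall>i\<in>{..<d}. \<exists>c. v i = (\<Sum>j\<in>K i. Const (c j) * (Y0 ^ j * Y1 ^ (k i - j)))"
    proof
      fix i assume i: "i \<in> {..<d}"
      show "\<exists>c. v i = (\<Sum>j\<in>K i. Const (c j) * (Y0 ^ j * Y1 ^ (k i - j)))"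
      proof (cases "int (m i) \<le> l")
        case True
        then have "v i \<in> homog (int (k i))" "v i \<in> R" using v(1)[of i] i by (auto simp: k_def)
        from R_form[OF this(2,1)] show ?thesis using True by (simp add: K_def k_def)
      next
        case False
        then have "v i = 0" using v(1)[of i] i homog_neg[of "l - int (m i)" "v i"] by auto
        then show ?thesis using False by (simp add: K_def)
      qed
    qed
    from bchoice[OF this] obtain c where c: "\<forall>i\<in>{..<d}. v i = (\<Sum>j\<in>K i. Const (c i j) * (Y0 ^ j * Y1 ^ (k i - j)))" ..
    have "(\<Sum>t\<in>?T. Const (case t of (i, j) \<Rightarrow> c i j) * ?g t) = (\<Sum>i<d. v i * b i)"
      unfolding sum using c by simp
    moreover have "(\<Sum>t\<in>?T. Const (case t of (i, j) \<Rightarrow> c i j) * ?g t) \<in> homog l"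
      by (intro homog_sum homog_Const_mult gh)
    ultimately have "p - (\<Sum>t\<in>?T. Const (case t of (i, j) \<Rightarrow> c i j) * ?g t) \<in> I \<inter> homog l"
      using v(2) p by (auto intro: homog_diff)
    then show "\<exists>c. p - (\<Sum>t\<in>?T. Const (c t) * ?g t) \<in> I \<inter> homog l"
      by (rule exI[of _ "\<lambda>t. case t of (i, j) \<Rightarrow> c i j"])
  qed
  from kv.qdimI[OF this refl] have "card ?T = hilbert_fun I l"
    using qdim_hilbert_fun[OF Is] kv.qdim_unique kv.subspace_inter[OF ideal_kv_subspace[OF Is] subspace_homog] by blast
  moreover have "card ?T = (\<Sum>i<d. card (K i))" by (rule card_SigmaI) (auto simp: fK)
  moreover have "int (card (K i)) = max 0 (l - int (m i) + 1)" for i by (simp add: K_def)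
  ultimately show ?thesis by (metis (no_types, lifting) of_nat_sum sum.cong)
qed

end

section \<open>Duality\<close>

text \<open>Dual bases: by \<open>rep\<close> the coordinate functionals of a basis of
  \<open>V/W\<close> are represented by elements \<open>e i\<close> of \<open>D\<close>. They span
  modulo \<open>D'\<close> because a vector of \<open>D\<close> is determined modulo
  \<open>D'\<close> by its values on the basis.\<close>

lemma (in kspace) qdim_pairing:
  fixes \<beta> :: "'b \<Rightarrow> 'b \<Rightarrow> 'a"
  assumes V: "subspace V" and W: "subspace W" "W \<subseteq> V" and D: "subspace D" and q: "qdim V W n"
    and addr: "\<And>c x y. c \<in> D \<Longrightarrow> x \<in> V \<Longrightarrow> y \<in> V \<Longrightarrow> \<beta> c (x + y) = \<beta> c x + \<beta> c y"
    and scaler: "\<And>a c x. c \<in> D \<Longrightarrow> x \<in> V \<Longrightarrow> \<beta> c (a *s x) = a * \<beta> c x"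
    and addl: "\<And>c d x. c \<in> D \<Longrightarrow> d \<in> D \<Longrightarrow> x \<in> V \<Longrightarrow> \<beta> (c + d) x = \<beta> c x + \<beta> d x"
    and scalel: "\<And>a c x. c \<in> D \<Longrightarrow> x \<in> V \<Longrightarrow> \<beta> (a *s c) x = a * \<beta> c x"
    and W0: "\<And>c x. c \<in> D \<Longrightarrow> x \<in> W \<Longrightarrow> \<beta> c x = 0"
    and D0: "\<And>c x. c \<in> D \<Longrightarrow> c \<in> D' \<Longrightarrow> x \<in> V \<Longrightarrow> \<beta> c x = 0"
    and nondeg: "\<And>c. c \<in> D \<Longrightarrow> (\<And>x. x \<in> V \<Longrightarrow> \<beta> c x = 0) \<Longrightarrow> c \<in> D'"
    and rep: "\<And>\<mu>. (\<And>x y. x \<in> V \<Longrightarrow> y \<in> V \<Longrightarrow> \<mu> (x + y) = \<mu> x + \<mu> y) \<Longrightarrow>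
       (\<And>a x. x \<in> V \<Longrightarrow> \<mu> (a *s x) = a * \<mu> x) \<Longrightarrow> (\<And>x. x \<in> W \<Longrightarrow> \<mu> x = 0) \<Longrightarrow>
       \<exists>c\<in>D. \<forall>x\<in>V. \<mu> x = \<beta> c x"
  shows "qdim D D' n"
proof -
  from q obtain b where b: "indep_mod W {..<n} b" "spans_mod V W {..<n} b" by (auto simp: qdim_def qbasis_def)
  have bV: "\<And>i. i < n \<Longrightarrow> b i \<in> V" using b(2) by (auto simp: spans_mod_def)
  define co where "co x = (SOME c. x - (\<Sum>i<n. c i *s b i) \<in> W)" for x
  have co: "x - (\<Sum>i<n. co x i *s b i) \<in> W" if "x \<in> V" for x
  proof -
    have "\<exists>c. x - (\<Sum>i<n. c i *s b i) \<in> W" using b(2) that by (auto simp: spans_mod_def)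
    then show ?thesis unfolding co_def by (rule someI_ex)
  qed
  have uniq: "c i = co x i" if "x - (\<Sum>i<n. c i *s b i) \<in> W" "x \<in> V" "i < n" for x c i
  proof -
    have "(x - (\<Sum>i<n. co x i *s b i)) - (x - (\<Sum>i<n. c i *s b i)) \<in> W"
      by (rule subspace_diff[OF W(1) co[OF that(2)] that(1)])
    also have "(x - (\<Sum>i<n. co x i *s b i)) - (x - (\<Sum>i<n. c i *s b i)) = (\<Sum>i<n. (c i - co x i) *s b i)"
      by (simp add: scale_left_diff_distrib sum_subtractf)
    finally have "\<forall>i\<in>{..<n}. c i - co x i = 0"
      using spec[OF conjunct2[OF b(1)[unfolded indep_mod_def]], of "\<lambda>i. c i - co x i"] by blast
    then show ?thesis using that(3) by simp
  qed
  have "\<exists>c\<in>D. \<forall>x\<in>V. co x i = \<beta> c x" if i: "i < n" for i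
  proof (rule rep)
    fix x y assume xy: "x \<in> V" "y \<in> V"
    have "(x - (\<Sum>i<n. co x i *s b i)) + (y - (\<Sum>i<n. co y i *s b i)) \<in> W"
      by (intro subspace_add[OF W(1)] co xy)
    then have "(x + y) - (\<Sum>i<n. (co x i + co y i) *s b i) \<in> W"
      by (simp add: scale_left_distrib sum.distrib algebra_simps)
    from uniq[OF this subspace_add[OF V xy] i] show "co (x + y) i = co x i + co y i" by simp
  next
    fix a x assume x: "x \<in> V"
    have "a *s (x - (\<Sum>i<n. co x i *s b i)) \<in> W"
      by (intro subspace_scale[OF W(1)] co x)
    then have "(a *s x) - (\<Sum>i<n. (a * co x i) *s b i) \<in> W"
      by (simp add: scale_right_diff_distrib scale_sum_right)
    from uniq[OF this subspace_scale[OF V x] i] show "co (a *s x) i = a * co x i" by simp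
  next
    fix x assume x: "x \<in> W"
    then have "x - (\<Sum>i<n. 0 *s b i) \<in> W" by simp
    from uniq[OF this _ i] x W(2) show "co x i = 0" by auto
  qed
  then have "\<forall>i\<in>{..<n}. \<exists>c. c \<in> D \<and> (\<forall>x\<in>V. co x i = \<beta> c x)" by auto
  from bchoice[OF this] obtain e where e: "\<forall>i\<in>{..<n}. e i \<in> D \<and> (\<forall>x\<in>V. co x i = \<beta> (e i) x)" ..
  have eD: "e i \<in> D" if "i < n" for i using e that by auto
  have sD: "(\<Sum>i\<in>T. a i *s e i) \<in> D" if "T \<subseteq> {..<n}" for a T
    using eD that by (intro subspace_sum[OF D] subspace_scale[OF D]) auto
  have bsum: "\<beta> (\<Sum>i\<in>T. a i *s e i) x = (\<Sum>i\<in>T. a i * co x i)" if T: "T \<subseteq> {..<n}" and x: "x \<in> V" for a T x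
  proof -
    have "finite T" using T finite_subset by blast
    then show ?thesis using T
    proof (induction T)
      case empty
      have "\<beta> (0 *s 0) x = 0 * \<beta> 0 x" by (rule scalel[OF subspace_0[OF D] x])
      then show ?case by simp
    next
      case (insert i T)
      have i: "i < n" "T \<subseteq> {..<n}" using insert.prems by auto
      have "\<beta> (\<Sum>i\<in>insert i T. a i *s e i) x = \<beta> (a i *s e i) x + \<beta> (\<Sum>i\<in>T. a i *s e i) x"
        using addl[OF subspace_scale[OF D eD[OF i(1)], of "a i"] sD[OF i(2), of a] x] insert.hyps by simp
      then show ?case using insert.IH[OF i(2)] insert.hyps e x i(1) scalel[OF eD[OF i(1)] x, of "a i"] by simp
    qed
  qed
  have cob: "co (b k) i = (if i = k then 1 else 0)" if "i < n" "k < n" for i k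
  proof -
    have "b k - (\<Sum>i<n. (if i = k then 1 else 0) *s b i) = 0"
    proof -
      have "(\<Sum>i<n. (if i = k then 1 else 0) *s b i) = (\<Sum>i<n. if i = k then b k else 0)"
        by (rule sum.cong) auto
      then show ?thesis using that by simp
    qed
    then have "b k - (\<Sum>i<n. (if i = k then 1 else 0) *s b i) \<in> W" using subspace_0[OF W(1)] by simp
    from uniq[OF this bV[OF that(2)] that(1)] show ?thesis by simp
  qed
  have "indep_mod D' {..<n} e"
    unfolding indep_mod_def
  proof (intro conjI allI impI ballI)
    fix a k assume h: "(\<Sum>i<n. a i *s e i) \<in> D'" and k: "k \<in> {..<n}"
    have "0 = \<beta> (\<Sum>i<n. a i *s e i) (b k)" using D0[OF sD h] bV k by simp
    also have "\<dots> = (\<Sum>i<n. a i * co (b k) i)" using bV k by (intro bsum) auto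
    also have "\<dots> = (\<Sum>i<n. if i = k then a k else 0)" using cob k by (intro sum.cong) auto
    also have "\<dots> = a k" using k by simp
    finally show "a k = 0" by simp
  qed simp
  moreover have "spans_mod D D' {..<n} e"
    unfolding spans_mod_def
  proof (intro conjI ballI)
    fix c assume c: "c \<in> D"
    let ?s = "\<Sum>i<n. \<beta> c (b i) *s e i"
    have dD: "c - ?s \<in> D" by (intro subspace_diff[OF D] c sD) auto
    have bd: "\<beta> (c - ?s) x = \<beta> c x - (\<Sum>i<n. \<beta> c (b i) * co x i)" if "x \<in> V" for x
      using addl[OF dD sD that, of "{..<n}" "\<lambda>i. \<beta> c (b i)"] bsum[OF _ that, of "{..<n}" "\<lambda>i. \<beta> c (b i)"] by simp
    have "\<beta> (c - ?s) x = 0" if x: "x \<in> V" for x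
    proof -
      have sV: "(\<Sum>i\<in>T. co x i *s b i) \<in> V" if "T \<subseteq> {..<n}" for T
        using bV that by (intro subspace_sum[OF V] subspace_scale[OF V]) auto
      have "\<beta> c (\<Sum>i\<in>T. co x i *s b i) = (\<Sum>i\<in>T. co x i * \<beta> c (b i))" if T: "T \<subseteq> {..<n}" for T
      proof -
        have "finite T" using T finite_subset by blast
        then show ?thesis using T
        proof (induction T)
          case empty
          have "\<beta> c (0 *s 0) = 0 * \<beta> c 0" by (rule scaler[OF c subspace_0[OF V]])
          then show ?case by simp
        next
          case (insert i T)
          have i: "i < n" "T \<subseteq> {..<n}" using insert.prems by auto
          have "\<beta> c (\<Sum>i\<in>insert i T. co x i *s b i) = \<beta> c (co x i *s b i) + \<beta> c (\<Sum>i\<in>T. co x i *s b i)"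
            using addr[OF c subspace_scale[OF V bV[OF i(1)], of "co x i"] sV[OF i(2)]] insert.hyps by simp
          then show ?case using insert.IH[OF i(2)] insert.hyps scaler[OF c bV[OF i(1)], of "co x i"] by simp
        qed
      qed
      from this[of "{..<n}"] have "\<beta> c (\<Sum>i<n. co x i *s b i) = (\<Sum>i<n. co x i * \<beta> c (b i))" by simp
      moreover have "\<beta> c x = \<beta> c (x - (\<Sum>i<n. co x i *s b i)) + \<beta> c (\<Sum>i<n. co x i *s b i)"
        using addr[OF c _ sV[of "{..<n}"], of "x - (\<Sum>i<n. co x i *s b i)"] co[OF x] W(2) by auto
      moreover have "\<beta> c (x - (\<Sum>i<n. co x i *s b i)) = 0" by (rule W0[OF c co[OF x]])
      ultimately show ?thesis using bd[OF x] by (simp add: mult.commute)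
    qed
    then have "c - ?s \<in> D'" by (rule nondeg[OF dD])
    then show "\<exists>a. c - (\<Sum>i<n. a i *s e i) \<in> D'" by (rule exI[of _ "\<lambda>i. \<beta> c (b i)"])
  qed (use eD in auto)
  ultimately show ?thesis unfolding qdim_def qbasis_def by blast
qed

text \<open>The linkage data. The \<open>f i\<close> with \<open>i\<close> outside
  \<open>{i0, i1}\<close> are the regular sequence in \<open>I\<close> and generate the ideal
  \<open>T\<close> below; \<open>g_gen\<close> and \<open>g_ann\<close> amount to
  \<open>(T : I) = (T, g)\<close> and \<open>(T : g) = I\<close>. The constant \<open>E\<close>
  bounds the degrees of the elements of \<open>I\<close> on which it suffices to test whether
  \<open>I y\<close> lies in an ideal, and \<open>sdeg N\<close> is the socle degree modulo
  \<open>Q N\<close>.\<close>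

locale linked_curve = free_curve I Y0 Y1 b d m + monic_family i0 i1 M f
  for I :: "('n::{finite, linorder}, 'k::field) mpoly set" and Y0 Y1 b d m and i0 i1 :: 'n and M
    and f :: "'n \<Rightarrow> ('n, 'k) mpoly" +
  fixes g :: "('n, 'k) mpoly" and \<gamma> :: int and E :: int and sdeg :: "nat \<Rightarrow> int"
  assumes sdeg: "\<And>N. sdeg N = (int (card (UNIV :: 'n set)) - 2) * (int M - 1) + 2 * (int N - 1)"
    and f0: "f i0 = Y0" and f1: "f i1 = Y1" and fI: "\<And>i. i \<noteq> i0 \<Longrightarrow> i \<noteq> i1 \<Longrightarrow> f i \<in> I"
    and g: "g \<in> homog \<gamma>"
    and g_gen: "\<And>u. (\<And>i. i \<in> I \<Longrightarrow> i * u \<in> pideal (-{i0,i1}) (\<lambda>_. 1)) \<Longrightarrow> \<exists>p. u - p * g \<in> pideal (-{i0,i1}) (\<lambda>_. 1)"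
    and g_ann: "\<And>p. p * g \<in> pideal (-{i0,i1}) (\<lambda>_. 1) \<longleftrightarrow> p \<in> I"
    and E: "\<And>J y. idl.subspace J \<Longrightarrow> (\<And>l i. l \<le> E \<Longrightarrow> i \<in> I \<inter> homog l \<Longrightarrow> i * y \<in> J) \<Longrightarrow> (\<And>i. i \<in> I \<Longrightarrow> i * y \<in> J)"
begin

abbreviation T where "T \<equiv> pideal (-{i0,i1}) (\<lambda>_. 1)"
abbreviation Q :: "nat \<Rightarrow> ('n, 'k) mpoly set" where "Q N \<equiv> pideal UNIV (\<lambda>i. if i = i0 \<or> i = i1 then N else 1)"

lemma Q_iff: "x \<in> Q N \<longleftrightarrow> (\<exists>p q. x - Y0 ^ N * p - Y1 ^ N * q \<in> T)"
proof -
  have im: "(\<lambda>j. f j ^ (if j = i0 \<or> j = i1 then N else 1)) ` UNIV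
      = insert (f i0 ^ N) (insert (f i1 ^ N) ((\<lambda>j. f j ^ 1) ` (-{i0,i1})))" (is "?l = ?r")
  proof -
    have "?l = (\<lambda>j. f j ^ (if j = i0 \<or> j = i1 then N else 1)) ` (insert i0 (insert i1 (-{i0,i1})))"
      by (rule arg_cong[where f = "image _"]) auto
    also have "\<dots> = ?r" by (auto simp: image_iff)
    finally show ?thesis .
  qed
  have "x \<in> Q N \<longleftrightarrow> (\<exists>p q. x - p * f i0 ^ N - q * f i1 ^ N \<in> T)"
    unfolding pideal_def im idl.span_breakdown_eq by (simp add: pideal_def)
  then show ?thesis by (simp only: f0 f1 mult.commute)
qed

lemma T_Q: "x \<in> T \<Longrightarrow> x \<in> Q N"
  unfolding Q_iff by (intro exI[of _ 0]) simp

text \<open>In degrees below \<open>N\<close> the generators \<open>Y0 ^ N\<close> and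
  \<open>Y1 ^ N\<close> contribute nothing. The lower bounds on \<open>N\<close> in
  \<open>duality\<close>, apart from positivity, enter through this lemma.\<close>

lemma Q_T: assumes x: "x \<in> homog l" and N: "l < int N" and "x \<in> Q N" shows "x \<in> T"
proof -
  obtain p q where pq: "x - Y0 ^ N * p - Y1 ^ N * q \<in> T" using assms(3) Q_iff by blast
  have z: "hc (l - int N) y = 0" for y :: "('n, 'k) mpoly" using hc_homog homog_neg[of "l - int N"] N by auto
  have "hc l (x - Y0 ^ N * p - Y1 ^ N * q) = x"
    using hc_mult[OF homog_power[OF Y0, of N], of l p] hc_mult[OF homog_power[OF Y1, of N], of l q] hc_id[OF x]
    by (simp add: hc_diff z)
  then show ?thesis using hideal_hc[OF hideal_pideal pq, of l] by simp
qed

lemma Ts: "idl.subspace T"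
  by (rule subspace_pideal)

lemma T_I: "x \<in> T \<Longrightarrow> x \<in> I"
proof -
  have "T \<subseteq> I" unfolding pideal_def by (rule idl.span_minimal[OF _ Is]) (use fI in auto)
  then show "x \<in> T \<Longrightarrow> x \<in> I" by blast
qed

lemma pairing_exists: assumes "N > 0"
  shows "\<exists>w. gorenstein_artinian (Q N) w (sdeg N) (\<Sum>i\<in>UNIV. int ((if i = i0 \<or> i = i1 then N else 1) * D i))"
proof -
  obtain w where "socle_generator (Q N) w" "w \<in> homog (sdeg N)" using power_socle[OF assms, folded sdeg] by blast
  then have "gorenstein_artinian (Q N) w (sdeg N) (\<Sum>i\<in>UNIV. int ((if i = i0 \<or> i = i1 then N else 1) * D i))"
    by unfold_locales (use hideal_pideal pideal_large in auto)
  then show ?thesis ..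
qed

text \<open>The degree \<open>l\<close> part of \<open>I + (Y0^N, Y1^N) J\<close>. The powers
  multiply \<open>J\<close> and not the whole ring, so that \<open>J\<close> modulo
  \<open>filt\<close> is the module \<open>J/I\<close> reduced modulo the two powers.\<close>

definition filt :: "nat \<Rightarrow> ('n, 'k) mpoly set \<Rightarrow> int \<Rightarrow> ('n, 'k) mpoly set" where
  "filt N J l = {x \<in> homog l. \<exists>y\<in>J. \<exists>z\<in>J. x - Y0 ^ N * y - Y1 ^ N * z \<in> I}"

text \<open>For \<open>u\<close> in \<open>J\<close> and regular modulo \<open>I\<close>,
  multiplication by \<open>c/u\<close> identifies these \<open>c\<close>, modulo \<open>I\<close>,
  with the homomorphisms from \<open>J/I\<close> to the coordinate ring whose degree is
  \<open>l\<close> minus the degree of \<open>u\<close>.\<close>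

definition colon :: "('n, 'k) mpoly \<Rightarrow> ('n, 'k) mpoly set \<Rightarrow> int \<Rightarrow> ('n, 'k) mpoly set" where
  "colon u J l = {c \<in> homog l. \<forall>a\<in>J. \<exists>b. c * a - u * b \<in> I}"

lemma subspace_filt: assumes J: "idl.subspace J" shows "kv.subspace (filt N J l)"
  unfolding kv.subspace_def
proof (intro conjI ballI allI)
  show "0 \<in> filt N J l" unfolding filt_def
    using idl.subspace_0[OF J] idl.subspace_0[OF Is] by (auto intro!: bexI[of _ 0])
  fix x assume "x \<in> filt N J l"
  then obtain y z where x: "x \<in> homog l" "y \<in> J" "z \<in> J" "x - Y0 ^ N * y - Y1 ^ N * z \<in> I" by (auto simp: filt_def)
  {
    fix x' assume "x' \<in> filt N J l"
    then obtain y' z' where x': "x' \<in> homog l" "y' \<in> J" "z' \<in> J" "x' - Y0 ^ N * y' - Y1 ^ N * z' \<in> I" by (auto simp: filt_def)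
    have "(x + x') - Y0 ^ N * (y + y') - Y1 ^ N * (z + z') \<in> I"
      using idl.subspace_add[OF Is x(4) x'(4)] by (simp add: algebra_simps)
    then show "x + x' \<in> filt N J l"
      unfolding filt_def using x x' idl.subspace_add[OF J] homog_add by blast
  next
    fix c
    have "Const c * x - Y0 ^ N * (Const c * y) - Y1 ^ N * (Const c * z) \<in> I"
      using idl.subspace_scale[OF Is x(4), of "Const c"] by (simp add: right_diff_distrib mult.left_commute)
    then show "Const c * x \<in> filt N J l"
      unfolding filt_def using x idl.subspace_scale[OF J] homog_Const_mult by blast
  }
qed

lemma subspace_colon: "kv.subspace (colon u J l)"
  unfolding kv.subspace_def
proof (intro conjI ballI allI)
  show "0 \<in> colon u J l" unfolding colon_def
    using idl.subspace_0[OF Is] by (auto intro!: exI[of _ 0])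
  fix x assume x: "x \<in> colon u J l"
  {
    fix y assume y: "y \<in> colon u J l"
    have "\<exists>b. (x + y) * a - u * b \<in> I" if "a \<in> J" for a
    proof -
      have "\<exists>b. x * a - u * b \<in> I" "\<exists>b. y * a - u * b \<in> I" using x y \<open>a \<in> J\<close> by (simp_all add: colon_def)
      then obtain b b' where e: "x * a - u * b \<in> I" "y * a - u * b' \<in> I" by (elim exE)
      have "(x + y) * a - u * (b + b') \<in> I" using idl.subspace_add[OF Is e] by (simp add: algebra_simps)
      then show ?thesis ..
    qed
    then show "x + y \<in> colon u J l" using x y homog_add by (auto simp: colon_def)
  next
    fix c
    have "\<exists>b. (Const c * x) * a - u * b \<in> I" if "a \<in> J" for a
    proof -
      obtain b where "x * a - u * b \<in> I" using x \<open>a \<in> J\<close> by (auto simp: colon_def)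
      then have "(Const c * x) * a - u * (Const c * b) \<in> I"
        using idl.subspace_scale[OF Is, of "x * a - u * b" "Const c"] by (simp add: right_diff_distrib mult_ac)
      then show ?thesis ..
    qed
    then show "Const c * x \<in> colon u J l" using x homog_Const_mult by (auto simp: colon_def)
  }
qed

text \<open>The pairing evaluates the homomorphism \<open>c/u\<close> at \<open>x\<close>,
  multiplies by \<open>g\<close> and applies \<open>sigma\<close>. The hard part is
  representability. Given a functional \<open>mu\<close>, for a form \<open>a\<close> of
  \<open>J\<close> the functional taking \<open>p\<close> to \<open>mu (p a)\<close> is represented
  by some \<open>y\<close>; since \<open>mu\<close> vanishes on \<open>I\<close>, the products
  \<open>I y\<close> lie in \<open>T\<close>, and \<open>y = g e\<close> modulo \<open>T\<close>.
  The \<open>e\<close> belonging to \<open>a = u\<close> is the wanted \<open>c\<close>, and the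
  \<open>e\<close> of a general \<open>a\<close> is the value of \<open>c/u\<close> at
  \<open>a\<close>. The parameter \<open>i\<close> is the degree of the homomorphisms.\<close>

lemma duality:
  assumes J: "hideal J" "I \<subseteq> J" and u: "u \<in> R" "u \<in> homog \<delta>" "u \<in> J" "u \<noteq> 0"
    and gen: "\<And>l. J \<inter> homog l \<subseteq> kv.span ({p * a | p a k. k \<le> E1 \<and> a \<in> J \<inter> homog k \<and> p \<in> homog (l - k)} \<union> (I \<inter> homog l))"
    and N: "N > 0" "\<gamma> + \<delta> + i < int N" "\<gamma> + \<delta> + i + E1 < int N" "\<gamma> + i + E1 + E < int N" "\<gamma> + i + \<delta> + E < int N"
    and q: "kv.qdim (J \<inter> homog (sdeg N - \<gamma> - i)) (filt N J (sdeg N - \<gamma> - i)) n"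
  shows "kv.qdim (colon u J (\<delta> + i)) (I \<inter> homog (\<delta> + i)) n"
proof -
  let ?t = "sdeg N - \<gamma>"
  obtain w where "gorenstein_artinian (Q N) w (sdeg N) (\<Sum>i\<in>UNIV. int ((if i = i0 \<or> i = i1 then N else 1) * D i))"
    using pairing_exists[OF N(1)] by blast
  then interpret G: gorenstein_artinian "Q N" w "sdeg N" "\<Sum>i\<in>UNIV. int ((if i = i0 \<or> i = i1 then N else 1) * D i)" .
  have Js: "idl.subspace J" using J(1) by (rule hideal_subspace)
  define V where "V = J \<inter> homog (?t - i)"
  define W where "W = filt N J (?t - i)"
  define C where "C = colon u J (\<delta> + i)"
  have V: "kv.subspace V" unfolding V_def by (intro kv.subspace_inter ideal_kv_subspace Js subspace_homog)
  have W: "kv.subspace W" unfolding W_def by (rule subspace_filt[OF Js])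
  have WV: "W \<subseteq> V"
  proof
    fix x assume "x \<in> W"
    then obtain y z where x: "x \<in> homog (?t - i)" "y \<in> J" "z \<in> J" "x - Y0 ^ N * y - Y1 ^ N * z \<in> I" by (auto simp: W_def filt_def)
    have "(x - Y0 ^ N * y - Y1 ^ N * z) + Y0 ^ N * y + Y1 ^ N * z \<in> J"
      using x J(2) by (intro idl.subspace_add[OF Js] idl.subspace_scale[OF Js]) auto
    then show "x \<in> V" using x(1) by (simp add: V_def)
  qed
  \<comment> \<open>Two admissible quotients differ by an element of \<open>I\<close>, because
    \<open>u\<close> is regular, and \<open>sigma (g * p)\<close> vanishes for \<open>p\<close> in
    \<open>I\<close>; so the choice does not affect the pairing.\<close>
  define quo where "quo c x = (SOME b. c * x - u * b \<in> I)" for c x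
  define \<beta> where "\<beta> c x = G.sigma (g * quo c x)" for c x
  have ureg: "p \<in> I" if "u * p \<in> I" for p using R_regular[OF u(1,2,4) that] .
  have gI: "G.sigma (g * p) = 0" if "p \<in> I" for p
  proof -
    have "p * g \<in> T" using g_ann that by blast
    then show ?thesis using G.sigma_Q[OF T_Q] by (simp add: mult.commute)
  qed
  have beta: "\<beta> c x = G.sigma (g * e)" if e: "c * x - u * e \<in> I" for c x e
  proof -
    have "c * x - u * quo c x \<in> I" unfolding quo_def using e by (rule someI)
    from idl.subspace_diff[OF Is e this] have "u * (quo c x - e) \<in> I" by (simp add: right_diff_distrib)
    then have "quo c x - e \<in> I" by (rule ureg)
    from gI[OF this] show ?thesis by (simp add: \<beta>_def right_diff_distrib G.sigma_diff)
  qed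
  have CI: "\<exists>e. c * x - u * e \<in> I" if "c \<in> C" "x \<in> J" for c x using that by (auto simp: C_def colon_def)
  have Ch: "c \<in> homog (\<delta> + i)" if "c \<in> C" for c using that by (auto simp: C_def colon_def)
  have "kv.qdim C (I \<inter> homog (\<delta> + i)) n"
  proof (rule kv.qdim_pairing[OF V W WV])
    show "kv.subspace C" unfolding C_def by (rule subspace_colon)
    show "kv.qdim V W n" using q unfolding V_def W_def .
    fix c assume c: "c \<in> C"
    {
      fix x y assume xy: "x \<in> V" "y \<in> V"
      have "\<exists>e. c * x - u * e \<in> I" "\<exists>e. c * y - u * e \<in> I" using CI[OF c] xy by (simp_all add: V_def)
      then obtain e e' where e: "c * x - u * e \<in> I" "c * y - u * e' \<in> I" by (elim exE)
      have "c * (x + y) - u * (e + e') \<in> I" using idl.subspace_add[OF Is e] by (simp add: algebra_simps)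
      from beta[OF this] show "\<beta> c (x + y) = \<beta> c x + \<beta> c y"
        by (simp add: beta[OF e(1)] beta[OF e(2)] distrib_left G.sigma_add)
    next
      fix a x assume x: "x \<in> V"
      obtain e where e: "c * x - u * e \<in> I" using CI[OF c] x by (auto simp: V_def)
      have e1: "c * (Const a * x) - u * (Const a * e) \<in> I"
        using idl.subspace_scale[OF Is e, of "Const a"] by (simp add: right_diff_distrib mult_ac)
      from beta[OF e1] show "\<beta> c (Const a * x) = a * \<beta> c x"
        by (simp only: beta[OF e] mult.left_commute[of g] G.sigma_Const_mult)
      have e2: "(Const a * c) * x - u * (Const a * e) \<in> I" using e1 by (simp only: mult_ac)
      from beta[OF e2] show "\<beta> (Const a * c) x = a * \<beta> c x"
        by (simp only: beta[OF e] mult.left_commute[of g] G.sigma_Const_mult)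
    next
      fix c' x assume c': "c' \<in> C" and x: "x \<in> V"
      have "\<exists>e. c * x - u * e \<in> I" "\<exists>e. c' * x - u * e \<in> I" using CI[OF c] CI[OF c'] x by (simp_all add: V_def)
      then obtain e e' where e: "c * x - u * e \<in> I" "c' * x - u * e' \<in> I" by (elim exE)
      have "(c + c') * x - u * (e + e') \<in> I" using idl.subspace_add[OF Is e] by (simp add: algebra_simps)
      from beta[OF this] show "\<beta> (c + c') x = \<beta> c x + \<beta> c' x"
        by (simp add: beta[OF e(1)] beta[OF e(2)] distrib_left G.sigma_add)
    next
      fix x assume "x \<in> W"
      then obtain y z where x: "y \<in> J" "z \<in> J" "x - Y0 ^ N * y - Y1 ^ N * z \<in> I" by (auto simp: W_def filt_def)
      obtain e e' where e: "c * y - u * e \<in> I" "c * z - u * e' \<in> I"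
        using CI[OF c x(1)] CI[OF c x(2)] by (elim exE)
      have "c * (x - Y0 ^ N * y - Y1 ^ N * z) + Y0 ^ N * (c * y - u * e) + Y1 ^ N * (c * z - u * e') \<in> I"
        by (intro idl.subspace_add[OF Is] idl.subspace_scale[OF Is] x e)
      then have "c * x - u * (Y0 ^ N * e + Y1 ^ N * e') \<in> I" by (simp add: algebra_simps)
      from beta[OF this] have "\<beta> c x = G.sigma (g * (Y0 ^ N * e + Y1 ^ N * e'))" .
      moreover have "g * (Y0 ^ N * e + Y1 ^ N * e') \<in> Q N"
        unfolding Q_iff by (rule exI[of _ "g * e", OF exI[of _ "g * e'"]])
          (simp add: distrib_left mult.left_commute[of g] idl.subspace_0[OF subspace_pideal])
      ultimately show "\<beta> c x = 0" using G.sigma_Q by simp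
    next
      fix x assume cI: "c \<in> I \<inter> homog (\<delta> + i)"
      have "c * x - u * 0 \<in> I" using idl.subspace_scale[OF Is, of c x] cI by (simp add: mult.commute)
      from beta[OF this] show "\<beta> c x = 0" by simp
    next
      assume z: "\<And>x. x \<in> V \<Longrightarrow> \<beta> c x = 0"
      have gc: "g * c \<in> homog (\<gamma> + \<delta> + i)" using homog_mult[OF g Ch[OF c]] by (simp add: add.assoc)
      \<comment> \<open>Nondegeneracy in \<open>c\<close> is tested on the multiples
        \<open>p u\<close> of \<open>u\<close> alone, where the pairing is
        \<open>sigma (p g c)\<close>.\<close>
      have "g * c \<in> Q N"
      proof (rule G.sigma_nondegenerate[OF gc])
        fix p :: "('n, 'k) mpoly" assume p: "p \<in> homog (sdeg N - (\<gamma> + \<delta> + i))"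
        have "p * u \<in> homog (?t - i)" by (rule homog_mult'[OF p u(2)]) simp
        then have "p * u \<in> V" unfolding V_def using idl.subspace_scale[OF Js u(3)] by simp
        moreover have "c * (p * u) - u * (p * c) \<in> I" by (simp add: mult_ac idl.subspace_0[OF Is])
        then have "\<beta> c (p * u) = G.sigma (g * (p * c))" by (rule beta)
        ultimately have "G.sigma (g * (p * c)) = 0" using z[of "p * u"] by simp
        then show "G.sigma (p * (g * c)) = 0" by (simp add: mult.left_commute)
      qed
      then have "g * c \<in> T" using Q_T[OF gc N(2)] by blast
      then have "c \<in> I" using g_ann[of c] by (simp add: mult.commute)
      then show "c \<in> I \<inter> homog (\<delta> + i)" using Ch[OF c] by simp
    }
  next
    fix \<mu> :: "('n, 'k) mpoly \<Rightarrow> 'k"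
    assume madd: "\<And>x y. x \<in> V \<Longrightarrow> y \<in> V \<Longrightarrow> \<mu> (x + y) = \<mu> x + \<mu> y"
      and mscale: "\<And>a x. x \<in> V \<Longrightarrow> \<mu> (Const a * x) = a * \<mu> x"
      and mW: "\<And>x. x \<in> W \<Longrightarrow> \<mu> x = 0"
    have IW: "x \<in> W" if "x \<in> I" "x \<in> homog (?t - i)" for x
      unfolding W_def filt_def using that idl.subspace_0[OF Js] by (auto intro!: bexI[of _ 0])
    \<comment> \<open>The bound on \<open>l\<close> keeps the products \<open>j * y\<close>, for
      \<open>j\<close> in \<open>I\<close> of degree at most \<open>E\<close>, below degree
      \<open>N\<close>, so that vanishing modulo \<open>Q N\<close> means vanishing modulo
      \<open>T\<close>.\<close>
    have step: "\<exists>e\<in>homog (i + l). \<forall>p\<in>homog (?t - i - l). \<mu> (p * a) = G.sigma (p * (g * e))"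
      if l: "\<gamma> + i + l + E < int N" and a: "a \<in> J" "a \<in> homog l" for a l
    proof -
      have pV: "p * a \<in> V" if "p \<in> homog (?t - i - l)" for p
        unfolding V_def using homog_mult[OF that a(2)] idl.subspace_scale[OF Js a(1)] by simp
      have "\<exists>y\<in>homog (sdeg N - (?t - i - l)). \<forall>p\<in>homog (?t - i - l). \<mu> (p * a) = G.sigma (p * y)"
      proof (rule G.sigma_represents)
        fix p assume p: "p \<in> homog (?t - i - l)" "p \<in> Q N"
        obtain y z where yz: "p - Y0 ^ N * y - Y1 ^ N * z \<in> T" using p(2) Q_iff by blast
        have "a * (p - Y0 ^ N * y - Y1 ^ N * z) \<in> I" by (intro idl.subspace_scale[OF Is] T_I yz)
        then have "p * a - Y0 ^ N * (y * a) - Y1 ^ N * (z * a) \<in> I" by (simp add: right_diff_distrib mult_ac)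
        then have "p * a \<in> W" unfolding W_def filt_def
          using pV[OF p(1)] idl.subspace_scale[OF Js a(1)] by (auto simp: V_def)
        then show "\<mu> (p * a) = 0" by (rule mW)
      next
        fix x y :: "('n, 'k) mpoly" assume xy: "x \<in> homog (?t - i - l)" "y \<in> homog (?t - i - l)"
        then show "\<mu> ((x + y) * a) = \<mu> (x * a) + \<mu> (y * a)" by (simp add: distrib_right madd pV)
      next
        fix c and x :: "('n, 'k) mpoly" assume x: "x \<in> homog (?t - i - l)"
        then show "\<mu> (Const c * x * a) = c * \<mu> (x * a)" by (simp add: mult.assoc mscale pV)
      qed
      then obtain y where y0: "y \<in> homog (sdeg N - (?t - i - l))" "\<forall>p\<in>homog (?t - i - l). \<mu> (p * a) = G.sigma (p * y)" by (elim bexE)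
      have "sdeg N - (?t - i - l) = \<gamma> + i + l" by simp
      with y0(1) have y1: "y \<in> homog (\<gamma> + i + l)" by (simp only:)
      note y = y1 y0(2)[rule_format]
      have "j * y \<in> T" if j: "j \<in> I" for j
        using Ts _ j
      proof (rule E)
        fix k j assume k: "k \<le> E" and j: "j \<in> I \<inter> homog k"
        have jy: "j * y \<in> homog (k + (\<gamma> + i + l))" using j y(1) by (intro homog_mult) auto
        have "j * y \<in> Q N"
        proof (rule G.sigma_nondegenerate[OF jy])
          fix p :: "('n, 'k) mpoly" assume p: "p \<in> homog (sdeg N - (k + (\<gamma> + i + l)))"
          have pj: "p * j \<in> homog (?t - i - l)" using j by (intro homog_mult'[OF p]) auto
          have "(p * a) * j \<in> I" using idl.subspace_scale[OF Is, of j "p * a"] j by blast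
          then have "p * j * a \<in> I" by (simp only: mult_ac)
          then have "\<mu> (p * j * a) = 0" using mW IW pV[OF pj] by (auto simp: V_def)
          then show "G.sigma (p * (j * y)) = 0" using y(2)[OF pj] by (simp add: mult.assoc)
        qed
        then show "j * y \<in> T" using k l by (intro Q_T[OF jy, of N]) linarith
      qed
      then obtain p where p: "y - p * g \<in> T" using g_gen by blast
      have "hc (\<gamma> + i + l) (y - g * p) \<in> T" by (rule hideal_hc[OF hideal_pideal]) (use p in \<open>simp add: mult.commute\<close>)
      then have e: "y - g * hc (i + l) p \<in> T" using hc_mult[OF g, of "\<gamma> + i + l" p] hc_id[OF y(1)] by (simp add: hc_diff add.assoc)
      have "G.sigma (q * y) = G.sigma (q * (g * hc (i + l) p))" for q
      proof -
        have "q * (y - g * hc (i + l) p) \<in> Q N" by (intro idl.subspace_scale[OF subspace_pideal] T_Q e)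
        from G.sigma_Q[OF this] show ?thesis by (simp add: right_diff_distrib G.sigma_diff)
      qed
      then show ?thesis using y(2) hc_homog by (intro bexI[of _ "hc (i + l) p"]) auto
    qed
    obtain c where c: "c \<in> homog (i + \<delta>)" "\<And>p. p \<in> homog (?t - i - \<delta>) \<Longrightarrow> \<mu> (p * u) = G.sigma (p * (g * c))"
      using step[OF N(5) u(3,2)] by blast
    \<comment> \<open>For \<open>a\<close> of degree at most \<open>E1\<close>, evaluating
      \<open>mu\<close> at \<open>p a u\<close> in two ways compares \<open>e\<close> with
      \<open>c\<close>; nondegeneracy then gives \<open>c a = u e\<close> modulo
      \<open>I\<close>.\<close>
    have low: "\<exists>e\<in>homog (i + l). c * a - u * e \<in> I \<and> (\<forall>p\<in>homog (?t - i - l). \<mu> (p * a) = G.sigma (p * (g * e)))"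
      if l: "l \<le> E1" and a: "a \<in> J \<inter> homog l" for a l
    proof -
      have "\<gamma> + i + l + E < int N" using N(4) l by linarith
      then obtain e where e: "e \<in> homog (i + l)" "\<And>p. p \<in> homog (?t - i - l) \<Longrightarrow> \<mu> (p * a) = G.sigma (p * (g * e))"
        using step a by blast
      have hom: "g * (c * a - u * e) \<in> homog (\<gamma> + \<delta> + i + l)"
        using a by (intro homog_mult'[OF g homog_diff[OF homog_mult'[OF c(1), of a l] homog_mult'[OF u(2) e(1)]]]) auto
      have "g * (c * a - u * e) \<in> Q N"
      proof (rule G.sigma_nondegenerate[OF hom])
        fix p :: "('n, 'k) mpoly" assume p: "p \<in> homog (sdeg N - (\<gamma> + \<delta> + i + l))"
        have "\<mu> ((p * a) * u) = G.sigma ((p * a) * (g * c))" using a by (intro c(2) homog_mult'[OF p]) auto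
        moreover have "\<mu> ((p * u) * a) = G.sigma ((p * u) * (g * e))" by (intro e(2) homog_mult'[OF p u(2)]) auto
        moreover have "(p * a) * u = (p * u) * a" by (simp only: mult_ac)
        moreover have "p * (g * (c * a - u * e)) = (p * a) * (g * c) - (p * u) * (g * e)"
          by (simp add: right_diff_distrib mult_ac)
        ultimately show "G.sigma (p * (g * (c * a - u * e))) = 0" by (simp add: G.sigma_diff)
      qed
      then have "g * (c * a - u * e) \<in> T" using N(3) l by (intro Q_T[OF hom, of N]) linarith
      then have "c * a - u * e \<in> I" using g_ann[of "c * a - u * e"] by (simp add: mult.commute)
      then show ?thesis using e by blast
    qed
    \<comment> \<open>Modulo \<open>I\<close>, the forms of degree at most \<open>E1\<close>
      generate \<open>J\<close>, and those \<open>a\<close> for which \<open>c a\<close> is a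
      multiple of \<open>u\<close> modulo \<open>I\<close> form an ideal.\<close>
    have cJ: "\<exists>e. c * a - u * e \<in> I" if a: "a \<in> J" for a
    proof -
      define U where "U = {a. \<exists>e. c * a - u * e \<in> I}"
      have U: "idl.subspace U" unfolding idl.subspace_def
      proof (intro conjI ballI allI)
        show "0 \<in> U" unfolding U_def using idl.subspace_0[OF Is] by (auto intro!: exI[of _ 0])
        show "x + y \<in> U" if xy: "x \<in> U" "y \<in> U" for x y
        proof -
          obtain e e' where "c * x - u * e \<in> I" "c * y - u * e' \<in> I" using xy by (auto simp: U_def)
          from idl.subspace_add[OF Is this] have "c * (x + y) - u * (e + e') \<in> I" by (simp add: algebra_simps)
          then show ?thesis unfolding U_def by blast
        qed
        show "p * x \<in> U" if x: "x \<in> U" for p x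
        proof -
          obtain e where "c * x - u * e \<in> I" using x by (auto simp: U_def)
          from idl.subspace_scale[OF Is this, of p] have "c * (p * x) - u * (p * e) \<in> I" by (simp add: right_diff_distrib mult_ac)
          then show ?thesis unfolding U_def by blast
        qed
      qed
      have "J \<inter> homog l \<subseteq> U" for l
      proof -
        have "I \<subseteq> U"
        proof
          fix x assume "x \<in> I"
          then have "c * x - u * 0 \<in> I" using idl.subspace_scale[OF Is] by simp
          then show "x \<in> U" unfolding U_def by blast
        qed
        moreover have "{p * a | p a k. k \<le> E1 \<and> a \<in> J \<inter> homog k \<and> p \<in> homog (l - k)} \<subseteq> U"
        proof
          fix x assume "x \<in> {p * a | p a k. k \<le> E1 \<and> a \<in> J \<inter> homog k \<and> p \<in> homog (l - k)}"
          then obtain p a k where x: "x = p * a" "k \<le> E1" "a \<in> J \<inter> homog k" by blast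
          then have "a \<in> U" using low[of k a] unfolding U_def by blast
          then show "x \<in> U" unfolding x(1) by (rule idl.subspace_scale[OF U])
        qed
        ultimately have "kv.span ({p * a | p a k. k \<le> E1 \<and> a \<in> J \<inter> homog k \<and> p \<in> homog (l - k)} \<union> (I \<inter> homog l)) \<subseteq> U"
          by (intro kv.span_minimal ideal_kv_subspace U) blast
        then show ?thesis using gen by blast
      qed
      then have h: "hc l a \<in> U" for l using hideal_hc[OF J(1) a] hc_homog by blast
      obtain L where "a = (\<Sum>l\<in>L. hc l a)" using hc_decomp by blast
      moreover have "(\<Sum>l\<in>L. hc l a) \<in> U" using h by (intro idl.subspace_sum[OF U])
      ultimately show ?thesis unfolding U_def by simp
    qed
    have cC: "c \<in> C" unfolding C_def colon_def using c(1) cJ by (simp add: add.commute)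
    have "\<mu> x = \<beta> c x" if x: "x \<in> V" for x
    proof -
      define U where "U = {x \<in> V. \<mu> x = \<beta> c x}"
      have badd: "\<beta> c (x + y) = \<beta> c x + \<beta> c y" if xy: "x \<in> V" "y \<in> V" for x y
      proof -
        have "\<exists>e. c * x - u * e \<in> I" "\<exists>e. c * y - u * e \<in> I" using cJ xy by (simp_all add: V_def)
        then obtain e e' where e: "c * x - u * e \<in> I" "c * y - u * e' \<in> I" by (elim exE)
        have "c * (x + y) - u * (e + e') \<in> I" using idl.subspace_add[OF Is e] by (simp add: algebra_simps)
        from beta[OF this] show ?thesis by (simp add: beta[OF e(1)] beta[OF e(2)] distrib_left G.sigma_add)
      qed
      have bscale: "\<beta> c (Const a * x) = a * \<beta> c x" if x: "x \<in> V" for a x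
      proof -
        obtain e where e: "c * x - u * e \<in> I" using cJ x by (auto simp: V_def)
        have "c * (Const a * x) - u * (Const a * e) \<in> I"
          using idl.subspace_scale[OF Is e, of "Const a"] by (simp add: right_diff_distrib mult_ac)
        from beta[OF this] show ?thesis by (simp only: beta[OF e] mult.left_commute[of g] G.sigma_Const_mult)
      qed
      have bI: "\<beta> c x = 0" if "x \<in> I" for x
      proof -
        have "c * x - u * 0 \<in> I" using idl.subspace_scale[OF Is that] by simp
        from beta[OF this] show ?thesis by simp
      qed
      have m0: "\<mu> 0 = 0" using mW kv.subspace_0[OF W] by blast
      have U: "kv.subspace U" unfolding kv.subspace_def U_def
        using kv.subspace_0[OF V] kv.subspace_add[OF V] kv.subspace_scale[OF V] m0 bI[OF idl.subspace_0[OF Is]]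
        by (simp add: madd mscale badd bscale)
      have "{p * a | p a k. k \<le> E1 \<and> a \<in> J \<inter> homog k \<and> p \<in> homog ((?t - i) - k)} \<subseteq> U"
      proof
        fix x assume "x \<in> {p * a | p a k. k \<le> E1 \<and> a \<in> J \<inter> homog k \<and> p \<in> homog ((?t - i) - k)}"
        then obtain p a k where pa: "x = p * a" "k \<le> E1" "a \<in> J \<inter> homog k" "p \<in> homog (?t - i - k)" by blast
        obtain e where e: "c * a - u * e \<in> I" "\<And>p. p \<in> homog (?t - i - k) \<Longrightarrow> \<mu> (p * a) = G.sigma (p * (g * e))"
          using low[OF pa(2,3)] by blast
        have "c * (p * a) - u * (p * e) \<in> I" using idl.subspace_scale[OF Is e(1), of p] by (simp add: right_diff_distrib mult_ac)
        from beta[OF this] have "\<beta> c x = G.sigma (g * (p * e))" by (simp only: pa(1))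
        then have "\<mu> x = \<beta> c x" using e(2)[OF pa(4)] by (simp add: pa(1) mult.left_commute)
        moreover have "x \<in> V" using pa idl.subspace_scale[OF Js] homog_mult[OF pa(4), of a k] by (auto simp: V_def)
        ultimately show "x \<in> U" by (simp add: U_def)
      qed
      moreover have "I \<inter> homog (?t - i) \<subseteq> U"
        using IW mW bI WV by (auto simp: U_def)
      ultimately have "kv.span ({p * a | p a k. k \<le> E1 \<and> a \<in> J \<inter> homog k \<and> p \<in> homog ((?t - i) - k)} \<union> (I \<inter> homog (?t - i))) \<subseteq> U"
        by (intro kv.span_minimal U) blast
      then show ?thesis using gen[of "?t - i"] x by (auto simp: U_def V_def)
    qed
    then show "\<exists>c\<in>C. \<forall>x\<in>V. \<mu> x = \<beta> c x" using cC by blast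
  qed
  then show ?thesis unfolding C_def .
qed

end

text \<open>The ideal \<open>I\<close> is generated by the entries \<open>D 0 0 k\<close> of the
  first differential, whose degrees are the finitely many \<open>e 1 k\<close>. The \<open>0\<close>
  inserted into the maximum covers the case without generators.\<close>

lemma (in resolution) I_bounded:
  "\<exists>E. \<forall>J y. idl.subspace J \<longrightarrow> (\<forall>l i. l \<le> E \<longrightarrow> i \<in> I \<inter> homog l \<longrightarrow> i * y \<in> J) \<longrightarrow> (\<forall>i\<in>I. i * y \<in> J)"
proof -
  define E where "E = Max (insert 0 (e 1 ` {..<r 1}))"
  have Eb: "e 1 k \<le> E" if "k < r 1" for k unfolding E_def using that by (intro Max_ge) auto
  have DI: "D 0 0 k \<in> I \<inter> homog (e 1 k)" if k: "k < r 1" for k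
  proof -
    let ?u = "\<lambda>l. if l = k then 1 else 0 :: ('n, 'k) mpoly"
    have "matrix_apply (r 0) (r 1) (D 0) ?u 0 \<in> I"
      unfolding I_image[symmetric] using k by (intro imageI) (auto simp: free_vectors_def)
    also have "matrix_apply (r 0) (r 1) (D 0) ?u 0 = (\<Sum>l<r 1. D 0 0 l * ?u l)"
      unfolding matrix_apply_def r0 by (rule if_P) simp
    also have "\<dots> = (\<Sum>l<r 1. if l = k then D 0 0 k else 0)"
      by (rule sum.cong) auto
    also have "\<dots> = D 0 0 k" using k by simp
    finally show ?thesis using D_homog[of 0 0 k] k by (simp add: r0 e0)
  qed
  have "i * y \<in> J" if J: "idl.subspace J" and h: "\<And>l i. l \<le> E \<Longrightarrow> i \<in> I \<inter> homog l \<Longrightarrow> i * y \<in> J" and i: "i \<in> I" for J y i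
  proof -
    from i I_image obtain v where "i = matrix_apply (r 0) (r 1) (D 0) v 0" by blast
    then have "i = (\<Sum>l<r 1. D 0 0 l * v l)" by (simp add: matrix_apply_def r0)
    then have "i * y = (\<Sum>l<r 1. v l * (D 0 0 l * y))" by (simp add: sum_distrib_right sum_distrib_left mult_ac)
    also have "\<dots> \<in> J"
    proof (rule idl.subspace_sum[OF J], rule idl.subspace_scale[OF J])
      fix l assume "l \<in> {..<r 1}"
      then have l: "l < r 1" by blast
      show "D 0 0 l * y \<in> J" by (rule h[OF Eb[OF l] DI[OF l]])
    qed
    finally show ?thesis .
  qed
  then show ?thesis by blast
qed

lemma (in monic_family) regular_pideal:
  assumes res: "resolution I r e Df" and fI: "\<And>i. i \<in> set xs \<Longrightarrow> f i \<in> I"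
  shows "distinct xs \<Longrightarrow> set xs \<inter> B = {} \<Longrightarrow> resolution.regular_on I (pideal B (\<lambda>_. 1)) (map f xs)"
  using fI
proof (induction xs arbitrary: B)
  case Nil
  then show ?case using resolution.regular_on.simps(1)[OF res] by simp
next
  case (Cons x xs)
  have ins: "idl.span (insert (f x) (pideal B (\<lambda>_. 1))) = pideal (insert x B) (\<lambda>_. 1)"
  proof
    have "insert (f x) (pideal B (\<lambda>_. 1)) \<subseteq> pideal (insert x B) (\<lambda>_. 1)"
      using pideal_mono[of B "insert x B" "\<lambda>_. 1"] by (auto simp: pideal_def intro: idl.span_base)
    then show "idl.span (insert (f x) (pideal B (\<lambda>_. 1))) \<subseteq> pideal (insert x B) (\<lambda>_. 1)"
      by (intro idl.span_minimal subspace_pideal)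
    have "(\<lambda>j. f j ^ 1) ` insert x B \<subseteq> idl.span (insert (f x) (pideal B (\<lambda>_. 1)))"
      by (auto simp: pideal_def intro!: idl.span_base)
    then show "pideal (insert x B) (\<lambda>_. 1) \<subseteq> idl.span (insert (f x) (pideal B (\<lambda>_. 1)))"
      unfolding pideal_def by (intro idl.span_minimal) (auto simp: pideal_def)
  qed
  have "resolution.regular_on I (pideal (insert x B) (\<lambda>_. 1)) (map f xs)"
    using Cons.prems by (intro Cons.IH) auto
  moreover have "p \<in> pideal B (\<lambda>_. 1)" if "f x * p \<in> pideal B (\<lambda>_. 1)" for p
    using pideal_regular[of x B 1 p "\<lambda>_. 1"] that Cons.prems by simp
  ultimately show ?case
    using Cons.prems f_homog[of x] ins resolution.regular_on.simps(2)[OF res] by auto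
qed

text \<open>By \<open>Y_spans\<close>, in degree \<open>m (d - 1) + 1\<close> the power of each
  variable lies in \<open>(Y0, Y1)\<close> modulo \<open>I\<close>; subtracting that combination
  gives forms of \<open>I\<close> that are monic in the complementary variables. The generator of
  Ext descends along them to index zero.\<close>

lemma (in free_curve) linked_curve_exists:
  assumes res: "resolution I r e Df" and gen: "resolution.generator I r e Df {0} (card (UNIV :: 'n set) - 2) v"
  shows "\<exists>i0 i1 M f g \<gamma> E sdeg. linked_curve I Y0 Y1 b d m i0 i1 M f g \<gamma> E sdeg"
proof -
  obtain i0 i1 where i01: "i0 \<noteq> i1" and lin: "\<And>j. \<exists>c d e. Var j = Const c * Y0 + Const d * Y1 + (\<Sum>i\<in>-{i0,i1}. Const (e i) * Var i)"
    using coordinates by blast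
  define M where "M = Suc (m (d - 1))"
  have "\<forall>i. \<exists>xy. fst xy \<in> homog (int M - 1) \<and> snd xy \<in> homog (int M - 1) \<and> Var i ^ M - Y0 * fst xy - Y1 * snd xy \<in> I"
  proof
    fix i
    have "(Var i ^ M :: ('n, 'k) mpoly) \<in> homog (int M)" using homog_power[OF homog_Var, of i M] by simp
    from Y_spans[OF this] obtain x y where "x \<in> homog (int M - 1)" "y \<in> homog (int M - 1)" "Var i ^ M - Y0 * x - Y1 * y \<in> I"
      by (auto simp: M_def)
    then show "\<exists>xy. fst xy \<in> homog (int M - 1) \<and> snd xy \<in> homog (int M - 1) \<and> Var i ^ M - Y0 * fst xy - Y1 * snd xy \<in> I"
      by (intro exI[of _ "(x, y)"]) simp
  qed
  from choice[OF this] obtain w where w: "\<forall>i. fst (w i) \<in> homog (int M - 1) \<and> snd (w i) \<in> homog (int M - 1) \<and> Var i ^ M - Y0 * fst (w i) - Y1 * snd (w i) \<in> I" ..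
  define f where "f i = (if i = i0 then Y0 else if i = i1 then Y1 else Var i ^ M - Y0 * fst (w i) - Y1 * snd (w i))" for i
  have f0: "f i0 = Y0" and f1: "f i1 = Y1" using i01 by (auto simp: f_def)
  have mf: "monic_family i0 i1 M f"
  proof
    show "\<exists>a\<in>homog (int M - 1). \<exists>b\<in>homog (int M - 1). f i = Var i ^ M + f i0 * a + f i1 * b" if "i \<noteq> i0" "i \<noteq> i1" for i
      using w that unfolding f0 f1
      by (intro bexI[of _ "- fst (w i)"] bexI[of _ "- snd (w i)"]) (auto simp: f_def homog_uminus)
    show "\<exists>c d e. Var j = Const c * f i0 + Const d * f i1 + (\<Sum>i\<in>-{i0,i1}. Const (e i) * Var i)" for j
      unfolding f0 f1 by (rule lin)
  qed (use i01 Y0 Y1 in \<open>simp_all add: f0 f1 M_def\<close>)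
  interpret F: monic_family i0 i1 M f by (rule mf)
  interpret P: resolution I r e Df by (rule res)
  have fI: "f i \<in> I" if "i \<noteq> i0" "i \<noteq> i1" for i using that w by (simp add: f_def)
  obtain xs where xs: "set xs = -{i0,i1}" "distinct xs" using finite_distinct_list[of "-{i0,i1}"] by auto
  have "card {i0, i1} = 2" using i01 by simp
  then have len: "length xs = card (UNIV :: 'n set) - 2"
    using xs by (metis Compl_eq_Diff_UNIV card_Diff_subset distinct_card finite subset_UNIV)
  have p0: "F.pideal {} (\<lambda>_. 1) = {0}" by (simp add: F.pideal_def)
  have reg: "P.regular_on {0} (map f xs)"
    using F.regular_pideal[OF res, of xs "{}"] fI xs p0 by auto
  have h0: "hideal ({0} :: ('n, 'k) mpoly set)" using F.hideal_pideal[of "{}" "\<lambda>_. 1"] unfolding p0 .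
  obtain w' where w': "P.generator (idl.span ({0} \<union> set (map f xs))) 0 w'"
    using P.generator_descend[OF h0 reg, of v] gen len by auto
  have "idl.span ({0} \<union> set (map f xs)) = F.pideal (-{i0,i1}) (\<lambda>_. 1)"
  proof -
    have "idl.span ({0} \<union> X) = idl.span X" for X :: "('n, 'k) mpoly set"
      using idl.span_zero[of X] idl.span_base[of _ X] idl.span_mono[of X "{0} \<union> X"]
      by (intro equalityI idl.span_minimal) auto
    then show ?thesis by (simp add: F.pideal_def xs(1))
  qed
  with w' P.generator_0 obtain \<gamma> g where g: "g \<in> homog \<gamma>"
    "\<forall>u. (\<forall>i\<in>I. i * u \<in> F.pideal (-{i0,i1}) (\<lambda>_. 1)) \<longrightarrow> (\<exists>p. u - p * g \<in> F.pideal (-{i0,i1}) (\<lambda>_. 1))"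
    "\<forall>p. p * g \<in> F.pideal (-{i0,i1}) (\<lambda>_. 1) \<longleftrightarrow> p \<in> I" by metis
  obtain E where E: "\<forall>J y. idl.subspace J \<longrightarrow> (\<forall>l i. l \<le> E \<longrightarrow> i \<in> I \<inter> homog l \<longrightarrow> i * y \<in> J) \<longrightarrow> (\<forall>i\<in>I. i * y \<in> J)"
    using P.I_bounded by blast
  have "linked_curve I Y0 Y1 b d m i0 i1 M f g \<gamma> E (\<lambda>N. (int (card (UNIV :: 'n set)) - 2) * (int M - 1) + 2 * (int N - 1))"
  proof (intro linked_curve.intro linked_curve_axioms.intro)
    show "free_curve I Y0 Y1 b d m" by (rule free_curve_axioms)
    show "monic_family i0 i1 M f" by (rule mf)
    fix u assume "\<And>i. i \<in> I \<Longrightarrow> i * u \<in> F.pideal (-{i0,i1}) (\<lambda>_. 1)"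
    then show "\<exists>p. u - p * g \<in> F.pideal (-{i0,i1}) (\<lambda>_. 1)" using g(2) by blast
  next
    show "p * g \<in> F.pideal (-{i0,i1}) (\<lambda>_. 1) \<longleftrightarrow> p \<in> I" for p using g(3) by blast
  next
    fix J y i assume "idl.subspace J" "\<And>l i. l \<le> E \<Longrightarrow> i \<in> I \<inter> homog l \<Longrightarrow> i * y \<in> J" "i \<in> I"
    then show "i * y \<in> J" using E by blast
  qed (use f0 f1 fI g(1) in auto)
  then show ?thesis by blast
qed

section \<open>Hilbert functions and the dimension of the space of numerators\<close>

context linked_curve
begin

text \<open>The Hilbert function of \<open>J/I\<close> when \<open>J\<close> contains
  \<open>I\<close>; for \<open>J = UNIV\<close> it is that of the coordinate ring.\<close>

definition h :: "('n, 'k) mpoly set \<Rightarrow> int \<Rightarrow> int" where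
  "h J l = int (hilbert_fun I l) - int (hilbert_fun J l)"

lemma subspace_graded: "idl.subspace J \<Longrightarrow> kv.subspace (J \<inter> homog l)"
  by (intro kv.subspace_inter ideal_kv_subspace subspace_homog)

lemma qdim_graded:
  assumes J: "idl.subspace J" "I \<subseteq> J"
  shows "\<exists>k. kv.qdim (J \<inter> homog l) (I \<inter> homog l) k \<and> int k = h J l"
proof -
  obtain k where k: "kv.qdim (J \<inter> homog l) (I \<inter> homog l) k"
    using qdim_homog_exists[OF subspace_graded[OF J(1)] subspace_graded[OF Is], of l l] by auto
  from kv.qdim_diff[OF subspace_homog subspace_graded[OF J(1)] subspace_graded[OF Is] _ _ k qdim_hilbert_fun[OF Is]]
  have d: "k \<le> hilbert_fun I l \<and> kv.qdim (homog l) (J \<inter> homog l) (hilbert_fun I l - k)" using J(2) by auto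
  then have "hilbert_fun I l - k = hilbert_fun J l"
    using qdim_hilbert_fun[OF J(1), of l] kv.qdim_unique[OF subspace_graded[OF J(1)]] by blast
  then show ?thesis using k d by (auto simp: h_def)
qed

text \<open>A Koszul count: modulo \<open>I\<close>, \<open>Y0^N J\<close> has dimension
  \<open>h J (l - N)\<close> in degree \<open>l\<close>, and adding \<open>Y1^N J\<close>
  contributes \<open>h J (l - N)\<close> minus the overlap. The overlap is
  \<open>Y0^N Y1^N J\<close>, because \<open>Y0 ^ N\<close>, \<open>Y1 ^ N\<close> is a regular
  sequence and \<open>sat\<close> holds.\<close>

lemma filt_dim:
  assumes J: "hideal J" "I \<subseteq> J" and sat: "\<And>z. Y0 ^ N * z \<in> J \<Longrightarrow> Y1 ^ N * z \<in> J \<Longrightarrow> z \<in> J"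
    and q: "kv.qdim (J \<inter> homog l) (filt N J l) n"
  shows "int n = h J l - 2 * h J (l - int N) + h J (l - 2 * int N)"
proof -
  have Js: "idl.subspace J" using J(1) by (rule hideal_subspace)
  define W1 where "W1 l = {x \<in> homog l. \<exists>y\<in>J. x - Y0 ^ N * y \<in> I}" for l
  have YN: "Y0 ^ N \<in> homog (int N)" "Y1 ^ N \<in> homog (int N)" using homog_power[OF Y0, of N] homog_power[OF Y1, of N] by auto
  have sW1: "kv.subspace (W1 l)" for l
    unfolding kv.subspace_def
  proof (intro conjI ballI allI)
    show "0 \<in> W1 l" unfolding W1_def using idl.subspace_0[OF Js] idl.subspace_0[OF Is] by (auto intro!: bexI[of _ 0])
    fix x assume "x \<in> W1 l"
    then obtain y where x: "x \<in> homog l" "y \<in> J" "x - Y0 ^ N * y \<in> I" by (auto simp: W1_def)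
    {
      fix x' assume "x' \<in> W1 l"
      then obtain y' where x': "x' \<in> homog l" "y' \<in> J" "x' - Y0 ^ N * y' \<in> I" by (auto simp: W1_def)
      have "(x + x') - Y0 ^ N * (y + y') \<in> I" using idl.subspace_add[OF Is x(3) x'(3)] by (simp add: algebra_simps)
      then show "x + x' \<in> W1 l" unfolding W1_def using x x' idl.subspace_add[OF Js] homog_add by blast
    next
      fix c
      have "Const c * x - Y0 ^ N * (Const c * y) \<in> I"
        using idl.subspace_scale[OF Is x(3), of "Const c"] by (simp add: right_diff_distrib mult.left_commute)
      then show "Const c * x \<in> W1 l" unfolding W1_def using x idl.subspace_scale[OF Js] homog_Const_mult by blast
    }
  qed
  have sK: "kv.subspace (I \<inter> homog l)" for l by (rule subspace_graded[OF Is])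
  have sJ: "kv.subspace (J \<inter> homog l)" for l by (rule subspace_graded[OF Js])
  have sF: "kv.subspace (filt N J l)" for l by (rule subspace_filt[OF Js])
  have KW1: "I \<inter> homog l \<subseteq> W1 l" for l
    unfolding W1_def using idl.subspace_0[OF Js] by (auto intro!: bexI[of _ 0])
  have W1F: "W1 l \<subseteq> filt N J l" for l
  proof
    fix x assume "x \<in> W1 l"
    then obtain y where "x \<in> homog l" "y \<in> J" "x - Y0 ^ N * y - Y1 ^ N * 0 \<in> I" by (auto simp: W1_def)
    then show "x \<in> filt N J l" unfolding filt_def using idl.subspace_0[OF Js] by blast
  qed
  have W1J: "W1 l \<subseteq> J \<inter> homog l" for l
  proof
    fix x assume "x \<in> W1 l"
    then obtain y where x: "x \<in> homog l" "y \<in> J" "x - Y0 ^ N * y \<in> I" by (auto simp: W1_def)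
    have "(x - Y0 ^ N * y) + Y0 ^ N * y \<in> J" using x J(2) by (intro idl.subspace_add[OF Js] idl.subspace_scale[OF Js]) auto
    then show "x \<in> J \<inter> homog l" using x(1) by simp
  qed
  have FJ: "filt N J l \<subseteq> J \<inter> homog l" for l
  proof
    fix x assume "x \<in> filt N J l"
    then obtain y z where x: "x \<in> homog l" "y \<in> J" "z \<in> J" "x - Y0 ^ N * y - Y1 ^ N * z \<in> I" by (auto simp: filt_def)
    have "(x - Y0 ^ N * y - Y1 ^ N * z) + Y0 ^ N * y + Y1 ^ N * z \<in> J"
      using x J(2) by (intro idl.subspace_add[OF Js] idl.subspace_scale[OF Js]) auto
    then show "x \<in> J \<inter> homog l" using x(1) by simp
  qed
  have d1: "\<exists>k. kv.qdim (W1 l) (I \<inter> homog l) k \<and> int k = h J (l - int N)" for l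
  proof -
    obtain k where k: "kv.qdim (J \<inter> homog (l - int N)) (I \<inter> homog (l - int N)) k" "int k = h J (l - int N)"
      using qdim_graded[OF Js J(2)] by blast
    have "kv.qdim (W1 l) (I \<inter> homog l) k"
    proof (rule kv.qdim_image[OF k(1), of "\<lambda>x. Y0 ^ N * x"])
      show "kv.subspace (J \<inter> homog (l - int N))" by (rule sJ)
      show "kv.subspace (I \<inter> homog l)" by (rule sK)
      fix x assume x: "x \<in> J \<inter> homog (l - int N)"
      then have xh: "Y0 ^ N * x \<in> homog l" by (intro homog_mult'[OF YN(1), of x "l - int N"]) auto
      then show "Y0 ^ N * x \<in> W1 l" unfolding W1_def using x idl.subspace_0[OF Is] by (auto intro!: bexI[of _ x])
      show "Y0 ^ N * x \<in> I \<inter> homog l \<longleftrightarrow> x \<in> I \<inter> homog (l - int N)"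
        using xh x Y_power_regular(1) idl.subspace_scale[OF Is] by blast
    next
      fix x assume "x \<in> W1 l"
      then obtain y where x: "x \<in> homog l" "y \<in> J" "x - Y0 ^ N * y \<in> I" by (auto simp: W1_def)
      have "hc l (x - Y0 ^ N * y) \<in> I" by (rule hideal_hc[OF I x(3)])
      then have "x - Y0 ^ N * hc (l - int N) y \<in> I" using hc_mult[OF YN(1), of l y] hc_id[OF x(1)] by (simp add: hc_diff)
      moreover have "x - Y0 ^ N * hc (l - int N) y \<in> homog l"
        by (intro homog_diff x homog_mult'[OF YN(1) hc_homog]) simp
      ultimately show "\<exists>v\<in>J \<inter> homog (l - int N). x - Y0 ^ N * v \<in> I \<inter> homog l"
        using hideal_hc[OF J(1) x(2)] hc_homog by blast
    qed (simp_all add: sum_distrib_left mult.left_commute right_diff_distrib kv.subspace_0[OF sK] idl.subspace_0[OF Is])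
    then show ?thesis using k(2) by blast
  qed
  obtain a where a: "kv.qdim (W1 l) (I \<inter> homog l) a" "int a = h J (l - int N)" using d1 by blast
  obtain a' where a': "kv.qdim (W1 (l - int N)) (I \<inter> homog (l - int N)) a'" "int a' = h J (l - 2 * int N)"
    using d1[of "l - int N"] by auto
  obtain k where k: "kv.qdim (J \<inter> homog (l - int N)) (I \<inter> homog (l - int N)) k" "int k = h J (l - int N)"
    using qdim_graded[OF Js J(2)] by blast
  have ka: "a' \<le> k \<and> kv.qdim (J \<inter> homog (l - int N)) (W1 (l - int N)) (k - a')"
    by (rule kv.qdim_diff[OF sJ sW1 sK KW1 W1J a'(1) k(1)])
  have F: "kv.qdim (filt N J l) (W1 l) (k - a')"
  proof (rule kv.qdim_image[OF conjunct2[OF ka], of "\<lambda>x. Y1 ^ N * x"])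
    show "kv.subspace (J \<inter> homog (l - int N))" by (rule sJ)
    show "kv.subspace (W1 l)" by (rule sW1)
    fix x assume x: "x \<in> J \<inter> homog (l - int N)"
    then have xh: "Y1 ^ N * x \<in> homog l" by (intro homog_mult'[OF YN(2), of x "l - int N"]) auto
    have "Y1 ^ N * x - Y0 ^ N * 0 - Y1 ^ N * x \<in> I" using idl.subspace_0[OF Is] by simp
    then show "Y1 ^ N * x \<in> filt N J l" unfolding filt_def using x xh idl.subspace_0[OF Js] by blast
    show "Y1 ^ N * x \<in> W1 l \<longleftrightarrow> x \<in> W1 (l - int N)"
    proof
      assume "x \<in> W1 (l - int N)"
      then obtain y where y: "y \<in> J" "x - Y0 ^ N * y \<in> I" by (auto simp: W1_def)
      have "Y1 ^ N * (x - Y0 ^ N * y) \<in> I" by (rule idl.subspace_scale[OF Is y(2)])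
      then have "Y1 ^ N * x - Y0 ^ N * (Y1 ^ N * y) \<in> I" by (simp add: right_diff_distrib mult.left_commute)
      then show "Y1 ^ N * x \<in> W1 l" unfolding W1_def using xh idl.subspace_scale[OF Js y(1)] by blast
    next
      assume "Y1 ^ N * x \<in> W1 l"
      then obtain y where y: "y \<in> J" "Y1 ^ N * x - Y0 ^ N * y \<in> I" by (auto simp: W1_def)
      have "hc l (Y1 ^ N * x - Y0 ^ N * y) \<in> I" by (rule hideal_hc[OF I y(2)])
      then have y': "Y1 ^ N * x - Y0 ^ N * hc (l - int N) y \<in> I" using hc_mult[OF YN(1), of l y] hc_id[OF xh] by (simp add: hc_diff)
      have yJ: "hc (l - int N) y \<in> J" by (rule hideal_hc[OF J(1) y(1)])
      \<comment> \<open>Regularity of the sequence gives \<open>x = Y0 ^ N z\<close> modulo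
        \<open>I\<close>; both \<open>Y0 ^ N z\<close> and \<open>Y1 ^ N z\<close> turn out to lie
        in \<open>J\<close>, so \<open>sat\<close> puts \<open>z\<close> there as well.\<close>
      obtain z where z: "x - Y0 ^ N * z \<in> I" using Y_division[OF _ hc_homog y', of "l - int N"] x by blast
      have xJ: "x \<in> J" and zJ: "x - Y0 ^ N * z \<in> J" using x z J(2) by blast+
      have "x - (x - Y0 ^ N * z) \<in> J" by (rule idl.subspace_diff[OF Js xJ zJ])
      then have z0: "Y0 ^ N * z \<in> J" by simp
      have "Y1 ^ N * (x - Y0 ^ N * z) - (Y1 ^ N * x - Y0 ^ N * hc (l - int N) y) \<in> I"
        by (intro idl.subspace_diff[OF Is] idl.subspace_scale[OF Is] z y')
      then have "Y0 ^ N * (hc (l - int N) y - Y1 ^ N * z) \<in> I" by (simp add: algebra_simps)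
      then have "hc (l - int N) y - Y1 ^ N * z \<in> I" by (rule Y_power_regular(1))
      then have "hc (l - int N) y - Y1 ^ N * z \<in> J" by (rule subsetD[OF J(2)])
      then have "hc (l - int N) y - (hc (l - int N) y - Y1 ^ N * z) \<in> J" by (rule idl.subspace_diff[OF Js yJ])
      then have "Y1 ^ N * z \<in> J" by simp
      then have "z \<in> J" using sat z0 by blast
      then show "x \<in> W1 (l - int N)" unfolding W1_def using z x by blast
    qed
  next
    fix x assume "x \<in> filt N J l"
    then obtain y z where x: "x \<in> homog l" "y \<in> J" "z \<in> J" "x - Y0 ^ N * y - Y1 ^ N * z \<in> I" by (auto simp: filt_def)
    let ?z = "hc (l - int N) z"
    have "hc l (x - Y0 ^ N * y - Y1 ^ N * z) \<in> I" by (rule hideal_hc[OF I x(4)])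
    then have "x - Y0 ^ N * hc (l - int N) y - Y1 ^ N * ?z \<in> I"
      using hc_mult[OF YN(1), of l y] hc_mult[OF YN(2), of l z] hc_id[OF x(1)] by (simp add: hc_diff)
    then have "(x - Y1 ^ N * ?z) - Y0 ^ N * hc (l - int N) y \<in> I" by (simp add: algebra_simps)
    moreover have "x - Y1 ^ N * ?z \<in> homog l" by (intro homog_diff x homog_mult'[OF YN(2) hc_homog]) simp
    ultimately have "x - Y1 ^ N * ?z \<in> W1 l" unfolding W1_def using hideal_hc[OF J(1) x(2)] by blast
    then show "\<exists>v\<in>J \<inter> homog (l - int N). x - Y1 ^ N * v \<in> W1 l"
      using hideal_hc[OF J(1) x(3)] hc_homog by blast
  qed (simp_all add: sum_distrib_left mult.left_commute right_diff_distrib kv.subspace_0[OF sW1])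
  obtain t where t: "kv.qdim (J \<inter> homog l) (I \<inter> homog l) t" "int t = h J l" using qdim_graded[OF Js J(2)] by blast
  have "kv.qdim (filt N J l) (I \<inter> homog l) (a + (k - a'))"
    by (rule kv.qdim_add[OF sF sW1 sK KW1 W1F a(1) F])
  from kv.qdim_diff[OF sJ sF sK order_trans[OF KW1 W1F] FJ this t(1)]
  have "a + (k - a') \<le> t" "kv.qdim (J \<inter> homog l) (filt N J l) (t - (a + (k - a')))" by auto
  moreover from this(2) q have "n = t - (a + (k - a'))" by (rule kv.qdim_unique[OF sF, rotated])
  ultimately show ?thesis using a(2) a'(2) k(2) t(2) ka by linarith
qed

lemma filt_dim_exists:
  assumes J: "hideal J" "I \<subseteq> J" and sat: "\<And>z. Y0 ^ N * z \<in> J \<Longrightarrow> Y1 ^ N * z \<in> J \<Longrightarrow> z \<in> J"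
  shows "\<exists>n. kv.qdim (J \<inter> homog l) (filt N J l) n \<and> int n = h J l - 2 * h J (l - int N) + h J (l - 2 * int N)"
  using qdim_homog_exists[OF subspace_graded[OF hideal_subspace[OF J(1)]] subspace_filt[OF hideal_subspace[OF J(1)]], of l l N l]
    filt_dim[OF J sat] by blast

text \<open>By \<open>Y_spans\<close> the forms of degree above \<open>m (d - 1)\<close> lie in
  \<open>(Y0, Y1)\<close> modulo \<open>I\<close>. So if \<open>Y0 z\<close> and \<open>Y1 z\<close>
  lie in \<open>J\<close>, all forms of high degree multiply \<open>z\<close> into \<open>J\<close>,
  and saturation brings this down to degree \<open>0\<close>. Higher powers are lowered one exponent
  at a time.\<close>

lemma saturated_Y_powers:
  assumes J: "idl.subspace J" "I \<subseteq> J" and sat: "saturated J"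
  shows "Y0 ^ a * z \<in> J \<Longrightarrow> Y1 ^ c * z \<in> J \<Longrightarrow> z \<in> J"
proof -
  have base: "z \<in> J" if z: "Y0 * z \<in> J" "Y1 * z \<in> J" for z
  proof -
    have high: "p * z \<in> J" if p: "p \<in> homog (int l)" and l: "l > m (d - 1)" for p l
    proof -
      obtain x y where xy: "p - Y0 * x - Y1 * y \<in> I" using Y_spans[OF p] l by auto
      have "z * (p - Y0 * x - Y1 * y) + x * (Y0 * z) + y * (Y1 * z) \<in> J"
        using xy J(2) by (intro idl.subspace_add[OF J(1)] idl.subspace_scale[OF J(1)] z) auto
      then show ?thesis by (simp add: algebra_simps)
    qed
    have "\<forall>p\<in>homog (int l). p * z \<in> J" if "l \<le> Suc (m (d - 1))" for l
      using that
    proof (induction rule: inc_induct)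
      case base
      show ?case using high[of _ "Suc (m (d - 1))"] by blast
    next
      case (step n)
      show ?case
      proof
        fix p :: "('n, 'k) mpoly" assume p: "p \<in> homog (int n)"
        have "Var i * (p * z) \<in> J" for i
        proof -
          have "Var i * p \<in> homog (int (Suc n))" using homog_mult[OF homog_Var p, of i] by simp
          then have "(Var i * p) * z \<in> J" using step.IH by blast
          then show ?thesis by (simp add: mult.assoc)
        qed
        then show "p * z \<in> J" using sat by (auto simp: saturated_def)
      qed
    qed
    from this[of 0] have "1 * z \<in> J" by (metis homog_1 le0 of_nat_0)
    then show ?thesis by simp
  qed
  show "Y0 ^ a * z \<in> J \<Longrightarrow> Y1 ^ c * z \<in> J \<Longrightarrow> z \<in> J"
  proof (induction "a + c" arbitrary: a c z rule: less_induct)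
    case less
    consider "a = 0 \<or> c = 0" | "a > 1" "c > 0" | "a = 1" "c > 1" | "a = 1" "c = 1" by linarith
    then show ?case
    proof cases
      case 1
      then show ?thesis using less.prems by auto
    next
      case 2
      then obtain a' where a': "a = Suc a'" "a' > 0" by (cases a) auto
      have "Y0 ^ a' * (Y0 * z) \<in> J" using less.prems(1) a' by (simp add: mult_ac)
      moreover have "Y1 ^ c * (Y0 * z) \<in> J" using idl.subspace_scale[OF J(1) less.prems(2), of Y0] by (simp add: mult.left_commute)
      ultimately have z0: "Y0 * z \<in> J" using less.hyps[of a' c "Y0 * z"] a' by simp
      have "Y0 ^ 1 * z \<in> J" using z0 by simp
      then show ?thesis using less.hyps[of 1 c z] less.prems(2) 2 by simp
    next
      case 3
      then obtain c' where c': "c = Suc c'" "c' > 0" by (cases c) auto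
      have "Y1 ^ c' * (Y1 * z) \<in> J" using less.prems(2) c' by (simp add: mult_ac)
      moreover have "Y0 ^ a * (Y1 * z) \<in> J" using idl.subspace_scale[OF J(1) less.prems(1), of Y1] by (simp add: mult.left_commute)
      ultimately have z0: "Y1 * z \<in> J" using less.hyps[of a c' "Y1 * z"] c' by simp
      then show ?thesis using base less.prems(1) 3 by simp
    next
      case 4
      then show ?thesis using base less.prems by simp
    qed
  qed
qed

text \<open>The hypothesis \<open>st\<close> says that above degree \<open>E1\<close> every form of
  \<open>J\<close> arises, modulo \<open>I\<close>, from forms of \<open>J\<close> one degree lower
  by multiplication with \<open>Y0\<close> and \<open>Y1\<close>; induction on the degree leads down
  to \<open>E1\<close>.\<close>

lemma generated_low:
  assumes J: "hideal J" "I \<subseteq> J" and st: "\<And>l. l > E1 \<Longrightarrow> J \<inter> homog l \<subseteq> filt 1 J l"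
  shows "J \<inter> homog l \<subseteq> kv.span ({p * a | p a k. k \<le> E1 \<and> a \<in> J \<inter> homog k \<and> p \<in> homog (l - k)} \<union> (I \<inter> homog l))"
proof (induction "nat (l - E1)" arbitrary: l)
  case 0
  show ?case
  proof
    fix x assume x: "x \<in> J \<inter> homog l"
    have "1 * x \<in> {p * a | p a k. k \<le> E1 \<and> a \<in> J \<inter> homog k \<and> p \<in> homog (l - k)}"
      using x 0 by (intro CollectI exI[of _ 1] exI[of _ x] exI[of _ l]) auto
    then show "x \<in> kv.span ({p * a | p a k. k \<le> E1 \<and> a \<in> J \<inter> homog k \<and> p \<in> homog (l - k)} \<union> (I \<inter> homog l))"
      by (intro kv.span_base) simp
  qed
next
  case (Suc n)
  let ?G = "\<lambda>l. {p * a | p a k. k \<le> E1 \<and> a \<in> J \<inter> homog k \<and> p \<in> homog (l - k)} \<union> (I \<inter> homog l)"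
  have IH: "J \<inter> homog (l - 1) \<subseteq> kv.span (?G (l - 1))" using Suc.hyps(2) by (intro Suc.hyps(1)) simp
  have up: "Y * x \<in> kv.span (?G l)" if Y: "Y \<in> homog 1" and x: "x \<in> kv.span (?G (l - 1))" for Y x
    using x
  proof (induction rule: kv.span_induct_alt)
    case base
    have "0 \<in> kv.span (?G l)" by (rule kv.span_zero)
    then show ?case by simp
  next
    case (step c x y)
    have "Y * x \<in> ?G l"
    proof (cases "x \<in> I \<inter> homog (l - 1)")
      case True
      then show ?thesis using idl.subspace_scale[OF Is] homog_mult'[OF Y, of x "l - 1" l] by auto
    next
      case False
      then obtain p a k where pa: "x = p * a" "k \<le> E1" "a \<in> J \<inter> homog k" "p \<in> homog (l - 1 - k)" using step(1) by blast
      have "Y * p \<in> homog (l - k)" by (rule homog_mult'[OF Y pa(4)]) simp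
      moreover have "Y * x = (Y * p) * a" by (simp add: pa(1) mult.assoc)
      ultimately show ?thesis using pa(2,3) by blast
    qed
    then have a: "Y * x \<in> kv.span (?G l)" by (rule kv.span_base)
    have "Const c * (Y * x) + Y * y \<in> kv.span (?G l)"
      by (rule kv.span_add[OF kv.span_scale[OF a]]) (use step in blast)
    then show ?case by (simp add: distrib_left mult.left_commute)
  qed
  show ?case
  proof
    fix x assume "x \<in> J \<inter> homog l"
    moreover have "l > E1" using Suc.hyps(2) by simp
    ultimately have xl: "x \<in> homog l" and "x \<in> filt 1 J l" using st by blast+
    then obtain y z where x: "y \<in> J" "z \<in> J" "x - Y0 ^ 1 * y - Y1 ^ 1 * z \<in> I" by (auto simp: filt_def)
    have "hc l (x - Y0 * y - Y1 * z) \<in> I" by (rule hideal_hc[OF I]) (use x(3) in simp)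
    then have i: "x - Y0 * hc (l - 1) y - Y1 * hc (l - 1) z \<in> I"
      using hc_mult[OF Y0, of l y] hc_mult[OF Y1, of l z] hc_id[OF xl] by (simp add: hc_diff)
    have "x - Y0 * hc (l - 1) y - Y1 * hc (l - 1) z \<in> homog l"
      by (intro homog_diff xl homog_mult'[OF Y0 hc_homog] homog_mult'[OF Y1 hc_homog]) simp_all
    with i have "x - Y0 * hc (l - 1) y - Y1 * hc (l - 1) z \<in> kv.span (?G l)" by (intro kv.span_base) simp
    moreover have "hc (l - 1) y \<in> kv.span (?G (l - 1))" "hc (l - 1) z \<in> kv.span (?G (l - 1))"
      using IH hideal_hc[OF J(1) x(1), of "l - 1"] hideal_hc[OF J(1) x(2), of "l - 1"] hc_homog by blast+
    then have "Y0 * hc (l - 1) y \<in> kv.span (?G l)" "Y1 * hc (l - 1) z \<in> kv.span (?G l)"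
      using up[OF Y0] up[OF Y1] by blast+
    ultimately have "(x - Y0 * hc (l - 1) y - Y1 * hc (l - 1) z) + Y0 * hc (l - 1) y + Y1 * hc (l - 1) z \<in> kv.span (?G l)"
      by (intro kv.span_add)
    then show "x \<in> kv.span (?G l)" by simp
  qed
qed

lemma hilbert_fun_UNIV: "hilbert_fun (UNIV :: ('n, 'k) mpoly set) l = 0"
proof -
  have "kv.qbasis (homog l) ((UNIV :: ('n, 'k) mpoly set) \<inter> homog l) ({} :: nat set) (\<lambda>_. 0)"
    by (auto simp: kv.qbasis_def kv.indep_mod_def kv.spans_mod_def)
  from kv.qdimI[OF this, of 0] have "kv.qdim (homog l) ((UNIV :: ('n, 'k) mpoly set) \<inter> homog l) 0" by simp
  moreover have "kv.qdim (homog l) ((UNIV :: ('n, 'k) mpoly set) \<inter> homog l) (hilbert_fun (UNIV :: ('n, 'k) mpoly set) l)"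
    by (rule qdim_hilbert_fun[OF idl.subspace_UNIV])
  moreover have "kv.subspace ((UNIV :: ('n, 'k) mpoly set) \<inter> homog l)" using subspace_homog by simp
  ultimately show ?thesis using kv.qdim_unique by blast
qed

lemma hilbert_fun_0: "hilbert_fun I 0 = 1"
proof -
  have "kv.qbasis (homog 0) (I \<inter> homog 0) {0 :: nat} (\<lambda>_. 1)"
    unfolding kv.qbasis_def kv.indep_mod_def kv.spans_mod_def
  proof (intro conjI allI impI ballI)
    fix c and i :: nat assume h: "(\<Sum>i\<in>{0 :: nat}. Const (c i) * 1) \<in> I \<inter> homog 0" and i: "i \<in> {0}"
    have "c 0 = 0"
    proof (rule ccontr)
      assume c: "c 0 \<noteq> 0"
      have "Const (1 / c 0) * Const (c 0) \<in> I" using h idl.subspace_scale[OF Is] by auto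
      then show False using one c by (simp add: Const_mult[symmetric])
    qed
    then show "c i = 0" using i by simp
  next
    fix p :: "('n, 'k) mpoly" assume "p \<in> homog 0"
    then obtain a where "p = Const a" using homog_0_Const by blast
    then show "\<exists>c. p - (\<Sum>i\<in>{0 :: nat}. Const (c i) * 1) \<in> I \<inter> homog 0"
      using idl.subspace_0[OF Is] by (intro exI[of _ "\<lambda>_. a"]) simp
  qed auto
  from kv.qdimI[OF this, of 1] have "kv.qdim (homog 0) (I \<inter> homog 0) 1" by simp
  then show ?thesis using kv.qdim_unique[OF subspace_graded[OF Is]] qdim_hilbert_fun[OF Is] by blast
qed

text \<open>With the unit ideal and \<open>u = 1\<close>, \<open>duality\<close> shows that the
  coordinate ring modulo \<open>(Y0^N, Y1^N)\<close> has the dimension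
  \<open>hilbert_fun I i\<close> in degree \<open>t - i\<close> for \<open>i <= 0\<close>, where
  \<open>t\<close> is \<open>sdeg N\<close> minus the degree of \<open>g\<close>: it is a line in
  degree \<open>t\<close> and zero above. Freeness over \<open>R\<close> makes the same ring a sum
  of shifts of \<open>R/(Y0^N, Y1^N)\<close>, whose last nonzero degree is
  \<open>m (d - 1) + 2 N - 2\<close>. Comparison determines \<open>t\<close>.\<close>

lemma top_degree_eq:
  assumes N: "N > 0" "\<gamma> < int N" "\<gamma> + E < int N"
  shows "sdeg N - \<gamma> = int (m (d - 1)) + 2 * int N - 2"
    and "h UNIV (sdeg N - \<gamma>) - 2 * h UNIV (sdeg N - \<gamma> - int N) + h UNIV (sdeg N - \<gamma> - 2 * int N) = 1"
proof -
  let ?t = "sdeg N - \<gamma>"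
  have hU: "h UNIV l = (\<Sum>i<d. max 0 (l - int (m i) + 1))" for l
    by (simp add: h_def hilbert_fun_UNIV hilbert_fun_eq)
  \<comment> \<open>The Hilbert function of \<open>R/(Y0^N, Y1^N)\<close>: positive exactly in
    degrees \<open>0\<close> to \<open>2 N - 2\<close>, with the value \<open>1\<close> in the
    last.\<close>
  define \<psi> :: "int \<Rightarrow> int" where "\<psi> x = max 0 (x + 1) - 2 * max 0 (x - int N + 1) + max 0 (x - 2 * int N + 1)" for x
  define \<Psi> where "\<Psi> j = h UNIV j - 2 * h UNIV (j - int N) + h UNIV (j - 2 * int N)" for j
  have Psi: "\<Psi> j = (\<Sum>i<d. \<psi> (j - int (m i)))" for j
    unfolding \<Psi>_def hU \<psi>_def by (simp add: sum.distrib sum_subtractf sum_distrib_left algebra_simps)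
  have hi: "hideal (UNIV :: ('n, 'k) mpoly set)" by (simp add: hideal_def)
  have key: "\<Psi> (?t - i) = int (hilbert_fun I i)" if "i \<le> 0" for i
  proof -
    obtain n where n: "kv.qdim (UNIV \<inter> homog (?t - i)) (filt N UNIV (?t - i)) n" "int n = \<Psi> (?t - i)"
      using filt_dim_exists[OF hi, of N "?t - i"] by (auto simp: \<Psi>_def)
    have gen: "UNIV \<inter> homog l \<subseteq> kv.span ({p * a | p a k. k \<le> 0 \<and> a \<in> UNIV \<inter> homog k \<and> p \<in> homog (l - k)} \<union> (I \<inter> homog l))" for l
    proof
      fix x :: "('n, 'k) mpoly" assume "x \<in> UNIV \<inter> homog l"
      then have "x * 1 \<in> {p * a | p a k. k \<le> 0 \<and> a \<in> UNIV \<inter> homog k \<and> p \<in> homog (l - k)}"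
        by (intro CollectI exI[of _ x] exI[of _ 1] exI[of _ 0]) auto
      then show "x \<in> kv.span ({p * a | p a k. k \<le> 0 \<and> a \<in> UNIV \<inter> homog k \<and> p \<in> homog (l - k)} \<union> (I \<inter> homog l))"
        by (intro kv.span_base) simp
    qed
    have "kv.qdim (colon 1 UNIV (0 + i)) (I \<inter> homog (0 + i)) n"
      by (rule duality[OF hi _ R_one homog_1 _ _ gen N(1) _ _ _ _ n(1)]) (use N that in auto)
    moreover have "colon 1 UNIV i = homog i"
    proof -
      have "\<exists>b. c * a - 1 * b \<in> I" for c a :: "('n, 'k) mpoly" using idl.subspace_0[OF Is] by (intro exI[of _ "c * a"]) simp
      then show ?thesis unfolding colon_def by blast
    qed
    ultimately have "n = hilbert_fun I i"
      using kv.qdim_unique[OF subspace_graded[OF Is]] qdim_hilbert_fun[OF Is, of i] by simp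
    then show ?thesis using n(2) by simp
  qed
  have P1: "\<Psi> ?t = 1" using key[of 0] hilbert_fun_0 by simp
  then show "h UNIV ?t - 2 * h UNIV (?t - int N) + h UNIV (?t - 2 * int N) = 1" by (simp add: \<Psi>_def)
  have P0: "\<Psi> j = 0" if "j > ?t" for j
    using key[of "?t - j"] that hilbert_fun_eq[of "?t - j"] by (simp add: sum.neutral)
  let ?j = "int (m (d - 1)) + 2 * int N - 2"
  have psi_nonneg: "\<psi> x \<ge> 0" for x using N(1) by (simp add: \<psi>_def max_def)
  have psi_zero: "\<psi> x = 0" if "x \<ge> 2 * int N - 1" for x using that N(1) by (simp add: \<psi>_def max_def)
  have "\<psi> (?j - int (m (d - 1))) \<le> \<Psi> ?j"
    unfolding Psi using d_pos psi_nonneg by (intro member_le_sum) auto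
  moreover have "\<psi> (?j - int (m (d - 1))) = 1" using N(1) by (simp add: \<psi>_def max_def)
  ultimately have "?j \<le> ?t" using P0[of ?j] by linarith
  moreover have "\<not> ?t > ?j"
  proof
    assume t: "?t > ?j"
    have "\<Psi> ?t = 0"
      unfolding Psi
    proof (rule sum.neutral, rule ballI)
      fix i assume "i \<in> {..<d}"
      then have "m i \<le> m (d - 1)" by (intro m_mono) auto
      then show "\<psi> (?t - int (m i)) = 0" using t by (intro psi_zero) linarith
    qed
    then show False using P1 by simp
  qed
  ultimately show "?t = ?j" by simp
qed

text \<open>A denominator \<open>u\<close> exists in degree \<open>max l0 \<alpha>\<close>, where
  the quotient by \<open>J\<close> has dimension \<open>\<alpha>\<close> only. With
  \<open>i = 0\<close>, \<open>duality\<close> reduces the dimension of the numerators to that of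
  \<open>J\<close> modulo \<open>filt\<close> in degree \<open>t\<close>, and
  \<open>filt_dim\<close> makes this a second difference.\<close>

lemma colon_dim:
  assumes J: "hideal J" "I \<subseteq> J" and sat: "saturated J"
    and const: "\<And>l. l \<ge> l0 \<Longrightarrow> hilbert_fun J (int l) = \<alpha>"
  shows "\<exists>u \<delta> n. u \<in> R \<and> u \<in> homog \<delta> \<and> u \<in> J \<and> u \<noteq> 0 \<and> kv.qdim (colon u J \<delta>) (I \<inter> homog \<delta>) n \<and>
    int n = 1 + int \<alpha> - int (hilbert_fun J (int (m (d - 1)) - 2))"
proof -
  have Js: "idl.subspace J" using J(1) by (rule hideal_subspace)
  have sat': "Y0 ^ N * z \<in> J \<Longrightarrow> Y1 ^ N * z \<in> J \<Longrightarrow> z \<in> J" for N z by (rule saturated_Y_powers[OF Js J(2) sat])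
  have const': "hilbert_fun J l = \<alpha>" if "l \<ge> int l0" for l using const[of "nat l"] that by simp
  define k where "k = max l0 \<alpha>"
  have "hilbert_fun J (int k) \<le> k" using const[of k] by (simp add: k_def)
  from section_exists[OF Js this] obtain u where u: "u \<in> R" "u \<in> homog (int k)" "u \<in> J" "u \<noteq> 0" by blast
  \<comment> \<open>For \<open>l\<close> above this bound, \<open>l\<close>, \<open>l - 1\<close>
    and \<open>l - 2\<close> are in the range where the Hilbert functions of \<open>I\<close> and
    \<open>J\<close> are polynomials of degree at most one, whose second difference is zero.\<close>
  define E1 where "E1 = int l0 + int (m (d - 1)) + 2"
  have st: "J \<inter> homog l \<subseteq> filt 1 J l" if l: "l > E1" for l
  proof -
    obtain n where n: "kv.qdim (J \<inter> homog l) (filt 1 J l) n" "int n = h J l - 2 * h J (l - 1) + h J (l - 2)"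
      using filt_dim_exists[OF J, of 1 l, OF sat'[of 1]] by auto
    have lin: "int (hilbert_fun I j) = (\<Sum>i<d. j - int (m i) + 1)" if "j \<ge> int (m (d - 1))" for j
      unfolding hilbert_fun_eq
    proof (rule sum.cong)
      fix i assume "i \<in> {..<d}"
      then have "m i \<le> m (d - 1)" by (intro m_mono) auto
      then show "max 0 (j - int (m i) + 1) = j - int (m i) + 1" using that by simp
    qed simp
    have "int n = (\<Sum>i<d. l - int (m i) + 1) - 2 * (\<Sum>i<d. (l - 1) - int (m i) + 1) + (\<Sum>i<d. (l - 2) - int (m i) + 1)"
      using n(2) l const'[of l] const'[of "l - 1"] const'[of "l - 2"] lin[of l] lin[of "l - 1"] lin[of "l - 2"]
      by (simp add: h_def E1_def)
    also have "\<dots> = 0" by (simp add: sum.distrib sum_subtractf algebra_simps)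
    finally have "n = 0" by simp
    then show ?thesis using n(1) by (auto simp: kv.qdim_def kv.qbasis_def kv.spans_mod_def)
  qed
  \<comment> \<open>All bounds asked for by \<open>duality\<close> and \<open>top_degree_eq\<close>
    are met, and \<open>N >= l0 + 2\<close> makes \<open>t\<close> and \<open>t - N\<close> at least
    \<open>l0\<close>, where the Hilbert function of \<open>J\<close> is constant.\<close>
  define N where "N = nat (1 + \<bar>\<gamma>\<bar> + int k + \<bar>E1\<bar> + \<bar>E\<bar> + int l0 + 2)"
  have N: "N > 0" "\<gamma> < int N" "\<gamma> + E < int N" "\<gamma> + int k + 0 < int N" "\<gamma> + int k + 0 + E1 < int N"
    "\<gamma> + 0 + E1 + E < int N" "\<gamma> + 0 + int k + E < int N" "int N \<ge> int l0 + 2"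
    by (auto simp: N_def)
  define t where "t = sdeg N - \<gamma>"
  have t: "t = int (m (d - 1)) + 2 * int N - 2" and t1: "h UNIV t - 2 * h UNIV (t - int N) + h UNIV (t - 2 * int N) = 1"
    using top_degree_eq[OF N(1-3)] by (simp_all add: t_def)
  obtain n where n: "kv.qdim (J \<inter> homog t) (filt N J t) n" "int n = h J t - 2 * h J (t - int N) + h J (t - 2 * int N)"
    using filt_dim_exists[OF J, of N t, OF sat'[of N]] by blast
  have q: "kv.qdim (J \<inter> homog (sdeg N - \<gamma> - 0)) (filt N J (sdeg N - \<gamma> - 0)) n" using n(1) by (simp add: t_def)
  have "kv.qdim (colon u J (int k + 0)) (I \<inter> homog (int k + 0)) n"
    by (rule duality[OF J u generated_low[OF J st] N(1,4-7) q])
  moreover have "int n = 1 + int \<alpha> - int (hilbert_fun J (int (m (d - 1)) - 2))"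
  proof -
    have "hilbert_fun J t = \<alpha>" "hilbert_fun J (t - int N) = \<alpha>" using N(8) t by (auto intro!: const')
    moreover have "t - 2 * int N = int (m (d - 1)) - 2" using t by simp
    moreover have "h J l = h UNIV l - int (hilbert_fun J l)" for l by (simp add: h_def hilbert_fun_UNIV)
    ultimately show ?thesis using n(2) t1 by simp
  qed
  ultimately show ?thesis using u by auto
qed

end

section \<open>Homogeneous primes and sections of the structure sheaf\<close>

text \<open>Remove from \<open>a\<close> and \<open>b\<close> the components lying in
  \<open>M\<close>. The product of the top remaining components is then a homogeneous component of
  an element of \<open>M\<close>, so it lies in \<open>M\<close>, and the hypothesis on forms
  applies to it.\<close>

lemma homogeneous_prime:
  fixes M :: "('n::finite, 'k::field) mpoly set"
  assumes M: "hideal M" and hp: "\<And>a b k l. a \<in> homog k \<Longrightarrow> b \<in> homog l \<Longrightarrow> a * b \<in> M \<Longrightarrow> a \<in> M \<or> b \<in> M"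
    and ab: "a * b \<in> M"
  shows "a \<in> M \<or> b \<in> M"
proof (rule ccontr)
  assume n: "\<not> (a \<in> M \<or> b \<in> M)"
  have Ms: "idl.subspace M" using M by (rule hideal_subspace)
  have red: "\<exists>L. finite L \<and> L \<noteq> {} \<and> (\<forall>l\<in>L. hc l x \<notin> M) \<and> x - (\<Sum>l\<in>L. hc l x) \<in> M" if x: "x \<notin> M" for x
  proof -
    obtain L where L: "finite L" "x = (\<Sum>l\<in>L. hc l x)" using hc_decomp by blast
    let ?L = "{l\<in>L. hc l x \<notin> M}"
    have "(\<Sum>l\<in>L. hc l x) = (\<Sum>l\<in>?L. hc l x) + (\<Sum>l\<in>L - ?L. hc l x)"
      using L(1) by (subst sum.subset_diff[of ?L L]) (auto simp: add.commute)
    moreover have "(\<Sum>l\<in>L - ?L. hc l x) \<in> M" by (rule idl.subspace_sum[OF Ms]) auto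
    moreover have "x - (\<Sum>l\<in>?L. hc l x) = (\<Sum>l\<in>L. hc l x) - (\<Sum>l\<in>?L. hc l x)" by (rule arg_cong[OF L(2)])
    ultimately have d: "x - (\<Sum>l\<in>?L. hc l x) \<in> M" by (simp only: add_diff_cancel_left')
    have "?L \<noteq> {}"
    proof
      assume e: "?L = {}"
      show False using d x by (simp only: e sum.empty diff_zero)
    qed
    then show ?thesis using L(1) d by (intro exI[of _ ?L]) auto
  qed
  obtain A where A: "finite A" "A \<noteq> {}" "\<forall>l\<in>A. hc l a \<notin> M" "a - (\<Sum>l\<in>A. hc l a) \<in> M" using red n by blast
  obtain B where B: "finite B" "B \<noteq> {}" "\<forall>l\<in>B. hc l b \<notin> M" "b - (\<Sum>l\<in>B. hc l b) \<in> M" using red n by blast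
  let ?a = "\<Sum>l\<in>A. hc l a" and ?b = "\<Sum>l\<in>B. hc l b"
  have hb: "hc j ?b = (if j \<in> B then hc j b else 0)" for j
  proof -
    have "hc j ?b = (\<Sum>l\<in>B. if l = j then hc j b else 0)"
      unfolding hc_sum
    proof (rule sum.cong)
      fix l show "hc j (hc l b) = (if l = j then hc j b else 0)"
        using hc_id[OF hc_homog, of j b] hc_other[OF hc_homog, of l j b] by auto
    qed simp
    then show ?thesis using B(1) by simp
  qed
  define l where "l = Max A"
  define k where "k = Max B"
  have l: "l \<in> A" "\<And>i. i \<in> A \<Longrightarrow> i \<le> l" using A by (auto simp: l_def)
  have k: "k \<in> B" "\<And>i. i \<in> B \<Longrightarrow> i \<le> k" using B by (auto simp: k_def)
  have "a * b - b * (a - ?a) - ?a * (b - ?b) \<in> M"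
    by (intro idl.subspace_diff[OF Ms] idl.subspace_scale[OF Ms] ab A(4) B(4))
  then have "?a * ?b \<in> M" by (simp add: algebra_simps)
  then have "hc (l + k) (?a * ?b) \<in> M" by (rule hideal_hc[OF M])
  also have "hc (l + k) (?a * ?b) = (\<Sum>i\<in>A. hc i a * hc (l + k - i) ?b)"
    by (simp only: sum_distrib_right hc_sum hc_mult[OF hc_homog])
  also have "\<dots> = (\<Sum>i\<in>A. if i = l then hc l a * hc k b else 0)"
  proof (rule sum.cong)
    fix i assume i: "i \<in> A"
    show "hc i a * hc (l + k - i) ?b = (if i = l then hc l a * hc k b else 0)"
    proof (cases "i = l")
      case True
      then show ?thesis using k(1) by (simp add: hb)
    next
      case False
      then have "l + k - i > k" using l(2)[OF i] by simp
      then have "l + k - i \<notin> B" using k(2) by fastforce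
      then show ?thesis using False by (simp add: hb)
    qed
  qed simp
  also have "\<dots> = hc l a * hc k b" using A(1) l(1) by simp
  finally have "hc l a * hc k b \<in> M" .
  from hp[OF hc_homog hc_homog this] show False using A(3) B(3) l(1) k(1) by blast
qed

text \<open>A homogeneous ideal maximal among those that contain \<open>K\<close> and avoid the
  powers of \<open>f y\<close> is prime. The factor \<open>f\<close> of positive degree guarantees
  that it does not contain all variables, so it is a point of \<open>Proj\<close>.\<close>

lemma Proj_avoiding:
  fixes K :: "('n::finite, 'k::field) mpoly set"
  assumes K: "hideal K" and f: "f \<in> homog l" "l > 0" and F: "f * y \<in> homog k" and av: "\<And>n. (f * y) ^ n \<notin> K"
  shows "\<exists>P\<in>Proj K. f * y \<notin> P"
proof -
  let ?F = "f * y"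
  define A where "A = {P. hideal P \<and> K \<subseteq> P \<and> (\<forall>n. ?F ^ n \<notin> P)}"
  have "\<exists>M\<in>A. \<forall>X\<in>A. M \<subseteq> X \<longrightarrow> X = M"
  proof (rule subset_Zorn_nonempty)
    show "A \<noteq> {}" using K av by (auto simp: A_def)
    fix C assume C: "C \<noteq> {}" "subset.chain A C"
    then have CA: "C \<subseteq> A" by (auto simp: subset.chain_def)
    have tot: "X \<subseteq> Y \<or> Y \<subseteq> X" if "X \<in> C" "Y \<in> C" for X Y
      using C(2) that unfolding subset_chain_def by blast
    have sub: "idl.subspace X" if "X \<in> C" for X using that CA hideal_subspace by (auto simp: A_def)
    have "idl.subspace (\<Union>C)"
      unfolding idl.subspace_def
    proof (intro conjI ballI allI)
      show "0 \<in> \<Union>C" using C(1) sub idl.subspace_0 by blast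
      fix x assume "x \<in> \<Union>C"
      then obtain X where X: "x \<in> X" "X \<in> C" by blast
      {
        fix z assume "z \<in> \<Union>C"
        then obtain Z where Z: "z \<in> Z" "Z \<in> C" by blast
        from tot[OF X(2) Z(2)] show "x + z \<in> \<Union>C"
        proof
          assume "X \<subseteq> Z"
          then have "x + z \<in> Z" using X Z sub by (intro idl.subspace_add) auto
          then show ?thesis using Z(2) by blast
        next
          assume "Z \<subseteq> X"
          then have "x + z \<in> X" using X Z sub by (intro idl.subspace_add) auto
          then show ?thesis using X(2) by blast
        qed
      next
        fix c
        have "c * x \<in> X" using X sub by (intro idl.subspace_scale) auto
        then show "c * x \<in> \<Union>C" using X(2) by blast
      }
    qed
    moreover have "\<forall>p\<in>\<Union>C. \<forall>l. hc l p \<in> \<Union>C"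
      using CA hideal_hc unfolding A_def by blast
    ultimately have "hideal (\<Union>C)" by (simp add: hideal_def)
    then show "\<Union>C \<in> A" using CA C(1) unfolding A_def by blast
  qed
  then obtain M where MA: "M \<in> A" and max': "\<forall>X\<in>A. M \<subseteq> X \<longrightarrow> X = M" by (elim bexE)
  have max: "X = M" if "X \<in> A" "M \<subseteq> X" for X using max' that by simp
  have M: "hideal M" "K \<subseteq> M" "\<And>n. ?F ^ n \<notin> M" using MA by (simp_all add: A_def)
  have Ms: "idl.subspace M" using M(1) by (rule hideal_subspace)
  have big: "\<exists>n q. ?F ^ n - q * a \<in> M" if a: "a \<in> homog e" "a \<notin> M" for a e
  proof (rule ccontr)
    assume n: "\<not> ?thesis"
    have "hideal (idl.span (M \<union> {a}))" using a(1) by (intro hideal_Un M) auto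
    then have "hideal (idl.span (insert a M))" by simp
    moreover have MS: "M \<subseteq> idl.span (insert a M)" by (auto intro: idl.span_base)
    moreover have "?F ^ n \<notin> idl.span (insert a M)" for n using n span_Un_singleton[OF Ms] by blast
    ultimately have "idl.span (insert a M) = M" using M(2) by (intro max) (auto simp: A_def)
    then show False using a(2) idl.span_base[of a "insert a M"] by blast
  qed
  have prime: "a \<in> M \<or> b \<in> M" if "a * b \<in> M" for a b
  proof (rule homogeneous_prime[OF M(1) _ that], rule ccontr)
    fix a b e e' assume ab: "a \<in> homog e" "b \<in> homog e'" "a * b \<in> M" "\<not> (a \<in> M \<or> b \<in> M)"
    obtain n q where n: "?F ^ n - q * a \<in> M" using big ab by blast
    obtain n' q' where n': "?F ^ n' - q' * b \<in> M" using big ab by blast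
    have "?F ^ n' * (?F ^ n - q * a) + (q * a) * (?F ^ n' - q' * b) + (q * q') * (a * b) \<in> M"
      by (intro idl.subspace_add[OF Ms] idl.subspace_scale[OF Ms] n n' ab)
    also have "?F ^ n' * (?F ^ n - q * a) + (q * a) * (?F ^ n' - q' * b) + (q * q') * (a * b) = ?F ^ (n + n')"
      by (simp add: power_add algebra_simps)
    finally show False using M(3) by blast
  qed
  have FM: "?F \<notin> M" using M(3)[of 1] by simp
  have oneM: "1 \<notin> M" using M(3)[of 0] by simp
  have "primeideal M class_ring"
  proof (rule primeidealI)
    show "ideal M class_ring" using Ms ideal_class_ring_iff by blast
    show "cring (class_ring :: ('n, 'k) mpoly ring)" by (rule class_cring.cring_axioms)
    show "carrier class_ring \<noteq> M" using oneM by auto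
  qed (use prime in auto)
  moreover have "\<exists>i. Var i \<notin> M"
  proof (rule ccontr)
    assume "\<not> ?thesis"
    then have "f * 1 \<in> M" by (intro homog_mult_mem[OF Ms f]) simp
    then have "y * f \<in> M" by (intro idl.subspace_scale[OF Ms]) simp
    then show False using FM by (simp add: mult.commute)
  qed
  ultimately have "M \<in> Proj K" using M by (simp add: Proj_def homogeneous_ideal_iff)
  then show ?thesis using FM by blast
qed

lemma Proj_mono: "I \<subseteq> K \<Longrightarrow> P \<in> Proj K \<Longrightarrow> P \<in> Proj I"
  by (auto simp: Proj_def)

text \<open>The annihilator of \<open>x\<close> modulo \<open>I\<close> is a homogeneous ideal; if
  it contained no power of \<open>f y\<close>, \<open>Proj_avoiding\<close> would give a point where
  \<open>f y\<close> is invertible and \<open>x\<close> is not locally zero. This turns vanishing of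
  sections into identities modulo \<open>I\<close>.\<close>

lemma power_annihilates:
  fixes I :: "('n::finite, 'k::field) mpoly set"
  assumes I: "hideal I" and f: "f \<in> homog l" "l > 0" and F: "f * y \<in> homog k" and x: "x \<in> homog j"
    and loc: "\<And>P. P \<in> Proj I \<Longrightarrow> f * y \<notin> P \<Longrightarrow> \<exists>t. t \<notin> P \<and> t * x \<in> I"
  shows "\<exists>n. (f * y) ^ n * x \<in> I"
proof (rule ccontr)
  assume n: "\<not> ?thesis"
  have Is: "idl.subspace I" using I by (rule hideal_subspace)
  define K where "K = {t. t * x \<in> I}"
  have "idl.subspace K"
    unfolding idl.subspace_def K_def
    using idl.subspace_0[OF Is] idl.subspace_add[OF Is] idl.subspace_scale[OF Is] by (auto simp: distrib_right mult.assoc)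
  moreover have "hc i t \<in> K" if "t \<in> K" for t i
  proof -
    have "hc (i + j) (x * t) \<in> I" using that by (intro hideal_hc[OF I]) (simp add: K_def mult.commute)
    then show ?thesis using hc_mult[OF x, of "i + j" t] by (simp add: K_def mult.commute)
  qed
  ultimately have "hideal K" by (simp add: hideal_def)
  then obtain P where P: "P \<in> Proj K" "f * y \<notin> P" using Proj_avoiding[OF _ f F, of K] n by (auto simp: K_def)
  have "I \<subseteq> K" using idl.subspace_scale[OF Is] by (auto simp: K_def mult.commute)
  then have "P \<in> Proj I" using P(1) Proj_mono by blast
  then obtain t where "t \<notin> P" "t * x \<in> I" using loc P(2) by blast
  then show False using P(1) by (auto simp: Proj_def K_def)
qed

section \<open>Calculus of fractions in the local rings\<close>

definition fracs :: "('n::finite, 'k::field) mpoly set \<Rightarrow> int \<Rightarrow> ('n, 'k) mpoly \<Rightarrow> ('n, 'k) mpoly \<Rightarrow> bool" where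
  "fracs P l a f \<longleftrightarrow> a \<in> homog l \<and> f \<in> homog l \<and> f \<notin> P"

context
  fixes I P :: "('n::finite, 'k::field) mpoly set"
  assumes I: "hideal I" and P: "P \<in> Proj I"
begin

lemma Proj_prime: "a * b \<in> P \<Longrightarrow> a \<in> P \<or> b \<in> P" and Proj_one: "1 \<notin> P" and Proj_sub: "idl.subspace P"
  and Proj_hideal: "hideal P"
proof -
  have p: "primeideal P class_ring" and h: "hideal P" using P by (auto simp: Proj_def homogeneous_ideal_iff)
  show "hideal P" by (rule h)
  show s: "idl.subspace P" using h by (rule hideal_subspace)
  show "a * b \<in> P \<Longrightarrow> a \<in> P \<or> b \<in> P" using primeideal.I_prime[OF p, of a b] by simp
  show "1 \<notin> P"
  proof
    assume o: "1 \<in> P"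
    have "x \<in> P" for x using idl.subspace_scale[OF s o, of x] by simp
    then show False using primeideal.I_notcarr[OF p] by auto
  qed
qed

lemma Proj_mult: "a \<notin> P \<Longrightarrow> b \<notin> P \<Longrightarrow> a * b \<notin> P"
  using Proj_prime by blast

lemma fracs_mult:
  assumes "fracs P l a f" "fracs P k b g" shows "fracs P (l + k) (a * b) (f * g)"
  using assms homog_mult[of a l b k] homog_mult[of f l g k] Proj_mult[of f g] by (simp add: fracs_def)

lemma fracs_add:
  assumes "fracs P l a f" "fracs P k b g" shows "fracs P (l + k) (a * g + b * f) (f * g)"
  using assms homog_add[OF homog_mult[of a l g k] homog_mult'[of b k f l "l + k"]] homog_mult[of f l g k] Proj_mult[of f g]
  by (simp add: fracs_def)

lemma Proj_multD: "a * b \<notin> P \<Longrightarrow> a \<notin> P \<and> b \<notin> P"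
  using idl.subspace_scale[OF Proj_sub, of a b] idl.subspace_scale[OF Proj_sub, of b a] by (auto simp: mult.commute)

lemma Proj_power: "a \<notin> P \<Longrightarrow> a ^ n \<notin> P"
  by (induction n) (auto simp: Proj_one Proj_mult)

lemma fraction_mem:
  fixes a f b g :: "('n, 'k) mpoly"
  shows "(b, g) \<in> fraction I P a f \<longleftrightarrow> (\<exists>l. fracs P l b g) \<and> (\<exists>l. \<exists>t\<in>homog l. t \<notin> P \<and> t * (a * g - b * f) \<in> I)"
  by (auto simp: fraction_def fracs_def)

text \<open>The common multiplier is \<open>t t' g\<close>; the denominator \<open>g\<close> of the
  middle fraction enters because equality in a localisation is only up to such multipliers.\<close>

lemma fraction_trans:
  assumes a: "fracs P l b g" and t: "t \<in> homog e" "t \<notin> P" "t * (a * g - b * f) \<in> I"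
    and t': "t' \<in> homog e'" "t' \<notin> P" "t' * (b * h - c * g) \<in> I"
  shows "\<exists>e. \<exists>t\<in>homog e. t \<notin> P \<and> t * (a * h - c * f) \<in> I"
proof -
  have Is: "idl.subspace I" using I by (rule hideal_subspace)
  have "(t' * h) * (t * (a * g - b * f)) + (t * f) * (t' * (b * h - c * g)) \<in> I"
    by (intro idl.subspace_add[OF Is] idl.subspace_scale[OF Is] t t')
  also have "(t' * h) * (t * (a * g - b * f)) + (t * f) * (t' * (b * h - c * g)) = ((t * t') * g) * (a * h - c * f)"
    by (simp add: algebra_simps)
  finally have "((t * t') * g) * (a * h - c * f) \<in> I" .
  moreover have "(t * t') * g \<in> homog (e + e' + l)" using a t t' by (intro homog_mult) (auto simp: fracs_def)
  moreover have "(t * t') * g \<notin> P" using a t t' by (intro Proj_mult) (auto simp: fracs_def)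
  ultimately show ?thesis by blast
qed

lemma fraction_sym:
  assumes "t * (a * g - b * f) \<in> I" shows "t * (b * f - a * g) \<in> I"
proof -
  have "- (t * (a * g - b * f)) \<in> I" using assms idl.subspace_neg[OF hideal_subspace[OF I]] by blast
  then show ?thesis by (simp add: algebra_simps)
qed

lemma fraction_eqI:
  assumes a: "fracs P l a f" and b: "fracs P k b g" and t: "t \<in> homog e" "t \<notin> P" "t * (a * g - b * f) \<in> I"
  shows "fraction I P a f = fraction I P b g"
proof -
  have "(c, h) \<in> fraction I P a f \<longleftrightarrow> (c, h) \<in> fraction I P b g" for c h
  proof
    assume "(c, h) \<in> fraction I P a f"
    then obtain l' e' t' where c: "fracs P l' c h" "t' \<in> homog e'" "t' \<notin> P" "t' * (a * h - c * f) \<in> I"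
      unfolding fraction_mem by blast
    have "\<exists>e. \<exists>t\<in>homog e. t \<notin> P \<and> t * (b * h - c * g) \<in> I"
      by (rule fraction_trans[OF a t(1,2) fraction_sym[OF t(3)] c(2-4)])
    then show "(c, h) \<in> fraction I P b g" unfolding fraction_mem using c(1) by blast
  next
    assume "(c, h) \<in> fraction I P b g"
    then obtain l' e' t' where c: "fracs P l' c h" "t' \<in> homog e'" "t' \<notin> P" "t' * (b * h - c * g) \<in> I"
      unfolding fraction_mem by blast
    have "\<exists>e. \<exists>t\<in>homog e. t \<notin> P \<and> t * (a * h - c * f) \<in> I"
      by (rule fraction_trans[OF b t c(2-4)])
    then show "(c, h) \<in> fraction I P a f" unfolding fraction_mem using c(1) by blast
  qed
  then show ?thesis by (auto simp: set_eq_iff)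
qed

lemma fraction_eqI': "fracs P l a f \<Longrightarrow> fracs P k b g \<Longrightarrow> a * g - b * f \<in> I \<Longrightarrow> fraction I P a f = fraction I P b g"
  by (rule fraction_eqI[of _ _ _ _ _ _ 1 0]) (auto simp: Proj_one)

lemma fraction_self: "fracs P l a f \<Longrightarrow> (a, f) \<in> fraction I P a f"
  unfolding fraction_mem using Proj_one idl.subspace_0[OF hideal_subspace[OF I]]
  by (intro conjI exI[of _ l] exI[of _ 0] bexI[of _ 1]) auto

lemma fraction_eqD:
  assumes "fracs P l a f" "fracs P k b g" "fraction I P a f = fraction I P b g"
  shows "\<exists>e. \<exists>t\<in>homog e. t \<notin> P \<and> t * (a * g - b * f) \<in> I"
proof -
  have "(b, g) \<in> fraction I P a f" using fraction_self[OF assms(2)] assms(3) by simp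
  then show ?thesis unfolding fraction_mem by blast
qed

text \<open>The operations of \<open>local_ring\<close> are unions over all representatives; as all
  of them give the same class, the union is that class.\<close>

lemma UN_UN_eq:
  assumes "(a, f) \<in> X" "(b, g) \<in> Y" "\<And>a f b g. (a, f) \<in> X \<Longrightarrow> (b, g) \<in> Y \<Longrightarrow> h a f b g = z"
  shows "(\<Union>(a, f)\<in>X. \<Union>(b, g)\<in>Y. h a f b g) = z"
proof -
  have "(\<Union>(a, f)\<in>X. \<Union>(b, g)\<in>Y. h a f b g) = (\<Union>x\<in>X. \<Union>y\<in>Y. z)"
    using assms(3) by (intro SUP_cong) (auto split: prod.splits)
  then show ?thesis using assms(1,2) by auto
qed

lemma fraction_mult:
  assumes a: "fracs P l a f" and b: "fracs P k b g"
  shows "fraction I P a f \<otimes>\<^bsub>local_ring I P\<^esub> fraction I P b g = fraction I P (a * b) (f * g)"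
proof -
  have Is: "idl.subspace I" using I by (rule hideal_subspace)
  have e: "fraction I P (a' * b') (f' * g') = fraction I P (a * b) (f * g)"
    if mem: "(a', f') \<in> fraction I P a f" "(b', g') \<in> fraction I P b g" for a' f' b' g'
  proof -
    obtain l' e t where x: "fracs P l' a' f'" "t \<in> homog e" "t \<notin> P" "t * (a * f' - a' * f) \<in> I"
      using mem(1) unfolding fraction_mem by blast
    obtain k' e' t' where y: "fracs P k' b' g'" "t' \<in> homog e'" "t' \<notin> P" "t' * (b * g' - b' * g) \<in> I"
      using mem(2) unfolding fraction_mem by blast
    have p: "fracs P (l' + k') (a' * b') (f' * g')" "fracs P (l + k) (a * b) (f * g)"
      by (rule fracs_mult[OF x(1) y(1)], rule fracs_mult[OF a b])
    have "(t' * (b * g')) * (t * (a * f' - a' * f)) + (t * (a' * f)) * (t' * (b * g' - b' * g)) \<in> I"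
      by (intro idl.subspace_add[OF Is] idl.subspace_scale[OF Is] x y)
    also have "(t' * (b * g')) * (t * (a * f' - a' * f)) + (t * (a' * f)) * (t' * (b * g' - b' * g))
      = (t * t') * ((a * b) * (f' * g') - (a' * b') * (f * g))"
      by (simp add: algebra_simps)
    finally have "(t * t') * ((a * b) * (f' * g') - (a' * b') * (f * g)) \<in> I" .
    from fraction_eqI[OF p(2,1) homog_mult[OF x(2) y(2)] Proj_mult[OF x(3) y(3)] this] show ?thesis by simp
  qed
  have "fraction I P a f \<otimes>\<^bsub>local_ring I P\<^esub> fraction I P b g
    = (\<Union>(a', f')\<in>fraction I P a f. \<Union>(b', g')\<in>fraction I P b g. fraction I P (a' * b') (f' * g'))"
    by (simp add: local_ring_def)
  also have "\<dots> = fraction I P (a * b) (f * g)"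
    by (rule UN_UN_eq[OF fraction_self[OF a] fraction_self[OF b] e])
  finally show ?thesis .
qed

lemma fraction_add:
  assumes a: "fracs P l a f" and b: "fracs P k b g"
  shows "fraction I P a f \<oplus>\<^bsub>local_ring I P\<^esub> fraction I P b g = fraction I P (a * g + b * f) (f * g)"
proof -
  have Is: "idl.subspace I" using I by (rule hideal_subspace)
  have e: "fraction I P (a' * g' + b' * f') (f' * g') = fraction I P (a * g + b * f) (f * g)"
    if mem: "(a', f') \<in> fraction I P a f" "(b', g') \<in> fraction I P b g" for a' f' b' g'
  proof -
    obtain l' e t where x: "fracs P l' a' f'" "t \<in> homog e" "t \<notin> P" "t * (a * f' - a' * f) \<in> I"
      using mem(1) unfolding fraction_mem by blast
    obtain k' e' t' where y: "fracs P k' b' g'" "t' \<in> homog e'" "t' \<notin> P" "t' * (b * g' - b' * g) \<in> I"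
      using mem(2) unfolding fraction_mem by blast
    have "(t' * (g * g')) * (t * (a * f' - a' * f)) + (t * (f * f')) * (t' * (b * g' - b' * g)) \<in> I"
      by (intro idl.subspace_add[OF Is] idl.subspace_scale[OF Is] x y)
    also have "(t' * (g * g')) * (t * (a * f' - a' * f)) + (t * (f * f')) * (t' * (b * g' - b' * g))
      = (t * t') * ((a * g + b * f) * (f' * g') - (a' * g' + b' * f') * (f * g))"
      by (simp add: algebra_simps)
    finally have "(t * t') * ((a * g + b * f) * (f' * g') - (a' * g' + b' * f') * (f * g)) \<in> I" .
    from fraction_eqI[OF fracs_add[OF a b] fracs_add[OF x(1) y(1)] homog_mult[OF x(2) y(2)] Proj_mult[OF x(3) y(3)] this]
    show ?thesis by simp
  qed
  have "fraction I P a f \<oplus>\<^bsub>local_ring I P\<^esub> fraction I P b g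
    = (\<Union>(a', f')\<in>fraction I P a f. \<Union>(b', g')\<in>fraction I P b g. fraction I P (a' * g' + b' * f') (f' * g'))"
    by (simp add: local_ring_def)
  also have "\<dots> = fraction I P (a * g + b * f) (f * g)"
    by (rule UN_UN_eq[OF fraction_self[OF a] fraction_self[OF b] e])
  finally show ?thesis .
qed

lemma fraction_cancel: "fracs P l a f \<Longrightarrow> fracs P k p p \<Longrightarrow> fraction I P (p * a) (p * f) = fraction I P a f"
  by (rule fraction_eqI'[OF fracs_mult]) (auto simp: mult_ac idl.subspace_0[OF hideal_subspace[OF I]])

lemma local_ring_carrier: "x \<in> carrier (local_ring I P) \<longleftrightarrow> (\<exists>l a f. fracs P l a f \<and> x = fraction I P a f)"
  by (auto simp: local_ring_def ideal_stalk_def fracs_def)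

end

section \<open>Basic open sets and sections over them\<close>

definition basic_open :: "('n::finite, 'k::field) mpoly set \<Rightarrow> ('n, 'k) mpoly \<Rightarrow> ('n, 'k) mpoly set set" where
  "basic_open I f = {P \<in> Proj I. f \<notin> P}"

lemma basic_open_open: assumes "f \<in> homog l" shows "basic_open I f \<in> zariski_opens I"
proof -
  have "hideal (idl.span {f})" using assms by (intro hideal_span) auto
  moreover have "f \<notin> P \<longleftrightarrow> \<not> idl.span {f} \<subseteq> P" if "P \<in> Proj I" for P
  proof -
    have "idl.subspace P" using that by (auto simp: Proj_def homogeneous_ideal_iff hideal_subspace)
    then show ?thesis using idl.span_minimal[of "{f}" P] idl.span_base[of f "{f}"] by blast
  qed
  ultimately show ?thesis unfolding zariski_opens_def basic_open_def homogeneous_ideal_iff by blast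
qed

lemma open_refine:
  assumes "U \<in> zariski_opens I" "P \<in> U"
  shows "P \<in> Proj I \<and> (\<exists>h l. h \<in> homog l \<and> h \<notin> P \<and> basic_open I h \<subseteq> U)"
proof -
  obtain K where K: "hideal K" "U = {P \<in> Proj I. \<not> K \<subseteq> P}" using assms(1) by (auto simp: zariski_opens_def homogeneous_ideal_iff)
  then obtain x where x: "x \<in> K" "x \<notin> P" and PI: "P \<in> Proj I" using assms(2) by blast
  have "hideal P" using PI by (auto simp: Proj_def homogeneous_ideal_iff)
  then obtain l where l: "hc l x \<notin> P" using x(2) hideal_mem_iff by blast
  have "hc l x \<in> K" using hideal_hc[OF K(1) x(1)] .
  then have "basic_open I (hc l x) \<subseteq> U" using K(2) by (auto simp: basic_open_def)
  then show ?thesis using l hc_homog PI by blast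
qed

lemma span_Un_finite:
  assumes "x \<in> idl.span (I \<union> H)" shows "\<exists>F. finite F \<and> F \<subseteq> H \<and> x \<in> idl.span (I \<union> F)"
  using assms
proof (induction rule: idl.span_induct_alt)
  case base
  show ?case by (rule exI[of _ "{}"]) (simp add: idl.span_zero)
next
  case (step c x y)
  then obtain F where F: "finite F" "F \<subseteq> H" "y \<in> idl.span (I \<union> F)" by blast
  let ?F = "F \<union> ({x} \<inter> H)"
  have "x \<in> I \<union> ?F" using step(1) by auto
  then have "c * x + y \<in> idl.span (I \<union> ?F)"
    by (rule idl.span_add[OF idl.span_scale[OF idl.span_base] subsetD[OF idl.span_mono F(3)]]) auto
  then show ?case using F by (intro exI[of _ ?F]) auto
qed

lemma span_Un_image:
  assumes I: "idl.subspace I" and F: "finite F" and x: "x \<in> idl.span (I \<union> G ` F)"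
  shows "\<exists>q. x - (\<Sum>h\<in>F. q h * G h) \<in> I"
proof -
  define V where "V = {x. \<exists>q. x - (\<Sum>h\<in>F. q h * G h) \<in> I}"
  have VI: "x - (\<Sum>h\<in>F. q h * G h) \<in> I \<Longrightarrow> x \<in> V" for x q unfolding V_def by blast
  have "idl.subspace V"
    unfolding idl.subspace_def
  proof (intro conjI ballI allI)
    show "0 \<in> V" by (rule VI[of _ "\<lambda>_. 0"]) (simp add: idl.subspace_0[OF I])
    fix x assume "x \<in> V"
    then obtain q where q: "x - (\<Sum>h\<in>F. q h * G h) \<in> I" by (auto simp: V_def)
    {
      fix y assume "y \<in> V"
      then obtain r where r: "y - (\<Sum>h\<in>F. r h * G h) \<in> I" by (auto simp: V_def)
      show "x + y \<in> V"
        by (rule VI[of _ "\<lambda>h. q h + r h"])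
          (use idl.subspace_add[OF I q r] in \<open>simp add: distrib_right sum.distrib algebra_simps\<close>)
    next
      fix c
      show "c * x \<in> V"
        by (rule VI[of _ "\<lambda>h. c * q h"])
          (use idl.subspace_scale[OF I q, of c] in \<open>simp add: right_diff_distrib sum_distrib_left mult.assoc\<close>)
    }
  qed
  moreover have "I \<union> G ` F \<subseteq> V"
  proof
    fix x assume "x \<in> I \<union> G ` F"
    then show "x \<in> V"
    proof
      assume "x \<in> I" then show ?thesis by (intro VI[of _ "\<lambda>_. 0"]) simp
    next
      assume "x \<in> G ` F"
      then obtain k where k: "k \<in> F" "x = G k" by blast
      have "(\<Sum>h\<in>F. (if h = k then 1 else 0) * G h) = (\<Sum>h\<in>F. if h = k then G k else 0)" by (rule sum.cong) auto
      then have "x - (\<Sum>h\<in>F. (if h = k then 1 else 0) * G h) = 0" using k F by simp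
      then show ?thesis using idl.subspace_0[OF I] by (intro VI[of _ "\<lambda>h. if h = k then 1 else 0"]) simp
    qed
  qed
  ultimately have "x \<in> V" using x idl.span_minimal by blast
  then show ?thesis by (simp add: V_def)
qed

lemma sections_carrier:
  "t \<in> carrier (sections I K U) \<longleftrightarrow> t \<in> (\<Pi>\<^sub>E P\<in>U. carrier (local_ring I P)) \<and>
     (\<forall>P\<in>U. \<exists>V \<in> zariski_opens I. P \<in> V \<and> V \<subseteq> U \<and>
          (\<exists>l. \<exists>a \<in> K \<inter> homog l. \<exists>f \<in> homog l. \<forall>Q\<in>V. f \<notin> Q \<and> t Q = fraction I Q a f))"
  by (simp add: sections_def)

text \<open>The loci \<open>h \<noteq> 0\<close> on which \<open>t\<close> is a single fraction \<open>a/g\<close> cover \<open>D(f)\<close>, so that a power of \<open>f\<close> is a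
  combination of finitely many \<open>(f h)\<^sup>N g\<close>; the same combination of the \<open>(f h)\<^sup>N a\<close> is the numerator.\<close>

lemma section_on_basic_open:
  fixes I :: "('n::finite, 'k::field) mpoly set"
  assumes I: "hideal I" and f: "f \<in> homog l" "l > 0" and t: "t \<in> carrier (structure_sheaf I (basic_open I f))"
  shows "\<exists>N. \<exists>b\<in>homog (int N * l). \<forall>P\<in>basic_open I f. t P = fraction I P b (f ^ N)"
proof -
  have Is: "idl.subspace I" using I by (rule hideal_subspace)
  let ?U = "basic_open I f"
  have UP: "P \<in> ?U \<longleftrightarrow> P \<in> Proj I \<and> f \<notin> P" for P by (simp add: basic_open_def)
  define ok where "ok a g h \<longleftrightarrow> (\<exists>e k. a \<in> homog e \<and> g \<in> homog e \<and> h \<in> homog k) \<and>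
     (\<forall>Q\<in>?U. h \<notin> Q \<longrightarrow> g \<notin> Q \<and> t Q = fraction I Q a g)" for a g h
  define H where "H = {h. \<exists>a g. ok a g h}"
  have Hh: "\<exists>k. h \<in> homog k" if "h \<in> H" for h using that by (auto simp: H_def ok_def)
  have cov: "\<exists>h\<in>H. h \<notin> P" if P: "P \<in> ?U" for P
  proof -
    obtain V e a g where V: "V \<in> zariski_opens I" "P \<in> V" "V \<subseteq> ?U" "a \<in> homog e" "g \<in> homog e"
      "\<forall>Q\<in>V. g \<notin> Q \<and> t Q = fraction I Q a g" using t P unfolding sections_carrier by blast
    obtain h k where h: "h \<in> homog k" "h \<notin> P" "basic_open I h \<subseteq> V" using open_refine[OF V(1,2)] by blast
    have "ok a g h" unfolding ok_def
    proof (intro conjI exI ballI impI)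
      show "a \<in> homog e" "g \<in> homog e" "h \<in> homog k" using V h by auto
      fix Q assume "Q \<in> ?U" "h \<notin> Q"
      then have "Q \<in> V" using h(3) UP by (auto simp: basic_open_def)
      then show "g \<notin> Q" "t Q = fraction I Q a g" using V(6) by auto
    qed
    then show ?thesis using h(2) unfolding H_def by blast
  qed
  have f1: "f * 1 \<in> homog l" "f * 1 = f" using f by simp_all
  have hK: "hideal (idl.span (I \<union> H))" using Hh by (intro hideal_Un I) auto
  have "\<exists>n. f ^ n \<in> idl.span (I \<union> H)"
  proof (rule ccontr)
    assume n: "\<not> ?thesis"
    then have av: "\<And>n. (f * 1) ^ n \<notin> idl.span (I \<union> H)" by simp
    obtain P where P: "P \<in> Proj (idl.span (I \<union> H))" "f \<notin> P"
      using Proj_avoiding[OF hK f f1(1) av] unfolding f1(2) by blast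
    have IH: "I \<union> H \<subseteq> idl.span (I \<union> H)" by (auto intro: idl.span_base)
    then have "P \<in> Proj I" using P(1) by (intro Proj_mono[of I]) auto
    then have "P \<in> ?U" using P(2) by (simp add: UP)
    moreover have "H \<subseteq> P" using P(1) IH by (auto simp: Proj_def)
    ultimately show False using cov by blast
  qed
  then obtain n where "f ^ n \<in> idl.span (I \<union> H)" by blast
  from span_Un_finite[OF this] obtain F where F0: "finite F \<and> F \<subseteq> H \<and> f ^ n \<in> idl.span (I \<union> F)" ..
  then have F: "finite F" "F \<subseteq> H" "f ^ n \<in> idl.span (I \<union> F)" by simp_all
  have cov': "\<exists>h\<in>F. h \<notin> P" if P: "P \<in> ?U" for P
  proof (rule ccontr)
    assume "\<not> ?thesis"
    moreover have PI: "P \<in> Proj I" "f \<notin> P" using P UP by auto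
    ultimately have "I \<union> F \<subseteq> P" by (auto simp: Proj_def)
    then have "f ^ n \<in> P" using F(3) idl.span_minimal[OF _ Proj_sub[OF I PI(1)]] by blast
    then show False using Proj_power[OF I PI] by blast
  qed
  have "\<forall>h\<in>F. \<exists>ag. ok (fst ag) (snd ag) h"
  proof
    fix h assume "h \<in> F"
    then have "\<exists>a g. ok a g h" using F(2) by (auto simp only: H_def)
    then obtain a g where "ok a g h" by (elim exE)
    then show "\<exists>ag. ok (fst ag) (snd ag) h" by (intro exI[of _ "(a, g)"]) simp
  qed
  from bchoice[OF this] obtain ag where ag: "\<forall>h\<in>F. ok (fst (ag h)) (snd (ag h)) h" ..
  define a where "a h = fst (ag h)" for h
  define g where "g h = snd (ag h)" for h
  have ok: "ok (a h) (g h) h" if "h \<in> F" for h using ag that by (simp add: a_def g_def)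
  have "\<forall>h\<in>F. \<exists>e. a h \<in> homog e \<and> g h \<in> homog e" using ok by (auto simp: ok_def)
  from bchoice[OF this] obtain e where e: "\<forall>h\<in>F. a h \<in> homog (e h) \<and> g h \<in> homog (e h)" ..
  have "\<forall>h\<in>F. \<exists>k. h \<in> homog k" using F(2) Hh by blast
  from bchoice[OF this] obtain k where k: "\<forall>h\<in>F. h \<in> homog (k h)" ..
  have tQ: "g h \<notin> Q \<and> t Q = fraction I Q (a h) (g h)" if "h \<in> F" "Q \<in> ?U" "h \<notin> Q" for h Q
    using ok[OF that(1)] that(2,3) unfolding ok_def by blast
  have "\<forall>hh\<in>F \<times> F. \<exists>n. (f * (fst hh * snd hh)) ^ n * (a (fst hh) * g (snd hh) - a (snd hh) * g (fst hh)) \<in> I"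
  proof
    fix hh assume "hh \<in> F \<times> F"
    then obtain h h' where hh: "hh = (h, h')" "h \<in> F" "h' \<in> F" by auto
    have "\<exists>n. (f * (h * h')) ^ n * (a h * g h' - a h' * g h) \<in> I"
    proof (rule power_annihilates[OF I f])
      show "f * (h * h') \<in> homog (l + (k h + k h'))" using k hh f by (intro homog_mult) auto
      show "a h * g h' - a h' * g h \<in> homog (e h + e h')"
        using e hh by (intro homog_diff homog_mult homog_mult'[of "a h'" "e h'" "g h" "e h"]) auto
      fix P assume P: "P \<in> Proj I" "f * (h * h') \<notin> P"
      then have np: "f \<notin> P" "h \<notin> P" "h' \<notin> P" using Proj_multD[OF I P(1)] by blast+
      then have PU: "P \<in> ?U" using P(1) UP by simp
      have 1: "g h \<notin> P" "t P = fraction I P (a h) (g h)" using tQ[OF hh(2) PU np(2)] by auto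
      have 2: "g h' \<notin> P" "t P = fraction I P (a h') (g h')" using tQ[OF hh(3) PU np(3)] by auto
      have "fracs P (e h) (a h) (g h)" "fracs P (e h') (a h') (g h')"
        using e hh 1(1) 2(1) by (auto simp: fracs_def)
      from fraction_eqD[OF I P(1) this] 1(2) 2(2) show "\<exists>t. t \<notin> P \<and> t * (a h * g h' - a h' * g h) \<in> I" by auto
    qed
    then show "\<exists>n. (f * (fst hh * snd hh)) ^ n * (a (fst hh) * g (snd hh) - a (snd hh) * g (fst hh)) \<in> I" by (simp add: hh(1))
  qed
  from bchoice[OF this] obtain nn where nn: "\<forall>hh\<in>F \<times> F. (f * (fst hh * snd hh)) ^ nn hh * (a (fst hh) * g (snd hh) - a (snd hh) * g (fst hh)) \<in> I" ..
  define N where "N = (\<Sum>hh\<in>F \<times> F. nn hh)"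
  have N: "(f * (h * h')) ^ N * (a h * g h' - a h' * g h) \<in> I" if hh: "h \<in> F" "h' \<in> F" for h h'
  proof -
    have "nn (h, h') \<le> N" unfolding N_def using hh F(1) by (intro member_le_sum) auto
    then have pw: "(f * (h * h')) ^ N = (f * (h * h')) ^ (N - nn (h, h')) * (f * (h * h')) ^ nn (h, h')"
      by (simp add: power_add[symmetric])
    have "(f * (h * h')) ^ nn (h, h') * (a h * g h' - a h' * g h) \<in> I" using nn[rule_format, of "(h, h')"] hh by simp
    from idl.subspace_scale[OF Is this, of "(f * (h * h')) ^ (N - nn (h, h'))"]
    show ?thesis by (simp only: pw mult.assoc)
  qed
  \<comment> \<open>After numerator and denominator are multiplied by \<open>(f h)^N\<close>, the
    cross differences lie in \<open>I\<close> itself and not only up to a multiplier.\<close>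
  define a' where "a' h = a h * (f * h) ^ N" for h
  define g' where "g' h = g h * (f * h) ^ N" for h
  define e' where "e' h = e h + int N * (l + k h)" for h
  have ag': "a' h \<in> homog (e' h)" "g' h \<in> homog (e' h)" if "h \<in> F" for h
    unfolding a'_def g'_def e'_def using e k f that by (auto intro!: homog_mult homog_power)
  have cross: "a' h * g' h' - a' h' * g' h \<in> I" if hh: "h \<in> F" "h' \<in> F" for h h'
  proof -
    have "f ^ N * ((f * (h * h')) ^ N * (a h * g h' - a h' * g h)) \<in> I" by (rule idl.subspace_scale[OF Is N[OF hh]])
    then show ?thesis by (simp add: a'_def g'_def power_mult_distrib algebra_simps)
  qed
  have tQ': "fracs Q (e' h) (a' h) (g' h) \<and> t Q = fraction I Q (a' h) (g' h)" if h: "h \<in> F" and Q: "Q \<in> ?U" "h \<notin> Q" for h Q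
  proof -
    have QI: "Q \<in> Proj I" "f \<notin> Q" using Q UP by auto
    have fh: "(f * h) ^ N \<notin> Q" by (rule Proj_power[OF I QI(1) Proj_mult[OF I QI(1) QI(2) Q(2)]])
    have g: "g h \<notin> Q" "t Q = fraction I Q (a h) (g h)" using tQ[OF h Q] by auto
    have 1: "fracs Q (e h) (a h) (g h)" using e h g(1) by (simp add: fracs_def)
    have 2: "fracs Q (e' h) (a' h) (g' h)"
      using ag'[OF h] Proj_mult[OF I QI(1) g(1) fh] by (simp add: fracs_def g'_def)
    have "fraction I Q (a h) (g h) = fraction I Q (a' h) (g' h)"
      by (rule fraction_eqI'[OF I QI(1) 1 2]) (simp add: a'_def g'_def mult_ac idl.subspace_0[OF Is])
    then show ?thesis using 2 g(2) by simp
  qed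
  have hK': "hideal (idl.span (I \<union> g' ` F))" using ag' by (intro hideal_Un I) auto
  have "\<exists>n. f ^ n \<in> idl.span (I \<union> g' ` F)"
  proof (rule ccontr)
    assume n: "\<not> ?thesis"
    then have av: "\<And>n. (f * 1) ^ n \<notin> idl.span (I \<union> g' ` F)" by simp
    obtain P where P: "P \<in> Proj (idl.span (I \<union> g' ` F))" "f \<notin> P"
      using Proj_avoiding[OF hK' f f1(1) av] unfolding f1(2) by blast
    have IH: "I \<union> g' ` F \<subseteq> idl.span (I \<union> g' ` F)" by (auto intro: idl.span_base)
    then have "P \<in> Proj I" using P(1) by (intro Proj_mono[of I]) auto
    then have PU: "P \<in> ?U" using P(2) by (simp add: UP)
    then obtain h where h: "h \<in> F" "h \<notin> P" using cov' by blast
    have "g' h \<notin> P" using tQ'[OF h(1) PU h(2)] PU UP by (simp add: fracs_def)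
    moreover have "g' ` F \<subseteq> P" using P(1) IH by (auto simp: Proj_def)
    ultimately show False using h(1) by blast
  qed
  then obtain n' where "f ^ n' \<in> idl.span (I \<union> g' ` F)" by blast
  from span_Un_image[OF Is F(1) this] obtain q where q: "f ^ n' - (\<Sum>h\<in>F. q h * g' h) \<in> I" by blast
  define q' where "q' h = hc (int n' * l - e' h) (q h)" for h
  have fn: "f ^ n' \<in> homog (int n' * l)" by (rule homog_power[OF f(1)])
  have "hc (int n' * l) (f ^ n' - (\<Sum>h\<in>F. q h * g' h)) \<in> I" by (rule hideal_hc[OF I q])
  also have "hc (int n' * l) (f ^ n' - (\<Sum>h\<in>F. q h * g' h)) = f ^ n' - (\<Sum>h\<in>F. q' h * g' h)"
  proof -
    have "hc (int n' * l) (q h * g' h) = q' h * g' h" if "h \<in> F" for h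
      using hc_mult[OF ag'(2)[OF that], of "int n' * l" "q h"] by (simp add: q'_def mult.commute)
    then show ?thesis by (simp add: hc_diff hc_sum hc_id[OF fn])
  qed
  finally have q': "f ^ n' - (\<Sum>h\<in>F. q' h * g' h) \<in> I" .
  define b where "b = (\<Sum>h\<in>F. q' h * a' h)"
  have bh: "b \<in> homog (int n' * l)"
    unfolding b_def
  proof (rule homog_sum)
    fix h assume "h \<in> F"
    then show "q' h * a' h \<in> homog (int n' * l)" by (intro homog_mult'[of _ "int n' * l - e' h" _ "e' h"] ag'(1)) (auto simp: q'_def hc_homog)
  qed
  have "t P = fraction I P b (f ^ n')" if P: "P \<in> ?U" for P
  proof -
    have PI: "P \<in> Proj I" "f \<notin> P" using P UP by auto
    obtain h where h: "h \<in> F" "h \<notin> P" using cov' P by blast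
    have th: "fracs P (e' h) (a' h) (g' h)" "t P = fraction I P (a' h) (g' h)" using tQ'[OF h(1) P h(2)] by auto
    have fb: "fracs P (int n' * l) b (f ^ n')" using bh fn Proj_power[OF I PI] by (simp add: fracs_def)
    have "(\<Sum>j\<in>F. q' j * (a' h * g' j - a' j * g' h)) + a' h * (f ^ n' - (\<Sum>h\<in>F. q' h * g' h)) \<in> I"
    proof (intro idl.subspace_add[OF Is])
      show "(\<Sum>j\<in>F. q' j * (a' h * g' j - a' j * g' h)) \<in> I"
        by (rule idl.subspace_sum[OF Is], rule idl.subspace_scale[OF Is], rule cross[OF h(1)])
      show "a' h * (f ^ n' - (\<Sum>h\<in>F. q' h * g' h)) \<in> I" by (rule idl.subspace_scale[OF Is q'])
    qed
    also have "(\<Sum>j\<in>F. q' j * (a' h * g' j - a' j * g' h)) + a' h * (f ^ n' - (\<Sum>h\<in>F. q' h * g' h)) = a' h * f ^ n' - b * g' h"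
      by (simp add: b_def right_diff_distrib sum_subtractf sum_distrib_left sum_distrib_right mult_ac)
    finally have "a' h * f ^ n' - b * g' h \<in> I" .
    from fraction_eqI'[OF I PI(1) th(1) fb this] th(2) show ?thesis by simp
  qed
  then show ?thesis using bh by blast
qed

section \<open>Global sections of the divisor sheaf\<close>

lemma zariski_opens_sub: "U \<in> zariski_opens I \<Longrightarrow> U \<subseteq> Proj I"
  by (auto simp: zariski_opens_def)

lemma basic_open_sub: "basic_open I h \<subseteq> Proj I"
  by (auto simp: basic_open_def)

lemma sections_rep:
  assumes s: "s \<in> carrier (sections I K U)" and P: "P \<in> U"
  shows "\<exists>V l a f. V \<in> zariski_opens I \<and> P \<in> V \<and> V \<subseteq> U \<and> a \<in> K \<and> (\<forall>Q\<in>V. fracs Q l a f \<and> s Q = fraction I Q a f)"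
proof -
  have "\<exists>V \<in> zariski_opens I. P \<in> V \<and> V \<subseteq> U \<and>
          (\<exists>l. \<exists>a \<in> K \<inter> homog l. \<exists>f \<in> homog l. \<forall>Q\<in>V. f \<notin> Q \<and> s Q = fraction I Q a f)"
    using s P unfolding sections_carrier by blast
  then obtain V l a f where V: "V \<in> zariski_opens I" "P \<in> V" "V \<subseteq> U" "a \<in> K \<inter> homog l" "f \<in> homog l"
    "\<forall>Q\<in>V. f \<notin> Q \<and> s Q = fraction I Q a f" by (elim bexE conjE exE)
  show ?thesis
    by (rule exI[of _ V], rule exI[of _ l], rule exI[of _ a], rule exI[of _ f]) (use V in \<open>auto simp: fracs_def\<close>)
qed

lemma sections_repI:
  assumes I: "hideal I" and U: "U \<in> zariski_opens I"
    and loc: "\<And>P. P \<in> U \<Longrightarrow> \<exists>V l a f. V \<in> zariski_opens I \<and> P \<in> V \<and> V \<subseteq> U \<and> a \<in> K \<and> (\<forall>Q\<in>V. fracs Q l a f \<and> s Q = fraction I Q a f)"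
    and ext: "s \<in> extensional U"
  shows "s \<in> carrier (sections I K U)"
  unfolding sections_carrier
proof (intro conjI ballI)
  have "s P \<in> carrier (local_ring I P)" if P: "P \<in> U" for P
  proof -
    obtain V l a f where "P \<in> V" "\<forall>Q\<in>V. fracs Q l a f \<and> s Q = fraction I Q a f" using loc[OF P] by (elim exE conjE)
    then have "fracs P l a f \<and> s P = fraction I P a f" by blast
    moreover have "P \<in> Proj I" using P U zariski_opens_sub by blast
    ultimately show ?thesis using local_ring_carrier[OF I] by blast
  qed
  then show "s \<in> (\<Pi>\<^sub>E P\<in>U. carrier (local_ring I P))" using ext by (auto simp: PiE_def)
  fix P assume P: "P \<in> U"
  obtain V l a f where V: "V \<in> zariski_opens I" "P \<in> V" "V \<subseteq> U" "a \<in> K" "\<forall>Q\<in>V. fracs Q l a f \<and> s Q = fraction I Q a f"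
    using loc[OF P] by (elim exE conjE)
  have "a \<in> homog l" "f \<in> homog l" using V(2,5) by (auto simp: fracs_def)
  then have e: "\<exists>l. \<exists>a \<in> K \<inter> homog l. \<exists>f \<in> homog l. \<forall>Q\<in>V. f \<notin> Q \<and> s Q = fraction I Q a f"
    by (intro exI[of _ l]) (rule bexI[of _ a], rule bexI[of _ f], use V in \<open>auto simp: fracs_def\<close>)
  show "\<exists>V \<in> zariski_opens I. P \<in> V \<and> V \<subseteq> U \<and>
          (\<exists>l. \<exists>a \<in> K \<inter> homog l. \<exists>f \<in> homog l. \<forall>Q\<in>V. f \<notin> Q \<and> s Q = fraction I Q a f)"
    by (rule bexI[OF _ V(1)]) (use V(2,3) e in \<open>simp only: simp_thms\<close>)
qed

lemma sections_restrict:
  assumes I: "hideal I" and s: "s \<in> carrier (sections I K U)" and V: "V \<in> zariski_opens I" "V \<subseteq> U"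
  shows "restrict s V \<in> carrier (sections I K V)"
proof (rule sections_repI[OF I V(1)])
  fix P assume P: "P \<in> V"
  have PI: "P \<in> Proj I" using P V zariski_opens_sub by blast
  obtain W l a f where W: "W \<in> zariski_opens I" "P \<in> W" "a \<in> K" "\<forall>Q\<in>W. fracs Q l a f \<and> s Q = fraction I Q a f"
    using sections_rep[OF s subsetD[OF V(2) P]] by (elim exE conjE)
  obtain h k where h: "h \<in> homog k" "h \<notin> P" "basic_open I h \<subseteq> W" using open_refine[OF W(1,2)] by (elim exE conjE)
  obtain h' k' where h': "h' \<in> homog k'" "h' \<notin> P" "basic_open I h' \<subseteq> V" using open_refine[OF V(1) P] by (elim exE conjE)
  have sub: "basic_open I (h * h') \<subseteq> basic_open I h \<inter> basic_open I h'"
    using Proj_multD[OF I] by (auto simp: basic_open_def)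
  show "\<exists>V' l a f. V' \<in> zariski_opens I \<and> P \<in> V' \<and> V' \<subseteq> V \<and> a \<in> K \<and>
      (\<forall>Q\<in>V'. fracs Q l a f \<and> restrict s V Q = fraction I Q a f)"
  proof (rule exI[of _ "basic_open I (h * h')"], rule exI[of _ l], rule exI[of _ a], rule exI[of _ f], intro conjI ballI)
    show "basic_open I (h * h') \<in> zariski_opens I" by (rule basic_open_open[OF homog_mult[OF h(1) h'(1)]])
    show "P \<in> basic_open I (h * h')" using Proj_mult[OF I PI h(2) h'(2)] PI by (simp add: basic_open_def)
    show "basic_open I (h * h') \<subseteq> V" using sub h'(3) by blast
    fix Q assume "Q \<in> basic_open I (h * h')"
    then have "Q \<in> V" "Q \<in> W" using sub h(3) h'(3) by blast+
    then show "fracs Q l a f" "restrict s V Q = fraction I Q a f" using W(4) by auto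
  qed (rule W(3))
qed simp

lemma quotient_section:
  assumes I: "hideal I" and U: "U \<in> zariski_opens I" and a: "a \<in> K" "a \<in> homog l" "f \<in> homog l" "\<And>P. P \<in> U \<Longrightarrow> f \<notin> P"
  shows "(\<lambda>P\<in>U. fraction I P a f) \<in> carrier (sections I K U)"
proof (rule sections_repI[OF I U])
  fix P assume "P \<in> U"
  then show "\<exists>V l a' f'. V \<in> zariski_opens I \<and> P \<in> V \<and> V \<subseteq> U \<and> a' \<in> K \<and>
      (\<forall>Q\<in>V. fracs Q l a' f' \<and> (\<lambda>P\<in>U. fraction I P a f) Q = fraction I Q a' f')"
    by (intro exI[of _ U] exI[of _ l] exI[of _ a] exI[of _ f]) (use U a in \<open>auto simp: fracs_def\<close>)
qed simp

text \<open>The form \<open>u\<close> is a common denominator: it lies in \<open>J\<close> and is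
  regular modulo \<open>I\<close>, so a morphism out of the ideal sheaf of \<open>J\<close> is
  determined by what it does to \<open>u\<close>.\<close>

locale curve_divisor = free_curve I Y0 Y1 bs d m
  for I :: "('n::{finite, linorder}, 'k::field) mpoly set" and Y0 Y1 bs d m +
  fixes J :: "('n, 'k) mpoly set" and u :: "('n, 'k) mpoly" and dn :: nat
  assumes J: "hideal J" and uR: "u \<in> R" and uh: "u \<in> homog (int dn)" and uJ: "u \<in> J" and u0: "u \<noteq> 0"
begin

lemma Js: "idl.subspace J" using J by (rule hideal_subspace)

definition C :: "('n, 'k) mpoly set" where
  "C = {c \<in> homog (int dn). \<forall>a\<in>J. \<exists>b. c * a - u * b \<in> I}"

lemma C_D:
  assumes c: "c \<in> C" and a: "a \<in> J" "a \<in> homog l" shows "\<exists>b. b \<in> homog l \<and> c * a - u * b \<in> I"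
proof -
  have ch: "c \<in> homog (int dn)" using c by (simp add: C_def)
  have "\<exists>b. c * a - u * b \<in> I" using c a(1) by (simp add: C_def)
  then obtain b where b: "c * a - u * b \<in> I" ..
  have "hc (int dn + l) (c * a - u * b) \<in> I" by (rule hideal_hc[OF I b])
  also have "hc (int dn + l) (c * a - u * b) = c * a - u * hc l b"
    by (simp add: hc_diff hc_id[OF homog_mult[OF ch a(2)]] hc_mult[OF uh])
  finally have "c * a - u * hc l b \<in> I" .
  then show ?thesis using hc_homog[of l b] by (intro exI[of _ "hc l b"]) simp
qed

text \<open>After multiplication by \<open>u\<close> the relation between \<open>b/f\<close> and
  \<open>b'/f'\<close> becomes the one between \<open>a/f\<close> and \<open>a'/f'\<close>, and
  \<open>u\<close> is regular modulo \<open>I\<close>.\<close>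

lemma value_unique:
  assumes P: "P \<in> Proj I" and a: "fracs P l a f" "fracs P l' a' f'" and e: "fraction I P a f = fraction I P a' f'"
    and b: "b \<in> homog l" "c * a - u * b \<in> I" and b': "b' \<in> homog l'" "c * a' - u * b' \<in> I"
  shows "fraction I P b f = fraction I P b' f'"
proof -
  obtain j t where t: "t \<in> homog j" "t \<notin> P" "t * (a * f' - a' * f) \<in> I" using fraction_eqD[OF I P a e] by (elim exE bexE conjE)
  have "c * (t * (a * f' - a' * f)) - (t * f') * (c * a - u * b) + (t * f) * (c * a' - u * b') \<in> I"
    by (intro idl.subspace_add[OF Is] idl.subspace_diff[OF Is] idl.subspace_scale[OF Is] t(3) b(2) b'(2))
  also have "c * (t * (a * f' - a' * f)) - (t * f') * (c * a - u * b) + (t * f) * (c * a' - u * b') = u * (t * (b * f' - b' * f))"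
    by (simp add: algebra_simps)
  finally have "t * (b * f' - b' * f) \<in> I" by (rule R_regular[OF uR uh u0])
  from fraction_eqI[OF I P _ _ t(1,2) this, of l l'] show ?thesis using a b(1) b'(1) by (simp add: fracs_def)
qed

text \<open>Multiplication by \<open>c/u\<close> on the stalk at \<open>P\<close>: it sends
  \<open>a/f\<close> to \<open>b/f\<close> where \<open>c a = u b\<close> modulo \<open>I\<close>,
  and \<open>value_unique\<close> shows that the representative does not matter.\<close>

definition val :: "('n, 'k) mpoly \<Rightarrow> ('n, 'k) mpoly set \<Rightarrow> (('n, 'k) mpoly \<times> ('n, 'k) mpoly) set \<Rightarrow> (('n, 'k) mpoly \<times> ('n, 'k) mpoly) set" where
  "val c P x = (SOME r. \<exists>l a f b. a \<in> J \<and> fracs P l a f \<and> x = fraction I P a f \<and> b \<in> homog l \<and> c * a - u * b \<in> I \<and>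
     r = fraction I P b f)"

lemma val_eq:
  assumes P: "P \<in> Proj I" and a: "a \<in> J" "fracs P l a f" and b: "b \<in> homog l" "c * a - u * b \<in> I"
  shows "val c P (fraction I P a f) = fraction I P b f"
proof -
  let ?Q = "\<lambda>r. \<exists>l' a' f' b'. a' \<in> J \<and> fracs P l' a' f' \<and> fraction I P a f = fraction I P a' f' \<and> b' \<in> homog l' \<and>
     c * a' - u * b' \<in> I \<and> r = fraction I P b' f'"
  have "?Q (fraction I P b f)"
    by (rule exI[of _ l], rule exI[of _ a], rule exI[of _ f], rule exI[of _ b]) (use a b in simp)
  then have "?Q (val c P (fraction I P a f))" unfolding val_def by (rule someI[of ?Q])
  then obtain l' a' f' b' where x: "fracs P l' a' f'" "fraction I P a f = fraction I P a' f'" "b' \<in> homog l'"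
    "c * a' - u * b' \<in> I" "val c P (fraction I P a f) = fraction I P b' f'" by (elim exE conjE)
  show ?thesis using value_unique[OF P a(2) x(1,2) b x(3,4)] x(5) by simp
qed

lemma val_add:
  assumes P: "P \<in> Proj I" and c: "c \<in> C" and a: "a \<in> J" "fracs P l a f" and a': "a' \<in> J" "fracs P l' a' f'"
  shows "val c P (fraction I P a f \<oplus>\<^bsub>local_ring I P\<^esub> fraction I P a' f') =
    val c P (fraction I P a f) \<oplus>\<^bsub>local_ring I P\<^esub> val c P (fraction I P a' f')"
proof -
  obtain b where b: "b \<in> homog l" "c * a - u * b \<in> I" using C_D[OF c a(1)] a(2) by (auto simp: fracs_def)
  obtain b' where b': "b' \<in> homog l'" "c * a' - u * b' \<in> I" using C_D[OF c a'(1)] a'(2) by (auto simp: fracs_def)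
  have fb: "fracs P l b f" "fracs P l' b' f'" using a a' b b' by (auto simp: fracs_def)
  have J': "a * f' + a' * f \<in> J"
    using idl.subspace_add[OF Js idl.subspace_scale[OF Js a(1), of f'] idl.subspace_scale[OF Js a'(1), of f]]
    by (simp add: mult.commute)
  have "f' * (c * a - u * b) + f * (c * a' - u * b') \<in> I"
    by (intro idl.subspace_add[OF Is] idl.subspace_scale[OF Is] b b')
  also have "f' * (c * a - u * b) + f * (c * a' - u * b') = c * (a * f' + a' * f) - u * (b * f' + b' * f)"
    by (simp add: algebra_simps)
  finally have e: "c * (a * f' + a' * f) - u * (b * f' + b' * f) \<in> I" .
  have "b * f' + b' * f \<in> homog (l + l')" using fracs_add[OF I P fb] by (simp add: fracs_def)
  from val_eq[OF P J' fracs_add[OF I P a(2) a'(2)] this e]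
  show ?thesis by (simp only: fraction_add[OF I P a(2) a'(2)] fraction_add[OF I P fb] val_eq[OF P a b] val_eq[OF P a' b'])
qed

lemma val_scale:
  assumes P: "P \<in> Proj I" and c: "c \<in> C" and a: "a \<in> J" "fracs P l a f" and q: "fracs P k p q"
  shows "val c P (fraction I P p q \<otimes>\<^bsub>local_ring I P\<^esub> fraction I P a f) =
    fraction I P p q \<otimes>\<^bsub>local_ring I P\<^esub> val c P (fraction I P a f)"
proof -
  obtain b where b: "b \<in> homog l" "c * a - u * b \<in> I" using C_D[OF c a(1)] a(2) by (auto simp: fracs_def)
  have fb: "fracs P l b f" using a b by (auto simp: fracs_def)
  have J': "p * a \<in> J" by (rule idl.subspace_scale[OF Js a(1)])
  have "p * (c * a - u * b) \<in> I" by (intro idl.subspace_scale[OF Is] b)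
  also have "p * (c * a - u * b) = c * (p * a) - u * (p * b)" by (simp add: algebra_simps)
  finally have e: "c * (p * a) - u * (p * b) \<in> I" .
  have "p * b \<in> homog (k + l)" using fracs_mult[OF I P q fb] by (simp add: fracs_def)
  from val_eq[OF P J' fracs_mult[OF I P q a(2)] this e]
  show ?thesis by (simp only: fraction_mult[OF I P q a(2)] fraction_mult[OF I P q fb] val_eq[OF P a b])
qed

definition phi :: "('n, 'k) mpoly \<Rightarrow> ('n, 'k) sheaf_map" where
  "phi c = (\<lambda>U\<in>zariski_opens I. \<lambda>s\<in>carrier (sections I J U). \<lambda>P\<in>U. val c P (s P))"

lemma phi_apply: "U \<in> zariski_opens I \<Longrightarrow> s \<in> carrier (sections I J U) \<Longrightarrow> phi c U s = (\<lambda>P\<in>U. val c P (s P))"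
  by (simp add: phi_def)

lemma section_stalk:
  assumes "U \<in> zariski_opens I" "s \<in> carrier (sections I K U)" "P \<in> U"
  shows "P \<in> Proj I \<and> (\<exists>l a f. a \<in> K \<and> fracs P l a f \<and> s P = fraction I P a f)"
proof -
  obtain V l a f where V: "P \<in> V" "a \<in> K" "\<forall>Q\<in>V. fracs Q l a f \<and> s Q = fraction I Q a f"
    using sections_rep[OF assms(2,3)] by (elim exE conjE)
  have "\<exists>l a f. a \<in> K \<and> fracs P l a f \<and> s P = fraction I P a f"
    by (rule exI[of _ l], rule exI[of _ a], rule exI[of _ f]) (use V in blast)
  then show ?thesis using zariski_opens_sub assms by blast
qed

lemma sections_add:
  assumes U: "U \<in> zariski_opens I" and s: "s \<in> carrier (sections I J U)" and t: "t \<in> carrier (sections I J U)"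
  shows "(\<lambda>P\<in>U. s P \<oplus>\<^bsub>local_ring I P\<^esub> t P) \<in> carrier (sections I J U)"
proof (rule sections_repI[OF I U])
  fix P assume P: "P \<in> U"
  obtain V l a f where V: "V \<in> zariski_opens I" "P \<in> V" "V \<subseteq> U" "a \<in> J" "\<forall>Q\<in>V. fracs Q l a f \<and> s Q = fraction I Q a f"
    using sections_rep[OF s P] by (elim exE conjE)
  have t': "restrict t V \<in> carrier (sections I J V)" by (rule sections_restrict[OF I t V(1,3)])
  obtain V' l' a' f' where V': "V' \<in> zariski_opens I" "P \<in> V'" "V' \<subseteq> V" "a' \<in> J" "\<forall>Q\<in>V'. fracs Q l' a' f' \<and> restrict t V Q = fraction I Q a' f'"
    using sections_rep[OF t' V(2)] by (elim exE conjE)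
  show "\<exists>V l a f. V \<in> zariski_opens I \<and> P \<in> V \<and> V \<subseteq> U \<and> a \<in> J \<and>
      (\<forall>Q\<in>V. fracs Q l a f \<and> (\<lambda>P\<in>U. s P \<oplus>\<^bsub>local_ring I P\<^esub> t P) Q = fraction I Q a f)"
  proof (rule exI[of _ V'], rule exI[of _ "l + l'"], rule exI[of _ "a * f' + a' * f"], rule exI[of _ "f * f'"], intro conjI ballI)
    show "V' \<subseteq> U" using V V' by blast
    show "a * f' + a' * f \<in> J"
      using idl.subspace_add[OF Js idl.subspace_scale[OF Js V(4), of f'] idl.subspace_scale[OF Js V'(4), of f]]
      by (simp add: mult.commute)
    fix Q assume Q: "Q \<in> V'"
    have QV: "Q \<in> V" "Q \<in> U" "Q \<in> Proj I" using Q V V' zariski_opens_sub by blast+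
    have 1: "fracs Q l a f" "s Q = fraction I Q a f" using V QV by blast+
    have 2: "fracs Q l' a' f'" "t Q = fraction I Q a' f'" using V' Q QV by auto
    show "fracs Q (l + l') (a * f' + a' * f) (f * f')" by (rule fracs_add[OF I QV(3) 1(1) 2(1)])
    show "(\<lambda>P\<in>U. s P \<oplus>\<^bsub>local_ring I P\<^esub> t P) Q = fraction I Q (a * f' + a' * f) (f * f')"
      using QV by (simp add: 1(2) 2(2) fraction_add[OF I QV(3) 1(1) 2(1)])
  qed (use V' in simp_all)
qed simp

lemma sections_scale:
  assumes U: "U \<in> zariski_opens I" and s: "s \<in> carrier (structure_sheaf I U)" and t: "t \<in> carrier (sections I J U)"
  shows "(\<lambda>P\<in>U. s P \<otimes>\<^bsub>local_ring I P\<^esub> t P) \<in> carrier (sections I J U)"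
proof (rule sections_repI[OF I U])
  fix P assume P: "P \<in> U"
  obtain V l a f where V: "V \<in> zariski_opens I" "P \<in> V" "V \<subseteq> U" "\<forall>Q\<in>V. fracs Q l a f \<and> s Q = fraction I Q a f"
    using sections_rep[OF s P] by (elim exE conjE)
  have t': "restrict t V \<in> carrier (sections I J V)" by (rule sections_restrict[OF I t V(1,3)])
  obtain V' l' a' f' where V': "V' \<in> zariski_opens I" "P \<in> V'" "V' \<subseteq> V" "a' \<in> J" "\<forall>Q\<in>V'. fracs Q l' a' f' \<and> restrict t V Q = fraction I Q a' f'"
    using sections_rep[OF t' V(2)] by (elim exE conjE)
  show "\<exists>V l a f. V \<in> zariski_opens I \<and> P \<in> V \<and> V \<subseteq> U \<and> a \<in> J \<and>
      (\<forall>Q\<in>V. fracs Q l a f \<and> (\<lambda>P\<in>U. s P \<otimes>\<^bsub>local_ring I P\<^esub> t P) Q = fraction I Q a f)"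
  proof (rule exI[of _ V'], rule exI[of _ "l + l'"], rule exI[of _ "a * a'"], rule exI[of _ "f * f'"], intro conjI ballI)
    show "V' \<subseteq> U" using V V' by blast
    show "a * a' \<in> J" by (rule idl.subspace_scale[OF Js V'(4)])
    fix Q assume Q: "Q \<in> V'"
    have QV: "Q \<in> V" "Q \<in> U" "Q \<in> Proj I" using Q V V' zariski_opens_sub by blast+
    have 1: "fracs Q l a f" "s Q = fraction I Q a f" using V QV by blast+
    have 2: "fracs Q l' a' f'" "t Q = fraction I Q a' f'" using V' Q QV by auto
    show "fracs Q (l + l') (a * a') (f * f')" by (rule fracs_mult[OF I QV(3) 1(1) 2(1)])
    show "(\<lambda>P\<in>U. s P \<otimes>\<^bsub>local_ring I P\<^esub> t P) Q = fraction I Q (a * a') (f * f')"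
      using QV by (simp add: 1(2) 2(2) fraction_mult[OF I QV(3) 1(1) 2(1)])
  qed (use V' in simp_all)
qed simp

lemma phi_section:
  assumes c: "c \<in> C" and U: "U \<in> zariski_opens I" and s: "s \<in> carrier (sections I J U)"
  shows "(\<lambda>P\<in>U. val c P (s P)) \<in> carrier (structure_sheaf I U)"
proof (rule sections_repI[OF I U])
  fix P assume P: "P \<in> U"
  obtain V l a f where V: "V \<in> zariski_opens I" "P \<in> V" "V \<subseteq> U" "a \<in> J" "\<forall>Q\<in>V. fracs Q l a f \<and> s Q = fraction I Q a f"
    using sections_rep[OF s P] by (elim exE conjE)
  obtain b where b: "b \<in> homog l" "c * a - u * b \<in> I" using C_D[OF c V(4)] V(2,5) by (auto simp: fracs_def)
  show "\<exists>V l a f. V \<in> zariski_opens I \<and> P \<in> V \<and> V \<subseteq> U \<and> a \<in> UNIV \<and>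
      (\<forall>Q\<in>V. fracs Q l a f \<and> (\<lambda>P\<in>U. val c P (s P)) Q = fraction I Q a f)"
  proof (rule exI[of _ V], rule exI[of _ l], rule exI[of _ b], rule exI[of _ f], intro conjI ballI)
    fix Q assume Q: "Q \<in> V"
    have QV: "Q \<in> U" "Q \<in> Proj I" using Q V zariski_opens_sub by blast+
    have 1: "fracs Q l a f" "s Q = fraction I Q a f" using V Q by blast+
    show "fracs Q l b f" using 1 b by (simp add: fracs_def)
    show "(\<lambda>P\<in>U. val c P (s P)) Q = fraction I Q b f" using QV 1 val_eq[OF QV(2) V(4) 1(1) b] by simp
  qed (use V in simp_all)
qed simp

lemma phi_carrier: assumes c: "c \<in> C" shows "phi c \<in> carrier (divisor_sections I J)"
proof -
  have "phi c U \<in> LinearCombinations.module_hom (structure_sheaf I U) (sections I J U) (structure_sheaf I U)"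
    if U: "U \<in> zariski_opens I" for U
    unfolding LinearCombinations.module_hom_def
  proof (intro CollectI conjI allI impI)
    show "phi c U \<in> carrier (sections I J U) \<rightarrow> carrier (structure_sheaf I U)"
      using phi_section[OF c U] by (simp add: phi_apply[OF U])
    fix s t assume "s \<in> carrier (sections I J U) \<and> t \<in> carrier (sections I J U)"
    then have st: "s \<in> carrier (sections I J U)" "t \<in> carrier (sections I J U)" by simp_all
    have "(\<lambda>P\<in>U. val c P (s P \<oplus>\<^bsub>local_ring I P\<^esub> t P)) = (\<lambda>P\<in>U. val c P (s P) \<oplus>\<^bsub>local_ring I P\<^esub> val c P (t P))"
    proof (rule restrict_ext)
      fix P assume P: "P \<in> U"
      obtain l a f where a: "P \<in> Proj I" "a \<in> J" "fracs P l a f" "s P = fraction I P a f"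
        using section_stalk[OF U st(1) P] by (elim exE conjE)
      obtain l' a' f' where a': "a' \<in> J" "fracs P l' a' f'" "t P = fraction I P a' f'"
        using section_stalk[OF U st(2) P] by (elim exE conjE)
      show "val c P (s P \<oplus>\<^bsub>local_ring I P\<^esub> t P) = val c P (s P) \<oplus>\<^bsub>local_ring I P\<^esub> val c P (t P)"
        unfolding a(4) a'(3) by (rule val_add[OF a(1) c a(2,3) a'(1,2)])
    qed
    moreover have "s \<oplus>\<^bsub>sections I J U\<^esub> t = (\<lambda>P\<in>U. s P \<oplus>\<^bsub>local_ring I P\<^esub> t P)" by (simp add: sections_def)
    moreover note sections_add[OF U st]
    ultimately show "phi c U (s \<oplus>\<^bsub>sections I J U\<^esub> t) = phi c U s \<oplus>\<^bsub>structure_sheaf I U\<^esub> phi c U t"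
      by (simp add: phi_apply[OF U] st) (simp add: sections_def cong: restrict_cong)
  next
    fix r t assume "r \<in> carrier (structure_sheaf I U) \<and> t \<in> carrier (sections I J U)"
    then have st: "r \<in> carrier (structure_sheaf I U)" "t \<in> carrier (sections I J U)" by simp_all
    have "(\<lambda>P\<in>U. val c P (r P \<otimes>\<^bsub>local_ring I P\<^esub> t P)) = (\<lambda>P\<in>U. r P \<otimes>\<^bsub>local_ring I P\<^esub> val c P (t P))"
    proof (rule restrict_ext)
      fix P assume P: "P \<in> U"
      obtain l a f where a: "P \<in> Proj I" "fracs P l a f" "r P = fraction I P a f"
        using section_stalk[OF U st(1) P] by (elim exE conjE)
      obtain l' a' f' where a': "a' \<in> J" "fracs P l' a' f'" "t P = fraction I P a' f'"
        using section_stalk[OF U st(2) P] by (elim exE conjE)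
      show "val c P (r P \<otimes>\<^bsub>local_ring I P\<^esub> t P) = r P \<otimes>\<^bsub>local_ring I P\<^esub> val c P (t P)"
        unfolding a(3) a'(3) by (rule val_scale[OF a(1) c a'(1,2) a(2)])
    qed
    moreover have "r \<odot>\<^bsub>sections I J U\<^esub> t = (\<lambda>P\<in>U. r P \<otimes>\<^bsub>local_ring I P\<^esub> t P)" by (simp add: sections_def)
    moreover note sections_scale[OF U st]
    ultimately show "phi c U (r \<odot>\<^bsub>sections I J U\<^esub> t) = r \<odot>\<^bsub>structure_sheaf I U\<^esub> phi c U t"
      by (simp add: phi_apply[OF U] st) (simp add: sections_def cong: restrict_cong)
  qed
  moreover have "phi c V (restrict s V) = restrict (phi c U s) V"
    if "U \<in> zariski_opens I" "V \<in> zariski_opens I" "V \<subseteq> U" "s \<in> carrier (sections I J U)" for U V s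
    using that sections_restrict[OF I that(4,2,3)] by (auto simp: phi_apply fun_eq_iff)
  ultimately show ?thesis by (simp add: divisor_sections_def) (simp add: phi_def)
qed

end

section \<open>Linearity and kernel of \<open>phi\<close>\<close>

context curve_divisor
begin

lemma phi_eqI:
  assumes "\<And>U s P. U \<in> zariski_opens I \<Longrightarrow> s \<in> carrier (sections I J U) \<Longrightarrow> P \<in> U \<Longrightarrow> F U s P = val c P (s P)"
  shows "(\<lambda>U\<in>zariski_opens I. \<lambda>s\<in>carrier (sections I J U). \<lambda>P\<in>U. F U s P) = phi c"
  unfolding phi_def by (intro restrict_ext assms)

lemma section_value:
  assumes c: "c \<in> C" and U: "U \<in> zariski_opens I" and s: "s \<in> carrier (sections I J U)" and P: "P \<in> U"
  shows "\<exists>l a f b. P \<in> Proj I \<and> a \<in> J \<and> fracs P l a f \<and> s P = fraction I P a f \<and> b \<in> homog l \<and> c * a - u * b \<in> I"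
proof -
  obtain l a f where a: "P \<in> Proj I" "a \<in> J" "fracs P l a f" "s P = fraction I P a f"
    using section_stalk[OF U s P] by (elim exE conjE)
  have "a \<in> homog l" using a(3) by (simp add: fracs_def)
  from C_D[OF c a(2) this] obtain b where "b \<in> homog l \<and> c * a - u * b \<in> I" ..
  then show ?thesis using a by (intro exI[of _ l] exI[of _ a] exI[of _ f] exI[of _ b]) simp
qed

lemma phi_zero: "phi 0 = \<zero>\<^bsub>divisor_sections I J\<^esub>"
proof -
  have "\<zero>\<^bsub>divisor_sections I J\<^esub> = (\<lambda>U\<in>zariski_opens I. \<lambda>s\<in>carrier (sections I J U). \<lambda>P\<in>U. fraction I P 0 1)"
    by (simp add: divisor_sections_def) (simp add: sections_def local_ring_def)
  also have "\<dots> = phi 0"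
  proof (rule phi_eqI)
    fix U s P assume U: "U \<in> zariski_opens I" "s \<in> carrier (sections I J U)" "P \<in> U"
    obtain l a f where a: "P \<in> Proj I" "a \<in> J" "fracs P l a f" "s P = fraction I P a f"
      using section_stalk[OF U] by (elim exE conjE)
    have 0: "fracs P l 0 f" "fracs P 0 0 1" using a(3) Proj_one[OF I a(1)] homog_1 by (auto simp: fracs_def)
    have "val 0 P (s P) = fraction I P 0 f"
      unfolding a(4) by (rule val_eq[OF a(1-3)]) (simp_all add: idl.subspace_0[OF Is])
    also have "\<dots> = fraction I P 0 1" by (rule fraction_eqI'[OF I a(1) 0]) (simp add: idl.subspace_0[OF Is])
    finally show "fraction I P 0 1 = val 0 P (s P)" by simp
  qed
  finally show ?thesis by simp
qed

lemma phi_add: assumes x: "x \<in> C" and y: "y \<in> C" shows "phi x \<oplus>\<^bsub>divisor_sections I J\<^esub> phi y = phi (x + y)"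
proof -
  have "phi x \<oplus>\<^bsub>divisor_sections I J\<^esub> phi y =
    (\<lambda>U\<in>zariski_opens I. \<lambda>s\<in>carrier (sections I J U). \<lambda>P\<in>U. phi x U s P \<oplus>\<^bsub>local_ring I P\<^esub> phi y U s P)"
    by (simp add: divisor_sections_def) (simp add: sections_def)
  also have "\<dots> = phi (x + y)"
  proof (rule phi_eqI)
    fix U s P assume U: "U \<in> zariski_opens I" "s \<in> carrier (sections I J U)" "P \<in> U"
    obtain l a f b where a: "P \<in> Proj I" "a \<in> J" "fracs P l a f" "s P = fraction I P a f" "b \<in> homog l" "x * a - u * b \<in> I"
      using section_value[OF x U] by (elim exE conjE)
    have ah: "a \<in> homog l" using a(3) by (simp add: fracs_def)
    obtain b' where b': "b' \<in> homog l" "y * a - u * b' \<in> I" using C_D[OF y a(2) ah] by (elim exE conjE)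
    have fb: "fracs P l b f" "fracs P l b' f" "fracs P l (b + b') f" using a(3,5) b'(1) by (simp_all add: fracs_def homog_add)
    have "(x * a - u * b) + (y * a - u * b') \<in> I" by (rule idl.subspace_add[OF Is a(6) b'(2)])
    then have e: "(x + y) * a - u * (b + b') \<in> I" by (simp add: algebra_simps)
    have "phi x U s P \<oplus>\<^bsub>local_ring I P\<^esub> phi y U s P = fraction I P b f \<oplus>\<^bsub>local_ring I P\<^esub> fraction I P b' f"
      using U by (simp add: phi_apply a(4) val_eq[OF a(1-3,5,6)] val_eq[OF a(1-3) b'])
    also have "\<dots> = fraction I P (b * f + b' * f) (f * f)" by (rule fraction_add[OF I a(1) fb(1,2)])
    also have "\<dots> = fraction I P (b + b') f"
      by (rule fraction_eqI'[OF I a(1) fracs_add[OF I a(1) fb(1,2)] fb(3)]) (simp add: algebra_simps idl.subspace_0[OF Is])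
    also have "\<dots> = val (x + y) P (s P)"
      unfolding a(4) by (rule val_eq[OF a(1-3) homog_add[OF a(5) b'(1)] e, symmetric])
    finally show "phi x U s P \<oplus>\<^bsub>local_ring I P\<^esub> phi y U s P = val (x + y) P (s P)" .
  qed
  finally show ?thesis .
qed

lemma phi_smult: assumes x: "x \<in> C" shows "k \<odot>\<^bsub>divisor_sections I J\<^esub> phi x = phi (Const k * x)"
proof -
  have "k \<odot>\<^bsub>divisor_sections I J\<^esub> phi x =
    (\<lambda>U\<in>zariski_opens I. \<lambda>s\<in>carrier (sections I J U). \<lambda>P\<in>U. fraction I P (Const k) 1 \<otimes>\<^bsub>local_ring I P\<^esub> phi x U s P)"
    by (simp add: divisor_sections_def) (simp add: sections_def cong: restrict_cong)
  also have "\<dots> = phi (Const k * x)"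
  proof (rule phi_eqI)
    fix U s P assume U: "U \<in> zariski_opens I" "s \<in> carrier (sections I J U)" "P \<in> U"
    obtain l a f b where a: "P \<in> Proj I" "a \<in> J" "fracs P l a f" "s P = fraction I P a f" "b \<in> homog l" "x * a - u * b \<in> I"
      using section_value[OF x U] by (elim exE conjE)
    have fb: "fracs P l b f" using a(3,5) by (simp add: fracs_def)
    have fk: "fracs P 0 (Const k) 1" using Proj_one[OF I a(1)] homog_1 homog_Const_mult[OF homog_1, of k] by (simp add: fracs_def)
    have "Const k * (x * a - u * b) \<in> I" by (rule idl.subspace_scale[OF Is a(6)])
    then have e: "(Const k * x) * a - u * (Const k * b) \<in> I" by (simp add: algebra_simps)
    have "phi x U s P = fraction I P b f" using U by (simp add: phi_apply a(4) val_eq[OF a(1-3,5,6)])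
    then have "fraction I P (Const k) 1 \<otimes>\<^bsub>local_ring I P\<^esub> phi x U s P = fraction I P (Const k * b) f"
      by (simp add: fraction_mult[OF I a(1) fk fb])
    also have "\<dots> = val (Const k * x) P (s P)"
      unfolding a(4) by (rule val_eq[OF a(1-3) homog_Const_mult[OF a(5)] e, symmetric])
    finally show "fraction I P (Const k) 1 \<otimes>\<^bsub>local_ring I P\<^esub> phi x U s P = val (Const k * x) P (s P)" .
  qed
  finally show ?thesis .
qed

lemma Y_cases: assumes "Y \<in> {Y0, Y1}" shows "Y \<in> homog 1" "Y ^ N * p \<in> I \<Longrightarrow> p \<in> I"
proof -
  have c: "Y = Y0 \<or> Y = Y1" using assms by simp
  then show "Y \<in> homog 1" using Y0 Y1 by (elim disjE) simp_all
  from c show "p \<in> I" if "Y ^ N * p \<in> I"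
  proof
    assume e: "Y = Y0"
    show ?thesis by (rule Y_power_regular(1)[OF that[unfolded e]])
  next
    assume e: "Y = Y1"
    show ?thesis by (rule Y_power_regular(2)[OF that[unfolded e]])
  qed
qed

lemma fracs_Y:
  assumes Y: "Y \<in> {Y0, Y1}" and P: "P \<in> basic_open I Y" and a: "a \<in> homog (int l)" shows "fracs P (int l) a (Y ^ l)"
proof -
  have P: "P \<in> Proj I" "Y \<notin> P" using P by (simp_all add: basic_open_def)
  have "Y ^ l \<in> homog (int l)" using homog_power[OF Y_cases(1)[OF Y], of l] by simp
  then show ?thesis using Proj_power[OF I P] a by (simp add: fracs_def)
qed

text \<open>By \<open>power_annihilates\<close>, a form that is locally zero where \<open>Y\<close>
  does not vanish is killed by a power of \<open>Y\<close>, and \<open>Y\<close> is regular modulo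
  \<open>I\<close>.\<close>

lemma Y_locally_zero:
  assumes Y: "Y \<in> {Y0, Y1}" and x: "x \<in> homog j" and loc: "\<And>P. P \<in> basic_open I Y \<Longrightarrow> \<exists>t. t \<notin> P \<and> t * x \<in> I"
  shows "x \<in> I"
proof -
  have "\<exists>n. (Y * 1) ^ n * x \<in> I"
    by (rule power_annihilates[OF I Y_cases(1)[OF Y] _ _ x, of 1 1])
      (use Y_cases(1)[OF Y] loc in \<open>simp_all add: basic_open_def\<close>)
  then obtain n where "Y ^ n * x \<in> I" by (elim exE) simp
  then show ?thesis by (rule Y_cases(2)[OF Y])
qed

lemma Y_locally_zero':
  assumes x: "x \<in> homog j" and loc: "\<And>P. P \<in> basic_open I (Y0 * Y1) \<Longrightarrow> \<exists>t. t \<notin> P \<and> t * x \<in> I"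
  shows "x \<in> I"
proof -
  have "\<exists>n. (Y0 * Y1) ^ n * x \<in> I"
    by (rule power_annihilates[OF I Y0 _ homog_mult[OF Y0 Y1] x]) (use loc in \<open>simp_all add: basic_open_def\<close>)
  then obtain n where "Y0 ^ n * (Y1 ^ n * x) \<in> I" by (auto simp: power_mult_distrib mult.assoc)
  from Y_power_regular(2)[OF Y_power_regular(1)[OF this]] show ?thesis .
qed

text \<open>The section \<open>a / Y^l\<close> on the chart where \<open>Y\<close> does not vanish.
  For forms \<open>a\<close> of \<open>J\<close> and the two charts, these are the test sections on
  which a sheaf morphism is evaluated.\<close>

abbreviation S where "S a l Y \<equiv> \<lambda>P\<in>basic_open I Y. fraction I P a (Y ^ l)"

lemma S_section:
  assumes Y: "Y \<in> {Y0, Y1}" and a: "a \<in> K" "a \<in> homog (int l)"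
  shows "S a l Y \<in> carrier (sections I K (basic_open I Y))"
proof (rule quotient_section[OF I basic_open_open[OF Y_cases(1)[OF Y]] a])
  show "Y ^ l \<in> homog (int l)" using homog_power[OF Y_cases(1)[OF Y], of l] by simp
  show "Y ^ l \<notin> P" if "P \<in> basic_open I Y" for P using fracs_Y[OF Y that a(2)] by (simp add: fracs_def)
qed

text \<open>The image of the section \<open>u / Y0^dn\<close> under \<open>phi c\<close> is
  \<open>c / Y0^dn\<close>, so \<open>c\<close> modulo \<open>I\<close> can be read off on one
  chart.\<close>

lemma phi_kernel:
  assumes x: "x \<in> C" and y: "y \<in> C" shows "phi x = phi y \<longleftrightarrow> x - y \<in> I"
proof
  assume e: "phi x = phi y"
  have Y: "Y0 \<in> {Y0, Y1}" by simp
  have U: "basic_open I Y0 \<in> zariski_opens I" by (rule basic_open_open[OF Y0])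
  have xh: "x \<in> homog (int dn)" "y \<in> homog (int dn)" using x y by (simp_all add: C_def)
  have v: "phi z (basic_open I Y0) (S u dn Y0) P = fraction I P z (Y0 ^ dn)"
    if P: "P \<in> basic_open I Y0" and z: "z \<in> homog (int dn)" for P z
  proof -
    have PI: "P \<in> Proj I" using P basic_open_sub by blast
    have "z * u - u * z \<in> I" by (simp add: mult.commute idl.subspace_0[OF Is])
    then show ?thesis using P by (simp add: phi_apply[OF U S_section[OF Y uJ uh]] val_eq[OF PI uJ fracs_Y[OF Y P uh] z])
  qed
  have "x * Y0 ^ dn - y * Y0 ^ dn \<in> I"
  proof (rule Y_locally_zero[OF Y])
    show "x * Y0 ^ dn - y * Y0 ^ dn \<in> homog (int dn + int dn * 1)"
      by (intro homog_diff homog_mult xh homog_power[OF Y0])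
    fix P assume P: "P \<in> basic_open I Y0"
    have PI: "P \<in> Proj I" using P basic_open_sub by blast
    have "fraction I P x (Y0 ^ dn) = fraction I P y (Y0 ^ dn)" using v[OF P xh(1)] v[OF P xh(2)] e by simp
    from fraction_eqD[OF I PI fracs_Y[OF Y P xh(1)] fracs_Y[OF Y P xh(2)] this]
    show "\<exists>t. t \<notin> P \<and> t * (x * Y0 ^ dn - y * Y0 ^ dn) \<in> I" by blast
  qed
  then have "Y0 ^ dn * (x - y) \<in> I" by (simp add: algebra_simps)
  then show "x - y \<in> I" by (rule Y_power_regular)
next
  assume e: "x - y \<in> I"
  show "phi x = phi y"
    unfolding phi_def[of x]
  proof (rule phi_eqI)
    fix U s P assume U: "U \<in> zariski_opens I" "s \<in> carrier (sections I J U)" "P \<in> U"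
    obtain l a f b where a: "P \<in> Proj I" "a \<in> J" "fracs P l a f" "s P = fraction I P a f" "b \<in> homog l" "x * a - u * b \<in> I"
      using section_value[OF x U] by (elim exE conjE)
    have "(x * a - u * b) - a * (x - y) \<in> I" by (rule idl.subspace_diff[OF Is a(6) idl.subspace_scale[OF Is e]])
    then have "y * a - u * b \<in> I" by (simp add: algebra_simps)
    then show "val x P (s P) = val y P (s P)" by (simp add: a(4) val_eq[OF a(1-3,5,6)] val_eq[OF a(1-3,5)])
  qed
qed

section \<open>Surjectivity of \<open>phi\<close>: the numerator of a given sheaf morphism\<close>

context
  fixes \<phi> :: "('n, 'k) sheaf_map" assumes \<phi>: "\<phi> \<in> carrier (divisor_sections I J)"
begin

lemma map_facts:
  shows map_extensional: "\<phi> \<in> extensional (zariski_opens I)"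
    and map_section_extensional: "U \<in> zariski_opens I \<Longrightarrow> \<phi> U \<in> extensional (carrier (sections I J U))"
    and map_section: "U \<in> zariski_opens I \<Longrightarrow> s \<in> carrier (sections I J U) \<Longrightarrow> \<phi> U s \<in> carrier (structure_sheaf I U)"
    and map_scale: "U \<in> zariski_opens I \<Longrightarrow> s \<in> carrier (sections I J U) \<Longrightarrow> r \<in> carrier (structure_sheaf I U) \<Longrightarrow>
      \<phi> U (\<lambda>P\<in>U. r P \<otimes>\<^bsub>local_ring I P\<^esub> s P) = (\<lambda>P\<in>U. r P \<otimes>\<^bsub>local_ring I P\<^esub> \<phi> U s P)"
    and map_restrict: "U \<in> zariski_opens I \<Longrightarrow> V \<in> zariski_opens I \<Longrightarrow> V \<subseteq> U \<Longrightarrow> s \<in> carrier (sections I J U) \<Longrightarrow>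
      \<phi> V (restrict s V) = restrict (\<phi> U s) V"
proof -
  have a: "\<phi> \<in> extensional (zariski_opens I)"
    "\<forall>U\<in>zariski_opens I. \<phi> U \<in> LinearCombinations.module_hom (structure_sheaf I U) (sections I J U) (structure_sheaf I U) \<and>
      \<phi> U \<in> extensional (carrier (sections I J U))"
    "\<forall>U\<in>zariski_opens I. \<forall>V\<in>zariski_opens I. V \<subseteq> U \<longrightarrow> (\<forall>s\<in>carrier (sections I J U). \<phi> V (restrict s V) = restrict (\<phi> U s) V)"
    using \<phi> by (simp_all add: divisor_sections_def)
  show "\<phi> \<in> extensional (zariski_opens I)" by (rule a(1))
  show "\<phi> U \<in> extensional (carrier (sections I J U))" if "U \<in> zariski_opens I" for U using a(2) that by blast
  show "\<phi> V (restrict s V) = restrict (\<phi> U s) V"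
    if "U \<in> zariski_opens I" "V \<in> zariski_opens I" "V \<subseteq> U" "s \<in> carrier (sections I J U)" for U V s
    using a(3) that by blast
  have h: "\<phi> U \<in> carrier (sections I J U) \<rightarrow> carrier (structure_sheaf I U)"
    "\<forall>r m. r \<in> carrier (structure_sheaf I U) \<and> m \<in> carrier (sections I J U) \<longrightarrow>
      \<phi> U (r \<odot>\<^bsub>sections I J U\<^esub> m) = r \<odot>\<^bsub>structure_sheaf I U\<^esub> \<phi> U m" if "U \<in> zariski_opens I" for U
    using a(2) that unfolding LinearCombinations.module_hom_def by blast+
  show "\<phi> U s \<in> carrier (structure_sheaf I U)" if "U \<in> zariski_opens I" "s \<in> carrier (sections I J U)" for U s
    using h(1)[OF that(1)] that(2) by blast
  show "\<phi> U (\<lambda>P\<in>U. r P \<otimes>\<^bsub>local_ring I P\<^esub> s P) = (\<lambda>P\<in>U. r P \<otimes>\<^bsub>local_ring I P\<^esub> \<phi> U s P)"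
    if "U \<in> zariski_opens I" "s \<in> carrier (sections I J U)" "r \<in> carrier (structure_sheaf I U)" for U s r
    using h(2)[OF that(1), rule_format, of r s] that(2,3) by (simp add: sections_def)
qed

text \<open>Restriction to \<open>W\<close> and linearity over the structure sheaf; this is the
  device that compares the values of the morphism on different open sets.\<close>

lemma map_transfer:
  assumes U: "U \<in> zariski_opens I" "V \<in> zariski_opens I" "W \<in> zariski_opens I" "W \<subseteq> U" "W \<subseteq> V"
    and s: "s \<in> carrier (sections I J U)" "s' \<in> carrier (sections I J V)" and r: "r \<in> carrier (structure_sheaf I W)"
    and e: "\<And>P. P \<in> W \<Longrightarrow> s P = r P \<otimes>\<^bsub>local_ring I P\<^esub> s' P" and P: "P \<in> W"
  shows "\<phi> U s P = r P \<otimes>\<^bsub>local_ring I P\<^esub> \<phi> V s' P"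
proof -
  have s'W: "restrict s' W \<in> carrier (sections I J W)" by (rule sections_restrict[OF I s(2) U(3,5)])
  have "\<phi> U s P = restrict (\<phi> U s) W P" using P by simp
  also have "\<dots> = \<phi> W (restrict s W) P" by (simp only: map_restrict[OF U(1,3,4) s(1)])
  also have "restrict s W = (\<lambda>P\<in>W. r P \<otimes>\<^bsub>local_ring I P\<^esub> restrict s' W P)" using e by (auto simp: fun_eq_iff)
  also have "\<phi> W \<dots> P = r P \<otimes>\<^bsub>local_ring I P\<^esub> \<phi> W (restrict s' W) P"
    by (rule trans[OF fun_cong[OF map_scale[OF U(3) s'W r]]]) (use P in simp)
  also have "\<phi> W (restrict s' W) P = \<phi> V s' P" using P by (simp only: map_restrict[OF U(2,3,5) s(2)] restrict_apply if_True)
  finally show ?thesis .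
qed

text \<open>A section on a basic open set is one fraction with a power of \<open>Y\<close> as
  denominator. The exponent is enlarged to \<open>l + N\<close> so that it contains the factor
  \<open>Y^l\<close> of the denominator of the test section.\<close>

lemma local_value:
  assumes Y: "Y \<in> {Y0, Y1}" and a: "a \<in> J" "a \<in> homog (int l)"
  shows "\<exists>N z. z \<in> homog (int (l + N)) \<and> (\<forall>P\<in>basic_open I Y. \<phi> (basic_open I Y) (S a l Y) P = fraction I P z (Y ^ (l + N)))"
proof -
  have U: "basic_open I Y \<in> zariski_opens I" by (rule basic_open_open[OF Y_cases(1)[OF Y]])
  have "\<exists>N. \<exists>z\<in>homog (int N * 1). \<forall>P\<in>basic_open I Y. \<phi> (basic_open I Y) (S a l Y) P = fraction I P z (Y ^ N)"
    by (rule section_on_basic_open[OF I Y_cases(1)[OF Y]]) (simp, rule map_section[OF U S_section[OF Y a]])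
  then obtain N z where z: "z \<in> homog (int N * 1)" "\<forall>P\<in>basic_open I Y. \<phi> (basic_open I Y) (S a l Y) P = fraction I P z (Y ^ N)"
    by (elim exE bexE)
  have zh: "z \<in> homog (int N)" using z(1) by simp
  have Yl: "Y ^ l \<in> homog (int l)" using homog_power[OF Y_cases(1)[OF Y], of l] by simp
  have "fraction I P z (Y ^ N) = fraction I P (Y ^ l * z) (Y ^ (l + N))" if P: "P \<in> basic_open I Y" for P
  proof -
    have "P \<in> Proj I" using P basic_open_sub by blast
    from fraction_cancel[OF I this fracs_Y[OF Y P zh] fracs_Y[OF Y P Yl]] show ?thesis by (simp add: power_add)
  qed
  moreover have "Y ^ l * z \<in> homog (int (l + N))" using homog_mult[OF Yl zh] by simp
  ultimately show ?thesis using z(2) by (intro exI[of _ N] exI[of _ "Y ^ l * z"]) simp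
qed

text \<open>The images of \<open>a / Y0^l\<close> and \<open>a / Y1^l\<close> have numerators
  \<open>b0\<close> and \<open>b1\<close>. On the overlap the two sections differ by the unit
  \<open>Y1^l / Y0^l\<close>, which forces \<open>Y1^N1 b0 = Y0^N0 b1\<close> modulo
  \<open>I\<close>, and \<open>Y_division\<close> produces one form \<open>z\<close> that serves
  both charts. This is the gluing that depth two of the coordinate ring allows.\<close>

lemma global_value:
  assumes a: "a \<in> J" "a \<in> homog (int l)"
  shows "\<exists>z. z \<in> homog (int l) \<and> (\<forall>Y\<in>{Y0, Y1}. \<forall>P\<in>basic_open I Y. \<phi> (basic_open I Y) (S a l Y) P = fraction I P z (Y ^ l))"
proof -
  have Y: "Y0 \<in> {Y0, Y1}" "Y1 \<in> {Y0, Y1}" by simp_all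
  obtain N0 b0 where b0: "b0 \<in> homog (int (l + N0))"
    "\<forall>P\<in>basic_open I Y0. \<phi> (basic_open I Y0) (S a l Y0) P = fraction I P b0 (Y0 ^ (l + N0))"
    using local_value[OF Y(1) a] by (elim exE conjE)
  obtain N1 b1 where b1: "b1 \<in> homog (int (l + N1))"
    "\<forall>P\<in>basic_open I Y1. \<phi> (basic_open I Y1) (S a l Y1) P = fraction I P b1 (Y1 ^ (l + N1))"
    using local_value[OF Y(2) a] by (elim exE conjE)
  let ?W = "basic_open I (Y0 * Y1)"
  have W: "?W \<in> zariski_opens I" by (rule basic_open_open[OF homog_mult[OF Y0 Y1]])
  have sub: "?W \<subseteq> basic_open I Y0" "?W \<subseteq> basic_open I Y1" using Proj_multD[OF I] by (auto simp: basic_open_def)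
  have Yh: "Y0 ^ n \<in> homog (int n)" "Y1 ^ n \<in> homog (int n)" for n
    using homog_power[OF Y0, of n] homog_power[OF Y1, of n] by simp_all
  define r where "r = (\<lambda>P\<in>?W. fraction I P (Y1 ^ l) (Y0 ^ l))"
  have r: "r \<in> carrier (structure_sheaf I ?W)"
    unfolding r_def
  proof (rule quotient_section[OF I W UNIV_I Yh(2) Yh(1)])
    show "Y0 ^ l \<notin> P" if "P \<in> ?W" for P using fracs_Y[OF Y(1) subsetD[OF sub(1) that] a(2)] by (simp add: fracs_def)
  qed
  have "Y0 ^ l * (Y1 ^ l * (Y1 ^ N1 * b0 - Y0 ^ N0 * b1)) \<in> I"
  proof (rule Y_locally_zero')
    have "Y1 ^ N1 * b0 \<in> homog (int (l + N0 + N1))" "Y0 ^ N0 * b1 \<in> homog (int (l + N0 + N1))"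
      by (rule homog_mult'[OF Yh(2) b0(1)], simp, rule homog_mult'[OF Yh(1) b1(1)], simp)
    then show "Y0 ^ l * (Y1 ^ l * (Y1 ^ N1 * b0 - Y0 ^ N0 * b1)) \<in> homog (int l + (int l + int (l + N0 + N1)))"
      by (intro homog_mult Yh homog_diff)
    fix P assume P: "P \<in> ?W"
    have PI: "P \<in> Proj I" using P basic_open_sub by blast
    have P01: "P \<in> basic_open I Y0" "P \<in> basic_open I Y1" using P sub by blast+
    have e: "S a l Y0 P = r P \<otimes>\<^bsub>local_ring I P\<^esub> S a l Y1 P" if P: "P \<in> ?W" for P
    proof -
      have PI: "P \<in> Proj I" using P basic_open_sub by blast
      have P01: "P \<in> basic_open I Y0" "P \<in> basic_open I Y1" using P sub by blast+
      note f = fracs_Y[OF Y(1) P01(1) Yh(2)] fracs_Y[OF Y(2) P01(2) a(2)]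
      have "fraction I P a (Y0 ^ l) = fraction I P (Y1 ^ l * a) (Y0 ^ l * Y1 ^ l)"
        by (rule fraction_eqI'[OF I PI fracs_Y[OF Y(1) P01(1) a(2)] fracs_mult[OF I PI f]]) (simp add: mult_ac idl.subspace_0[OF Is])
      then show ?thesis using P P01 by (simp add: r_def fraction_mult[OF I PI f])
    qed
    note f = fracs_Y[OF Y(1) P01(1) Yh(2)[of l]] fracs_Y[OF Y(2) P01(2) b1(1)]
    have "fraction I P b0 (Y0 ^ (l + N0)) = \<phi> (basic_open I Y0) (S a l Y0) P" using b0(2) P01(1) by simp
    also have "\<dots> = r P \<otimes>\<^bsub>local_ring I P\<^esub> \<phi> (basic_open I Y1) (S a l Y1) P"
      by (rule map_transfer[OF basic_open_open[OF Y0] basic_open_open[OF Y1] W sub S_section[OF Y(1) a] S_section[OF Y(2) a] r e P])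
    also have "\<dots> = fraction I P (Y1 ^ l * b1) (Y0 ^ l * Y1 ^ (l + N1))"
      using b1(2) P01(2) P by (simp only: r_def restrict_apply if_True fraction_mult[OF I PI f])
    finally have e': "fraction I P b0 (Y0 ^ (l + N0)) = fraction I P (Y1 ^ l * b1) (Y0 ^ l * Y1 ^ (l + N1))" .
    obtain j t where "t \<notin> P" "t * (b0 * (Y0 ^ l * Y1 ^ (l + N1)) - (Y1 ^ l * b1) * Y0 ^ (l + N0)) \<in> I"
      using fraction_eqD[OF I PI fracs_Y[OF Y(1) P01(1) b0(1)] fracs_mult[OF I PI f] e'] by (elim exE bexE conjE)
    moreover have "b0 * (Y0 ^ l * Y1 ^ (l + N1)) - (Y1 ^ l * b1) * Y0 ^ (l + N0) = Y0 ^ l * (Y1 ^ l * (Y1 ^ N1 * b0 - Y0 ^ N0 * b1))"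
      by (simp add: power_add algebra_simps)
    ultimately have "t \<notin> P \<and> t * (Y0 ^ l * (Y1 ^ l * (Y1 ^ N1 * b0 - Y0 ^ N0 * b1))) \<in> I" by simp
    then show "\<exists>t. t \<notin> P \<and> t * (Y0 ^ l * (Y1 ^ l * (Y1 ^ N1 * b0 - Y0 ^ N0 * b1))) \<in> I" ..
  qed
  then have e: "Y1 ^ N1 * b0 - Y0 ^ N0 * b1 \<in> I" by (rule Y_power_regular(2)[OF Y_power_regular(1)])
  obtain z where z: "z \<in> homog (int (l + N0) - int N0)" "b0 - Y0 ^ N0 * z \<in> I" using Y_division[OF b0(1) b1(1) e] by (elim bexE)
  have zh: "z \<in> homog (int l)" using z(1) by simp
  have "Y1 ^ N1 * (b0 - Y0 ^ N0 * z) - (Y1 ^ N1 * b0 - Y0 ^ N0 * b1) \<in> I"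
    by (rule idl.subspace_diff[OF Is idl.subspace_scale[OF Is z(2)] e])
  also have "Y1 ^ N1 * (b0 - Y0 ^ N0 * z) - (Y1 ^ N1 * b0 - Y0 ^ N0 * b1) = Y0 ^ N0 * (b1 - Y1 ^ N1 * z)"
    by (simp add: algebra_simps)
  finally have z1: "b1 - Y1 ^ N1 * z \<in> I" by (rule Y_power_regular(1))
  have cl: "fraction I P x (Y ^ (l + N)) = fraction I P z (Y ^ l)"
    if Y: "Y \<in> {Y0, Y1}" and P: "P \<in> basic_open I Y" and x: "x \<in> homog (int (l + N))" "x - Y ^ N * z \<in> I" for Y N x P
  proof -
    have PI: "P \<in> Proj I" using P basic_open_sub by blast
    have "Y ^ l * (x - Y ^ N * z) \<in> I" by (rule idl.subspace_scale[OF Is x(2)])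
    then have "x * Y ^ l - z * Y ^ (l + N) \<in> I" by (simp add: power_add algebra_simps)
    then show ?thesis by (rule fraction_eqI'[OF I PI fracs_Y[OF Y P x(1)] fracs_Y[OF Y P zh]])
  qed
  have "\<phi> (basic_open I Y0) (S a l Y0) P = fraction I P z (Y0 ^ l)" if "P \<in> basic_open I Y0" for P
    using b0(2) that cl[OF Y(1) that b0(1) z(2)] by simp
  moreover have "\<phi> (basic_open I Y1) (S a l Y1) P = fraction I P z (Y1 ^ l)" if "P \<in> basic_open I Y1" for P
    using b1(2) that cl[OF Y(2) that b1(1) z1] by simp
  ultimately show ?thesis using zh by (intro exI[of _ z]) simp
qed

text \<open>The section \<open>u a / Y0^(dn + l)\<close> is a multiple both of
  \<open>u / Y0^dn\<close> and of \<open>a / Y0^l\<close>. Linearity computes its image in two ways,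
  and the comparison on the chart of \<open>Y0\<close> suffices because \<open>Y0\<close> is regular
  modulo \<open>I\<close>.\<close>

lemma global_value_colon:
  assumes c: "c \<in> homog (int dn)" "\<forall>P\<in>basic_open I Y0. \<phi> (basic_open I Y0) (S u dn Y0) P = fraction I P c (Y0 ^ dn)"
    and a: "a \<in> J" "a \<in> homog (int l)"
    and z: "z \<in> homog (int l)" "\<forall>P\<in>basic_open I Y0. \<phi> (basic_open I Y0) (S a l Y0) P = fraction I P z (Y0 ^ l)"
  shows "c * a - u * z \<in> I"
proof -
  have Y: "Y0 \<in> {Y0, Y1}" by simp
  let ?U = "basic_open I Y0"
  have U: "?U \<in> zariski_opens I" by (rule basic_open_open[OF Y0])
  have ua: "u * a \<in> J" "u * a \<in> homog (int (dn + l))" using idl.subspace_scale[OF Js a(1)] homog_mult[OF uh a(2)] by simp_all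
  have 1: "Y0 ^ (dn + l) * (c * a - u * z) \<in> I"
  proof (rule Y_locally_zero[OF Y])
    show "Y0 ^ (dn + l) * (c * a - u * z) \<in> homog (int (dn + l) * 1 + (int dn + int l))"
      by (intro homog_mult homog_power Y0 homog_diff c(1) a(2) uh z(1))
    fix P assume P: "P \<in> ?U"
    have PI: "P \<in> Proj I" using P basic_open_sub by blast
    note f = fracs_Y[OF Y P uh] fracs_Y[OF Y P a(2)] fracs_Y[OF Y P c(1)] fracs_Y[OF Y P z(1)]
    have e1: "S (u * a) (dn + l) Y0 P = S a l Y0 P \<otimes>\<^bsub>local_ring I P\<^esub> S u dn Y0 P" if P: "P \<in> ?U" for P
    proof -
      have PI: "P \<in> Proj I" using P basic_open_sub by blast
      show ?thesis using P by (simp add: fraction_mult[OF I PI fracs_Y[OF Y P a(2)] fracs_Y[OF Y P uh]] power_add mult.commute)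
    qed
    have e2: "S (u * a) (dn + l) Y0 P = S u dn Y0 P \<otimes>\<^bsub>local_ring I P\<^esub> S a l Y0 P" if P: "P \<in> ?U" for P
    proof -
      have PI: "P \<in> Proj I" using P basic_open_sub by blast
      show ?thesis using P by (simp add: fraction_mult[OF I PI fracs_Y[OF Y P uh] fracs_Y[OF Y P a(2)]] power_add)
    qed
    have "fraction I P (a * c) (Y0 ^ l * Y0 ^ dn) = S a l Y0 P \<otimes>\<^bsub>local_ring I P\<^esub> \<phi> ?U (S u dn Y0) P"
      using P c(2) by (simp add: fraction_mult[OF I PI f(2,3)])
    also have "\<dots> = \<phi> ?U (S (u * a) (dn + l) Y0) P"
      by (rule map_transfer[OF U U U order_refl order_refl S_section[OF Y ua] S_section[OF Y uJ uh] S_section[OF Y UNIV_I a(2)] e1 P, symmetric])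
    also have "\<dots> = S u dn Y0 P \<otimes>\<^bsub>local_ring I P\<^esub> \<phi> ?U (S a l Y0) P"
      by (rule map_transfer[OF U U U order_refl order_refl S_section[OF Y ua] S_section[OF Y a] S_section[OF Y UNIV_I uh] e2 P])
    also have "\<dots> = fraction I P (u * z) (Y0 ^ dn * Y0 ^ l)"
      using P z(2) by (simp add: fraction_mult[OF I PI f(1,4)])
    finally have e: "fraction I P (a * c) (Y0 ^ l * Y0 ^ dn) = fraction I P (u * z) (Y0 ^ dn * Y0 ^ l)" .
    obtain j t where "t \<notin> P" "t * ((a * c) * (Y0 ^ dn * Y0 ^ l) - (u * z) * (Y0 ^ l * Y0 ^ dn)) \<in> I"
      using fraction_eqD[OF I PI fracs_mult[OF I PI f(2,3)] fracs_mult[OF I PI f(1,4)] e] by (elim exE bexE conjE)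
    moreover have "(a * c) * (Y0 ^ dn * Y0 ^ l) - (u * z) * (Y0 ^ l * Y0 ^ dn) = Y0 ^ (dn + l) * (c * a - u * z)"
      by (simp add: power_add algebra_simps)
    ultimately have "t \<notin> P \<and> t * (Y0 ^ (dn + l) * (c * a - u * z)) \<in> I" by simp
    then show "\<exists>t. t \<notin> P \<and> t * (Y0 ^ (dn + l) * (c * a - u * z)) \<in> I" ..
  qed
  then show ?thesis by (rule Y_power_regular(1))
qed

text \<open>The numerator \<open>c\<close> is the global value at \<open>u\<close>, and
  \<open>global_value_colon\<close> puts it in \<open>C\<close>. Near each point an arbitrary
  section is a multiple of some \<open>a / Y^n\<close>, so the morphism is determined by its values
  on those.\<close>

lemma phi_surj: "\<exists>c\<in>C. phi c = \<phi>"
proof -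
  obtain c where c: "c \<in> homog (int dn)"
    "\<forall>Y\<in>{Y0, Y1}. \<forall>P\<in>basic_open I Y. \<phi> (basic_open I Y) (S u dn Y) P = fraction I P c (Y ^ dn)"
    using global_value[OF uJ uh] by (elim exE conjE)
  have c0: "\<forall>P\<in>basic_open I Y0. \<phi> (basic_open I Y0) (S u dn Y0) P = fraction I P c (Y0 ^ dn)" using c(2) by simp
  have colon: "c * a - u * z \<in> I"
    if "a \<in> J" "a \<in> homog (int l)" "z \<in> homog (int l)"
      "\<forall>Y\<in>{Y0, Y1}. \<forall>P\<in>basic_open I Y. \<phi> (basic_open I Y) (S a l Y) P = fraction I P z (Y ^ l)" for a l z
    by (rule global_value_colon[OF c(1) c0 that(1-3)]) (use that(4) in simp)
  have hom: "\<exists>z. c * a - u * z \<in> I" if a: "a \<in> J" "a \<in> homog l" for a l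
  proof (cases "l < 0")
    case True
    then have "a = 0" using a(2) homog_neg by blast
    then show ?thesis by (intro exI[of _ 0]) (simp add: idl.subspace_0[OF Is])
  next
    case False
    then have al: "a \<in> homog (int (nat l))" using a(2) by simp
    obtain z where z: "z \<in> homog (int (nat l))"
      "\<forall>Y\<in>{Y0, Y1}. \<forall>P\<in>basic_open I Y. \<phi> (basic_open I Y) (S a (nat l) Y) P = fraction I P z (Y ^ nat l)"
      using global_value[OF a(1) al] by (elim exE conjE)
    show ?thesis by (rule exI[of _ z]) (rule colon[OF a(1) al z])
  qed
  have "\<exists>z. c * a - u * z \<in> I" if a: "a \<in> J" for a
  proof -
    obtain L where L: "finite L" "a = (\<Sum>l\<in>L. hc l a)" using hc_decomp[of a] by (elim exE conjE)
    have "\<forall>l\<in>L. \<exists>z. c * hc l a - u * z \<in> I"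
    proof
      fix l show "\<exists>z. c * hc l a - u * z \<in> I" by (rule hom[OF hideal_hc[OF J a] hc_homog])
    qed
    from bchoice[OF this] obtain z where z: "\<forall>l\<in>L. c * hc l a - u * z l \<in> I" ..
    have "(\<Sum>l\<in>L. c * hc l a - u * z l) \<in> I" by (rule idl.subspace_sum[OF Is]) (use z in blast)
    then have "c * (\<Sum>l\<in>L. hc l a) - u * (\<Sum>l\<in>L. z l) \<in> I" by (simp add: sum_subtractf sum_distrib_left)
    then have "c * a - u * (\<Sum>l\<in>L. z l) \<in> I" by (simp only: L(2)[symmetric])
    then show ?thesis ..
  qed
  then have cC: "c \<in> C" using c(1) by (simp add: C_def)
  have v: "val c P (s P) = \<phi> U s P" if U: "U \<in> zariski_opens I" and s: "s \<in> carrier (sections I J U)" and P: "P \<in> U" for U s P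
  proof -
    obtain V l a f where V: "V \<in> zariski_opens I" "P \<in> V" "V \<subseteq> U" "a \<in> J" "\<forall>Q\<in>V. fracs Q l a f \<and> s Q = fraction I Q a f"
      using sections_rep[OF s P] by (elim exE conjE)
    have PI: "P \<in> Proj I" using P U zariski_opens_sub by blast
    have fP: "fracs P l a f" using V(2,5) by blast
    \<comment> \<open>Forms of negative degree are zero and zero lies in every prime, so a
      denominator has nonnegative degree and \<open>global_value\<close> applies.\<close>
    have "\<not> l < 0"
    proof
      assume "l < 0"
      then have "f = 0" using fP homog_neg by (auto simp: fracs_def)
      then show False using fP idl.subspace_0[OF Proj_sub[OF I PI]] by (simp add: fracs_def)
    qed
    then obtain n where n: "l = int n" by (metis nonneg_int_cases not_less)
    have ah: "a \<in> homog (int n)" "f \<in> homog (int n)" using fP n by (simp_all add: fracs_def)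
    obtain z where z: "z \<in> homog (int n)"
      "\<forall>Y\<in>{Y0, Y1}. \<forall>P\<in>basic_open I Y. \<phi> (basic_open I Y) (S a n Y) P = fraction I P z (Y ^ n)"
      using global_value[OF V(4) ah(1)] by (elim exE conjE)
    have cz: "c * a - u * z \<in> I" by (rule colon[OF V(4) ah(1) z])
    obtain Y where Y: "Y \<in> {Y0, Y1}" "Y \<notin> P" using cover[OF PI] by blast
    obtain h k where h: "h \<in> homog k" "h \<notin> P" "basic_open I h \<subseteq> V" using open_refine[OF V(1,2)] by (elim exE conjE)
    let ?W = "basic_open I (h * Y)"
    have W: "?W \<in> zariski_opens I" by (rule basic_open_open[OF homog_mult[OF h(1) Y_cases(1)[OF Y(1)]]])
    have sub: "?W \<subseteq> basic_open I h" "?W \<subseteq> basic_open I Y" using Proj_multD[OF I] by (auto simp: basic_open_def)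
    have PW: "P \<in> ?W" using Proj_mult[OF I PI h(2) Y(2)] PI by (simp add: basic_open_def)
    have WU: "?W \<subseteq> U" using sub(1) h(3) V(3) by blast
    have UY: "basic_open I Y \<in> zariski_opens I" by (rule basic_open_open[OF Y_cases(1)[OF Y(1)]])
    have Yn: "Y ^ n \<in> homog (int n)" using homog_power[OF Y_cases(1)[OF Y(1)], of n] by simp
    have fQ: "fracs Q (int n) (Y ^ n) f \<and> fracs Q (int n) a f \<and> s Q = fraction I Q a f" if "Q \<in> ?W" for Q
    proof -
      have "Q \<in> V" using that sub(1) h(3) by blast
      then have "fracs Q (int n) a f \<and> s Q = fraction I Q a f" using V(5) n by blast
      then show ?thesis using Yn by (simp add: fracs_def)
    qed
    define r where "r = (\<lambda>Q\<in>?W. fraction I Q (Y ^ n) f)"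
    have r: "r \<in> carrier (structure_sheaf I ?W)"
      unfolding r_def by (rule quotient_section[OF I W UNIV_I Yn ah(2)]) (use fQ in \<open>simp add: fracs_def\<close>)
    have e: "s Q = r Q \<otimes>\<^bsub>local_ring I Q\<^esub> S a n Y Q" if Q: "Q \<in> ?W" for Q
    proof -
      have QI: "Q \<in> Proj I" "Q \<in> basic_open I Y" using Q sub(2) basic_open_sub by blast+
      have fs: "fracs Q (int n) (Y ^ n) f" "fracs Q (int n) a f" "s Q = fraction I Q a f" using fQ[OF Q] by simp_all
      have ay: "fracs Q (int n) a (Y ^ n)" by (rule fracs_Y[OF Y(1) QI(2) ah(1)])
      have "fraction I Q a f = fraction I Q (Y ^ n * a) (f * Y ^ n)"
        by (rule fraction_eqI'[OF I QI(1) fs(2) fracs_mult[OF I QI(1) fs(1) ay]]) (simp add: mult_ac idl.subspace_0[OF Is])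
      then show ?thesis using Q QI(2) by (simp add: r_def fs(3) fraction_mult[OF I QI(1) fs(1) ay])
    qed
    have PY: "P \<in> basic_open I Y" using PW sub(2) by blast
    have fs: "fracs P (int n) (Y ^ n) f" "fracs P (int n) a f" "s P = fraction I P a f" using fQ[OF PW] by simp_all
    have zy: "fracs P (int n) z (Y ^ n)" by (rule fracs_Y[OF Y(1) PY z(1)])
    have zf: "fracs P (int n) z f" using fs(2) z(1) by (simp add: fracs_def)
    have "\<phi> U s P = r P \<otimes>\<^bsub>local_ring I P\<^esub> \<phi> (basic_open I Y) (S a n Y) P"
      by (rule map_transfer[OF U UY W WU sub(2) s S_section[OF Y(1) V(4) ah(1)] r e PW])
    also have "\<phi> (basic_open I Y) (S a n Y) P = fraction I P z (Y ^ n)" using z(2) Y(1) PY by blast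
    also have "r P \<otimes>\<^bsub>local_ring I P\<^esub> fraction I P z (Y ^ n) = fraction I P (Y ^ n * z) (f * Y ^ n)"
      using PW by (simp only: r_def restrict_apply if_True fraction_mult[OF I PI fs(1) zy])
    also have "\<dots> = fraction I P z f"
      by (rule fraction_eqI'[OF I PI fracs_mult[OF I PI fs(1) zy] zf]) (simp add: mult_ac idl.subspace_0[OF Is])
    also have "\<dots> = val c P (s P)" unfolding fs(3) by (rule val_eq[OF PI V(4) fs(2) z(1) cz, symmetric])
    finally show ?thesis by simp
  qed
  have "phi c = \<phi>"
  proof (rule extensionalityI[where A = "zariski_opens I"])
    show "phi c \<in> extensional (zariski_opens I)" by (simp add: phi_def)
    show "\<phi> \<in> extensional (zariski_opens I)" by (rule map_extensional)
    fix U assume U: "U \<in> zariski_opens I"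
    show "phi c U = \<phi> U"
    proof (rule extensionalityI[where A = "carrier (sections I J U)"])
      show "phi c U \<in> extensional (carrier (sections I J U))" using U by (simp add: phi_def)
      show "\<phi> U \<in> extensional (carrier (sections I J U))" by (rule map_section_extensional[OF U])
      fix s assume s: "s \<in> carrier (sections I J U)"
      show "phi c U s = \<phi> U s"
      proof (rule extensionalityI[where A = U])
        show "phi c U s \<in> extensional U" by (simp add: phi_apply[OF U s])
        show "\<phi> U s \<in> extensional U" using map_section[OF U s] by (auto simp: sections_carrier PiE_def)
        show "phi c U s P = \<phi> U s P" if "P \<in> U" for P using v[OF U s that] that by (simp add: phi_apply[OF U s])
      qed
    qed
  qed
  then show ?thesis using cC by (intro bexI[of _ c])
qed

end

lemma divisor_sections_dim:
  assumes C: "kv.subspace C" and q: "kv.qdim C (I \<inter> homog (int dn)) n"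
  shows "vectorspace.dim (class_ring :: 'k ring) (divisor_sections I J) = n"
proof (rule dim_transport[OF C _ q, of phi])
  show "kv.subspace (I \<inter> homog (int dn))" by (intro kv.subspace_inter ideal_kv_subspace Is subspace_homog)
  show "phi ` C = carrier (divisor_sections I J)"
  proof
    show "phi ` C \<subseteq> carrier (divisor_sections I J)" using phi_carrier by blast
    show "carrier (divisor_sections I J) \<subseteq> phi ` C"
    proof
      fix \<phi> assume "\<phi> \<in> carrier (divisor_sections I J)"
      from phi_surj[OF this] obtain c where "c \<in> C" "phi c = \<phi>" by (elim bexE)
      then show "\<phi> \<in> phi ` C" by (intro image_eqI[of _ _ c]) simp_all
    qed
  qed
  fix x y assume x: "x \<in> C"
  show "k \<odot>\<^bsub>divisor_sections I J\<^esub> phi x = phi (Const k * x)" for k by (rule phi_smult[OF x])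
  assume y: "y \<in> C"
  show "phi x \<oplus>\<^bsub>divisor_sections I J\<^esub> phi y = phi (x + y)" by (rule phi_add[OF x y])
  have "x - y \<in> homog (int dn)" using x y by (simp add: C_def homog_diff)
  then show "phi x = phi y \<longleftrightarrow> x - y \<in> I \<inter> homog (int dn)" using phi_kernel[OF x y] by blast
qed (rule phi_zero)

end

theorem mainTheorem12:
  fixes IX IY :: "('n::{finite, linorder}, 'k::{alg_closed_field, field_char_0}) mpoly set"
    and m :: "nat \<Rightarrow> nat" and d \<alpha> :: nat
  assumes "curve IX" and "gorenstein IX" and "has_degree IX 1 d"
    and "characteristic_sequence IX d m"
    and "group_of_points IY" and "IX \<subseteq> IY" and "has_degree IY 0 \<alpha>"
    and "locally_principal IX IY"
  shows "linear_system_dim IX IY = int \<alpha> - int (hilbert_fun IY (int (m (d - 1)) - 2))"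
proof -
  have I: "hideal IX" and dim: "has_dimension IX 1"
    using assms(1) by (simp_all add: curve_def projective_subscheme_def homogeneous_ideal_iff)
  have J: "hideal IY" and sat: "saturated IY"
    using assms(5) by (simp_all add: group_of_points_def projective_subscheme_def homogeneous_ideal_iff)
  \<comment> \<open>A curve has a point, and the prime at that point contains the ideal but not
    \<open>1\<close>.\<close>
  have one: "1 \<notin> IX"
  proof -
    from dim obtain P where "P \<in> Proj IX" by (auto simp: has_dimension_def chain_above_def)
    then show ?thesis using Proj_one[OF I] by (auto simp: Proj_def)
  qed
  obtain Y0 Y1 b where Y: "Y0 \<in> homog 1" "Y1 \<in> homog 1" "\<forall>P \<in> Proj IX. \<not> (Y0 \<in> P \<and> Y1 \<in> P)"
    and b: "\<forall>i<d. b i \<in> homog (int (m i))"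
      "\<forall>l. \<forall>p\<in>homog l. \<exists>v. (\<forall>i<d. v i \<in> subalgebra_gen {Y0, Y1} \<inter> homog (l - int (m i))) \<and> p - (\<Sum>i<d. v i * b i) \<in> IX"
      "\<forall>v. (\<forall>i<d. v i \<in> subalgebra_gen {Y0, Y1}) \<longrightarrow> (\<Sum>i<d. v i * b i) \<in> IX \<longrightarrow> (\<forall>i<d. v i = 0)"
    using characteristic_sequence_basis[OF I assms(4)] by (elim exE conjE)
  interpret F: free_curve IX Y0 Y1 b d m
  proof
    show "Y0 \<notin> P \<or> Y1 \<notin> P" if "P \<in> Proj IX" for P using Y(3) that by blast
    show "m i \<le> m j" if "i \<le> j" "j < d" for i j using assms(4) that by (simp add: characteristic_sequence_def)
    show "v i = 0" if "\<And>i. i < d \<Longrightarrow> v i \<in> subalgebra_gen {Y0, Y1}" "(\<Sum>i<d. v i * b i) \<in> IX" "i < d" for v i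
      using b(3) that by blast
  qed (use I one Y b assms(3) in simp_all)
  obtain r e D v where res: "resolution IX r e D" "resolution.generator IX r e D {0} (card (UNIV :: 'n set) - 2) v"
    using gorenstein_generator[OF I dim assms(2)] by (elim exE conjE)
  obtain i0 i1 M f g \<gamma> E sdeg where L: "linked_curve IX Y0 Y1 b d m i0 i1 M f g \<gamma> E sdeg"
    using F.linked_curve_exists[OF res] by (elim exE)
  interpret L: linked_curve IX Y0 Y1 b d m i0 i1 M f g \<gamma> E sdeg by (rule L)
  obtain q :: "rat poly" and l0 where q: "Polynomial.degree q \<le> 0" "\<forall>l\<ge>l0. of_nat (hilbert_fun IY (int l)) = poly q (of_nat l)"
    "of_nat \<alpha> = fact 0 * Polynomial.coeff q 0"
    using assms(7) unfolding has_degree_def by (elim exE conjE)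
  \<comment> \<open>A Hilbert polynomial of degree at most \<open>0\<close> is the constant
    \<open>\<alpha>\<close>.\<close>
  have const: "hilbert_fun IY (int l) = \<alpha>" if "l \<ge> l0" for l
  proof -
    have "poly q (of_nat l) = Polynomial.coeff q 0" using q(1) by (auto elim: degree_eq_zeroE)
    then have "(of_nat (hilbert_fun IY (int l)) :: rat) = of_nat \<alpha>" using q(2,3) that by simp
    then show ?thesis by (simp only: of_nat_eq_iff)
  qed
  have cd: "\<exists>u \<delta> n. u \<in> F.R \<and> u \<in> homog \<delta> \<and> u \<in> IY \<and> u \<noteq> 0 \<and> kv.qdim (L.colon u IY \<delta>) (IX \<inter> homog \<delta>) n \<and>
    int n = 1 + int \<alpha> - int (hilbert_fun IY (int (m (d - 1)) - 2))"
    by (rule L.colon_dim[OF J assms(6) sat], rule const)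
  obtain u \<delta> n where u: "u \<in> F.R" "u \<in> homog \<delta>" "u \<in> IY" "u \<noteq> 0" "kv.qdim (L.colon u IY \<delta>) (IX \<inter> homog \<delta>) n"
    "int n = 1 + int \<alpha> - int (hilbert_fun IY (int (m (d - 1)) - 2))"
    using cd by (elim exE conjE)
  have "\<delta> \<ge> 0" using u(2,4) homog_neg[of \<delta> u] by linarith
  then have \<delta>: "int (nat \<delta>) = \<delta>" by simp
  interpret D: curve_divisor IX Y0 Y1 b d m IY u "nat \<delta>"
    by unfold_locales (use J assms(6) u \<delta> in simp_all)
  have C: "D.C = L.colon u IY \<delta>" unfolding D.C_def L.colon_def \<delta> ..
  have "vectorspace.dim (class_ring :: 'k ring) (divisor_sections IX IY) = n"
    by (rule D.divisor_sections_dim) (use u(5) L.subspace_colon C \<delta> in simp_all)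
  then show ?thesis using u(6) by (simp add: linear_system_dim_def)
qed

end
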